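(* Let $(V_a)_{a\in K^{|y|}}$ be a definable family of differential varieties in $K^n$. Then the set of Kolchin polynomials $$\{\omega_{V_a}:\ a\in K^{|y|}\}$$ is finite.
   Context: Setting: $(K,\Delta)$ is a differentially closed field of characteristic zero with $m\ge 1$ commuting derivations $\Delta=\{\delta_1,\dots,\delta_m\}$, assumed to be a saturated (universal) model of $\mathrm{DCF}_{0,m}$; $k$ is a small differential subfield of $K$ (small: cardinality less than $|K|$). For $\xi=(u_1,\dots,u_m)\in\mathbb N^m$, $\operatorname{ord}\xi=u_1+\cdots+u_m$ and $\delta^\xi=\delta_1^{u_1}\cdots\delta_m^{u_m}$. A numerical polynomial is $p\in\mathbb Q[t]$ with $p(s)\in\mathbb Z$ for all integers $s$. For numerical polynomials, $p\le q$ (eventual domination) means $p(s)\le q(s)$ for all sufficiently large $s\in\mathbb N$; this is a total order. Kolchin polynomial: for a small differential subfield $L$ of $K$ and a tuple $b=(b_1,\dots,b_n)$ from $K$, $\omega_{b/L}$ is the (unique, existing by a theorem of Kolchin) numerical polynomial with $\omega_{b/L}(s)=\operatorname{trdeg}_L L(\delta^\xi b_i:\operatorname{ord}\xi\le s,\ 1\le i\le n)$ for all sufficiently large $s\in\mathbb N$. A differential variety $V\subseteq K^n$ over $L$ is the zero set in $K^n$ of a collection of differential polynomials over $L$ in $n$ differential indeterminates. If $V$ is irreducible over $L$, a generic point of $V$ over $L$ is $b\in V$ such that the differential polynomials over $L$ vanishing at $b$ are exactly those vanishing on $V$, and $\omega_V:=\omega_{b/L}$. For arbitrary $V$, $\omega_V:=\max\{\omega_W: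 W \text{ an irreducible component of } V\}$, the maximum with respect to eventual domination. Definable family: given a collection $F(x,y)$ of differential polynomials over $k$ in tuples of differential indeterminates $x=(x_1,\dots,x_n)$ and $y$, for each $a\in K^{|y|}$ let $V_a\subseteq K^n$ be the differential variety over $k\langle a\rangle$ defined by $F(x,a)=0$, where $k\langle a\rangle$ is the differential field generated by $a$ over $k$; $(V_a)$ is called a definable family of differential varieties. Convention: parameters $a$ with $V_a=\emptyset$, for which $\omega_{V_a}$ is undefined, contribute nothing to the set. *)

theory Defs
  imports
    "HOL-Library.Poly_Mapping"
    "HOL-Library.Equipollence"
    "HOL-Computational_Algebra.Polynomial"
    "HOL-Algebra.Generated_Fields"
    "HOL-Algebra.Algebraic_Closure_Type"
begin

text \<open>
  The universal differential field is the whole type \<open>'a\<close>, with derivations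
  \<open>\<delta> 0, \<dots>, \<delta> (m - 1)\<close>; values \<open>\<delta> i\<close> with \<open>i \<ge> m\<close> are never used. Where subfields and field
  extensions are involved, \<open>'a\<close> is viewed as the ring \<^const>\<open>ring_of_type_algebra\<close> of
  HOL-Algebra. Points of affine \<open>n\<close>-space are lists of length \<open>n\<close>.
\<close>

subsection \<open>Differential fields\<close>

definition derivation :: "('b, 'e) ring_scheme \<Rightarrow> ('b \<Rightarrow> 'b) \<Rightarrow> bool" where
  "derivation R d \<longleftrightarrow> d \<in> carrier R \<rightarrow> carrier R \<and>
     (\<forall>x\<in>carrier R. \<forall>y\<in>carrier R.
        d (x \<oplus>\<^bsub>R\<^esub> y) = d x \<oplus>\<^bsub>R\<^esub> d y \<and>
        d (x \<otimes>\<^bsub>R\<^esub> y) = (d x \<otimes>\<^bsub>R\<^esub> y) \<oplus>\<^bsub>R\<^esub> (x \<otimes>\<^bsub>R\<^esub> d y))"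

definition differential_field :: "nat \<Rightarrow> ('b, 'e) ring_scheme \<Rightarrow> (nat \<Rightarrow> 'b \<Rightarrow> 'b) \<Rightarrow> bool" where
  "differential_field m R d \<longleftrightarrow> field R \<and> (\<forall>i<m. derivation R (d i)) \<and>
     (\<forall>i<m. \<forall>j<m. \<forall>x\<in>carrier R. d i (d j x) = d j (d i x))"

definition differential_subfield :: "nat \<Rightarrow> (nat \<Rightarrow> 'a \<Rightarrow> 'a) \<Rightarrow> 'a::field set \<Rightarrow> bool" where
  "differential_subfield m \<delta> L \<longleftrightarrow>
     subfield L ring_of_type_algebra \<and> (\<forall>i<m. \<forall>x\<in>L. \<delta> i x \<in> L)"

definition differential_field_adjoin ::
    "nat \<Rightarrow> (nat \<Rightarrow> 'a \<Rightarrow> 'a) \<Rightarrow> 'a::field set \<Rightarrow> 'a set \<Rightarrow> 'a set" where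
  "differential_field_adjoin m \<delta> k A = \<Inter>{L. differential_subfield m \<delta> L \<and> k \<union> A \<subseteq> L}"

subsection \<open>First-order formulas in the language of differential rings\<close>

datatype 'c dterm =
    TVar nat
  | TConst 'c
  | TZero
  | TOne
  | TNeg "'c dterm"
  | TAdd "'c dterm" "'c dterm"
  | TMul "'c dterm" "'c dterm"
  | TDer nat "'c dterm"

datatype 'c dform =
    FEq "'c dterm" "'c dterm"
  | FNot "'c dform"
  | FAnd "'c dform" "'c dform"
  | FEx nat "'c dform"

text \<open>\<open>dterm_over m A t\<close>: only parameters from \<open>A\<close> and the first \<open>m\<close> derivations occur in \<open>t\<close>.\<close>

primrec dterm_over :: "nat \<Rightarrow> 'c set \<Rightarrow> 'c dterm \<Rightarrow> bool" where
  "dterm_over m A (TVar x) = True"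
| "dterm_over m A (TConst c) = (c \<in> A)"
| "dterm_over m A TZero = True"
| "dterm_over m A TOne = True"
| "dterm_over m A (TNeg s) = dterm_over m A s"
| "dterm_over m A (TAdd s t) = (dterm_over m A s \<and> dterm_over m A t)"
| "dterm_over m A (TMul s t) = (dterm_over m A s \<and> dterm_over m A t)"
| "dterm_over m A (TDer i s) = (i < m \<and> dterm_over m A s)"

primrec dform_over :: "nat \<Rightarrow> 'c set \<Rightarrow> 'c dform \<Rightarrow> bool" where
  "dform_over m A (FEq s t) = (dterm_over m A s \<and> dterm_over m A t)"
| "dform_over m A (FNot p) = dform_over m A p"
| "dform_over m A (FAnd p q) = (dform_over m A p \<and> dform_over m A q)"
| "dform_over m A (FEx x p) = dform_over m A p"

primrec dterm_vars :: "'c dterm \<Rightarrow> nat set" where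
  "dterm_vars (TVar x) = {x}"
| "dterm_vars (TConst c) = {}"
| "dterm_vars TZero = {}"
| "dterm_vars TOne = {}"
| "dterm_vars (TNeg s) = dterm_vars s"
| "dterm_vars (TAdd s t) = dterm_vars s \<union> dterm_vars t"
| "dterm_vars (TMul s t) = dterm_vars s \<union> dterm_vars t"
| "dterm_vars (TDer i s) = dterm_vars s"

primrec free_vars :: "'c dform \<Rightarrow> nat set" where
  "free_vars (FEq s t) = dterm_vars s \<union> dterm_vars t"
| "free_vars (FNot p) = free_vars p"
| "free_vars (FAnd p q) = free_vars p \<union> free_vars q"
| "free_vars (FEx x p) = free_vars p - {x}"

primrec quantifier_free :: "'c dform \<Rightarrow> bool" where
  "quantifier_free (FEq s t) = True"
| "quantifier_free (FNot p) = quantifier_free p"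
| "quantifier_free (FAnd p q) = (quantifier_free p \<and> quantifier_free q)"
| "quantifier_free (FEx x p) = False"

text \<open>Semantics in the structure \<open>(R, d)\<close>; \<open>h\<close> interprets the parameters, \<open>v\<close> the variables.\<close>

primrec dterm_val ::
    "('b, 'e) ring_scheme \<Rightarrow> (nat \<Rightarrow> 'b \<Rightarrow> 'b) \<Rightarrow> ('c \<Rightarrow> 'b) \<Rightarrow> (nat \<Rightarrow> 'b) \<Rightarrow> 'c dterm \<Rightarrow> 'b" where
  "dterm_val R d h v (TVar x) = v x"
| "dterm_val R d h v (TConst c) = h c"
| "dterm_val R d h v TZero = \<zero>\<^bsub>R\<^esub>"
| "dterm_val R d h v TOne = \<one>\<^bsub>R\<^esub>"
| "dterm_val R d h v (TNeg s) = \<ominus>\<^bsub>R\<^esub> dterm_val R d h v s"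
| "dterm_val R d h v (TAdd s t) = dterm_val R d h v s \<oplus>\<^bsub>R\<^esub> dterm_val R d h v t"
| "dterm_val R d h v (TMul s t) = dterm_val R d h v s \<otimes>\<^bsub>R\<^esub> dterm_val R d h v t"
| "dterm_val R d h v (TDer i s) = d i (dterm_val R d h v s)"

primrec satisfies ::
    "('b, 'e) ring_scheme \<Rightarrow> (nat \<Rightarrow> 'b \<Rightarrow> 'b) \<Rightarrow> ('c \<Rightarrow> 'b) \<Rightarrow> (nat \<Rightarrow> 'b) \<Rightarrow> 'c dform \<Rightarrow> bool" where
  "satisfies R d h v (FEq s t) = (dterm_val R d h v s = dterm_val R d h v t)"
| "satisfies R d h v (FNot p) = (\<not> satisfies R d h v p)"
| "satisfies R d h v (FAnd p q) = (satisfies R d h v p \<and> satisfies R d h v q)"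
| "satisfies R d h v (FEx x p) = (\<exists>c\<in>carrier R. satisfies R d h (v(x := c)) p)"

text \<open>
  A differentially closed field is a differential field that is existentially closed in all its
  differential field extensions. It suffices to let the extensions range over those whose carrier
  is a subset of \<open>'a\<close>: a solution in any extension lies in a differential field generated over
  the base field by finitely many elements, and this has the same (infinite) cardinality as the
  base field, so it has an isomorphic copy on a subset of \<open>'a\<close>.
\<close>

definition differentially_closed :: "nat \<Rightarrow> (nat \<Rightarrow> 'a::field_char_0 \<Rightarrow> 'a) \<Rightarrow> bool" where
  "differentially_closed m \<delta> \<longleftrightarrow>
     differential_field m (ring_of_type_algebra :: 'a ring) \<delta> \<and>
     (\<forall>(R :: 'a ring) d h p v.
        differential_field m R d \<and>
        h \<in> ring_hom ring_of_type_algebra R \<and> (\<forall>i<m. \<forall>x. h (\<delta> i x) = d i (h x)) \<and>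
        quantifier_free p \<and> dform_over m UNIV p \<and>
        (\<forall>x. v x \<in> carrier R) \<and> satisfies R d h v p
        \<longrightarrow> (\<exists>w. satisfies ring_of_type_algebra \<delta> id w p))"

text \<open>
  Every (partial) finitary type over a parameter set of cardinality less than that of the
  field is realised in the field.
\<close>

definition saturated :: "nat \<Rightarrow> (nat \<Rightarrow> 'a::field_char_0 \<Rightarrow> 'a) \<Rightarrow> bool" where
  "saturated m \<delta> \<longleftrightarrow>
     (\<forall>A r T. A \<prec> (UNIV :: 'a set) \<and>
        (\<forall>p\<in>T. dform_over m A p \<and> free_vars p \<subseteq> {..<r}) \<and>
        (\<forall>T0\<subseteq>T. finite T0 \<longrightarrow>
           (\<exists>v. \<forall>p\<in>T0. satisfies (ring_of_type_algebra :: 'a ring) \<delta> id v p))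
        \<longrightarrow> (\<exists>v. \<forall>p\<in>T. satisfies (ring_of_type_algebra :: 'a ring) \<delta> id v p))"

subsection \<open>Polynomials and transcendence degree\<close>

definition mpolys :: "'a::zero set \<Rightarrow> 'v set \<Rightarrow> (('v \<Rightarrow>\<^sub>0 nat) \<Rightarrow>\<^sub>0 'a) set" where
  "mpolys A I = {P. (\<forall>u\<in>Poly_Mapping.keys P. Poly_Mapping.lookup P u \<in> A \<and> Poly_Mapping.keys u \<subseteq> I)}"

definition mpoly_eval :: "('v \<Rightarrow> 'a::comm_semiring_1) \<Rightarrow> (('v \<Rightarrow>\<^sub>0 nat) \<Rightarrow>\<^sub>0 'a) \<Rightarrow> 'a" where
  "mpoly_eval \<rho> P =
     (\<Sum>u\<in>Poly_Mapping.keys P. Poly_Mapping.lookup P u * (\<Prod>x\<in>Poly_Mapping.keys u. \<rho> x ^ Poly_Mapping.lookup u x))"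

definition alg_independent :: "'a::field set \<Rightarrow> 'a set \<Rightarrow> bool" where
  "alg_independent L B \<longleftrightarrow> (\<forall>P\<in>mpolys L B. mpoly_eval id P = 0 \<longrightarrow> P = 0)"

definition transcendence_basis :: "'a::field set \<Rightarrow> 'a set \<Rightarrow> 'a set \<Rightarrow> bool" where
  "transcendence_basis L E B \<longleftrightarrow> B \<subseteq> E \<and> alg_independent L B \<and>
     (\<forall>C. B \<subseteq> C \<and> C \<subseteq> E \<and> alg_independent L C \<longrightarrow> C = B)"

definition trdeg :: "'a::field set \<Rightarrow> 'a set \<Rightarrow> nat" where
  "trdeg L E = (THE d. \<exists>B. transcendence_basis L E B \<and> finite B \<and> d = card B)"

subsection \<open>Differential polynomials and differential varieties\<close>

text \<open>A multi-index \<open>\<xi>\<close> is a finitely supported function with support in \<open>{..<m}\<close>.\<close>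

definition multi_indices :: "nat \<Rightarrow> (nat \<Rightarrow>\<^sub>0 nat) set" where
  "multi_indices m = {\<xi>. Poly_Mapping.keys \<xi> \<subseteq> {..<m}}"

definition ord_idx :: "nat \<Rightarrow> (nat \<Rightarrow>\<^sub>0 nat) \<Rightarrow> nat" where
  "ord_idx m \<xi> = (\<Sum>i<m. Poly_Mapping.lookup \<xi> i)"

definition der_pow :: "nat \<Rightarrow> (nat \<Rightarrow> 'a \<Rightarrow> 'a) \<Rightarrow> (nat \<Rightarrow>\<^sub>0 nat) \<Rightarrow> 'a \<Rightarrow> 'a" where
  "der_pow m \<delta> \<xi> x = foldr (\<lambda>i. \<delta> i ^^ Poly_Mapping.lookup \<xi> i) [0..<m] x"

text \<open>The pair \<open>(i, \<xi>)\<close> stands for the derivative of index \<open>\<xi>\<close> of the \<open>i\<close>-th indeterminate.\<close>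

type_synonym 'a dpoly = "((nat \<times> (nat \<Rightarrow>\<^sub>0 nat)) \<Rightarrow>\<^sub>0 nat) \<Rightarrow>\<^sub>0 'a"

definition dpolys :: "nat \<Rightarrow> 'a::zero set \<Rightarrow> nat \<Rightarrow> 'a dpoly set" where
  "dpolys m L n = mpolys L ({..<n} \<times> multi_indices m)"

definition dpoly_eval ::
    "nat \<Rightarrow> (nat \<Rightarrow> 'a \<Rightarrow> 'a) \<Rightarrow> 'a::comm_semiring_1 list \<Rightarrow> 'a dpoly \<Rightarrow> 'a" where
  "dpoly_eval m \<delta> b f = mpoly_eval (\<lambda>(i, \<xi>). der_pow m \<delta> \<xi> (b ! i)) f"

definition differential_variety ::
    "nat \<Rightarrow> (nat \<Rightarrow> 'a \<Rightarrow> 'a) \<Rightarrow> 'a::field set \<Rightarrow> nat \<Rightarrow> 'a list set \<Rightarrow> bool" where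
  "differential_variety m \<delta> L n V \<longleftrightarrow>
     (\<exists>S\<subseteq>dpolys m L n. V = {b. length b = n \<and> (\<forall>f\<in>S. dpoly_eval m \<delta> b f = 0)})"

definition irreducible_variety ::
    "nat \<Rightarrow> (nat \<Rightarrow> 'a \<Rightarrow> 'a) \<Rightarrow> 'a::field set \<Rightarrow> nat \<Rightarrow> 'a list set \<Rightarrow> bool" where
  "irreducible_variety m \<delta> L n V \<longleftrightarrow> differential_variety m \<delta> L n V \<and> V \<noteq> {} \<and>
     (\<forall>V1 V2. differential_variety m \<delta> L n V1 \<and> differential_variety m \<delta> L n V2 \<and>
        V = V1 \<union> V2 \<longrightarrow> V = V1 \<or> V = V2)"

definition irreducible_component ::
    "nat \<Rightarrow> (nat \<Rightarrow> 'a \<Rightarrow> 'a) \<Rightarrow> 'a::field set \<Rightarrow> nat \<Rightarrow> 'a list set \<Rightarrow> 'a list set \<Rightarrow> bool" where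
  "irreducible_component m \<delta> L n V W \<longleftrightarrow> irreducible_variety m \<delta> L n W \<and> W \<subseteq> V \<and>
     (\<forall>W'. irreducible_variety m \<delta> L n W' \<and> W \<subseteq> W' \<and> W' \<subseteq> V \<longrightarrow> W' = W)"

definition generic_point ::
    "nat \<Rightarrow> (nat \<Rightarrow> 'a \<Rightarrow> 'a) \<Rightarrow> 'a::field set \<Rightarrow> nat \<Rightarrow> 'a list set \<Rightarrow> 'a list \<Rightarrow> bool" where
  "generic_point m \<delta> L n V b \<longleftrightarrow> b \<in> V \<and>
     (\<forall>f\<in>dpolys m L n. dpoly_eval m \<delta> b f = 0 \<longleftrightarrow> (\<forall>c\<in>V. dpoly_eval m \<delta> c f = 0))"

subsection \<open>Kolchin polynomials\<close>

definition numerical_poly :: "rat poly \<Rightarrow> bool" where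
  "numerical_poly p \<longleftrightarrow> (\<forall>s::int. poly p (of_int s) \<in> \<int>)"

definition eventually_dominated :: "rat poly \<Rightarrow> rat poly \<Rightarrow> bool" where
  "eventually_dominated p q \<longleftrightarrow> (\<forall>\<^sub>F s::nat in sequentially. poly p (of_nat s) \<le> poly q (of_nat s))"

definition kolchin_poly_point ::
    "nat \<Rightarrow> (nat \<Rightarrow> 'a \<Rightarrow> 'a) \<Rightarrow> 'a::field set \<Rightarrow> 'a list \<Rightarrow> rat poly" where
  "kolchin_poly_point m \<delta> L b = (THE p. numerical_poly p \<and>
     (\<forall>\<^sub>F s::nat in sequentially. poly p (of_nat s) =
        of_nat (trdeg L (generate_field ring_of_type_algebra
          (L \<union> {der_pow m \<delta> \<xi> (b ! i) | \<xi> i.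
                  \<xi> \<in> multi_indices m \<and> ord_idx m \<xi> \<le> s \<and> i < length b})))))"

text \<open>
  Any two generic points of an irreducible variety over \<open>L\<close> are isomorphic over \<open>L\<close>, so the
  choice of the generic point is immaterial.
\<close>

definition kolchin_poly_irreducible ::
    "nat \<Rightarrow> (nat \<Rightarrow> 'a \<Rightarrow> 'a) \<Rightarrow> 'a::field set \<Rightarrow> nat \<Rightarrow> 'a list set \<Rightarrow> rat poly" where
  "kolchin_poly_irreducible m \<delta> L n V =
     kolchin_poly_point m \<delta> L (SOME b. generic_point m \<delta> L n V b)"

definition kolchin_poly_variety ::
    "nat \<Rightarrow> (nat \<Rightarrow> 'a \<Rightarrow> 'a) \<Rightarrow> 'a::field set \<Rightarrow> nat \<Rightarrow> 'a list set \<Rightarrow> rat poly" where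
  "kolchin_poly_variety m \<delta> L n V =
     (let P = {kolchin_poly_irreducible m \<delta> L n W | W. irreducible_component m \<delta> L n V W}
      in THE p. p \<in> P \<and> (\<forall>q\<in>P. eventually_dominated q p))"

subsection \<open>Definable families\<close>

text \<open>
  \<open>F\<close> is a set of differential polynomials in \<open>n + l\<close> indeterminates, where \<open>l\<close> is the length of
  \<open>a\<close>. The first \<open>n\<close> indeterminates are \<open>x\<close> and the remaining ones are \<open>y\<close>.
\<close>

definition family_member ::
    "nat \<Rightarrow> (nat \<Rightarrow> 'a \<Rightarrow> 'a) \<Rightarrow> nat \<Rightarrow> 'a::field dpoly set \<Rightarrow> 'a list \<Rightarrow> 'a list set" where
  "family_member m \<delta> n F a = {b. length b = n \<and> (\<forall>f\<in>F. dpoly_eval m \<delta> (b @ a) f = 0)}"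

end

theory Submission
  imports Defs "HOL-Library.Product_Plus"
begin

text \<open>
  Rank the derivatives of the indeterminates by order. For a point \<open>b\<close> of \<open>V\<^sub>a\<close> let \<open>E(b)\<close> be the set
  of derivatives \<open>\<delta>\<^sup>\<xi> b\<^sub>i\<close> that are algebraic over \<open>k\<langle>a\<rangle>\<close> and the derivatives of lower rank. It is
  closed under \<open>\<Delta>\<close>, hence generated by finitely many elements, and the Kolchin polynomial of \<open>b\<close>
  counts its complement. Since the relations at the finitely many generators persist nearby, \<open>E(b)\<close>
  can only grow on a neighbourhood of \<open>(b, a)\<close> in the constructible topology. Conversely, if finitely
  many initials and separants do not vanish at \<open>a'\<close>, a specialisation \<open>a \<mapsto> a'\<close> of the parameters extends
  to a specialisation \<open>b \<mapsto> b'\<close> with \<open>E(b') \<subseteq> E(b)\<close>; it is built in a differential field extension,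
  transporting relations of minimal degree along the ranking, and brought back by differential
  closedness and saturation. Therefore the maximum of the Kolchin polynomials of the points of \<open>V\<^sub>a\<close> is
  locally constant in \<open>a\<close>, and compactness, i.e. saturation, leaves finitely many values. This
  maximum is \<open>\<omega>\<close> of \<open>V\<^sub>a\<close>, because each point lies in a component, components have generic points, and
  specialisation does not increase the Kolchin polynomial.
\<close>

section \<open>Algebraic dependence\<close>

text \<open>Working with all points of V(a) is what makes the dependence on a manageable: components
  and their generic points are not visibly given by formulas uniform in a, whereas membership of a
  point is. The main obstacle is an asymmetry. That a derivative is algebraic over lower ones is
  witnessed by one equation and one inequation. That it is not algebraic is an infinite scheme of
  conditions, so a point with few leaders cannot be moved to nearby parameters by a single formula;
  it needs an algebraically closed field with one fresh transcendental per rank, and then the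
  realisation of a type. Homomorphisms and derivations defined only on generated subrings are
  handled through their graphs, as subrings of a product and of the dual numbers; extending a map by
  one generator then becomes a single question, whether the graph still has only zero above zero.
  Parameters enter leaders only through an algebraic closure, so generators of a differential ring
  stand for k\<langle>a\<rangle> until the final comparison.\<close>

inductive_set rgen :: "'r::comm_ring_1 set \<Rightarrow> 'r set" for S where
  rgen_one: "1 \<in> rgen S"
| rgen_base: "x \<in> S \<Longrightarrow> x \<in> rgen S"
| rgen_add: "x \<in> rgen S \<Longrightarrow> y \<in> rgen S \<Longrightarrow> x + y \<in> rgen S"
| rgen_neg: "x \<in> rgen S \<Longrightarrow> - x \<in> rgen S"
| rgen_mult: "x \<in> rgen S \<Longrightarrow> y \<in> rgen S \<Longrightarrow> x * y \<in> rgen S"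

lemma rgen_diff: "x \<in> rgen S \<Longrightarrow> y \<in> rgen S \<Longrightarrow> x - y \<in> rgen S"
  using rgen_add[of x S "- y"] rgen_neg[of y S] by simp

lemma rgen_zero: "0 \<in> rgen S"
  using rgen_diff[OF rgen_one rgen_one] by simp

lemma rgen_power: "x \<in> rgen S \<Longrightarrow> x ^ n \<in> rgen S"
  by (induction n) (auto intro: rgen_one rgen_mult)

lemma rgen_of_nat: "of_nat n \<in> rgen S"
  by (induction n) (auto intro: rgen_one rgen_add rgen_zero)

lemma rgen_sum: "(\<And>i. i \<in> I \<Longrightarrow> f i \<in> rgen S) \<Longrightarrow> sum f I \<in> rgen S"
  by (induction I rule: infinite_finite_induct) (auto intro: rgen_zero rgen_add)

lemma rgen_prod: "(\<And>i. i \<in> I \<Longrightarrow> f i \<in> rgen S) \<Longrightarrow> prod f I \<in> rgen S"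
  by (induction I rule: infinite_finite_induct) (auto intro: rgen_one rgen_mult)

lemma rgen_least: assumes "S \<subseteq> rgen T" shows "rgen S \<subseteq> rgen T"
proof
  fix x assume "x \<in> rgen S" then show "x \<in> rgen T"
    by induction (use assms in \<open>auto intro: rgen.intros\<close>)
qed

lemma rgen_mono: "S \<subseteq> T \<Longrightarrow> rgen S \<subseteq> rgen T"
  by (rule rgen_least) (auto intro: rgen_base)

definition pov :: "'r::comm_ring_1 set \<Rightarrow> 'r poly set" where
  "pov A = {p. \<forall>i. Polynomial.coeff p i \<in> A}"

lemma pov_mono: "A \<subseteq> B \<Longrightarrow> p \<in> pov A \<Longrightarrow> p \<in> pov B"
  by (auto simp: pov_def)

lemma pov_coeff: "p \<in> pov A \<Longrightarrow> Polynomial.coeff p i \<in> A"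
  by (auto simp: pov_def)

lemma pov_0: "0 \<in> pov (rgen S)"
  by (auto simp: pov_def rgen_zero)

lemma pov_add: "p \<in> pov (rgen S) \<Longrightarrow> q \<in> pov (rgen S) \<Longrightarrow> p + q \<in> pov (rgen S)"
  by (auto simp: pov_def rgen_add)

lemma pov_neg: "p \<in> pov (rgen S) \<Longrightarrow> - p \<in> pov (rgen S)"
  by (auto simp: pov_def rgen_neg)

lemma pov_diff: "p \<in> pov (rgen S) \<Longrightarrow> q \<in> pov (rgen S) \<Longrightarrow> p - q \<in> pov (rgen S)"
  by (auto simp: pov_def rgen_diff)

lemma pov_smult: "c \<in> rgen S \<Longrightarrow> q \<in> pov (rgen S) \<Longrightarrow> smult c q \<in> pov (rgen S)"
  by (auto simp: pov_def rgen_mult)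

lemma pov_mult: "p \<in> pov (rgen S) \<Longrightarrow> q \<in> pov (rgen S) \<Longrightarrow> p * q \<in> pov (rgen S)"
  by (auto simp: pov_def coeff_mult intro!: rgen_sum rgen_mult)

lemma pov_monom: "c \<in> rgen S \<Longrightarrow> Polynomial.monom c n \<in> pov (rgen S)"
  by (auto simp: pov_def rgen_zero)

lemma pov_pCons: "c \<in> rgen S \<Longrightarrow> q \<in> pov (rgen S) \<Longrightarrow> pCons c q \<in> pov (rgen S)"
  by (auto simp: pov_def coeff_pCons split: nat.splits)

lemma pov_sum: "(\<And>i. i \<in> I \<Longrightarrow> f i \<in> pov (rgen S)) \<Longrightarrow> sum f I \<in> pov (rgen S)"
  by (induction I rule: infinite_finite_induct) (auto intro: pov_0 pov_add)

lemma pov_pderiv: "p \<in> pov (rgen S) \<Longrightarrow> pderiv p \<in> pov (rgen S)"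
  unfolding pov_def
  by (auto simp only: Polynomial.coeff_pderiv mem_Collect_eq intro!: rgen_mult rgen_of_nat)

lemma poly_in_rgen: "p \<in> pov (rgen S) \<Longrightarrow> x \<in> rgen S \<Longrightarrow> poly p x \<in> rgen S"
  unfolding poly_altdef by (intro rgen_sum rgen_mult rgen_power) (auto simp: pov_def)

text \<open>All extension arguments add one generator at a time; this reduces them to statements
  about univariate polynomials.\<close>

lemma rgen_insert: "rgen (insert x S) = {poly p x |p. p \<in> pov (rgen S)}" (is "?L = ?R")
proof
  show "?L \<subseteq> ?R"
  proof
    fix z assume "z \<in> ?L"
    then show "z \<in> ?R"
    proof induction
      case rgen_one
      have "[:1:] \<in> pov (rgen S)" "poly [:1:] x = 1" by (auto intro!: pov_pCons pov_0 rgen.intros)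
      then show ?case by (metis (mono_tags, lifting) mem_Collect_eq)
    next
      case (rgen_base y)
      show ?case
      proof (cases "y = x")
        case True
        have "[:0,1:] \<in> pov (rgen S)" "poly [:0,1:] x = y"
          using True by (auto intro!: pov_pCons pov_0 rgen.intros rgen_zero)
        then show ?thesis by (metis (mono_tags, lifting) mem_Collect_eq)
      next
        case False
        then have "[:y:] \<in> pov (rgen S)" "poly [:y:] x = y"
          using rgen_base by (auto intro!: pov_pCons pov_0 rgen.intros)
        then show ?thesis by (metis (mono_tags, lifting) mem_Collect_eq)
      qed
    next
      case (rgen_add y z)
      then show ?case by (force intro: pov_add simp flip: poly_add)
    next
      case (rgen_neg y)
      then show ?case by (force intro: pov_neg simp flip: poly_minus)
    next
      case (rgen_mult y z)
      then show ?case by (force intro: pov_mult simp flip: poly_mult)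
    qed
  qed
  show "?R \<subseteq> ?L"
    using pov_mono[OF rgen_mono[of S "insert x S"]]
    by (auto intro!: poly_in_rgen rgen.rgen_base[of x] simp del: insertCI)
qed

section \<open>Relative algebraic closure in a field\<close>

definition acl :: "'a::field set \<Rightarrow> 'a set" where
  "acl S = {x. \<exists>p\<in>pov (rgen S). p \<noteq> 0 \<and> poly p x = 0}"

abbreviation rta :: "'a::field ring" where "rta \<equiv> ring_of_type_algebra"

lemma rta_simps [simp]:
  "carrier rta = UNIV" "x \<otimes>\<^bsub>rta\<^esub> y = x * y" "\<one>\<^bsub>rta\<^esub> = 1" "\<zero>\<^bsub>rta\<^esub> = 0" "x \<oplus>\<^bsub>rta\<^esub> y = x + y"
  by (simp_all add: ring_of_type_algebra_def)

lemma rta_neg [simp]: "\<ominus>\<^bsub>rta\<^esub> x = - (x::'a::field)"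
proof -
  interpret field "rta :: 'a ring" by (rule field_from_type_algebra)
  show ?thesis using minus_equality[of "-x" x] by simp
qed

lemma rta_inv: assumes "x \<noteq> 0" shows "inv\<^bsub>rta\<^esub> x = inverse (x::'a::field)"
proof -
  interpret field "rta :: 'a ring" by (rule field_from_type_algebra)
  show ?thesis using comm_inv_char[of x "inverse x"] assms by simp
qed

lemma rta_pow [simp]: "x [^]\<^bsub>rta\<^esub> (n::nat) = (x::'a::field) ^ n"
proof -
  interpret field "rta :: 'a ring" by (rule field_from_type_algebra)
  show ?thesis by (induction n) auto
qed

lemma rta_eval: "ring.eval rta p (x::'a::field) = poly (Poly (rev p)) x"
proof -
  interpret field "rta :: 'a ring" by (rule field_from_type_algebra)
  show ?thesis by (induction p) (auto simp: Poly_append poly_monom add.commute)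
qed

lemma subfield_rta:
  assumes "1 \<in> K" "\<And>x y. x \<in> K \<Longrightarrow> y \<in> K \<Longrightarrow> x + y \<in> K" "\<And>x. x \<in> K \<Longrightarrow> - x \<in> K"
    "\<And>x y. x \<in> K \<Longrightarrow> y \<in> K \<Longrightarrow> x * y \<in> K" "\<And>x. x \<in> K \<Longrightarrow> inverse x \<in> K"
  shows "subfield K (rta :: 'a::field ring)"
proof -
  interpret field "rta :: 'a ring" by (rule field_from_type_algebra)
  show ?thesis using assms by (intro subfieldI' subringI) (auto simp: rta_inv)
qed

lemma subfield_rtaD:
  assumes "subfield K (rta :: 'a::field ring)"
  shows "1 \<in> K" "0 \<in> K" "x \<in> K \<Longrightarrow> y \<in> K \<Longrightarrow> x + y \<in> K" "x \<in> K \<Longrightarrow> - x \<in> K"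
    "x \<in> K \<Longrightarrow> y \<in> K \<Longrightarrow> x * y \<in> K" "x \<in> K \<Longrightarrow> inverse x \<in> K"
proof -
  interpret field "rta :: 'a ring" by (rule field_from_type_algebra)
  note * = subfieldE[OF assms] subringE[OF subfieldE(1)[OF assms]]
  show "1 \<in> K" "0 \<in> K" "x \<in> K \<Longrightarrow> y \<in> K \<Longrightarrow> x + y \<in> K" "x \<in> K \<Longrightarrow> - x \<in> K"
    "x \<in> K \<Longrightarrow> y \<in> K \<Longrightarrow> x * y \<in> K"
    using * by auto
  show "x \<in> K \<Longrightarrow> inverse x \<in> K"
    using subfield_m_inv(1)[OF assms, of x] *(2) \<open>0 \<in> K\<close> by (cases "x = 0") (auto simp: rta_inv)
qed

lemma generate_field_quotient:
  assumes "z \<in> generate_field rta (S::'a::field set)"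
  shows "\<exists>a\<in>rgen S. \<exists>b\<in>rgen S. b \<noteq> 0 \<and> z = a / b"
  using assms
proof induction
  case one
  then show ?case by (intro bexI[of _ 1]) (auto intro: rgen_one)
next
  case (incl h)
  then show ?case by (intro bexI[of _ h] bexI[of _ 1]) (auto intro: rgen_one rgen_base)
next
  case (a_inv h)
  then show ?case by (metis rgen_neg minus_divide_left rta_neg)
next
  case (m_inv h)
  then show ?case by (metis divide_eq_0_iff inverse_divide rta_inv rta_simps(4))
next
  case (eng_add h1 h2)
  then obtain a b c d where "a \<in> rgen S" "b \<in> rgen S" "c \<in> rgen S" "d \<in> rgen S" "b \<noteq> 0" "d \<noteq> 0"
     "h1 = a / b" "h2 = c / d" by blast
  then show ?case
    by (intro bexI[of _ "a * d + c * b"] bexI[of _ "b * d"])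
      (auto intro!: rgen_add rgen_mult simp: add_frac_eq)
next
  case (eng_mult h1 h2)
  then obtain a b c d where "a \<in> rgen S" "b \<in> rgen S" "c \<in> rgen S" "d \<in> rgen S" "b \<noteq> 0" "d \<noteq> 0"
     "h1 = a / b" "h2 = c / d" by blast
  then show ?case
    by (intro bexI[of _ "a * c"] bexI[of _ "b * d"]) (auto intro!: rgen_mult)
qed

lemma rgen_generate_field: "rgen S \<subseteq> generate_field (rta::'a::field ring) S"
proof
  fix x assume "x \<in> rgen S"
  then show "x \<in> generate_field (rta::'a::field ring) S"
    by induction (metis generate_field.intros rta_simps rta_neg)+
qed

text \<open>\<open>acl\<close> asks for a relation over the generated subring, which avoids
  fractions; a relation over the generated field becomes one after multiplication by a common
  denominator. Facts about algebraic elements of field extensions thus transfer to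
  \<open>acl\<close>.\<close>

lemma acl_iff_algebraic:
  "x \<in> acl S \<longleftrightarrow> (ring.algebraic (rta::'a::field ring) over generate_field rta S) x"
proof -
  interpret field "rta :: 'a ring" by (rule field_from_type_algebra)
  let ?K = "generate_field rta S"
  have sf: "subfield ?K rta" by (rule generate_field_is_subfield) simp
  show ?thesis
  proof
    assume "x \<in> acl S"
    then obtain p where p: "p \<in> pov (rgen S)" "p \<noteq> 0" "poly p x = 0" by (auto simp: acl_def)
    let ?l = "rev (coeffs p)"
    have "set (coeffs p) \<subseteq> ?K"
      using p(1) rgen_generate_field[of S] range_coeff[of p]
      by (auto simp: pov_def) (metis in_mono insert_iff rangeE)
    then have "?l \<in> carrier (?K[X]\<^bsub>rta\<^esub>)"
      using p(2) by (auto simp: univ_poly_def polynomial_def hd_rev last_coeffs_eq_coeff_degree)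
    moreover have "?l \<noteq> []" using p(2) by simp
    moreover have "eval ?l x = \<zero>\<^bsub>rta\<^esub>" using p(3) by (simp add: rta_eval)
    ultimately show "(algebraic over ?K) x" by (rule algebraicI)
  next
    assume "(algebraic over ?K) x"
    then obtain l where l: "l \<in> carrier (?K[X]\<^bsub>rta\<^esub>)" "l \<noteq> []" "eval l x = \<zero>\<^bsub>rta\<^esub>"
      using algebraicE[OF subfieldE(1)[OF sf]] by auto
    define q where "q = Poly (rev l)"
    have q0: "poly q x = 0" using l(3) by (simp add: rta_eval q_def)
    have "Polynomial.coeff q (length l - 1) = hd l"
      using l(2) by (simp add: q_def nth_default_def rev_nth hd_conv_nth)
    moreover have "hd l \<noteq> 0" using l(1,2) by (auto simp: univ_poly_def polynomial_def)
    ultimately have "q \<noteq> 0" by auto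
    have "set l \<subseteq> ?K" using l(1,2) by (auto simp: univ_poly_def polynomial_def)
    then have cK: "Polynomial.coeff q i \<in> ?K" for i
      using subfield_rtaD(2)[OF sf] by (auto simp: q_def nth_default_def) (metis length_rev nth_mem set_rev subsetD)
    then have "\<forall>i. \<exists>b\<in>rgen S. b \<noteq> 0 \<and> b * Polynomial.coeff q i \<in> rgen S"
      using generate_field_quotient[of _ S] by (metis nonzero_mult_div_cancel_left times_divide_eq_right)
    then obtain b where b: "b i \<in> rgen S" "b i \<noteq> 0" "b i * Polynomial.coeff q i \<in> rgen S" for i by metis
    \<comment> \<open>The product of the denominators chosen up to the degree; beyond it the
      coefficients are zero anyway.\<close>
    define d where "d = (\<Prod>i\<le>Polynomial.degree q. b i)"
    have "d * Polynomial.coeff q i \<in> rgen S" for i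
    proof (cases "i \<le> Polynomial.degree q")
      case True
      then have "d = (\<Prod>j\<in>{..Polynomial.degree q} - {i}. b j) * b i"
        unfolding d_def using prod.remove[of "{..Polynomial.degree q}" i b] by (simp add: mult.commute)
      then have "d * Polynomial.coeff q i = (\<Prod>j\<in>{..Polynomial.degree q} - {i}. b j) * (b i * Polynomial.coeff q i)"
        by simp
      moreover have "(\<Prod>j\<in>{..Polynomial.degree q} - {i}. b j) \<in> rgen S" by (intro rgen_prod b)
      ultimately show ?thesis using b(3)[of i] rgen_mult by metis
    next
      case False
      then show ?thesis by (simp add: coeff_eq_0 rgen_zero)
    qed
    then have "smult d q \<in> pov (rgen S)" by (simp add: pov_def)
    moreover have "d \<noteq> 0" by (simp add: d_def b)
    ultimately show "x \<in> acl S" unfolding acl_def using q0 \<open>q \<noteq> 0\<close>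
      by (intro CollectI bexI[of _ "smult d q"]) auto
  qed
qed

lemma acl_base: "S \<subseteq> acl (S::'a::field set)"
proof
  fix x assume "x \<in> S"
  then have "[:-x, 1:] \<in> pov (rgen S)" by (intro pov_pCons pov_0) (auto intro: rgen.intros)
  then show "x \<in> acl S" unfolding acl_def by (intro CollectI bexI[of _ "[:-x,1:]"]) auto
qed

lemma acl_mono: "S \<subseteq> T \<Longrightarrow> acl S \<subseteq> acl T"
  unfolding acl_def using pov_mono[OF rgen_mono[of S T]] by blast

lemma subfield_acl: "subfield (acl S) (rta::'a::field ring)"
proof -
  interpret field "rta :: 'a ring" by (rule field_from_type_algebra)
  have "subfield (generate_field rta S) rta" by (rule generate_field_is_subfield) simp
  from subfield_of_algebraics[OF this] show ?thesis
    by (simp add: acl_iff_algebraic[symmetric])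
qed

lemmas acl_closed = subfield_rtaD[OF subfield_acl]

lemma generate_field_subset: "subfield K (rta::'a::field ring) \<Longrightarrow> S \<subseteq> K \<Longrightarrow> generate_field rta S \<subseteq> K"
proof -
  interpret field "rta :: 'a ring" by (rule field_from_type_algebra)
  show "subfield K (rta::'a::field ring) \<Longrightarrow> S \<subseteq> K \<Longrightarrow> generate_field rta S \<subseteq> K"
    by (rule generate_field_min_subfield1) auto
qed

text \<open>Transitivity by degrees: the coefficients \<open>l\<close> of a relation for
  \<open>z\<close> generate a finite extension \<open>E\<close> of the base field, and
  \<open>z\<close> has finite degree over \<open>E\<close>, hence over the base.\<close>

lemma acl_least: assumes "T \<subseteq> acl (S::'a::field set)" shows "acl T \<subseteq> acl S"
proof
  interpret field "rta :: 'a ring" by (rule field_from_type_algebra)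
  fix z assume "z \<in> acl T"
  then have z: "(algebraic over generate_field rta T) z" by (simp add: acl_iff_algebraic)
  let ?F = "generate_field rta S"
  have sF: "subfield ?F rta" by (rule generate_field_is_subfield) simp
  have sT: "subfield (generate_field rta T) rta" by (rule generate_field_is_subfield) simp
  obtain l where l: "l \<in> carrier ((generate_field rta T)[X]\<^bsub>rta\<^esub>)" "l \<noteq> []" "eval l z = \<zero>\<^bsub>rta\<^esub>"
    using algebraicE[OF subfieldE(1)[OF sT] _ z] by auto
  have lT: "set l \<subseteq> generate_field rta T" using l(1,2) by (auto simp: univ_poly_def polynomial_def)
  have alg: "(algebraic over ?F) x" if "x \<in> set l" for x
    using that lT generate_field_subset[OF subfield_acl assms] by (auto simp: acl_iff_algebraic)
  define E where "E = finite_extension ?F l"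
  have sE: "subfield E rta" "finite_dimension ?F E"
    unfolding E_def using finite_extension_is_subfield[OF sF _ alg]
      finite_extension_finite_dimension(1)[OF sF _ alg] by auto
  have "set l \<subseteq> E" unfolding E_def by (rule finite_extension_mem) (use subfieldE(1)[OF sF] in auto)
  then have "l \<in> carrier (E[X]\<^bsub>rta\<^esub>)" using l(1,2) by (auto simp: univ_poly_def polynomial_def)
  then have zE: "(algebraic over E) z" using l(2,3) by (rule algebraicI)
  have fd: "finite_dimension ?F (simple_extension E z)"
    using telescopic_base_dim(1)[OF sF sE] finite_dimension_simple_extension[OF sE(1), of z] zE by auto
  have "subring (simple_extension E z) rta"
    by (rule simple_extension_is_subring[OF subfieldE(1)[OF sE(1)]]) simp
  from finite_dimension_imp_algebraic[OF sF this fd] simple_extension_mem[OF subfieldE(1)[OF sE(1)], of z]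
  show "z \<in> acl S" by (auto simp: acl_iff_algebraic)
qed

lemma acl_eqI: "T \<subseteq> acl (S::'a::field set) \<Longrightarrow> S \<subseteq> acl T \<Longrightarrow> acl T = acl S"
  by (meson acl_least subset_antisym)

lemma rgen_subset_acl: "rgen S \<subseteq> acl (S::'a::field set)"
proof
  fix x assume "x \<in> rgen S" then show "x \<in> acl S"
    by induction (use acl_base in \<open>auto intro: acl_closed\<close>)
qed

lemma acl_root: "p \<in> pov (rgen S) \<Longrightarrow> p \<noteq> 0 \<Longrightarrow> poly p x = 0 \<Longrightarrow> x \<in> acl S"
  by (auto simp: acl_def)

text \<open>A relation for \<open>y\<close> over \<open>S\<close> and \<open>x\<close> is regrouped
  by powers of \<open>x\<close>. Since \<open>y\<close> is transcendental over \<open>S\<close>, a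
  coefficient polynomial vanishing at \<open>y\<close> is zero, so the regrouped relation for
  \<open>x\<close> over \<open>S\<close> and \<open>y\<close> cannot be trivial.\<close>

lemma acl_exchange:
  assumes "y \<in> acl (insert x S)" "y \<notin> acl S" shows "x \<in> acl (insert y S)"
proof -
  obtain p where p: "p \<in> pov (rgen (insert x S))" "p \<noteq> 0" "poly p y = 0"
    using assms(1) by (auto simp: acl_def)
  have "\<forall>k. \<exists>q\<in>pov (rgen S). Polynomial.coeff p k = poly q x"
    using p(1) by (auto simp: pov_def rgen_insert)
  then obtain q where q: "q k \<in> pov (rgen S)" "Polynomial.coeff p k = poly (q k) x" for k by metis
  define D where "D = Max ((\<lambda>k. Polynomial.degree (q k)) ` {..Polynomial.degree p})"
  have D: "Polynomial.degree (q k) \<le> D" if "k \<le> Polynomial.degree p" for k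
    unfolding D_def using that by (intro Max_ge) auto
  define r where "r = (\<lambda>j. \<Sum>k\<le>Polynomial.degree p. Polynomial.monom (Polynomial.coeff (q k) j) k)"
  have cr: "Polynomial.coeff (r j) k = (if k \<le> Polynomial.degree p then Polynomial.coeff (q k) j else 0)" for j k
    unfolding r_def coeff_sum by (auto simp: sum.delta)
  have r: "r j \<in> pov (rgen S)" for j
    by (auto simp: pov_def cr rgen_zero intro: pov_coeff[OF q(1)])
  define P where "P = (\<Sum>j\<le>D. Polynomial.monom (poly (r j) y) j)"
  have cP: "Polynomial.coeff P j = (if j \<le> D then poly (r j) y else 0)" for j
    unfolding P_def coeff_sum by (auto simp: sum.delta)
  have Pov: "P \<in> pov (rgen (insert y S))"
  proof -
    have "poly (r j) y \<in> rgen (insert y S)" for j using r[of j] by (auto simp: rgen_insert)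
    then show ?thesis by (simp add: pov_def cP rgen_zero)
  qed
  have "poly P x = (\<Sum>j\<le>D. \<Sum>k\<le>Polynomial.degree p. Polynomial.coeff (q k) j * y ^ k * x ^ j)"
    by (simp add: P_def poly_sum poly_monom r_def sum_distrib_right)
  also have "\<dots> = (\<Sum>k\<le>Polynomial.degree p. \<Sum>j\<le>D. Polynomial.coeff (q k) j * y ^ k * x ^ j)"
    by (rule sum.swap)
  also have "\<dots> = (\<Sum>k\<le>Polynomial.degree p. poly (q k) x * y ^ k)"
  proof (rule sum.cong[OF refl])
    fix k assume "k \<in> {..Polynomial.degree p}"
    then have "poly (q k) x = (\<Sum>j\<le>D. Polynomial.coeff (q k) j * x ^ j)"
      using D[of k] by (auto simp: poly_altdef intro!: sum.mono_neutral_left coeff_eq_0)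
    then show "(\<Sum>j\<le>D. Polynomial.coeff (q k) j * y ^ k * x ^ j) = poly (q k) x * y ^ k"
      by (simp add: sum_distrib_left mult_ac)
  qed
  also have "\<dots> = poly p y" by (simp add: poly_altdef q(2))
  finally have "poly P x = 0" using p(3) by simp
  moreover have "P \<noteq> 0"
  proof
    assume "P = 0"
    then have "poly (r j) y = 0" if "j \<le> D" for j using cP[of j] that by simp
    then have r0: "r j = 0" if "j \<le> D" for j using assms(2) r[of j] that by (auto simp: acl_def)
    let ?k = "Polynomial.degree p"
    have "Polynomial.coeff (q ?k) j = 0" for j
    proof (cases "j \<le> D")
      case True then show ?thesis using cr[of j ?k] r0[of j] by simp
    next
      case False then show ?thesis using D[of ?k] by (simp add: coeff_eq_0)
    qed
    then have "q ?k = 0" by (simp add: poly_eq_iff)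
    then show False using q(2)[of ?k] p(2) by simp
  qed
  ultimately show ?thesis using Pov by (auto intro: acl_root)
qed


text \<open>For \<open>D\<close> maximal between \<open>D0\<close> and \<open>B\<close> with
  \<open>c\<close> not algebraic over it, any further element of \<open>B\<close> can be exchanged
  for \<open>c\<close>. Starting from \<open>D0\<close> protects its elements from being exchanged
  away.\<close>

lemma exchange_step:
  assumes "finite B" "c \<in> acl (L \<union> B)" "D0 \<subseteq> B" "c \<notin> acl (L \<union> D0)"
  obtains b where "b \<in> B" "b \<notin> D0" "b \<in> acl (insert c (L \<union> (B - {b})))"
proof -
  have "finite {D. D \<subseteq> B \<and> D0 \<subseteq> D \<and> c \<notin> acl (L \<union> D)}"
    by (rule finite_subset[of _ "Pow B"]) (use assms in auto)
  moreover have "D0 \<in> {D. D \<subseteq> B \<and> D0 \<subseteq> D \<and> c \<notin> acl (L \<union> D)}" using assms by auto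
  ultimately obtain D where D: "D \<in> {D. D \<subseteq> B \<and> D0 \<subseteq> D \<and> c \<notin> acl (L \<union> D)}" 
    and max: "\<And>D'. D' \<in> {D. D \<subseteq> B \<and> D0 \<subseteq> D \<and> c \<notin> acl (L \<union> D)} \<Longrightarrow> D \<subseteq> D' \<Longrightarrow> D = D'"
    using finite_has_maximal2 by (metis (no_types, lifting))
  from D assms(2) have "D \<noteq> B" by auto
  then obtain b where b: "b \<in> B" "b \<notin> D" using D by auto
  have "c \<in> acl (insert b (L \<union> D))"
  proof (rule ccontr)
    assume "c \<notin> acl (insert b (L \<union> D))"
    then have "D = insert b D" by (intro max) (use D b in auto)
    then show False using b by auto
  qed
  then have "b \<in> acl (insert c (L \<union> D))" by (rule acl_exchange) (use D in auto)
  moreover have "acl (insert c (L \<union> D)) \<subseteq> acl (insert c (L \<union> (B - {b})))"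
    by (rule acl_mono) (use D b in auto)
  ultimately show ?thesis using that[of b] b D by auto
qed

text \<open>Induction on the number of elements of \<open>C\<close> outside \<open>B\<close>: such
  an element replaces one of \<open>B\<close>. Protecting \<open>B \<inter> C\<close> ensures that
  the replaced element lies outside \<open>C\<close>, so progress is never undone.\<close>

lemma steinitz_card_le:
  assumes "finite B" "finite C" "C \<subseteq> acl (L \<union> B)" "\<forall>c\<in>C. c \<notin> acl (L \<union> (C - {c}))"
  shows "card C \<le> card B"
  using assms(1,3)
proof (induction "card (C - B)" arbitrary: B rule: less_induct)
  case less
  show ?case
  proof (cases "C \<subseteq> B")
    case True then show ?thesis using less.prems card_mono by blast
  next
    case False
    then obtain c where c: "c \<in> C" "c \<notin> B" by auto
    have "acl (L \<union> (B \<inter> C)) \<subseteq> acl (L \<union> (C - {c}))" by (rule acl_mono) (use c in auto)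
    then have "c \<notin> acl (L \<union> (B \<inter> C))" using assms(4) c by auto
    then obtain b where b: "b \<in> B" "b \<notin> B \<inter> C" "b \<in> acl (insert c (L \<union> (B - {b})))"
      using exchange_step[of B c L "B \<inter> C"] less.prems c by blast
    let ?B = "insert c (B - {b})"
    have "L \<union> B \<subseteq> acl (L \<union> ?B)" using b acl_base[of "L \<union> ?B"] by auto
    then have "C \<subseteq> acl (L \<union> ?B)" using less.prems(2) acl_least by blast
    moreover have "C - ?B \<subset> C - B" using b c by auto
    then have "card (C - ?B) < card (C - B)" by (intro psubset_card_mono) (use assms in auto)
    ultimately have "card C \<le> card ?B" using less.prems by (intro less.hyps) auto
    also have "card ?B = card B" using b c less.prems card.remove[of B b] by (simp add: card_insert_if)
    finally show ?thesis .
  qed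
qed

subsection \<open>Evaluation of polynomials\<close>

definition mono_eval :: "('v \<Rightarrow> 'a::comm_semiring_1) \<Rightarrow> ('v \<Rightarrow>\<^sub>0 nat) \<Rightarrow> 'a" where
  "mono_eval \<rho> u = (\<Prod>x\<in>Poly_Mapping.keys u. \<rho> x ^ Poly_Mapping.lookup u x)"

lemma mono_eval_superset:
  assumes "finite A" "Poly_Mapping.keys u \<subseteq> A"
  shows "mono_eval \<rho> u = (\<Prod>x\<in>A. \<rho> x ^ Poly_Mapping.lookup u x)"
  unfolding mono_eval_def by (rule prod.mono_neutral_left) (use assms in \<open>auto simp: in_keys_iff\<close>)

lemma mono_eval_add: "mono_eval \<rho> (u + v) = mono_eval \<rho> u * mono_eval \<rho> v"
proof -
  let ?A = "Poly_Mapping.keys u \<union> Poly_Mapping.keys v"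
  have "Poly_Mapping.keys (u + v) \<subseteq> ?A" by (rule Poly_Mapping.keys_add)
  then show ?thesis
    by (simp add: mono_eval_superset[of ?A] lookup_add power_add prod.distrib)
qed

lemma mono_eval_single: "mono_eval \<rho> (Poly_Mapping.single x k) = \<rho> x ^ k"
  by (simp add: mono_eval_superset[of "{x}"])

lemma mono_eval_0 [simp]: "mono_eval \<rho> 0 = 1"
  by (simp add: mono_eval_def)

lemma mpoly_eval_superset:
  assumes "finite A" "Poly_Mapping.keys P \<subseteq> A"
  shows "mpoly_eval \<rho> P = (\<Sum>u\<in>A. Poly_Mapping.lookup P u * mono_eval \<rho> u)"
  unfolding mpoly_eval_def mono_eval_def[symmetric]
  by (rule sum.mono_neutral_left) (use assms in \<open>auto simp: in_keys_iff\<close>)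

lemma mpoly_eval_add: "mpoly_eval \<rho> (P + Q) = mpoly_eval \<rho> P + mpoly_eval \<rho> Q"
proof -
  let ?A = "Poly_Mapping.keys P \<union> Poly_Mapping.keys Q"
  have "Poly_Mapping.keys (P + Q) \<subseteq> ?A" by (rule Poly_Mapping.keys_add)
  then show ?thesis
    by (simp add: mpoly_eval_superset[of ?A] lookup_add algebra_simps sum.distrib)
qed

lemma mpoly_eval_0 [simp]: "mpoly_eval \<rho> 0 = 0"
  by (simp add: mpoly_eval_def)

lemma mpoly_eval_sum: "mpoly_eval \<rho> (\<Sum>i\<in>I. f i) = (\<Sum>i\<in>I. mpoly_eval \<rho> (f i))"
  by (induction I rule: infinite_finite_induct) (auto simp: mpoly_eval_add)

lemma mpoly_eval_single: "mpoly_eval \<rho> (Poly_Mapping.single u c) = c * mono_eval \<rho> u"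
  by (simp add: mpoly_eval_superset[of "{u}"])

lemma poly_mapping_sum_single: "P = (\<Sum>u\<in>Poly_Mapping.keys P. Poly_Mapping.single u (Poly_Mapping.lookup P u))"
proof (rule poly_mapping_eqI)
  fix u
  show "Poly_Mapping.lookup P u = Poly_Mapping.lookup (\<Sum>u\<in>Poly_Mapping.keys P. Poly_Mapping.single u (Poly_Mapping.lookup P u)) u"
    by (simp add: lookup_sum lookup_single when_def sum.delta in_keys_iff)
qed

lemma mpoly_eval_mult:
  fixes \<rho> :: "'v \<Rightarrow> 'a::comm_semiring_1"
  shows "mpoly_eval \<rho> (P * Q) = mpoly_eval \<rho> P * mpoly_eval \<rho> Q"
proof -
  have 1: "mpoly_eval \<rho> (Poly_Mapping.single u c * Poly_Mapping.single v d) = (c * mono_eval \<rho> u) * (d * mono_eval \<rho> v)"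
    for u v c d by (simp add: mult_single mpoly_eval_single mono_eval_add mult_ac)
  have "mpoly_eval \<rho> (P * Q) = mpoly_eval \<rho> ((\<Sum>u\<in>Poly_Mapping.keys P. Poly_Mapping.single u (Poly_Mapping.lookup P u))
      * (\<Sum>u\<in>Poly_Mapping.keys Q. Poly_Mapping.single u (Poly_Mapping.lookup Q u)))"
    by (simp flip: poly_mapping_sum_single)
  also have "\<dots> = (\<Sum>u\<in>Poly_Mapping.keys P. Poly_Mapping.lookup P u * mono_eval \<rho> u) *
      (\<Sum>u\<in>Poly_Mapping.keys Q. Poly_Mapping.lookup Q u * mono_eval \<rho> u)"
    unfolding sum_product mpoly_eval_sum 1 ..
  finally show ?thesis by (simp add: mpoly_eval_def mono_eval_def)
qed

lemma mpoly_eval_uminus: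
  fixes \<rho> :: "'v \<Rightarrow> 'a::comm_ring_1"
  shows "mpoly_eval \<rho> (- P) = - mpoly_eval \<rho> P"
  using mpoly_eval_add[of \<rho> P "- P"] by (simp add: eq_neg_iff_add_eq_0 add.commute)

lemma rgen_closed:
  assumes "rgen A \<subseteq> A"
  shows "x \<in> A \<Longrightarrow> y \<in> A \<Longrightarrow> x + y \<in> A" "x \<in> A \<Longrightarrow> y \<in> A \<Longrightarrow> x * y \<in> A"
    "1 \<in> A" "x \<in> A \<Longrightarrow> - x \<in> A" "0 \<in> A"
  using assms rgen_zero[of A] by (meson rgen.intros subsetD)+

lemma mpolysI: "(\<And>u. u \<in> Poly_Mapping.keys P \<Longrightarrow> Poly_Mapping.lookup P u \<in> A \<and> Poly_Mapping.keys u \<subseteq> I) \<Longrightarrow> P \<in> mpolys A I"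
  by (auto simp: mpolys_def)

lemma mpolys_mono: "A \<subseteq> B \<Longrightarrow> I \<subseteq> J \<Longrightarrow> mpolys A I \<subseteq> mpolys B J"
  by (fastforce simp: mpolys_def)

lemma mpolys_lookup: "P \<in> mpolys A I \<Longrightarrow> 0 \<in> A \<Longrightarrow> Poly_Mapping.lookup P u \<in> A"
  by (cases "u \<in> Poly_Mapping.keys P") (auto simp: mpolys_def in_keys_iff)

lemma mpolys_0: "0 \<in> mpolys A I"
  by (simp add: mpolys_def)

lemma mpolys_single: "c \<in> A \<Longrightarrow> Poly_Mapping.keys u \<subseteq> I \<Longrightarrow> Poly_Mapping.single u c \<in> mpolys A I"
  by (auto simp: mpolys_def)

lemma mpolys_add:
  assumes "rgen A \<subseteq> A" "P \<in> mpolys A I" "Q \<in> mpolys A I" shows "P + Q \<in> mpolys A I"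
proof (rule mpolysI)
  fix u assume u: "u \<in> Poly_Mapping.keys (P + Q)"
  have "0 \<in> A" using assms(1) rgen_zero by blast
  then have "Poly_Mapping.lookup P u \<in> A" "Poly_Mapping.lookup Q u \<in> A" using assms mpolys_lookup by metis+
  then have "Poly_Mapping.lookup P u + Poly_Mapping.lookup Q u \<in> A"
    using rgen_closed(1)[OF assms(1)] by blast
  moreover have "Poly_Mapping.keys u \<subseteq> I"
    using u Poly_Mapping.keys_add[of P Q] assms(2,3) by (auto simp: mpolys_def)
  ultimately show "Poly_Mapping.lookup (P + Q) u \<in> A \<and> Poly_Mapping.keys u \<subseteq> I" by (simp add: lookup_add)
qed

lemma mpolys_sum:
  assumes "rgen A \<subseteq> A" "\<And>i. i \<in> S \<Longrightarrow> f i \<in> mpolys A I" shows "sum f S \<in> mpolys A I"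
  using assms(2) by (induction S rule: infinite_finite_induct) (auto intro: mpolys_0 mpolys_add[OF assms(1)])

lemma mpolys_mult:
  assumes "rgen A \<subseteq> A" "P \<in> mpolys A I" "Q \<in> mpolys A I" shows "P * Q \<in> mpolys A I"
proof -
  have "P * Q = (\<Sum>u\<in>Poly_Mapping.keys P. \<Sum>v\<in>Poly_Mapping.keys Q. 
      Poly_Mapping.single (u + v) (Poly_Mapping.lookup P u * Poly_Mapping.lookup Q v))"
    unfolding mult_single[symmetric] sum_product[symmetric] poly_mapping_sum_single[symmetric] ..
  also have "\<dots> \<in> mpolys A I"
  proof (intro mpolys_sum[OF assms(1)] mpolys_single)
    fix u v assume uv: "u \<in> Poly_Mapping.keys P" "v \<in> Poly_Mapping.keys Q"
    show "Poly_Mapping.lookup P u * Poly_Mapping.lookup Q v \<in> A"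
      using uv assms rgen_closed(2)[OF assms(1)] by (auto simp: mpolys_def)
    show "Poly_Mapping.keys (u + v) \<subseteq> I"
      using uv assms Poly_Mapping.keys_add[of u v] by (auto simp: mpolys_def) blast
  qed
  finally show ?thesis .
qed

lemma mpolys_uminus:
  assumes "rgen A \<subseteq> A" "P \<in> mpolys A I" shows "- P \<in> mpolys A (I :: 'v set)"
proof -
  have "Poly_Mapping.single (0 :: 'v \<Rightarrow>\<^sub>0 nat) (- 1) \<in> mpolys A I"
    by (rule mpolys_single) (auto intro!: subsetD[OF assms(1)] rgen_neg rgen_one)
  from mpolys_mult[OF assms(1) this assms(2)] show ?thesis by (simp add: single_uminus)
qed

lemma mpoly_eval_in_rgen:
  assumes "P \<in> mpolys A I" shows "mpoly_eval \<rho> P \<in> rgen (A \<union> \<rho> ` I)"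
  unfolding mpoly_eval_def using assms
  by (intro rgen_sum rgen_mult rgen_prod rgen_power) (auto simp: mpolys_def intro!: rgen_base)

lemma rgen_eq_mpoly_eval:
  assumes "rgen A \<subseteq> A" shows "rgen (A \<union> \<rho> ` I) = mpoly_eval \<rho> ` mpolys A I"
proof
  show "mpoly_eval \<rho> ` mpolys A I \<subseteq> rgen (A \<union> \<rho> ` I)" using mpoly_eval_in_rgen by blast
  show "rgen (A \<union> \<rho> ` I) \<subseteq> mpoly_eval \<rho> ` mpolys A I"
  proof
    have const: "c \<in> mpoly_eval \<rho> ` mpolys A I" if "c \<in> A" for c
      using that by (intro image_eqI[of _ _ "Poly_Mapping.single 0 c"] mpolys_single) (auto simp: mpoly_eval_single)
    fix z assume "z \<in> rgen (A \<union> \<rho> ` I)"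
    then show "z \<in> mpoly_eval \<rho> ` mpolys A I"
    proof induction
      case rgen_one
      then show ?case using const assms rgen.rgen_one by blast
    next
      case (rgen_base x)
      then show ?case
      proof
        assume "x \<in> A" then show ?thesis by (rule const)
      next
        assume "x \<in> \<rho> ` I"
        then obtain i where "i \<in> I" "x = \<rho> i" by auto
        moreover have "1 \<in> A" using assms rgen.rgen_one by blast
        ultimately show ?thesis
          by (intro image_eqI[of _ _ "Poly_Mapping.single (Poly_Mapping.single i 1) 1"] mpolys_single)
            (auto simp: mpoly_eval_single mono_eval_single)
      qed
    next
      case (rgen_add x y)
      then show ?case by (auto simp flip: mpoly_eval_add intro!: imageI mpolys_add[OF assms])
    next
      case (rgen_neg x)
      then show ?case by (auto simp flip: mpoly_eval_uminus intro!: imageI mpolys_uminus[OF assms])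
    next
      case (rgen_mult x y)
      then show ?case by (auto simp flip: mpoly_eval_mult intro!: imageI mpolys_mult[OF assms])
    qed
  qed
qed

lemma lookup_mult_single_one:
  fixes Q :: "('v \<Rightarrow>\<^sub>0 nat) \<Rightarrow>\<^sub>0 'a::comm_semiring_1"
  shows "Poly_Mapping.lookup (Q * Poly_Mapping.single s 1) v =
    (\<Sum>u\<in>Poly_Mapping.keys Q. if u + s = v then Poly_Mapping.lookup Q u else 0)"
proof -
  have "Q * Poly_Mapping.single s 1 = (\<Sum>u\<in>Poly_Mapping.keys Q. Poly_Mapping.single u (Poly_Mapping.lookup Q u)) * Poly_Mapping.single s 1"
    by (simp flip: poly_mapping_sum_single)
  then show ?thesis
    by (simp add: sum_distrib_right mult_single lookup_sum lookup_single when_def)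
qed

text \<open>The \<open>Q k\<close> do not contain the variable \<open>x\<close>, so the exponent of
  \<open>x\<close> in a monomial determines \<open>k\<close> and nothing cancels between different
  \<open>k\<close>.\<close>

lemma mpoly_comb_nonzero:
  fixes Q :: "nat \<Rightarrow> ('v \<Rightarrow>\<^sub>0 nat) \<Rightarrow>\<^sub>0 'a::comm_semiring_1"
  assumes "\<And>k u. u \<in> Poly_Mapping.keys (Q k) \<Longrightarrow> x \<notin> Poly_Mapping.keys u" "k0 \<le> d" "Q k0 \<noteq> 0"
  shows "(\<Sum>k\<le>d. Q k * Poly_Mapping.single (Poly_Mapping.single x k) 1) \<noteq> 0"
proof -
  obtain u0 where u0: "u0 \<in> Poly_Mapping.keys (Q k0)" using assms(3) by (metis ex_in_conv keys_eq_empty)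
  let ?v = "u0 + Poly_Mapping.single x k0"
  have key: "u + Poly_Mapping.single x k = ?v \<longleftrightarrow> k = k0 \<and> u = u0" if "u \<in> Poly_Mapping.keys (Q k)" for u k
  proof
    assume eq: "u + Poly_Mapping.single x k = ?v"
    have "Poly_Mapping.lookup u x = 0" "Poly_Mapping.lookup u0 x = 0"
      using assms(1) that u0 by (auto simp: in_keys_iff)
    moreover have "Poly_Mapping.lookup (u + Poly_Mapping.single x k) x = Poly_Mapping.lookup ?v x" using eq by simp
    ultimately have "k = k0" by (simp add: lookup_add)
    then show "k = k0 \<and> u = u0" using eq by simp
  qed simp
  have "Poly_Mapping.lookup (\<Sum>k\<le>d. Q k * Poly_Mapping.single (Poly_Mapping.single x k) 1) ?v =
     (\<Sum>k\<le>d. \<Sum>u\<in>Poly_Mapping.keys (Q k). if k = k0 \<and> u = u0 then Poly_Mapping.lookup (Q k) u else 0)"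
    unfolding lookup_sum lookup_mult_single_one by (intro sum.cong refl) (simp add: key)
  also have "\<dots> = (\<Sum>k\<le>d. if k = k0 then Poly_Mapping.lookup (Q k0) u0 else 0)"
    using u0 by (intro sum.cong refl) (auto simp: sum.delta)
  also have "\<dots> = Poly_Mapping.lookup (Q k0) u0" using assms(2) by simp
  finally show ?thesis using u0 by (auto simp: in_keys_iff)
qed

text \<open>Collecting the monomials by their exponent of \<open>x\<close> gives coefficients that
  serve every valuation \<open>\<rho>\<close> at once.\<close>

lemma mpoly_split:
  fixes P :: "('v \<Rightarrow>\<^sub>0 nat) \<Rightarrow>\<^sub>0 'a::comm_ring_1"
  assumes "P \<in> mpolys A (insert x B)" "rgen A \<subseteq> A" "x \<notin> B"
  obtains Q d where "\<And>k. Q k \<in> mpolys A B" "\<And>\<rho>. mpoly_eval \<rho> P = (\<Sum>k\<le>d. mpoly_eval \<rho> (Q k) * \<rho> x ^ k)"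
    "P \<noteq> 0 \<Longrightarrow> \<exists>k\<le>d. Q k \<noteq> 0"
proof -
  let ?l = "\<lambda>u. Poly_Mapping.lookup u x"
  let ?r = "\<lambda>u. u - Poly_Mapping.single x (?l u)"
  define d where "d = Max (insert 0 (?l ` Poly_Mapping.keys P))"
  have d: "?l u \<le> d" if "u \<in> Poly_Mapping.keys P" for u unfolding d_def using that by (intro Max_ge) auto
  define Q where "Q = (\<lambda>k. \<Sum>u\<in>Poly_Mapping.keys P. if ?l u = k then Poly_Mapping.single (?r u) (Poly_Mapping.lookup P u) else 0)"
  have ru: "?r u + Poly_Mapping.single x (?l u) = u" for u :: "'v \<Rightarrow>\<^sub>0 nat"
    by (rule poly_mapping_eqI) (auto simp: lookup_add lookup_minus lookup_single when_def)
  have keysr: "Poly_Mapping.keys (?r u) \<subseteq> Poly_Mapping.keys u - {x}" for u :: "'v \<Rightarrow>\<^sub>0 nat"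
    by (auto simp: in_keys_iff lookup_minus lookup_single when_def split: if_splits)
  have 1: "Q k \<in> mpolys A B" for k
    unfolding Q_def
  proof (rule mpolys_sum[OF assms(2)])
    fix u assume u: "u \<in> Poly_Mapping.keys P"
    show "(if ?l u = k then Poly_Mapping.single (?r u) (Poly_Mapping.lookup P u) else 0) \<in> mpolys A B"
      using u assms(1) keysr[of u] by (auto intro!: mpolys_0 mpolys_single simp: mpolys_def)
  qed
  have 2: "mpoly_eval \<rho> P = (\<Sum>k\<le>d. mpoly_eval \<rho> (Q k) * \<rho> x ^ k)" for \<rho>
  proof -
    have "(\<Sum>k\<le>d. mpoly_eval \<rho> (Q k) * \<rho> x ^ k) = 
      (\<Sum>k\<le>d. \<Sum>u\<in>Poly_Mapping.keys P. if ?l u = k then Poly_Mapping.lookup P u * mono_eval \<rho> (?r u) * \<rho> x ^ k else 0)"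
      unfolding Q_def mpoly_eval_sum sum_distrib_right
      by (intro sum.cong refl) (auto simp: mpoly_eval_single)
    also have "\<dots> = (\<Sum>u\<in>Poly_Mapping.keys P. \<Sum>k\<le>d. if ?l u = k then Poly_Mapping.lookup P u * mono_eval \<rho> (?r u) * \<rho> x ^ k else 0)"
      by (rule sum.swap)
    also have "\<dots> = (\<Sum>u\<in>Poly_Mapping.keys P. Poly_Mapping.lookup P u * (mono_eval \<rho> (?r u) * \<rho> x ^ ?l u))"
      using d by (intro sum.cong refl) (auto simp: sum.delta' mult.assoc)
    also have "\<dots> = (\<Sum>u\<in>Poly_Mapping.keys P. Poly_Mapping.lookup P u * mono_eval \<rho> u)"
      by (simp add: mono_eval_single[symmetric] mono_eval_add[symmetric] ru)
    finally show ?thesis by (simp add: mpoly_eval_def mono_eval_def)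
  qed
  have 3: "\<exists>k\<le>d. Q k \<noteq> 0" if "P \<noteq> 0"
  proof -
    obtain u0 where u0: "u0 \<in> Poly_Mapping.keys P" using \<open>P \<noteq> 0\<close> by (metis ex_in_conv keys_eq_empty)
    have "Poly_Mapping.lookup (Q (?l u0)) (?r u0) = (\<Sum>u\<in>Poly_Mapping.keys P. if u = u0 then Poly_Mapping.lookup P u else 0)"
      unfolding Q_def lookup_sum
    proof (intro sum.cong refl)
      fix u
      have "?l u = ?l u0 \<and> ?r u = ?r u0 \<longleftrightarrow> u = u0" by (metis ru)
      then show "Poly_Mapping.lookup (if ?l u = ?l u0 then Poly_Mapping.single (?r u) (Poly_Mapping.lookup P u) else 0) (?r u0)
        = (if u = u0 then Poly_Mapping.lookup P u else 0)"
        by (auto simp: lookup_single when_def)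
    qed
    also have "\<dots> = Poly_Mapping.lookup P u0" using u0 by simp
    finally show ?thesis using u0 d by (metis in_keys_iff lookup_zero)
  qed
  from that[OF 1 2 3] show ?thesis .
qed

text \<open>Independence of an indexed family. Over a subring \<open>L\<close> it excludes repeated
  values (\<open>indep_inj\<close>), unlike \<open>alg_independent\<close> of the image; this
  matters because different derivatives of a point may coincide.\<close>

definition indep :: "'a::field set \<Rightarrow> ('v \<Rightarrow> 'a) \<Rightarrow> 'v set \<Rightarrow> bool" where
  "indep L \<rho> B \<longleftrightarrow> (\<forall>P\<in>mpolys L B. mpoly_eval \<rho> P = 0 \<longrightarrow> P = 0)"

lemma alg_independent_indep: "alg_independent L B \<longleftrightarrow> indep L id B"
  by (simp add: alg_independent_def indep_def)

lemma indep_mono: "indep L \<rho> B \<Longrightarrow> C \<subseteq> B \<Longrightarrow> indep L \<rho> C"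
  unfolding indep_def using mpolys_mono[of L L C B] by blast

lemma indep_empty:
  fixes \<rho> :: "'v \<Rightarrow> 'a::field" shows "indep L \<rho> {}"
  unfolding indep_def
proof (intro ballI impI)
  fix P :: "('v \<Rightarrow>\<^sub>0 nat) \<Rightarrow>\<^sub>0 'a" assume P: "P \<in> mpolys L {}" "mpoly_eval \<rho> P = 0"
  have keys: "Poly_Mapping.keys P \<subseteq> {0}" using P(1) by (auto simp: mpolys_def)
  have "Poly_Mapping.lookup P 0 = 0" using P(2) mpoly_eval_superset[OF _ keys, of \<rho>] by simp
  then have "0 \<notin> Poly_Mapping.keys P" by (simp add: in_keys_iff)
  then show "P = 0" using keys by (metis insert_absorb keys_eq_empty subset_singletonD insertI1)
qed

text \<open>Links two views of dependence: a multivariate relation involving \<open>x\<close> is a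
  univariate relation for \<open>\<rho> x\<close> whose coefficients lie in the ring generated by
  the other values, and conversely.\<close>

lemma indep_insert:
  fixes L :: "'a::field set"
  assumes L: "rgen L \<subseteq> L" and x: "x \<notin> B"
  shows "indep L \<rho> (insert x B) \<longleftrightarrow> indep L \<rho> B \<and> \<rho> x \<notin> acl (L \<union> \<rho> ` B)"
proof
  assume ind: "indep L \<rho> (insert x B)"
  have B: "indep L \<rho> B" by (rule indep_mono[OF ind]) auto
  have "\<rho> x \<notin> acl (L \<union> \<rho> ` B)"
  proof
    assume "\<rho> x \<in> acl (L \<union> \<rho> ` B)"
    then obtain p where p: "p \<in> pov (rgen (L \<union> \<rho> ` B))" "p \<noteq> 0" "poly p (\<rho> x) = 0" by (auto simp: acl_def)
    have "\<forall>k. \<exists>q\<in>mpolys L B. Polynomial.coeff p k = mpoly_eval \<rho> q"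
      using p(1) rgen_eq_mpoly_eval[OF L, of \<rho> B] by (auto simp: pov_def)
    then obtain Q where Q: "Q k \<in> mpolys L B" "Polynomial.coeff p k = mpoly_eval \<rho> (Q k)" for k by metis
    let ?d = "Polynomial.degree p"
    let ?P = "\<Sum>k\<le>?d. Q k * Poly_Mapping.single (Poly_Mapping.single x k) 1"
    have "?P \<noteq> 0"
    proof (rule mpoly_comb_nonzero[of _ _ ?d])
      show "Q ?d \<noteq> 0" using Q(2)[of ?d] p(2) by auto
      show "x \<notin> Poly_Mapping.keys u" if "u \<in> Poly_Mapping.keys (Q k)" for k u
        using that Q(1)[of k] x by (auto simp: mpolys_def)
    qed simp
    moreover have "?P \<in> mpolys L (insert x B)"
    proof (intro mpolys_sum[OF L] mpolys_mult[OF L] mpolys_single)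
      show "Q k \<in> mpolys L (insert x B)" for k using Q(1)[of k] mpolys_mono[of L L B "insert x B"] by auto
      show "1 \<in> L" using L rgen_one by blast
    qed auto
    moreover have "mpoly_eval \<rho> ?P = 0"
      using p(3) by (simp add: mpoly_eval_sum mpoly_eval_mult mpoly_eval_single mono_eval_single poly_altdef Q(2))
    ultimately show False using ind by (auto simp: indep_def)
  qed
  with B show "indep L \<rho> B \<and> \<rho> x \<notin> acl (L \<union> \<rho> ` B)" by simp
next
  assume *: "indep L \<rho> B \<and> \<rho> x \<notin> acl (L \<union> \<rho> ` B)"
  show "indep L \<rho> (insert x B)"
    unfolding indep_def
  proof (intro ballI impI, rule ccontr)
    fix P assume P: "P \<in> mpolys L (insert x B)" "mpoly_eval \<rho> P = 0" "P \<noteq> 0"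
    obtain Q d where Q: "\<And>k. Q k \<in> mpolys L B" "mpoly_eval \<rho> P = (\<Sum>k\<le>d. mpoly_eval \<rho> (Q k) * \<rho> x ^ k)"
      "\<exists>k\<le>d. Q k \<noteq> 0" using mpoly_split[OF P(1) L x] P(3) by metis
    define p where "p = (\<Sum>k\<le>d. Polynomial.monom (mpoly_eval \<rho> (Q k)) k)"
    have cp: "Polynomial.coeff p k = (if k \<le> d then mpoly_eval \<rho> (Q k) else 0)" for k
      unfolding p_def coeff_sum by (auto simp: sum.delta)
    have "p \<noteq> 0"
      using Q(1,3) * cp unfolding indep_def by (metis Polynomial.coeff_0)
    moreover have "p \<in> pov (rgen (L \<union> \<rho> ` B))"
      using mpoly_eval_in_rgen[OF Q(1), of \<rho>] by (auto simp: pov_def cp rgen_zero)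
    moreover have "poly p (\<rho> x) = 0" using P(2) Q(2) by (simp add: p_def poly_sum poly_monom)
    ultimately show False using * by (auto intro: acl_root)
  qed
qed

lemma alg_independent_mono: "alg_independent L B \<Longrightarrow> C \<subseteq> B \<Longrightarrow> alg_independent L C"
  unfolding alg_independent_indep by (rule indep_mono)

lemma alg_independent_insert:
  assumes "rgen L \<subseteq> (L :: 'a::field set)" "x \<notin> B"
  shows "alg_independent L (insert x B) \<longleftrightarrow> alg_independent L B \<and> x \<notin> acl (L \<union> B)"
  using indep_insert[OF assms, of id] by (simp add: alg_independent_indep)

lemma indep_not_acl:
  assumes "rgen L \<subseteq> (L::'a::field set)" "indep L \<rho> B" "b \<in> B"
  shows "\<rho> b \<notin> acl (L \<union> \<rho> ` (B - {b}))"
  using indep_insert[OF assms(1), of b "B - {b}"] assms(2,3) by (simp add: insert_absorb)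

lemma indep_inj:
  assumes "rgen L \<subseteq> (L::'a::field set)" "indep L \<rho> B" shows "inj_on \<rho> B"
proof (rule inj_onI, rule ccontr)
  fix x y assume xy: "x \<in> B" "y \<in> B" "\<rho> x = \<rho> y" "x \<noteq> y"
  then have "\<rho> x \<in> L \<union> \<rho> ` (B - {x})" by auto
  then have "\<rho> x \<in> acl (L \<union> \<rho> ` (B - {x}))" by (rule subsetD[OF acl_base])
  then show False using indep_not_acl[OF assms xy(1)] by (rule notE[rotated])
qed

lemma indep_image_not_acl:
  assumes "rgen L \<subseteq> (L::'a::field set)" "indep L \<rho> B" "c \<in> \<rho> ` B"
  shows "c \<notin> acl (L \<union> (\<rho> ` B - {c}))"
proof -
  obtain b where b: "b \<in> B" "c = \<rho> b" using assms(3) by auto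
  have "\<rho> ` B - {c} = \<rho> ` (B - {b})"
    using inj_on_image_set_diff[OF indep_inj[OF assms(1,2)], of B "{b}"] b by simp
  then show ?thesis using indep_not_acl[OF assms(1,2) b(1)] b(2) by simp
qed

lemma alg_independent_not_acl:
  assumes "rgen L \<subseteq> (L::'a::field set)" "alg_independent L B" "b \<in> B"
  shows "b \<notin> acl (L \<union> (B - {b}))"
  using alg_independent_insert[OF assms(1), of b "B - {b}"] assms(2,3) by (simp add: insert_absorb)

text \<open>\<open>trdeg\<close> is a definite description over finite maximal independent sets, so
  one basis has to be compared with every other; Steinitz in both directions gives equal
  cardinalities.\<close>

lemma trdeg_eq_card:
  assumes L: "rgen L \<subseteq> (L::'a::field set)" and B: "finite B" "alg_independent L B" "B \<subseteq> E" "E \<subseteq> acl (L \<union> B)"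
  shows "trdeg L E = card B"
proof -
  have basis: "transcendence_basis L E B"
    unfolding transcendence_basis_def
  proof (intro conjI B(2,3) allI impI)
    fix C assume C: "B \<subseteq> C \<and> C \<subseteq> E \<and> alg_independent L C"
    show "C = B"
    proof (rule ccontr)
      assume "C \<noteq> B"
      then obtain c where c: "c \<in> C" "c \<notin> B" using C by auto
      then have "alg_independent L (insert c B)" using C c alg_independent_mono[of L C "insert c B"] by simp
      then have "c \<notin> acl (L \<union> B)" using alg_independent_insert[OF L c(2)] by simp
      then show False using c(1) C B(4) by auto
    qed
  qed
  have "card B' = card B" if "transcendence_basis L E B'" "finite B'" for B'
  proof -
    have B': "alg_independent L B'" "B' \<subseteq> E"
      and max: "\<And>C. B' \<subseteq> C \<Longrightarrow> C \<subseteq> E \<Longrightarrow> alg_independent L C \<Longrightarrow> C = B'"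
      using that by (auto simp: transcendence_basis_def)
    have "E \<subseteq> acl (L \<union> B')"
    proof
      fix e assume e: "e \<in> E"
      show "e \<in> acl (L \<union> B')"
      proof (rule ccontr)
        assume ne: "e \<notin> acl (L \<union> B')"
        then have "e \<notin> B'" using acl_base[of "L \<union> B'"] by auto
        then have "alg_independent L (insert e B')"
          using alg_independent_insert[OF L \<open>e \<notin> B'\<close>] B' ne by simp
        then have "insert e B' = B'" using e B' by (intro max) auto
        then show False using \<open>e \<notin> B'\<close> by auto
      qed
    qed
    then have "B \<subseteq> acl (L \<union> B')" using B(3) by (rule order_trans[rotated])
    then have "card B \<le> card B'"
      by (rule steinitz_card_le[OF that(2) B(1)]) (blast dest: alg_independent_not_acl[OF L B(2)])
    moreover have "B' \<subseteq> acl (L \<union> B)" using B'(2) B(4) by (rule order_trans)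
    then have "card B' \<le> card B"
      by (rule steinitz_card_le[OF B(1) that(2)]) (blast dest: alg_independent_not_acl[OF L B'(1)])
    ultimately show ?thesis by simp
  qed
  note * = this
  show ?thesis unfolding trdeg_def
  proof (rule the_equality)
    show "\<exists>B'. transcendence_basis L E B' \<and> finite B' \<and> card B = card B'" using basis B(1) by blast
  next
    fix d assume "\<exists>B. transcendence_basis L E B \<and> finite B \<and> d = card B"
    then obtain B' where B': "transcendence_basis L E B'" "finite B'" "d = card B'" by (elim exE conjE)
    show "d = card B" using *[OF B'(1,2)] B'(3) by simp
  qed
qed


section \<open>Multi-indices\<close>

abbreviation sngl :: "nat \<Rightarrow> nat \<Rightarrow> (nat \<Rightarrow>\<^sub>0 nat)" where "sngl \<equiv> Poly_Mapping.single"
abbreviation lkp :: "('v \<Rightarrow>\<^sub>0 'b::zero) \<Rightarrow> 'v \<Rightarrow> 'b" where "lkp \<equiv> Poly_Mapping.lookup"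

lemma multi_indices_iff: "\<xi> \<in> multi_indices m \<longleftrightarrow> (\<forall>j. m \<le> j \<longrightarrow> lkp \<xi> j = 0)"
proof -
  have "\<xi> \<in> multi_indices m \<longleftrightarrow> (\<forall>j. lkp \<xi> j \<noteq> 0 \<longrightarrow> j < m)" by (auto simp: multi_indices_def in_keys_iff subset_iff)
  then show ?thesis by (metis not_le)
qed

lemma multi_indices_add: "\<xi> \<in> multi_indices m \<Longrightarrow> \<eta> \<in> multi_indices m \<Longrightarrow> \<xi> + \<eta> \<in> multi_indices m"
  by (auto simp: multi_indices_iff lookup_add)

lemma multi_indices_minus: "\<xi> \<in> multi_indices m \<Longrightarrow> \<xi> - \<eta> \<in> multi_indices m"
  by (auto simp: multi_indices_iff lookup_minus)

lemma multi_indices_0: "0 \<in> multi_indices m"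
  by (auto simp: multi_indices_iff)

lemma multi_indices_single: "j < m \<Longrightarrow> sngl j k \<in> multi_indices m"
  by (auto simp: multi_indices_iff lookup_single when_def)

lemma ord_idx_add: "ord_idx m (\<xi> + \<eta>) = ord_idx m \<xi> + ord_idx m \<eta>"
  by (simp add: ord_idx_def lookup_add sum.distrib)

lemma ord_idx_single: "j < m \<Longrightarrow> ord_idx m (sngl j k) = k"
  by (simp add: ord_idx_def lookup_single when_def sum.delta)

text \<open>Divisibility of monomials. The order \<open><\<close> on multi-indices is lexicographic
  and total, and is used only to break ties in the ranking.\<close>

definition pm_le :: "(nat \<Rightarrow>\<^sub>0 nat) \<Rightarrow> (nat \<Rightarrow>\<^sub>0 nat) \<Rightarrow> bool" where
  "pm_le \<xi> \<eta> \<longleftrightarrow> (\<forall>j. lkp \<xi> j \<le> lkp \<eta> j)"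

lemma pm_le_diff: "pm_le \<xi> \<eta> \<Longrightarrow> \<xi> + (\<eta> - \<xi>) = \<eta>"
  by (rule poly_mapping_eqI) (auto simp: lookup_add lookup_minus pm_le_def)

lemma pm_le_add: "pm_le \<xi> (\<xi> + \<eta>)"
  by (auto simp: lookup_add pm_le_def)

text \<open>The last entry is a slack variable: it turns the bound on the order into an equation, so
  that the lists with a given sum can be counted.\<close>

lemma bij_betw_multi_indices_lists:
  "bij_betw (\<lambda>\<xi>. map (lkp \<xi>) [0..<m] @ [s - ord_idx m \<xi>]) {\<xi> \<in> multi_indices m. ord_idx m \<xi> \<le> s}
     {l. length l = Suc m \<and> sum_list l = s}"
proof (rule bij_betwI')
  fix \<xi> \<eta> assume *: "\<xi> \<in> {\<xi> \<in> multi_indices m. ord_idx m \<xi> \<le> s}" "\<eta> \<in> {\<xi> \<in> multi_indices m. ord_idx m \<xi> \<le> s}"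
  show "map (lkp \<xi>) [0..<m] @ [s - ord_idx m \<xi>] = map (lkp \<eta>) [0..<m] @ [s - ord_idx m \<eta>] \<longleftrightarrow> \<xi> = \<eta>"
  proof
    assume "map (lkp \<xi>) [0..<m] @ [s - ord_idx m \<xi>] = map (lkp \<eta>) [0..<m] @ [s - ord_idx m \<eta>]"
    then have 1: "\<forall>j<m. lkp \<xi> j = lkp \<eta> j" by (simp add: map_eq_conv)
    show "\<xi> = \<eta>"
    proof (rule poly_mapping_eqI)
      fix j show "lkp \<xi> j = lkp \<eta> j" using 1 * by (cases "j < m") (auto simp: multi_indices_iff)
    qed
  qed simp
next
  fix \<xi> assume "\<xi> \<in> {\<xi> \<in> multi_indices m. ord_idx m \<xi> \<le> s}"
  then show "map (lkp \<xi>) [0..<m] @ [s - ord_idx m \<xi>] \<in> {l. length l = Suc m \<and> sum_list l = s}"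
    by (auto simp: ord_idx_def interv_sum_list_conv_sum_set_nat atLeast0LessThan)
next
  fix l :: "nat list" assume l: "l \<in> {l. length l = Suc m \<and> sum_list l = s}"
  define \<xi> where "\<xi> = (\<Sum>j<m. sngl j (l ! j))"
  have lk: "lkp \<xi> j = (if j < m then l ! j else 0)" for j
    by (auto simp: \<xi>_def lookup_sum lookup_single when_def)
  have "s = (\<Sum>j<Suc m. l ! j)" using l by (auto simp: sum_list_sum_nth atLeast0LessThan)
  then have s: "s = ord_idx m \<xi> + l ! m" by (simp add: ord_idx_def lk)
  have "l = map (lkp \<xi>) [0..<m] @ [s - ord_idx m \<xi>]"
    using l s by (intro nth_equalityI) (auto simp: nth_append lk less_Suc_eq)
  moreover have "\<xi> \<in> multi_indices m" by (auto simp: multi_indices_iff lk)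
  ultimately show "\<exists>\<xi>\<in>{\<xi> \<in> multi_indices m. ord_idx m \<xi> \<le> s}. l = map (lkp \<xi>) [0..<m] @ [s - ord_idx m \<xi>]"
    using s by auto
qed

lemma finite_multi_indices_ord: "finite {\<xi> \<in> multi_indices m. ord_idx m \<xi> \<le> s}"
proof -
  have "finite {l. set l \<subseteq> {..s} \<and> length l = Suc m}" by (rule finite_lists_length_eq) simp
  then have "finite {l. length l = Suc m \<and> sum_list l = s}"
    by (rule finite_subset[rotated]) (use member_le_sum_list in auto)
  then show ?thesis using bij_betw_finite[OF bij_betw_multi_indices_lists[of m s]] by simp
qed

lemma card_multi_indices_ord: "card {\<xi> \<in> multi_indices m. ord_idx m \<xi> \<le> s} = (s + m) choose m"
proof -
  have "card {\<xi> \<in> multi_indices m. ord_idx m \<xi> \<le> s} = card {l::nat list. size l = Suc m \<and> sum_list l = s}"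
    using bij_betw_same_card[OF bij_betw_multi_indices_lists] .
  also have "\<dots> = (s + m) choose s" by (subst card_length_sum_list) simp
  also have "\<dots> = (s + m) choose m" by (subst binomial_symmetric) auto
  finally show ?thesis .
qed

subsection \<open>Numerical polynomials\<close>

text \<open>Integer values allow the subtractions of inclusion-exclusion. Only eventual agreement is
  asked for, which admits shifted counts with a zero initial part
  (\<open>npoly_shift\<close>).\<close>

definition npoly :: "(nat \<Rightarrow> int) \<Rightarrow> bool" where
  "npoly f \<longleftrightarrow> (\<exists>p. numerical_poly p \<and> (\<forall>\<^sub>F s::nat in sequentially. poly p (of_nat s) = of_int (f s)))"

lemma npoly_add: assumes "npoly f" "npoly g" shows "npoly (\<lambda>s. f s + g s)"
proof -
  obtain p q where pq: "numerical_poly p" "\<forall>\<^sub>F s::nat in sequentially. poly p (of_nat s) = of_int (f s)"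
    "numerical_poly q" "\<forall>\<^sub>F s::nat in sequentially. poly q (of_nat s) = of_int (g s)"
    using assms by (auto simp: npoly_def)
  have "\<forall>\<^sub>F s::nat in sequentially. poly (p + q) (of_nat s) = of_int (f s + g s)"
    using pq(2,4) by eventually_elim simp
  moreover have "numerical_poly (p + q)" using pq(1,3) by (auto simp: numerical_poly_def)
  ultimately show ?thesis by (auto simp: npoly_def)
qed

lemma npoly_uminus: assumes "npoly f" shows "npoly (\<lambda>s. - f s)"
proof -
  obtain p where p: "numerical_poly p" "\<forall>\<^sub>F s::nat in sequentially. poly p (of_nat s) = of_int (f s)"
    using assms by (auto simp: npoly_def)
  have "\<forall>\<^sub>F s::nat in sequentially. poly (- p) (of_nat s) = of_int (- f s)"
    using p(2) by eventually_elim simp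
  moreover have "numerical_poly (- p)" using p(1) by (auto simp: numerical_poly_def)
  ultimately show ?thesis unfolding npoly_def by blast
qed

lemma npoly_diff: "npoly f \<Longrightarrow> npoly g \<Longrightarrow> npoly (\<lambda>s. f s - g s)"
  using npoly_add[of f "\<lambda>s. - g s"] npoly_uminus by simp

lemma npoly_0: "npoly (\<lambda>s. 0)"
  unfolding npoly_def by (intro exI[of _ 0]) (auto simp: numerical_poly_def)

lemma npoly_sum: "(\<And>i. i \<in> I \<Longrightarrow> npoly (f i)) \<Longrightarrow> npoly (\<lambda>s. \<Sum>i\<in>I. f i s)"
  by (induction I rule: infinite_finite_induct) (auto intro: npoly_0 npoly_add)

lemma npoly_shift: assumes "npoly f" shows "npoly (\<lambda>s. if c \<le> s then f (s - c) else 0)"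
proof -
  obtain p where p: "numerical_poly p" "\<forall>\<^sub>F s::nat in sequentially. poly p (of_nat s) = of_int (f s)"
    using assms by (auto simp: npoly_def)
  let ?q = "pcompose p [:- of_nat c, 1:]"
  have q: "poly ?q x = poly p (x - of_nat c)" for x by (simp add: poly_pcompose)
  have "numerical_poly ?q" unfolding numerical_poly_def
  proof
    fix s :: int
    have "poly p (of_int (s - int c)) \<in> \<int>" using p(1) unfolding numerical_poly_def by blast
    then show "poly ?q (of_int s) \<in> \<int>" by (simp add: q)
  qed
  moreover obtain N where N: "poly p (of_nat s) = of_int (f s)" if "s \<ge> N" for s
    using p(2) by (auto simp: eventually_sequentially)
  have "poly ?q (of_nat s) = of_int (if c \<le> s then f (s - c) else 0)" if "s \<ge> N + c" for s
    using N[of "s - c"] that by (auto simp: q of_nat_diff)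
  then have "\<forall>\<^sub>F s::nat in sequentially. poly ?q (of_nat s) = of_int (if c \<le> s then f (s - c) else 0)"
    unfolding eventually_sequentially by blast
  ultimately show ?thesis unfolding npoly_def by blast
qed

text \<open>\<open>numerical_poly\<close> demands integral values at negative integers as well;
  there upper negation gives an ordinary binomial coefficient up to sign.\<close>

lemma gbinomial_of_int_Ints: "(of_int z gchoose k :: rat) \<in> \<int>"
proof (cases "z \<ge> 0")
  case True
  then have "(of_int z gchoose k :: rat) = of_nat (nat z choose k)"
    by (simp add: binomial_gbinomial)
  then show ?thesis by simp
next
  case False
  then obtain n where n: "z = - int n" "n > 0" by (metis neg_int_cases not_le)
  have "(of_int z gchoose k :: rat) = (- 1) ^ k * (of_nat (n + k - 1) gchoose k)"
    using gbinomial_minus[of "of_nat n :: rat" k] n by (simp add: of_nat_diff)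
  also have "\<dots> = (- 1) ^ k * of_nat ((n + k - 1) choose k)" by (simp only: binomial_gbinomial)
  finally show ?thesis by simp
qed

lemma npoly_binomial: "npoly (\<lambda>s. int ((s + m) choose m))"
proof -
  define p :: "rat poly" where "p = smult (1 / fact m) (\<Prod>i<m. [:of_nat m - of_nat i, 1:])"
  have p: "poly p x = (x + of_nat m) gchoose m" for x
    by (simp add: p_def gbinomial_prod_rev poly_prod algebra_simps atLeast0LessThan)
  have "numerical_poly p" unfolding numerical_poly_def p
  proof
    fix s :: int
    show "(of_int s + of_nat m :: rat) gchoose m \<in> \<int>" using gbinomial_of_int_Ints[of "s + int m" m] by simp
  qed
  moreover have "poly p (of_nat s) = of_int (int ((s + m) choose m))" for s
    using binomial_gbinomial[of "s + m" m, where 'a=rat] by (simp add: p)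
  ultimately show ?thesis by (auto simp: npoly_def)
qed

text \<open>The cumulative Hilbert function of the monomial ideal generated by
  \<open>G\<close>.\<close>

definition up_count :: "nat \<Rightarrow> (nat \<Rightarrow>\<^sub>0 nat) set \<Rightarrow> nat \<Rightarrow> int" where
  "up_count m G s = int (card {\<xi> \<in> multi_indices m. ord_idx m \<xi> \<le> s \<and> (\<exists>g\<in>G. pm_le g \<xi>)})"

text \<open>Translation by \<open>g\<close> carries the multi-indices of order at most
  \<open>s - ord_idx m g\<close> onto the multiples of \<open>g\<close> of order at most
  \<open>s\<close>; for smaller \<open>s\<close> there are none.\<close>

lemma npoly_up_count_single: assumes "g \<in> multi_indices m" shows "npoly (up_count m {g})"
proof -
  have "up_count m {g} s = (if ord_idx m g \<le> s then int ((s - ord_idx m g + m) choose m) else 0)" for s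
  proof (cases "ord_idx m g \<le> s")
    case True
    have "{\<xi> \<in> multi_indices m. ord_idx m \<xi> \<le> s \<and> (\<exists>g\<in>{g}. pm_le g \<xi>)} =
      (\<lambda>\<xi>. g + \<xi>) ` {\<xi> \<in> multi_indices m. ord_idx m \<xi> \<le> s - ord_idx m g}" (is "?L = ?R")
    proof
      show "?L \<subseteq> ?R"
      proof
        fix \<xi> assume \<xi>: "\<xi> \<in> ?L"
        then have e: "g + (\<xi> - g) = \<xi>" by (simp add: pm_le_diff)
        then have "ord_idx m g + ord_idx m (\<xi> - g) = ord_idx m \<xi>" by (metis ord_idx_add)
        then show "\<xi> \<in> ?R" using \<xi> multi_indices_minus[of \<xi> m g] True
          by (intro image_eqI[of _ _ "\<xi> - g"]) (auto simp: e)
      qed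
      show "?R \<subseteq> ?L" using True assms by (auto simp: multi_indices_add ord_idx_add pm_le_add)
    qed
    then have "up_count m {g} s = int (card ((\<lambda>\<xi>. g + \<xi>) ` {\<xi> \<in> multi_indices m. ord_idx m \<xi> \<le> s - ord_idx m g}))"
      by (simp add: up_count_def)
    also have "\<dots> = int (card {\<xi> \<in> multi_indices m. ord_idx m \<xi> \<le> s - ord_idx m g})"
      by (subst card_image) (auto simp: inj_on_def)
    finally show ?thesis using True by (simp add: card_multi_indices_ord)
  next
    case False
    have "ord_idx m g \<le> ord_idx m \<xi>" if "pm_le g \<xi>" for \<xi>
      using that by (auto simp: ord_idx_def pm_le_def intro: sum_mono)
    then have *: "{\<xi> \<in> multi_indices m. ord_idx m \<xi> \<le> s \<and> (\<exists>g\<in>{g}. pm_le g \<xi>)} = {}" using False by fastforce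
    show ?thesis using False unfolding up_count_def * by simp
  qed
  then have "up_count m {g} = (\<lambda>s. if ord_idx m g \<le> s then int ((s - ord_idx m g + m) choose m) else 0)" by auto
  then show ?thesis using npoly_shift[OF npoly_binomial[of m], of "ord_idx m g"] by simp
qed

text \<open>Inclusion-exclusion on the generators. The multiples of \<open>g\<close> that are also
  multiples of some \<open>h\<close> in \<open>H\<close> form the ideal generated by the least
  common multiples of \<open>g\<close> and \<open>h\<close>; these are at most \<open>card H\<close>
  many, so the induction on the number of generators applies to them.\<close>

lemma npoly_up_count: assumes "finite G" "G \<subseteq> multi_indices m" shows "npoly (up_count m G)"
  using assms
proof (induction "card G" arbitrary: G rule: less_induct)
  case less
  show ?case
  proof (cases "G = {}")
    case True then have "up_count m G = (\<lambda>s. 0)" by (auto simp: up_count_def)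
    then show ?thesis using npoly_0 by simp
  next
    case False
    then obtain g where g: "g \<in> G" by auto
    define H where "H = G - {g}"
    have G: "G = insert g H" "g \<notin> H" "finite H" using g less.prems by (auto simp: H_def)
    have cH: "card H < card G" using G by (simp add: card_insert_if)
    \<comment> \<open>With truncated subtraction this is the componentwise maximum of
      \<open>g\<close> and \<open>h\<close>.\<close>
    let ?l = "\<lambda>h. g + (h - g)"
    have l: "pm_le (?l h) \<xi> \<longleftrightarrow> pm_le g \<xi> \<and> pm_le h \<xi>" for h \<xi>
    proof -
      have "a + (b - a) \<le> c \<longleftrightarrow> a \<le> c \<and> b \<le> c" for a b c :: nat by auto
      then show ?thesis by (auto simp: pm_le_def lookup_add lookup_minus)
    qed
    have "card (?l ` H) < card G" using cH card_image_le[OF G(3), of ?l] by simp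
    moreover have "?l ` H \<subseteq> multi_indices m"
      using less.prems G by (auto intro!: multi_indices_add multi_indices_minus)
    ultimately have 1: "npoly (up_count m (?l ` H))" using G(3) by (intro less.hyps) auto
    have 2: "npoly (up_count m H)" using cH G less.prems by (intro less.hyps) auto
    have 3: "npoly (up_count m {g})" using less.prems g by (intro npoly_up_count_single) auto
    have "up_count m G s = up_count m {g} s + up_count m H s - up_count m (?l ` H) s" for s
    proof -
      let ?S = "\<lambda>K. {\<xi> \<in> multi_indices m. ord_idx m \<xi> \<le> s \<and> (\<exists>g\<in>K. pm_le g \<xi>)}"
      have fin: "finite (?S K)" for K by (rule finite_subset[OF _ finite_multi_indices_ord[of m s]]) auto
      have "?S G = ?S {g} \<union> ?S H" using G by auto
      moreover have "?S {g} \<inter> ?S H = ?S (?l ` H)" using l by auto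
      ultimately show ?thesis using card_Un_Int[OF fin[of "{g}"] fin[of H]] by (simp add: up_count_def)
    qed
    then show ?thesis using npoly_diff[OF npoly_add[OF 3 2] 1] by presburger
  qed
qed

subsection \<open>The ranking of the derivatives\<close>

type_synonym dvar = "nat \<times> (nat \<Rightarrow>\<^sub>0 nat)"

definition idxs :: "nat \<Rightarrow> nat set \<Rightarrow> dvar set" where "idxs m I = I \<times> multi_indices m"

definition shift :: "nat \<Rightarrow> dvar \<Rightarrow> dvar" where "shift j w = (fst w, snd w + sngl j 1)"

text \<open>An orderly ranking: order first, ties broken by a total order compatible with
  \<open>shift\<close>. For finitely many indeterminates only finitely many derivatives lie below a
  given one, so \<open>rk\<close> is meaningful and constructions run along the natural
  numbers.\<close>

definition dless :: "nat \<Rightarrow> dvar \<Rightarrow> dvar \<Rightarrow> bool" where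
  "dless m v w \<longleftrightarrow> ord_idx m (snd v) < ord_idx m (snd w) \<or> ord_idx m (snd v) = ord_idx m (snd w) \<and>
     (snd v < snd w \<or> snd v = snd w \<and> fst v < fst w)"

definition rk :: "nat \<Rightarrow> nat set \<Rightarrow> dvar \<Rightarrow> nat" where
  "rk m I w = card {v \<in> idxs m I. dless m v w}"

lemma dless_trans: "dless m u v \<Longrightarrow> dless m v w \<Longrightarrow> dless m u w"
  by (auto simp: dless_def)

lemma dless_irrefl: "\<not> dless m v v"
  by (auto simp: dless_def)

lemma dless_total: "v = w \<or> dless m v w \<or> dless m w v"
  by (cases v; cases w) (auto simp: dless_def)

lemma finite_idxs_ord: "finite I \<Longrightarrow> finite {w \<in> idxs m I. ord_idx m (snd w) \<le> s}"
  by (rule finite_subset[of _ "I \<times> {\<xi> \<in> multi_indices m. ord_idx m \<xi> \<le> s}"])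
    (auto simp: idxs_def finite_multi_indices_ord)

lemma finite_dless: "finite I \<Longrightarrow> finite {v \<in> idxs m I. dless m v w}"
  by (rule finite_subset[OF _ finite_idxs_ord[of I m "ord_idx m (snd w)"]]) (auto simp: dless_def)

lemma rk_less: assumes "finite I" "v \<in> idxs m I" "dless m v w" shows "rk m I v < rk m I w"
  unfolding rk_def
proof (rule psubset_card_mono[OF finite_dless[OF assms(1)]])
  show "{u \<in> idxs m I. dless m u v} \<subset> {v \<in> idxs m I. dless m v w}"
    using assms dless_trans dless_irrefl by blast
qed

lemma rk_less_iff: assumes "finite I" "v \<in> idxs m I" "w \<in> idxs m I" shows "rk m I v < rk m I w \<longleftrightarrow> dless m v w"
  using rk_less[OF assms(1)] assms dless_total[of v w m] by (metis less_asym less_irrefl)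

lemma rk_inj: "finite I \<Longrightarrow> inj_on (rk m I) (idxs m I)"
  by (rule inj_onI) (metis dless_total less_irrefl rk_less_iff)

lemma shift_idxs: "w \<in> idxs m I \<Longrightarrow> j < m \<Longrightarrow> shift j w \<in> idxs m I"
  by (auto simp: idxs_def shift_def intro: multi_indices_add multi_indices_single)

lemma shift_dless: "j < m \<Longrightarrow> dless m w (shift j w)"
  by (auto simp: dless_def shift_def ord_idx_add ord_idx_single)

lemma shift_mono: "j < m \<Longrightarrow> dless m v w \<Longrightarrow> dless m (shift j v) (shift j w)"
  by (auto simp: dless_def shift_def ord_idx_add ord_idx_single)

lemma shift_commute: "shift i (shift j w) = shift j (shift i w)"
  by (simp add: shift_def add_ac)

lemma ord_shift: "j < m \<Longrightarrow> ord_idx m (snd (shift j w)) = Suc (ord_idx m (snd w))"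
  by (simp add: shift_def ord_idx_add ord_idx_single)

section \<open>Upward closed sets of derivatives and Dickson's lemma\<close>

definition upclosed :: "nat \<Rightarrow> dvar set \<Rightarrow> bool" where
  "upclosed m E \<longleftrightarrow> (\<forall>w\<in>E. \<forall>j<m. shift j w \<in> E)"

definition mins :: "nat \<Rightarrow> dvar set \<Rightarrow> dvar set" where
  "mins m E = {w \<in> E. \<forall>v\<in>E. \<forall>j<m. w \<noteq> shift j v}"

lemma multi_index_induct [consumes 1, case_names zero step]:
  assumes "\<xi> \<in> multi_indices m" "P 0" 
    "\<And>\<xi> j. \<xi> \<in> multi_indices m \<Longrightarrow> j < m \<Longrightarrow> P \<xi> \<Longrightarrow> P (\<xi> + sngl j 1)"
  shows "P \<xi>"
  using assms(1)
proof (induction "ord_idx m \<xi>" arbitrary: \<xi>)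
  case 0
  then have "lkp \<xi> j = 0" for j by (cases "j < m") (auto simp: ord_idx_def multi_indices_iff)
  then have "\<xi> = 0" by (intro poly_mapping_eqI) simp
  then show ?case using assms(2) by simp
next
  case (Suc k)
  have "\<exists>j<m. lkp \<xi> j \<noteq> 0"
  proof (rule ccontr)
    assume "\<not> (\<exists>j<m. lkp \<xi> j \<noteq> 0)"
    then have "ord_idx m \<xi> = 0" by (simp add: ord_idx_def)
    then show False using Suc by simp
  qed
  then obtain j where j: "j < m" "lkp \<xi> j \<noteq> 0" by auto
  have e: "(\<xi> - sngl j 1) + sngl j 1 = \<xi>"
    by (rule poly_mapping_eqI) (use j in \<open>auto simp: lookup_add lookup_minus lookup_single when_def\<close>)
  then have "ord_idx m (\<xi> - sngl j 1) + 1 = ord_idx m \<xi>" by (metis ord_idx_add ord_idx_single j(1))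
  then have "P (\<xi> - sngl j 1)" using Suc by (intro Suc.hyps) (auto intro: multi_indices_minus)
  then show ?case using assms(3)[OF multi_indices_minus[OF Suc.prems] j(1)] e by metis
qed

lemma upclosed_add:
  assumes "upclosed m E" "\<zeta> \<in> multi_indices m" "(i, \<xi>) \<in> E" shows "(i, \<xi> + \<zeta>) \<in> E"
  using assms(2)
proof (induction rule: multi_index_induct)
  case zero then show ?case using assms(3) by simp
next
  case (step \<zeta> j)
  then have "shift j (i, \<xi> + \<zeta>) \<in> E" using assms(1) by (auto simp: upclosed_def)
  then show ?case by (simp add: shift_def add.assoc)
qed

lemma mins_generate:
  assumes "w \<in> E"
  shows "\<exists>g\<in>mins m E. fst g = fst w \<and> pm_le (snd g) (snd w)"
  using assms
proof (induction "ord_idx m (snd w)" arbitrary: w rule: less_induct)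
  case less
  show ?case
  proof (cases "w \<in> mins m E")
    case True then show ?thesis by (intro bexI[of _ w]) (auto simp: pm_le_def)
  next
    case False
    then obtain v j where v: "v \<in> E" "j < m" "w = shift j v" using less.prems by (auto simp: mins_def)
    then have "ord_idx m (snd v) < ord_idx m (snd w)" by (simp add: ord_shift)
    from less.hyps[OF this v(1)] obtain g where "g \<in> mins m E" "fst g = fst v" "pm_le (snd g) (snd v)" by auto
    then show ?thesis using v(3) by (intro bexI[of _ g]) (auto simp: shift_def pm_le_def lookup_add intro: le_trans)
  qed
qed

text \<open>A monotone subsequence always exists; if it decreases, it is constant from the place
  where its minimum is attained.\<close>

lemma nat_incseq_subseq: fixes s :: "nat \<Rightarrow> nat" shows "\<exists>f. strict_mono f \<and> incseq (\<lambda>n. s (f n))"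
proof -
  obtain f where f: "strict_mono f" "monoseq (\<lambda>n. s (f n))" using seq_monosub by blast
  show ?thesis
  proof (cases "incseq (\<lambda>n. s (f n))")
    case True then show ?thesis using f by auto
  next
    case False
    then have d: "decseq (\<lambda>n. s (f n))" using f(2) by (simp add: monoseq_iff)
    define M where "M = (LEAST x. x \<in> range (\<lambda>n. s (f n)))"
    have "M \<in> range (\<lambda>n. s (f n))" unfolding M_def by (rule LeastI[of _ "s (f 0)"]) auto
    then obtain N where N: "M = s (f N)" by auto
    have "s (f (n + N)) = M" for n
    proof (rule antisym)
      show "s (f (n + N)) \<le> M" using d N by (simp add: decseq_def)
      show "M \<le> s (f (n + N))" unfolding M_def by (rule Least_le) auto
    qed
    then have "incseq (\<lambda>n. s (f (n + N)))" by (simp add: incseq_def)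
    moreover have "strict_mono (\<lambda>n. f (n + N))" using f(1) by (simp add: strict_mono_def)
    ultimately show ?thesis by blast
  qed
qed

lemma multi_index_incseq_subseq:
  fixes f :: "nat \<Rightarrow> (nat \<Rightarrow>\<^sub>0 nat)"
  shows "\<exists>\<phi>. strict_mono \<phi> \<and> (\<forall>j<r. incseq (\<lambda>k. lkp (f (\<phi> k)) j))"
proof (induction r)
  case 0 then show ?case by (intro exI[of _ id]) (auto simp: strict_mono_def)
next
  case (Suc r)
  then obtain \<phi> where \<phi>: "strict_mono \<phi>" "\<forall>j<r. incseq (\<lambda>k. lkp (f (\<phi> k)) j)" by auto
  obtain \<psi> where \<psi>: "strict_mono \<psi>" "incseq (\<lambda>k. lkp (f (\<phi> (\<psi> k))) r)"
    using nat_incseq_subseq[of "\<lambda>k. lkp (f (\<phi> k)) r"] by auto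
  have "incseq (\<lambda>k. lkp (f (\<phi> (\<psi> k))) j)" if "j < r" for j
    using \<phi>(2) that strict_mono_mono[OF \<psi>(1)] by (auto simp: incseq_def mono_def)
  then have "\<forall>j<Suc r. incseq (\<lambda>k. lkp (f (\<phi> (\<psi> k))) j)" using \<psi>(2) by (auto simp: less_Suc_eq)
  moreover have "strict_mono (\<lambda>k. \<phi> (\<psi> k))" using \<phi>(1) \<psi>(1) by (simp add: strict_mono_def)
  ultimately show ?case by blast
qed

text \<open>Dickson's lemma. An infinite set of minimal elements would contain, for one
  indeterminate, distinct \<open>?v\<close> and \<open>?w\<close> with \<open>?v\<close> below
  \<open>?w\<close> in every coordinate. Lowering \<open>?w\<close> by one where they differ stays
  above \<open>?v\<close>, hence in \<open>E\<close>, so \<open>?w\<close> is a shift of an element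
  of \<open>E\<close> after all.\<close>

lemma finite_mins:
  assumes "finite I" "E \<subseteq> idxs m I" "upclosed m E" shows "finite (mins m E)"
proof (rule ccontr)
  assume inf: "infinite (mins m E)"
  have "finite (fst ` mins m E)" by (rule finite_subset[OF _ assms(1)]) (use assms(2) in \<open>auto simp: mins_def idxs_def\<close>)
  from pigeonhole_infinite[OF inf this] obtain a0 where "infinite {a \<in> mins m E. fst a = fst a0}" by auto
  then obtain f :: "nat \<Rightarrow> dvar" where f: "inj f" "range f \<subseteq> {a \<in> mins m E. fst a = fst a0}"
    by (metis infinite_countable_subset)
  obtain \<phi> where \<phi>: "strict_mono \<phi>" "\<forall>j<m. incseq (\<lambda>k. lkp (snd (f (\<phi> k))) j)"
    using multi_index_incseq_subseq[of m "\<lambda>k. snd (f k)"] by auto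
  let ?v = "f (\<phi> 0)" and ?w = "f (\<phi> 1)"
  have "f k \<in> {a \<in> mins m E. fst a = fst a0}" for k using f(2) by auto
  then have vw: "?v \<in> mins m E" "?w \<in> mins m E" "fst ?v = fst ?w" by simp_all
  have mi: "snd ?v \<in> multi_indices m" "snd ?w \<in> multi_indices m" using vw(1,2) assms(2) by (auto simp: mins_def idxs_def)
  have le: "lkp (snd ?v) j \<le> lkp (snd ?w) j" for j
    using \<phi>(2) mi by (cases "j < m") (auto simp: incseq_def multi_indices_iff)
  have "\<phi> 0 \<noteq> \<phi> 1" using \<phi>(1) by (metis less_irrefl strict_monoD zero_less_one)
  then have "?v \<noteq> ?w" using f(1) by (auto dest: injD)
  then have "snd ?v \<noteq> snd ?w" using vw(3) by (metis prod_eqI)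
  then obtain j where j: "lkp (snd ?v) j \<noteq> lkp (snd ?w) j" by (metis poly_mapping_eqI)
  then have jm: "j < m" "lkp (snd ?v) j < lkp (snd ?w) j" using mi le[of j] by (auto simp: multi_indices_iff not_less[symmetric])
  let ?z = "snd ?w - sngl j 1 - snd ?v"
  have "snd ?v + ?z = snd ?w - sngl j 1"
    by (rule pm_le_diff) (use le jm in \<open>auto simp: pm_le_def lookup_minus lookup_single when_def\<close>)
  moreover have "(fst ?v, snd ?v + ?z) \<in> E"
    by (rule upclosed_add[OF assms(3)]) (use mi vw(1) in \<open>simp_all add: mins_def multi_indices_minus\<close>)
  ultimately have in_E: "(fst ?w, snd ?w - sngl j 1) \<in> E" using vw(3) by simp
  have "snd ?w - sngl j 1 + sngl j 1 = snd ?w"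
    by (rule poly_mapping_eqI) (use jm in \<open>auto simp: lookup_add lookup_minus lookup_single when_def\<close>)
  then have "?w = shift j (fst ?w, snd ?w - sngl j 1)" by (simp add: shift_def)
  then show False using vw(2) in_E jm(1) by (auto simp: mins_def)
qed

definition cocount :: "nat \<Rightarrow> nat set \<Rightarrow> dvar set \<Rightarrow> nat \<Rightarrow> nat" where
  "cocount m I E s = card {w \<in> idxs m I - E. ord_idx m (snd w) \<le> s}"

text \<open>For each indeterminate, \<open>E\<close> is a monomial ideal with finitely many
  generators, so its complement is counted by a binomial coefficient minus a Hilbert
  function.\<close>

lemma npoly_cocount:
  assumes I: "finite I" and E: "E \<subseteq> idxs m I" "upclosed m E"
  shows "npoly (\<lambda>s. int (cocount m I E s))"
proof -
  define G where "G = (\<lambda>i. snd ` {g \<in> mins m E. fst g = i})"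
  have G: "finite (G i)" "G i \<subseteq> multi_indices m" for i
    unfolding G_def using finite_mins[OF assms] E(1) by (simp, auto simp: mins_def idxs_def)
  have mem: "(i, \<xi>) \<in> E \<longleftrightarrow> (\<exists>g\<in>G i. pm_le g \<xi>)" if "\<xi> \<in> multi_indices m" for i \<xi>
  proof
    assume "(i, \<xi>) \<in> E"
    from mins_generate[OF this, of m] show "\<exists>g\<in>G i. pm_le g \<xi>" by (force simp: G_def)
  next
    assume "\<exists>g\<in>G i. pm_le g \<xi>"
    then obtain g where g: "(i, g) \<in> mins m E" "pm_le g \<xi>" by (auto simp: G_def)
    have "(i, g + (\<xi> - g)) \<in> E"
      by (rule upclosed_add[OF E(2) multi_indices_minus[OF that]]) (use g in \<open>auto simp: mins_def\<close>)
    then show "(i, \<xi>) \<in> E" by (simp add: pm_le_diff[OF g(2)])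
  qed
  have "int (cocount m I E s) = (\<Sum>i\<in>I. int ((s + m) choose m) - up_count m (G i) s)" for s
  proof -
    let ?M = "{\<xi> \<in> multi_indices m. ord_idx m \<xi> \<le> s}"
    let ?U = "\<lambda>i. {\<xi> \<in> multi_indices m. ord_idx m \<xi> \<le> s \<and> (\<exists>g\<in>G i. pm_le g \<xi>)}"
    have "{w \<in> idxs m I - E. ord_idx m (snd w) \<le> s} = (SIGMA i:I. ?M - ?U i)"
      using mem by (auto simp: idxs_def)
    then have "cocount m I E s = (\<Sum>i\<in>I. card (?M - ?U i))"
      unfolding cocount_def by (simp add: card_SigmaI[OF I] finite_multi_indices_ord)
    moreover have "int (card (?M - ?U i)) = int ((s + m) choose m) - up_count m (G i) s" for i
    proof -
      have "card (?M - ?U i) = card ?M - card (?U i)"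
        by (rule card_Diff_subset) (auto intro: finite_subset[OF _ finite_multi_indices_ord[of m s]])
      moreover have "card (?U i) \<le> card ?M" by (rule card_mono[OF finite_multi_indices_ord]) auto
      ultimately show ?thesis by (simp add: up_count_def of_nat_diff card_multi_indices_ord)
    qed
    ultimately show ?thesis by simp
  qed
  moreover have "npoly (\<lambda>s. \<Sum>i\<in>I. int ((s + m) choose m) - up_count m (G i) s)"
    by (intro npoly_sum npoly_diff npoly_binomial npoly_up_count G)
  ultimately show ?thesis by simp
qed

section \<open>Kolchin polynomials of leader sets and eventual domination\<close>

lemma poly_eventually_eq:
  fixes p q :: "rat poly"
  assumes "\<forall>\<^sub>F s::nat in sequentially. poly p (of_nat s) = poly q (of_nat s)" shows "p = q"
proof -
  obtain N where N: "\<And>s. s \<ge> N \<Longrightarrow> poly p (of_nat s) = poly q (of_nat s)"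
    using assms by (auto simp: eventually_sequentially)
  have "infinite (of_nat ` {N..} :: rat set)" by (subst finite_image_iff) (auto simp: inj_on_def infinite_Ici)
  moreover have "of_nat ` {N..} \<subseteq> {x. poly (p - q) x = 0}" using N by auto
  ultimately have "infinite {x. poly (p - q) x = 0}" using finite_subset by blast
  then show ?thesis using poly_roots_finite[of "p - q"] by auto
qed

definition kpoly :: "nat \<Rightarrow> nat set \<Rightarrow> dvar set \<Rightarrow> rat poly" where
  "kpoly m I E = (THE p. numerical_poly p \<and> (\<forall>\<^sub>F s::nat in sequentially. poly p (of_nat s) = of_nat (cocount m I E s)))"

lemma kpoly:
  assumes "finite I" "E \<subseteq> idxs m I" "upclosed m E"
  shows "numerical_poly (kpoly m I E)"
    "\<forall>\<^sub>F s::nat in sequentially. poly (kpoly m I E) (of_nat s) = of_nat (cocount m I E s)"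
proof -
  obtain p where p: "numerical_poly p" "\<forall>\<^sub>F s::nat in sequentially. poly p (of_nat s) = of_nat (cocount m I E s)"
    using npoly_cocount[OF assms] by (auto simp: npoly_def)
  have "\<exists>!p. numerical_poly p \<and> (\<forall>\<^sub>F s::nat in sequentially. poly p (of_nat s) = of_nat (cocount m I E s))"
  proof (rule ex1I[of _ p])
    fix q assume q: "numerical_poly q \<and> (\<forall>\<^sub>F s::nat in sequentially. poly q (of_nat s) = of_nat (cocount m I E s))"
    have "\<forall>\<^sub>F s::nat in sequentially. poly q (of_nat s) = poly p (of_nat s)"
      using conjunct2[OF q] p(2) by eventually_elim simp
    then show "q = p" by (rule poly_eventually_eq)
  qed (use p in auto)
  from theI'[OF this] show "numerical_poly (kpoly m I E)"
    "\<forall>\<^sub>F s::nat in sequentially. poly (kpoly m I E) (of_nat s) = of_nat (cocount m I E s)"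
    unfolding kpoly_def by auto
qed

lemma eventually_dominated_refl: "eventually_dominated p p"
  by (simp add: eventually_dominated_def)

lemma eventually_dominated_trans: "eventually_dominated p q \<Longrightarrow> eventually_dominated q r \<Longrightarrow> eventually_dominated p r"
  unfolding eventually_dominated_def by (erule (1) eventually_elim2) auto

lemma eventually_dominated_antisym:
  assumes "eventually_dominated p q" "eventually_dominated q p" shows "p = q"
proof (rule poly_eventually_eq)
  show "\<forall>\<^sub>F s::nat in sequentially. poly p (of_nat s) = poly q (of_nat s)"
    using assms unfolding eventually_dominated_def by eventually_elim simp
qed

text \<open>A nonzero polynomial is eventually at least some \<open>c > 0\<close> or at most
  \<open>- c\<close>. This uniform bound, and not merely the sign, carries the induction: after
  multiplication by the argument it outgrows the new constant coefficient.\<close>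

lemma eventually_dominated_linear: "eventually_dominated p q \<or> eventually_dominated q p"
proof -
  have "r = 0 \<or> (\<exists>c>0. (\<forall>\<^sub>F s::nat in sequentially. poly r (of_nat s) \<ge> c) \<or>
      (\<forall>\<^sub>F s::nat in sequentially. poly r (of_nat s) \<le> - c))" for r :: "rat poly"
  proof (induction r)
    case 0 then show ?case by simp
  next
    case (pCons a r)
    show ?case
    proof (cases "r = 0")
      case True
      then have "a \<noteq> 0" using pCons by auto
      then show ?thesis using True by (intro disjI2 exI[of _ "\<bar>a\<bar>"]) (auto simp: abs_if)
    next
      case False
      then obtain c where c: "c > 0" "(\<forall>\<^sub>F s::nat in sequentially. poly r (of_nat s) \<ge> c) \<or>
          (\<forall>\<^sub>F s::nat in sequentially. poly r (of_nat s) \<le> - c)" using pCons by auto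
      obtain N :: nat where N: "(1 + \<bar>a\<bar>) / c \<le> of_nat N" using real_arch_simple by blast
      have big: "c * of_nat s \<ge> 1 + \<bar>a\<bar>" if "s \<ge> N" for s
      proof -
        have "1 + \<bar>a\<bar> \<le> of_nat N * c" using N c(1) by (simp add: divide_le_eq)
        also have "\<dots> \<le> of_nat s * c" using that c(1) by (intro mult_right_mono) auto
        finally show ?thesis by (simp add: mult.commute)
      qed
      have ev: "\<forall>\<^sub>F s::nat in sequentially. c * of_nat s \<ge> 1 + \<bar>a\<bar>"
        using big by (auto simp: eventually_sequentially)
      show ?thesis using c(2)
      proof
        assume "\<forall>\<^sub>F s::nat in sequentially. poly r (of_nat s) \<ge> c"
        then have "\<forall>\<^sub>F s::nat in sequentially. poly (pCons a r) (of_nat s) \<ge> 1" using ev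
        proof eventually_elim
          case (elim s)
          have "c * of_nat s \<le> poly r (of_nat s) * of_nat s" using elim(1) by (intro mult_right_mono) auto
          then show ?case using elim(2) by (simp add: mult.commute)
        qed
        then show ?thesis by (intro disjI2 exI[of _ 1]) auto
      next
        assume "\<forall>\<^sub>F s::nat in sequentially. poly r (of_nat s) \<le> - c"
        then have "\<forall>\<^sub>F s::nat in sequentially. poly (pCons a r) (of_nat s) \<le> - 1" using ev
        proof eventually_elim
          case (elim s)
          have "poly r (of_nat s) * of_nat s \<le> - c * of_nat s" using elim(1) by (intro mult_right_mono) auto
          then show ?case using elim(2) by (simp add: mult.commute)
        qed
        then show ?thesis by (intro disjI2 exI[of _ 1]) auto
      qed
    qed
  qed
  from this[of "q - p"] show ?thesis
  proof (elim disjE exE conjE)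
    fix c :: rat assume "c > 0" "\<forall>\<^sub>F s::nat in sequentially. poly (q - p) (of_nat s) \<ge> c"
    from this(2) have "eventually_dominated p q" unfolding eventually_dominated_def
      by eventually_elim (use \<open>c > 0\<close> in auto)
    then show ?thesis by simp
  next
    fix c :: rat assume "c > 0" "\<forall>\<^sub>F s::nat in sequentially. poly (q - p) (of_nat s) \<le> - c"
    from this(2) have "eventually_dominated q p" unfolding eventually_dominated_def
      by eventually_elim (use \<open>c > 0\<close> in auto)
    then show ?thesis by simp
  qed (simp add: eventually_dominated_refl)
qed

lemma kpoly_mono:
  assumes "finite I" "E \<subseteq> idxs m I" "upclosed m E" "E' \<subseteq> idxs m I" "upclosed m E'" 
    "\<And>s. cocount m I E s \<le> cocount m I E' s"
  shows "eventually_dominated (kpoly m I E) (kpoly m I E')"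
  unfolding eventually_dominated_def using kpoly(2)[OF assms(1-3)] kpoly(2)[OF assms(1,4,5)]
  by eventually_elim (use assms(6) in simp)

lemma cocount_mono: "finite I \<Longrightarrow> E \<subseteq> E' \<Longrightarrow> cocount m I E' s \<le> cocount m I E s"
  unfolding cocount_def by (rule card_mono) (auto intro: finite_subset[OF _ finite_idxs_ord[of I m s]])


section \<open>Graphs of homomorphisms and of derivations\<close>

text \<open>Graphs of homomorphisms are subrings of a product. Products have zero divisors, which is
  why \<open>rgen\<close> and \<open>pov\<close> are set up for \<open>comm_ring_1\<close>.\<close>

instantiation prod :: (comm_ring_1, comm_ring_1) comm_ring_1
begin
definition one_prod_def: "1 = (1, 1)"
definition times_prod_def: "x * y = (fst x * fst y, snd x * snd y)"
instance
  by standard (auto simp: one_prod_def times_prod_def plus_prod_def zero_prod_def minus_prod_def uminus_prod_def algebra_simps)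
end

lemma fst_snd_ring [simp]:
  "fst (x * y) = fst x * fst y" "snd (x * y) = snd x * snd y" "fst 1 = 1" "snd 1 = 1"
  by (simp_all add: one_prod_def times_prod_def)

text \<open>The dual numbers \<open>re + eps * t\<close> with \<open>t\<close> of square zero:
  \<open>D\<close> is a derivation exactly when x \<mapsto> \<open>Dual x (D x)\<close> is a ring
  homomorphism.\<close>

datatype 'b dual = Dual (re: 'b) (eps: 'b)

instantiation dual :: (comm_ring_1) comm_ring_1
begin
definition "0 = Dual 0 0"
definition "1 = Dual 1 0"
definition "x + y = Dual (re x + re y) (eps x + eps y)"
definition "x - y = Dual (re x - re y) (eps x - eps y)"
definition "- x = Dual (- re x) (- eps x)"
definition "x * y = Dual (re x * re y) (re x * eps y + eps x * re y)"
instance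
  by standard (auto simp: zero_dual_def one_dual_def plus_dual_def minus_dual_def uminus_dual_def times_dual_def algebra_simps)
end

lemma dual_simps [simp]:
  "re (x + y) = re x + re y" "eps (x + y) = eps x + eps y"
  "re (x - y) = re x - re y" "eps (x - y) = eps x - eps y"
  "re (x * y) = re x * re y" "eps (x * y) = re x * eps y + eps x * re y"
  "re 0 = 0" "eps 0 = 0" "re 1 = 1" "eps 1 = 0" "re (- x) = - re x" "eps (- x) = - eps x"
  for x y :: "'b::comm_ring_1 dual"
  by (simp_all add: zero_dual_def one_dual_def plus_dual_def minus_dual_def uminus_dual_def times_dual_def)

section \<open>Ring homomorphisms and generated subrings\<close>

definition rhom :: "('c::comm_ring_1 \<Rightarrow> 'd::comm_ring_1) \<Rightarrow> bool" where
  "rhom \<pi> \<longleftrightarrow> \<pi> 1 = 1 \<and> (\<forall>x y. \<pi> (x + y) = \<pi> x + \<pi> y) \<and> (\<forall>x y. \<pi> (x * y) = \<pi> x * \<pi> y)"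

lemma rhomD:
  assumes "rhom \<pi>"
  shows "\<pi> 1 = 1" "\<pi> (x + y) = \<pi> x + \<pi> y" "\<pi> (x * y) = \<pi> x * \<pi> y" "\<pi> 0 = 0" "\<pi> (- x) = - \<pi> x"
    "\<pi> (x - y) = \<pi> x - \<pi> y"
proof -
  show *: "\<pi> 1 = 1" "\<pi> (x + y) = \<pi> x + \<pi> y" "\<pi> (x * y) = \<pi> x * \<pi> y" for x y
    using assms by (auto simp: rhom_def)
  show z: "\<pi> 0 = 0" using *(2)[of 0 0] by simp
  show n: "\<pi> (- x) = - \<pi> x" for x using *(2)[of x "- x"] z by (simp add: eq_neg_iff_add_eq_0 add.commute)
  show "\<pi> (x - y) = \<pi> x - \<pi> y" using *(2)[of x "- y"] n[of y] by simp
qed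

lemma rhom_power: "rhom \<pi> \<Longrightarrow> \<pi> (x ^ n) = \<pi> x ^ n"
  by (induction n) (simp_all add: rhomD)

lemma rhom_sum: "rhom \<pi> \<Longrightarrow> \<pi> (sum f I) = (\<Sum>i\<in>I. \<pi> (f i))"
  by (induction I rule: infinite_finite_induct) (simp_all add: rhomD)

lemma rhom_poly:
  assumes "rhom \<pi>" shows "\<pi> (poly p x) = poly (map_poly \<pi> p) (\<pi> x)"
  by (induction p) (simp_all add: rhomD[OF assms] map_poly_pCons)

lemma rhom_image_rgen:
  assumes "rhom \<pi>" shows "\<pi> ` rgen S = rgen (\<pi> ` S)"
proof
  show "\<pi> ` rgen S \<subseteq> rgen (\<pi> ` S)"
  proof (rule image_subsetI)
    fix x assume "x \<in> rgen S" then show "\<pi> x \<in> rgen (\<pi> ` S)"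
      by induction (auto simp: rhomD[OF assms] intro: rgen.intros)
  qed
  show "rgen (\<pi> ` S) \<subseteq> \<pi> ` rgen S"
  proof
    fix y assume "y \<in> rgen (\<pi> ` S)" then show "y \<in> \<pi> ` rgen S"
    proof induction
      case rgen_one then show ?case by (metis rhomD(1)[OF assms] rgen.rgen_one imageI)
    next
      case (rgen_base x) then show ?case by (auto intro: rgen.rgen_base)
    next
      case (rgen_add x y) then show ?case by (auto simp flip: rhomD[OF assms] intro: rgen.rgen_add)
    next
      case (rgen_neg x) then show ?case by (auto simp flip: rhomD[OF assms] intro: rgen.rgen_neg)
    next
      case (rgen_mult x y) then show ?case by (auto simp flip: rhomD[OF assms] intro: rgen.rgen_mult)
    qed
  qed
qed

lemma rhom_fst: "rhom fst" and rhom_snd: "rhom snd" and rhom_re: "rhom re"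
  by (simp_all add: rhom_def)

lemma rhom_map_poly_pov: "rhom \<pi> \<Longrightarrow> p \<in> pov (rgen S) \<Longrightarrow> map_poly \<pi> p \<in> pov (rgen (\<pi> ` S))"
  by (auto simp: pov_def coeff_map_poly rhomD simp flip: rhom_image_rgen)

text \<open>The value of the formal derivative; \<^const>\<open>pderiv\<close> excludes rings with zero divisors, such as
  products and dual numbers.\<close>

definition sep :: "'c::comm_ring_1 poly \<Rightarrow> 'c \<Rightarrow> 'c" where
  "sep p z = (\<Sum>i\<le>Polynomial.degree p. of_nat i * Polynomial.coeff p i * z ^ (i - 1))"

lemma sep_superset:
  assumes "Polynomial.degree p \<le> n" shows "sep p z = (\<Sum>i\<le>n. of_nat i * Polynomial.coeff p i * z ^ (i - 1))"
  unfolding sep_def by (rule sum.mono_neutral_left) (use assms in \<open>auto simp: coeff_eq_0\<close>)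

lemma rhom_of_nat: "rhom \<pi> \<Longrightarrow> \<pi> (of_nat n) = of_nat n"
  by (induction n) (simp_all add: rhomD)

lemma degree_map_poly_rhom: "rhom \<pi> \<Longrightarrow> Polynomial.degree (map_poly \<pi> p) \<le> Polynomial.degree p"
  by (rule degree_le) (simp add: coeff_map_poly rhomD coeff_eq_0)

lemma rhom_sep: assumes "rhom \<pi>" shows "\<pi> (sep p z) = sep (map_poly \<pi> p) (\<pi> z)"
  by (subst sep_superset[OF degree_map_poly_rhom[OF assms]])
    (simp add: sep_def[of p] rhom_sum[OF assms] rhomD[OF assms]
      rhom_power[OF assms] rhom_of_nat[OF assms] coeff_map_poly)

lemma sep_eq_pderiv: "sep p (z::'d::idom) = poly (pderiv p) z"
proof -
  have "poly (pderiv p) z = (\<Sum>i\<le>Polynomial.degree p. Polynomial.coeff (pderiv p) i * z ^ i)"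
  proof -
    have "Polynomial.degree (pderiv p) \<le> Polynomial.degree p"
      by (rule degree_le) (simp add: Polynomial.coeff_pderiv coeff_eq_0)
    then show ?thesis unfolding poly_altdef by (intro sum.mono_neutral_left) (auto simp: coeff_eq_0)
  qed
  also have "\<dots> = (\<Sum>i\<le>Polynomial.degree p. of_nat (Suc i) * Polynomial.coeff p (Suc i) * z ^ i)"
    by (simp only: Polynomial.coeff_pderiv)
  also have "\<dots> = (\<Sum>i\<le>Suc (Polynomial.degree p). of_nat i * Polynomial.coeff p i * z ^ (i - 1))"
    by (subst sum.atMost_Suc_shift) simp
  also have "\<dots> = sep p z" by (rule sep_superset[symmetric]) simp
  finally show ?thesis by simp
qed

lemma sep_in_rgen: "p \<in> pov (rgen S) \<Longrightarrow> z \<in> rgen S \<Longrightarrow> sep p z \<in> rgen S"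
  unfolding sep_def by (intro rgen_sum rgen_mult rgen_of_nat rgen_power) (auto simp: pov_def)

lemma rhom_map_poly_mult: assumes "rhom \<pi>" shows "map_poly \<pi> (p * q) = map_poly \<pi> p * map_poly \<pi> q"
  by (rule poly_eqI) (simp add: coeff_map_poly coeff_mult rhomD[OF assms] rhom_sum[OF assms])

lemma rhom_map_poly_smult: assumes "rhom \<pi>" shows "map_poly \<pi> (smult c q) = smult (\<pi> c) (map_poly \<pi> q)"
  by (rule poly_eqI) (simp add: coeff_map_poly rhomD[OF assms])

text \<open>Multiplying by the leading coefficient replaces division, which products and dual
  numbers do not allow in general. Degrees are expressed by vanishing coefficients because leading
  coefficients may be zero divisors; \<open>n\<close> bounds the degree of \<open>Q\<close> and
  drops by one in each round.\<close>

lemma pseudo_division: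
  assumes P: "P \<in> pov (rgen S)" and d: "\<And>i. i > d \<Longrightarrow> Polynomial.coeff P i = 0"
    and Q: "Q \<in> pov (rgen S)" "\<And>i. i \<ge> n \<Longrightarrow> Polynomial.coeff Q i = 0"
  shows "\<exists>N U R. U \<in> pov (rgen S) \<and> R \<in> pov (rgen S) \<and> smult (Polynomial.coeff P d ^ N) Q = P * U + R \<and>
    (\<forall>i\<ge>d. Polynomial.coeff R i = 0)"
  using Q
proof (induction n arbitrary: Q)
  case 0
  then have "Q = 0" by (simp add: poly_eq_iff)
  then show ?case by (intro exI[of _ 0]) (auto intro: pov_0)
next
  case (Suc n)
  show ?case
  proof (cases "n < d")
    case True
    then show ?thesis using Suc.prems by (intro exI[of _ 0] exI[of _ Q]) (auto intro: pov_0)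
  next
    case False
    let ?c = "Polynomial.coeff P d"
    let ?M = "Polynomial.monom (Polynomial.coeff Q n) (n - d)"
    let ?Q = "smult ?c Q - P * ?M"
    have M: "?M \<in> pov (rgen S)" using Suc.prems(1) by (intro pov_monom) (auto simp: pov_def)
    have c: "?c \<in> rgen S" using P by (simp add: pov_def)
    have "?Q \<in> pov (rgen S)" by (intro pov_diff pov_smult pov_mult c P M Suc.prems)
    moreover have "Polynomial.coeff ?Q i = 0" if "i \<ge> n" for i
    proof -
      have cM: "Polynomial.coeff (P * ?M) i = Polynomial.coeff P (i - (n - d)) * Polynomial.coeff Q n"
        using that False unfolding mult.commute[of P] coeff_monom_mult by (auto simp: mult.commute)
      show ?thesis
      proof (cases "i = n")
        case True then show ?thesis using False cM by simp
      next
        case neq: False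
        then have "i - (n - d) > d" using that False by auto
        then show ?thesis using cM d Suc.prems(2)[of i] neq that by simp
      qed
    qed
    ultimately obtain N U R where NUR: "U \<in> pov (rgen S)" "R \<in> pov (rgen S)"
       "smult (?c ^ N) ?Q = P * U + R" "\<forall>i\<ge>d. Polynomial.coeff R i = 0" using Suc.IH by blast
    have "smult (?c ^ Suc N) Q = smult (?c ^ N) (?Q + P * ?M)" by (simp add: mult.commute)
    also have "\<dots> = P * (U + smult (?c ^ N) ?M) + R" using NUR(3) by (simp only: smult_add_right) (simp add: algebra_simps)
    finally have "smult (?c ^ Suc N) Q = P * (U + smult (?c ^ N) ?M) + R" .
    moreover have "U + smult (?c ^ N) ?M \<in> pov (rgen S)" by (intro pov_add pov_smult rgen_power c NUR M)
    ultimately show ?thesis using NUR by blast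
  qed
qed

text \<open>For a subring \<open>\<Gamma>\<close> this says that \<open>\<Gamma>\<close> is the graph of a function of the \<open>\<pi>\<close>-component, so that
  homomorphisms (\<open>\<pi> = fst\<close>) and derivations (\<open>\<pi> = re\<close>) are represented by sets of generators.\<close>

definition functional :: "('c::comm_ring_1 \<Rightarrow> 'd::comm_ring_1) \<Rightarrow> 'c set \<Rightarrow> bool" where
  "functional \<pi> \<Gamma> \<longleftrightarrow> (\<forall>\<gamma>\<in>\<Gamma>. \<pi> \<gamma> = 0 \<longrightarrow> \<gamma> = 0)"

lemma functionalD: "functional \<pi> \<Gamma> \<Longrightarrow> \<gamma> \<in> \<Gamma> \<Longrightarrow> \<pi> \<gamma> = 0 \<Longrightarrow> \<gamma> = 0"
  by (auto simp: functional_def)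

lemma functional_subset: "functional \<pi> \<Gamma> \<Longrightarrow> \<Delta> \<subseteq> \<Gamma> \<Longrightarrow> functional \<pi> \<Delta>"
  by (auto simp: functional_def)

lemma functional_pov:
  assumes "rhom \<pi>" "functional \<pi> (rgen S)" "p \<in> pov (rgen S)" "map_poly \<pi> p = 0" shows "p = 0"
proof (rule poly_eqI)
  fix i
  have "\<pi> (Polynomial.coeff p i) = Polynomial.coeff (map_poly \<pi> p) i" by (simp add: coeff_map_poly rhomD[OF assms(1)])
  then show "Polynomial.coeff p i = Polynomial.coeff 0 i"
    using assms functionalD[OF assms(2)] by (simp add: pov_def)
qed

text \<open>An element of the enlarged graph is \<open>poly p z\<close>. If its image is zero,
  transcendence makes the image of \<open>p\<close> the zero polynomial, and functionality of the
  old graph lifts this to \<open>p\<close>.\<close>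

lemma functional_transcendental:
  fixes \<pi> :: "'c::comm_ring_1 \<Rightarrow> 'd::field"
  assumes "rhom \<pi>" "functional \<pi> (rgen S)" "\<pi> z \<notin> acl (\<pi> ` S)"
  shows "functional \<pi> (rgen (insert z S))"
  unfolding functional_def
proof (intro ballI impI)
  fix \<gamma> assume "\<gamma> \<in> rgen (insert z S)" "\<pi> \<gamma> = 0"
  then obtain p where p: "p \<in> pov (rgen S)" "\<gamma> = poly p z" "poly (map_poly \<pi> p) (\<pi> z) = 0"
    by (auto simp: rgen_insert rhom_poly[OF assms(1)])
  then have "map_poly \<pi> p = 0" using rhom_map_poly_pov[OF assms(1) p(1)] assms(3) by (auto simp: acl_def)
  then show "\<gamma> = 0" using functional_pov[OF assms(1,2) p(1)] p(2) by simp
qed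

text \<open>The pseudo-remainder \<open>R\<close> of \<open>Q\<close> modulo \<open>P\<close> has
  smaller degree, and the image of \<open>poly R z\<close> vanishes, so minimality forces
  \<open>R = 0\<close>. What remains is a power of the leading coefficient times \<gamma>, and
  \<open>nzd\<close> removes the factors one by one.\<close>

lemma functional_algebraic:
  fixes \<pi> :: "'c::comm_ring_1 \<Rightarrow> 'd::idom"
  assumes \<pi>: "rhom \<pi>" "functional \<pi> (rgen S)"
    and P: "P \<in> pov (rgen S)" "P \<noteq> 0" "poly P z = 0"
    and min: "\<And>R. R \<in> pov (rgen S) \<Longrightarrow> R \<noteq> 0 \<Longrightarrow> \<pi> (poly R z) = 0 \<Longrightarrow> Polynomial.degree P \<le> Polynomial.degree R"
    and nzd: "\<And>\<gamma>. \<pi> \<gamma> = 0 \<Longrightarrow> Polynomial.lead_coeff P * \<gamma> = 0 \<Longrightarrow> \<gamma> = 0"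
  shows "functional \<pi> (rgen (insert z S))"
  unfolding functional_def
proof (intro ballI impI)
  fix \<gamma> assume \<gamma>: "\<gamma> \<in> rgen (insert z S)" "\<pi> \<gamma> = 0"
  then obtain Q where Q: "Q \<in> pov (rgen S)" "\<gamma> = poly Q z" by (auto simp: rgen_insert)
  let ?c = "Polynomial.lead_coeff P" and ?d = "Polynomial.degree P"
  obtain N U R where R: "U \<in> pov (rgen S)" "R \<in> pov (rgen S)" "smult (?c ^ N) Q = P * U + R"
    "\<forall>i\<ge>?d. Polynomial.coeff R i = 0"
    using pseudo_division[OF P(1) _ Q(1), of ?d "Suc (Polynomial.degree Q)"] coeff_eq_0
    by (metis Suc_le_eq)
  have "?c ^ N * \<gamma> = poly R z" using arg_cong[OF R(3), of "\<lambda>p. poly p z"] P(3) Q(2) by simp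
  then have "\<pi> (poly R z) = 0" using \<gamma>(2) by (metis rhomD(3)[OF \<pi>(1)] mult_zero_right)
  moreover have "R \<noteq> 0 \<Longrightarrow> Polynomial.degree R < ?d"
    using R(4) by (metis leading_coeff_0_iff not_le)
  ultimately have "R = 0" using min[OF R(2)] by fastforce
  then have 0: "?c ^ N * \<gamma> = 0" using \<open>?c ^ N * \<gamma> = poly R z\<close> by simp
  have "?c ^ k * \<gamma> = 0 \<Longrightarrow> \<gamma> = 0" for k
  proof (induction k)
    case (Suc k)
    have "?c * (?c ^ k * \<gamma>) = 0" using Suc.prems by (simp add: mult.assoc)
    moreover have "\<pi> (?c ^ k * \<gamma>) = 0" using \<gamma>(2) by (simp add: rhomD[OF \<pi>(1)])
    ultimately show ?case using nzd Suc.IH by blast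
  qed simp
  then show "\<gamma> = 0" using 0 .
qed

text \<open>In degree one minimality is automatic, since a nonzero constant of the old graph has
  nonzero image.\<close>

lemma functional_linear:
  fixes \<pi> :: "'c::comm_ring_1 \<Rightarrow> 'd::idom"
  assumes \<pi>: "rhom \<pi>" "functional \<pi> (rgen S)"
    and sr: "s \<in> rgen S" "r \<in> rgen S" "s * z = r" "s \<noteq> 0"
    and nzd: "\<And>\<gamma>. \<pi> \<gamma> = 0 \<Longrightarrow> s * \<gamma> = 0 \<Longrightarrow> \<gamma> = 0"
  shows "functional \<pi> (rgen (insert z S))"
proof (rule functional_algebraic[OF \<pi>, of "[:- r, s:]"])
  show "[:- r, s:] \<in> pov (rgen S)" by (intro pov_pCons pov_0 rgen_neg sr)
  show "poly [:- r, s:] z = 0" using sr by (simp add: mult.commute)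
  show "\<gamma> = 0" if "\<pi> \<gamma> = 0" "Polynomial.lead_coeff [:- r, s:] * \<gamma> = 0" for \<gamma>
    using nzd that sr(4) by simp
  show "[:- r, s:] \<noteq> 0" using sr(4) by simp
  fix R assume R: "R \<in> pov (rgen S)" "R \<noteq> 0" "\<pi> (poly R z) = 0"
  show "Polynomial.degree [:- r, s:] \<le> Polynomial.degree R"
  proof (rule ccontr)
    assume "\<not> ?thesis"
    then have "Polynomial.degree R = 0" using sr(4) by simp
    then obtain a where a: "R = [:a:]" by (metis degree_eq_zeroE)
    then have "a \<in> rgen S" "\<pi> a = 0" using R by (auto simp: pov_def dest: spec[of _ 0])
    then have "a = 0" using functionalD[OF \<pi>(2)] by simp
    then show False using a R(2) by simp
  qed
qed

text \<open>For dual numbers the hypothesis on \<open>a * b\<close> holds with \<open>\<pi>\<close> the real part; the lemma then says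
  that a derivation extends to a separable algebraic element, whose image is forced.\<close>

lemma functional_separable:
  fixes \<pi> :: "'c::comm_ring_1 \<Rightarrow> 'd::idom"
  assumes \<pi>: "rhom \<pi>" "functional \<pi> (rgen S)"
    and P: "P \<in> pov (rgen S)" "poly P z = 0" "\<pi> (sep P z) \<noteq> 0"
    and nzd: "\<And>a b. \<pi> a \<noteq> 0 \<Longrightarrow> \<pi> b = 0 \<Longrightarrow> a * b = 0 \<Longrightarrow> b = 0"
  shows "functional \<pi> (rgen (insert z S))"
proof -
  \<comment> \<open>Minimality is imposed on the image only; that the chosen \<open>Q\<close>
    vanishes at \<open>z\<close> itself has to be extracted from \<open>P\<close>.\<close>
  let ?X = "{Q \<in> pov (rgen S). Q \<noteq> 0 \<and> \<pi> (poly Q z) = 0}"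
  have "P \<noteq> 0" using P(3) rhomD(4)[OF \<pi>(1)] by (auto simp: sep_def)
  then have "P \<in> ?X" using P rhomD(4)[OF \<pi>(1)] by simp
  then obtain Q where Q: "Q \<in> ?X" "\<And>R. R \<in> ?X \<Longrightarrow> Polynomial.degree Q \<le> Polynomial.degree R"
    using ex_has_least_nat[of "\<lambda>q. q \<in> ?X" P Polynomial.degree] by blast
  let ?c = "Polynomial.lead_coeff Q" and ?d = "Polynomial.degree Q"
  have "?c \<in> rgen S" using Q(1) by (simp add: pov_def)
  then have c: "\<pi> ?c \<noteq> 0" using functionalD[OF \<pi>(2)] Q(1) by fastforce
  obtain N U R where R: "U \<in> pov (rgen S)" "R \<in> pov (rgen S)" "smult (?c ^ N) P = Q * U + R"
    "\<forall>i\<ge>?d. Polynomial.coeff R i = 0"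
    using pseudo_division[of Q S ?d P "Suc (Polynomial.degree P)"] Q(1) P(1) coeff_eq_0
    by (metis (no_types, lifting) Suc_le_eq mem_Collect_eq)
  let ?q = "poly Q z"
  have "poly R z = - (?q * poly U z)"
    using arg_cong[OF R(3), of "\<lambda>p. poly p z"] P(2) by (simp add: eq_neg_iff_add_eq_0 add.commute)
  then have "\<pi> (poly R z) = 0" using Q(1) by (simp add: rhomD[OF \<pi>(1)])
  moreover have "R \<noteq> 0 \<Longrightarrow> Polynomial.degree R < ?d"
    using R(4) by (metis leading_coeff_0_iff not_le)
  ultimately have "R = 0" using Q(2)[of R] R(2) by fastforce
  then have PQ: "smult (?c ^ N) P = Q * U" using R(3) by simp
  have qU: "poly U z * ?q = 0"
    using arg_cong[OF PQ, of "\<lambda>p. poly p z"] P(2) by (simp add: mult.commute)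
  have "smult (\<pi> ?c ^ N) (map_poly \<pi> P) = map_poly \<pi> Q * map_poly \<pi> U"
    using arg_cong[OF PQ, of "map_poly \<pi>"]
    by (simp add: rhom_map_poly_mult[OF \<pi>(1)] rhom_map_poly_smult[OF \<pi>(1)] rhom_power[OF \<pi>(1)])
  \<comment> \<open>Differentiation in the image, where \<open>Q\<close> has the root: as the
    separant of \<open>P\<close> is nonzero, \<open>U\<close> cannot vanish there, and
    \<open>poly U z * ?q = 0\<close> then leaves \<open>?q = 0\<close>.\<close>
  from arg_cong[OF this, of "\<lambda>p. poly (pderiv p) (\<pi> z)"]
  have "\<pi> ?c ^ N * \<pi> (sep P z) = poly (map_poly \<pi> Q) (\<pi> z) * poly (pderiv (map_poly \<pi> U)) (\<pi> z) +
      poly (map_poly \<pi> U) (\<pi> z) * poly (pderiv (map_poly \<pi> Q)) (\<pi> z)"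
    by (simp add: pderiv_smult pderiv_mult rhom_sep[OF \<pi>(1)] sep_eq_pderiv)
  moreover have "poly (map_poly \<pi> Q) (\<pi> z) = 0" using Q(1) by (simp add: rhom_poly[OF \<pi>(1)])
  ultimately have "\<pi> (poly U z) \<noteq> 0" using P(3) c by (auto simp: rhom_poly[OF \<pi>(1)])
  then have q0: "?q = 0" using nzd[of "poly U z" ?q] Q(1) qU by simp
  show ?thesis
  proof (rule functional_algebraic[OF \<pi>, of Q])
    show "Q \<in> pov (rgen S)" "Q \<noteq> 0" using Q(1) by auto
    show "Polynomial.degree Q \<le> Polynomial.degree R" if "R \<in> pov (rgen S)" "R \<noteq> 0" "\<pi> (poly R z) = 0" for R
      using Q(2) that by simp
  qed (use q0 nzd c in auto)
qed

lemma dual_nzd: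
  fixes a b :: "'b::idom dual"
  assumes "re a \<noteq> 0" "re b = 0" "a * b = 0" shows "b = 0"
proof -
  have "re a * eps b = 0" using arg_cong[OF assms(3), of eps] assms(2) by simp
  then show ?thesis using assms(1,2) by (cases b) (simp add: zero_dual_def)
qed

lemma prod_nzd:
  fixes a b :: "'a::idom \<times> 'b::idom"
  assumes "snd a \<noteq> 0" "fst b = 0" "a * b = 0" shows "b = 0"
  using assms by (cases a; cases b) (auto simp: zero_prod_def times_prod_def)

lemma minimal_root_polynomial:
  assumes "x \<in> acl S"
  obtains p where "p \<in> pov (rgen S)" "p \<noteq> 0" "poly p x = 0"
    "\<And>q. q \<in> pov (rgen S) \<Longrightarrow> q \<noteq> 0 \<Longrightarrow> poly q x = 0 \<Longrightarrow> Polynomial.degree p \<le> Polynomial.degree q"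
    "Polynomial.degree p > 0"
proof -
  let ?X = "{Q \<in> pov (rgen S). Q \<noteq> 0 \<and> poly Q x = 0}"
  obtain p0 where "p0 \<in> ?X" using assms by (auto simp: acl_def)
  then obtain p where p: "p \<in> ?X" "\<And>R. R \<in> ?X \<Longrightarrow> Polynomial.degree p \<le> Polynomial.degree R"
    using ex_has_least_nat[of "\<lambda>q. q \<in> ?X" p0 Polynomial.degree] by blast
  have "Polynomial.degree p > 0"
  proof (rule ccontr)
    assume "\<not> ?thesis"
    then obtain a where "p = [:a:]" by (metis degree_eq_zeroE gr0I)
    then show False using p(1) by simp
  qed
  then show ?thesis using p that[of p] by auto
qed

text \<open>In characteristic zero the formal derivative is nonzero and of smaller degree, so by
  minimality it has no root at \<open>x\<close>.\<close>

lemma minimal_polynomial_separable: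
  fixes x :: "'a::field_char_0"
  assumes "p \<in> pov (rgen S)" "Polynomial.degree p > 0"
    "\<And>q. q \<in> pov (rgen S) \<Longrightarrow> q \<noteq> 0 \<Longrightarrow> poly q x = 0 \<Longrightarrow> Polynomial.degree p \<le> Polynomial.degree q"
  shows "sep p x \<noteq> 0"
  unfolding sep_eq_pderiv
proof
  assume "poly (pderiv p) x = 0"
  moreover have "pderiv p \<noteq> 0" using assms(2) by (simp add: pderiv_eq_0_iff)
  ultimately have "Polynomial.degree p \<le> Polynomial.degree (pderiv p)" using assms(1) by (intro assms(3) pov_pderiv)
  then show False using assms(2) by (simp add: degree_pderiv)
qed


section \<open>Differential polynomials and leaders\<close>

definition ini :: "nat \<Rightarrow> nat set \<Rightarrow> nat \<Rightarrow> dvar set" where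
  "ini m I N = {w \<in> idxs m I. rk m I w < N}"

lemma ini_mono: "M \<le> N \<Longrightarrow> ini m I M \<subseteq> ini m I N"
  by (auto simp: ini_def)

lemma ini_idxs: "ini m I N \<subseteq> idxs m I"
  by (auto simp: ini_def)

lemma idxs_eq_Union_ini: "idxs m I = (\<Union>N. ini m I N)"
  by (auto simp: ini_def)

lemma ini_shift:
  assumes "finite I" "j < m" "v \<in> ini m I (rk m I w)" "w \<in> idxs m I"
  shows "shift j v \<in> ini m I (rk m I (shift j w))"
  using assms by (auto simp: ini_def rk_less_iff shift_idxs intro!: shift_mono)

lemma ini_shift_self:
  assumes "finite I" "j < m" "w \<in> idxs m I" shows "w \<in> ini m I (rk m I (shift j w))"
  using assms by (auto simp: ini_def rk_less_iff shift_idxs intro!: shift_dless)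

lemma ini_rk_shift:
  assumes "finite I" "j < m" "w \<in> idxs m I" shows "ini m I (rk m I w) \<subseteq> ini m I (rk m I (shift j w))"
  by (rule ini_mono) (use ini_shift_self[OF assms] in \<open>simp add: ini_def\<close>)

lemma ini_Suc: assumes "finite I" "w \<in> idxs m I" shows "ini m I (Suc (rk m I w)) = insert w (ini m I (rk m I w))"
  using assms rk_inj[OF assms(1), of m] by (auto simp: ini_def less_Suc_eq dest: inj_onD)

lemma ini_Suc_not: assumes "\<not> (\<exists>w\<in>idxs m I. rk m I w = N)" shows "ini m I (Suc N) = ini m I N"
  using assms by (auto simp: ini_def less_Suc_eq)

section \<open>Derivations and the differentiation of relations\<close>

definition der :: "('c::comm_ring_1 \<Rightarrow> 'c) \<Rightarrow> bool" where
  "der d \<longleftrightarrow> (\<forall>x y. d (x + y) = d x + d y) \<and> (\<forall>x y. d (x * y) = d x * y + x * d y)"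

lemma derD:
  assumes "der d"
  shows "d (x + y) = d x + d y" "d (x * y) = d x * y + x * d y" "d 0 = 0" "d 1 = 0" "d (- x) = - d x"
proof -
  show *: "d (x + y) = d x + d y" "d (x * y) = d x * y + x * d y" for x y using assms by (auto simp: der_def)
  show z: "d 0 = 0" using *(1)[of 0 0] by simp
  show "d 1 = 0" using *(2)[of 1 1] by simp
  show "d (- x) = - d x" using *(1)[of x "- x"] z by (simp add: eq_neg_iff_add_eq_0 add.commute)
qed

lemma der_rgen:
  assumes "der d" "T \<subseteq> rgen T'" "\<And>x. x \<in> T \<Longrightarrow> d x \<in> rgen T'" "x \<in> rgen T" shows "d x \<in> rgen T'"
proof -
  have "d x \<in> rgen T' \<and> x \<in> rgen T'" using assms(4)
    by induction (use assms(2,3) in \<open>auto simp: derD[OF assms(1)] intro: rgen.intros rgen_zero\<close>)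
  then show ?thesis ..
qed

lemma sep_pCons: "sep (pCons a p) z = poly p z + z * sep p z"
proof -
  let ?n = "Polynomial.degree p"
  have "sep (pCons a p) z = (\<Sum>i\<le>Suc ?n. of_nat i * Polynomial.coeff (pCons a p) i * z ^ (i - 1))"
    by (rule sep_superset) (rule degree_pCons_le)
  also have "\<dots> = (\<Sum>i\<le>?n. of_nat (Suc i) * Polynomial.coeff p i * z ^ i)"
    by (subst sum.atMost_Suc_shift) simp
  also have "\<dots> = (\<Sum>i\<le>?n. Polynomial.coeff p i * z ^ i + z * (of_nat i * Polynomial.coeff p i * z ^ (i - 1)))"
  proof (intro sum.cong refl)
    fix i show "of_nat (Suc i) * Polynomial.coeff p i * z ^ i = Polynomial.coeff p i * z ^ i + z * (of_nat i * Polynomial.coeff p i * z ^ (i - 1))"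
      by (cases i) (simp_all add: algebra_simps)
  qed
  finally show ?thesis by (simp add: sum.distrib poly_altdef sep_def sum_distrib_left)
qed

lemma der_poly:
  assumes "der d" shows "d (poly p z) = poly (map_poly d p) z + sep p z * d z"
proof (induction p)
  case 0 then show ?case by (simp add: derD[OF assms] sep_def)
next
  case (pCons a p)
  then show ?case by (simp add: derD[OF assms] map_poly_pCons sep_pCons algebra_simps)
qed

text \<open>Differentiating an algebraic relation for the leader \<open>z g\<close> gives linear relations, all with
  the same separant \<open>sep P (z g)\<close>, for all proper derivatives of \<open>z g\<close>.\<close>

lemma separant_reduction:
  fixes d :: "nat \<Rightarrow> 'c::comm_ring_1 \<Rightarrow> 'c"
  assumes I: "finite I" and d: "\<And>j. j < m \<Longrightarrow> der (d j)" and S: "\<And>j x. j < m \<Longrightarrow> x \<in> S \<Longrightarrow> d j x \<in> rgen S"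
    and z: "\<And>j w. j < m \<Longrightarrow> w \<in> idxs m I \<Longrightarrow> z (shift j w) = d j (z w)"
    and g: "(i, \<eta>) \<in> idxs m I" and P: "P \<in> pov (rgen (S \<union> z ` ini m I (rk m I (i, \<eta>))))" "poly P (z (i, \<eta>)) = 0"
    and \<zeta>: "\<zeta> \<in> multi_indices m" "\<zeta> \<noteq> 0"
  shows "sep P (z (i, \<eta>)) * z (i, \<eta> + \<zeta>) \<in> rgen (S \<union> z ` ini m I (rk m I (i, \<eta> + \<zeta>)))"
    and "sep P (z (i, \<eta>)) \<in> rgen (S \<union> z ` ini m I (rk m I (i, \<eta> + \<zeta>)))"
proof -
  let ?B = "\<lambda>w. rgen (S \<union> z ` ini m I (rk m I w))"
  let ?g = "(i, \<eta>)"
  let ?s = "sep P (z ?g)"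
  have in_idxs: "(i, \<eta> + \<zeta>) \<in> idxs m I" if "\<zeta> \<in> multi_indices m" for \<zeta>
    using g that by (auto simp: idxs_def multi_indices_add)
  \<comment> \<open>Differentiation respects the ranking: what is built from derivatives below
    \<open>w\<close> goes to what is built from derivatives below \<open>shift j w\<close>.\<close>
  have dB: "d j x \<in> ?B (shift j w)" if "x \<in> ?B w" "j < m" "w \<in> idxs m I" for x j w
  proof (rule der_rgen[OF d[OF that(2)] _ _ that(1)])
    show "S \<union> z ` ini m I (rk m I w) \<subseteq> ?B (shift j w)"
      using ini_rk_shift[OF I that(2,3)] by (auto intro: rgen_base)
    fix x assume "x \<in> S \<union> z ` ini m I (rk m I w)"
    then show "d j x \<in> ?B (shift j w)"
    proof
      assume "x \<in> S" then show ?thesis using S[OF that(2)] rgen_mono[of S "S \<union> z ` ini m I (rk m I (shift j w))"] by auto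
    next
      assume "x \<in> z ` ini m I (rk m I w)"
      then obtain v where v: "v \<in> ini m I (rk m I w)" "x = z v" by auto
      then have "d j x = z (shift j v)" using z[OF that(2)] subsetD[OF ini_idxs] by simp
      then show ?thesis using ini_shift[OF I that(2) v(1) that(3)] by (auto intro: rgen_base)
    qed
  qed
  have self: "z w \<in> ?B (shift j w)" if "j < m" "w \<in> idxs m I" for j w
    using ini_shift_self[OF I that] by (auto intro: rgen_base)
  have mono: "?B w \<subseteq> ?B (shift j w)" if "j < m" "w \<in> idxs m I" for j w
    using ini_rk_shift[OF I that] by (intro rgen_mono) auto
  have "\<zeta> = 0 \<or> (?s \<in> ?B (i, \<eta> + \<zeta>) \<and> ?s * z (i, \<eta> + \<zeta>) \<in> ?B (i, \<eta> + \<zeta>))"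
    using \<zeta>(1)
  proof (induction rule: multi_index_induct)
    case (step \<zeta> j)
    let ?w = "(i, \<eta> + \<zeta>)"
    have w: "?w \<in> idxs m I" using in_idxs step.hyps by auto
    have sh: "shift j ?w = (i, \<eta> + (\<zeta> + sngl j 1))" by (simp add: shift_def add.assoc)
    show ?case
    proof (cases "\<zeta> = 0")
      case True
      have s: "?s \<in> ?B (shift j ?g)"
      proof (rule sep_in_rgen)
        show "P \<in> pov (?B (shift j ?g))" using pov_mono[OF mono[OF step.hyps(2) g] P(1)] .
        show "z ?g \<in> ?B (shift j ?g)" by (rule self[OF step.hyps(2) g])
      qed
      have "map_poly (d j) P \<in> pov (?B (shift j ?g))"
        using dB[OF _ step.hyps(2) g] P(1) by (auto simp: pov_def coeff_map_poly derD[OF d[OF step.hyps(2)]])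
      then have "poly (map_poly (d j) P) (z ?g) \<in> ?B (shift j ?g)" using self[OF step.hyps(2) g] by (rule poly_in_rgen)
      moreover have "poly (map_poly (d j) P) (z ?g) + ?s * z (shift j ?g) = 0"
        using der_poly[OF d[OF step.hyps(2)], of P "z ?g"] P(2) derD(3)[OF d[OF step.hyps(2)]]
        by (simp add: z[OF step.hyps(2) g])
      then have "?s * z (shift j ?g) = - poly (map_poly (d j) P) (z ?g)"
        by (simp add: eq_neg_iff_add_eq_0 add.commute)
      ultimately have "?s * z (shift j ?g) \<in> ?B (shift j ?g)" by (simp add: rgen_neg)
      then show ?thesis using s True sh by simp
    next
      case False
      then have IH: "?s \<in> ?B ?w" "?s * z ?w \<in> ?B ?w" using step.IH by auto
      \<comment> \<open>Leibniz rule; solving for the new derivative keeps the same factor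
        \<open>?s\<close>, and both terms of the difference lie below
        \<open>shift j ?w\<close>.\<close>
      have "d j (?s * z ?w) = d j ?s * z ?w + ?s * z (shift j ?w)"
        by (simp add: derD[OF d[OF step.hyps(2)]] z[OF step.hyps(2) w])
      then have "?s * z (shift j ?w) = d j (?s * z ?w) - d j ?s * z ?w" by simp
      also have "\<dots> \<in> ?B (shift j ?w)"
        by (intro rgen_diff rgen_mult dB IH step.hyps w self)
      finally have "?s * z (shift j ?w) \<in> ?B (shift j ?w)" .
      moreover have "?s \<in> ?B (shift j ?w)" using IH(1) mono[OF step.hyps(2) w] by auto
      ultimately show ?thesis unfolding sh by simp
    qed
  qed simp
  then show "?s * z (i, \<eta> + \<zeta>) \<in> ?B (i, \<eta> + \<zeta>)" "?s \<in> ?B (i, \<eta> + \<zeta>)" using \<zeta>(2) by auto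
qed

text \<open>\<open>leads A z\<close> consists of the leaders of the relations of \<open>z\<close> over \<open>A\<close>.\<close>

definition leads :: "nat \<Rightarrow> nat set \<Rightarrow> 'a::field set \<Rightarrow> (dvar \<Rightarrow> 'a) \<Rightarrow> dvar set" where
  "leads m I A z = {w \<in> idxs m I. z w \<in> acl (A \<union> z ` ini m I (rk m I w))}"

lemma leads_idxs: "leads m I A z \<subseteq> idxs m I"
  by (auto simp: leads_def)

text \<open>Permits replacing the field of parameters by generators of a differential ring with the
  same algebraic closure.\<close>

lemma leads_cong: assumes "acl A = acl A'" shows "leads m I A z = leads m I A' z"
proof -
  have "acl (A \<union> Z) = acl (A' \<union> Z)" for Z
  proof (rule acl_eqI)
    show "A \<union> Z \<subseteq> acl (A' \<union> Z)" "A' \<union> Z \<subseteq> acl (A \<union> Z)"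
      using assms acl_base acl_mono[of A' "A' \<union> Z"] acl_mono[of A "A \<union> Z"] acl_base[of "A' \<union> Z"] acl_base[of "A \<union> Z"]
       acl_base[of A] acl_base[of A'] by blast+
  qed
  then show ?thesis by (simp add: leads_def)
qed

lemma acl_linear: assumes "s \<in> rgen S" "s * x \<in> rgen S" "s \<noteq> 0" shows "x \<in> acl S"
proof (rule acl_root[of "[:- (s * x), s:]"])
  show "[:- (s * x), s:] \<in> pov (rgen S)" by (intro pov_pCons pov_0 rgen_neg assms)
qed (use assms in auto)

locale dfld =
  fixes m :: nat and \<delta> :: "nat \<Rightarrow> 'a::field_char_0 \<Rightarrow> 'a"
  assumes der: "\<And>j. j < m \<Longrightarrow> der (\<delta> j)"
    and comm: "\<And>i j x. i < m \<Longrightarrow> j < m \<Longrightarrow> \<delta> i (\<delta> j x) = \<delta> j (\<delta> i x)"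
begin

definition dv :: "(nat \<Rightarrow> 'a) \<Rightarrow> dvar \<Rightarrow> 'a" where
  "dv v w = der_pow m \<delta> (snd w) (v (fst w))"

lemma funpow_comm: "i < m \<Longrightarrow> j < m \<Longrightarrow> (\<delta> i ^^ k) (\<delta> j x) = \<delta> j ((\<delta> i ^^ k) x)"
  by (induction k) (simp_all add: comm)

lemma der_pow_Suc:
  assumes j: "j < m" shows "der_pow m \<delta> (\<xi> + sngl j 1) x = \<delta> j (der_pow m \<delta> \<xi> x)"
proof -
  let ?e = "lkp \<xi>" and ?e' = "lkp (\<xi> + sngl j 1)"
  have e': "?e' i = (if i = j then Suc (?e i) else ?e i)" for i
    by (auto simp: lookup_add lookup_single when_def)
  have "distinct xs \<Longrightarrow> set xs \<subseteq> {..<m} \<Longrightarrow> foldr (\<lambda>i. \<delta> i ^^ ?e' i) xs x =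
     (if j \<in> set xs then \<delta> j (foldr (\<lambda>i. \<delta> i ^^ ?e i) xs x) else foldr (\<lambda>i. \<delta> i ^^ ?e i) xs x)" for xs
    by (induction xs) (auto simp: e' funpow_comm j simp del: One_nat_def)
  from this[of "[0..<m]"] j show ?thesis by (simp add: der_pow_def atLeast0LessThan)
qed

lemma dv_shift: "j < m \<Longrightarrow> dv v (shift j w) = \<delta> j (dv v w)"
  using der_pow_Suc by (simp add: dv_def shift_def)

lemma dv_0: "dv v (i, 0) = v i"
proof -
  have "foldr (\<lambda>i. \<delta> i ^^ lkp 0 i) xs x = x" for xs x by (induction xs) auto
  then show ?thesis by (simp add: dv_def der_pow_def)
qed

lemma dv_cong: "v (fst w) = v' (fst w) \<Longrightarrow> dv v w = dv v' w"
  by (simp add: dv_def)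

text \<open>Stated for generators only; by the Leibniz rule all of \<open>rgen A\<close> is then
  closed (\<open>der_rgen_closed\<close>).\<close>

definition dclosed :: "'a set \<Rightarrow> bool" where
  "dclosed A \<longleftrightarrow> (\<forall>j<m. \<forall>x\<in>A. \<delta> j x \<in> rgen A)"

lemma dclosed_idxs: "dclosed A \<Longrightarrow> dclosed (A \<union> dv v ` idxs m I)"
  unfolding dclosed_def
proof (intro allI impI ballI)
  fix j x assume *: "\<forall>j<m. \<forall>x\<in>A. \<delta> j x \<in> rgen A" "j < m" "x \<in> A \<union> dv v ` idxs m I"
  from *(3) show "\<delta> j x \<in> rgen (A \<union> dv v ` idxs m I)"
  proof
    assume "x \<in> A"
    then show ?thesis using * rgen_mono[of A "A \<union> dv v ` idxs m I"] by auto
  next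
    assume "x \<in> dv v ` idxs m I"
    then show ?thesis using * shift_idxs[of _ m I j] by (auto simp: dv_shift[OF *(2), symmetric] intro!: rgen_base)
  qed
qed

lemma der_rgen_closed: "dclosed A \<Longrightarrow> j < m \<Longrightarrow> x \<in> rgen A \<Longrightarrow> \<delta> j x \<in> rgen A"
  by (rule der_rgen[OF der]) (auto simp: dclosed_def intro: rgen_base)

text \<open>The minimal polynomial of \<open>x\<close> is separable; differentiating it expresses
  \<open>\<delta> j x\<close> as a quotient with the separant as denominator, hence as an element
  algebraic over \<open>A\<close> and \<open>x\<close>.\<close>

lemma der_acl_closed:
  assumes "dclosed A" "j < m" "x \<in> acl A" shows "\<delta> j x \<in> acl A"
proof -
  obtain p where p: "p \<in> pov (rgen A)" "p \<noteq> 0" "poly p x = 0"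
    "\<And>q. q \<in> pov (rgen A) \<Longrightarrow> q \<noteq> 0 \<Longrightarrow> poly q x = 0 \<Longrightarrow> Polynomial.degree p \<le> Polynomial.degree q"
    "Polynomial.degree p > 0" using minimal_root_polynomial[OF assms(3)] by metis
  have s: "sep p x \<noteq> 0" by (rule minimal_polynomial_separable[OF p(1,5,4)])
  have "poly (map_poly (\<delta> j) p) x + sep p x * \<delta> j x = 0"
    using der_poly[OF der[OF assms(2)], of p x] p(3) derD(3)[OF der[OF assms(2)]] by simp
  then have "\<delta> j x = - poly (map_poly (\<delta> j) p) x * inverse (sep p x)"
    using s by (simp add: field_simps eq_neg_iff_add_eq_0)
  moreover have "map_poly (\<delta> j) p \<in> pov (rgen A)"
    using der_rgen_closed[OF assms(1,2)] p(1) by (auto simp: pov_def coeff_map_poly derD[OF der[OF assms(2)]])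
  ultimately have "\<delta> j x \<in> acl (insert x A)"
    using poly_in_rgen[of "map_poly (\<delta> j) p" "insert x A" x] sep_in_rgen[of p "insert x A" x] p(1)
      pov_mono[OF rgen_mono[of A "insert x A"]] rgen_subset_acl[of "insert x A"]
    by (auto intro!: acl_closed rgen_base)
  moreover have "acl (insert x A) \<subseteq> acl A" by (rule acl_least) (use assms(3) acl_base in auto)
  ultimately show ?thesis by auto
qed

text \<open>Differentiating a minimal relation of a leader gives a linear relation for its shift,
  with the nonvanishing separant as coefficient.\<close>

lemma upclosed_leads:
  assumes I: "finite I" and A: "dclosed A" shows "upclosed m (leads m I A (dv v))"
  unfolding upclosed_def
proof (intro ballI allI impI)
  fix w j assume w: "w \<in> leads m I A (dv v)" and j: "j < m"
  obtain i \<eta> where w': "w = (i, \<eta>)" by (cases w)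
  from w have wI: "w \<in> idxs m I" and "dv v w \<in> acl (A \<union> dv v ` ini m I (rk m I w))" by (auto simp: leads_def)
  from minimal_root_polynomial[OF this(2)] obtain p where
    p: "p \<in> pov (rgen (A \<union> dv v ` ini m I (rk m I w)))" "p \<noteq> 0" "poly p (dv v w) = 0"
    "\<And>q. q \<in> pov (rgen (A \<union> dv v ` ini m I (rk m I w))) \<Longrightarrow> q \<noteq> 0 \<Longrightarrow> poly q (dv v w) = 0 \<Longrightarrow> Polynomial.degree p \<le> Polynomial.degree q"
    "Polynomial.degree p > 0" by metis
  have s: "sep p (dv v w) \<noteq> 0" by (rule minimal_polynomial_separable[OF p(1,5,4)])
  have nz: "sngl j (1::nat) \<noteq> 0" by (metis lookup_single_eq lookup_zero zero_neq_one)
  note red = separant_reduction[OF I der, of S for S, where z="dv v", OF _ _ dv_shift wI[unfolded w'] p(1,3)[unfolded w'] multi_indices_single[OF j] nz]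
  have "dv v (shift j w) \<in> acl (A \<union> dv v ` ini m I (rk m I (shift j w)))"
    using red s A by (intro acl_linear[of "sep p (dv v w)"]) (auto simp: w' shift_def dclosed_def)
  then show "shift j w \<in> leads m I A (dv v)" using shift_idxs[OF wI j] by (simp add: leads_def)
qed

subsection \<open>Differential polynomial functions\<close>

text \<open>Differential polynomials as functions of the point, so that one relation can be
  evaluated at two points without choosing a representative; terms and polynomials are recovered by
  \<open>PF_PT\<close> and \<open>PF_mpoly_eval\<close>.\<close>

inductive_set PF :: "'a set \<Rightarrow> dvar set \<Rightarrow> ((nat \<Rightarrow> 'a) \<Rightarrow> 'a) set" for A W where
  PF_one: "(\<lambda>v. 1) \<in> PF A W"
| PF_const: "c \<in> A \<Longrightarrow> (\<lambda>v. c) \<in> PF A W"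
| PF_var: "w \<in> W \<Longrightarrow> (\<lambda>v. dv v w) \<in> PF A W"
| PF_add: "f \<in> PF A W \<Longrightarrow> g \<in> PF A W \<Longrightarrow> (\<lambda>v. f v + g v) \<in> PF A W"
| PF_neg: "f \<in> PF A W \<Longrightarrow> (\<lambda>v. - f v) \<in> PF A W"
| PF_mult: "f \<in> PF A W \<Longrightarrow> g \<in> PF A W \<Longrightarrow> (\<lambda>v. f v * g v) \<in> PF A W"

lemma PF_mono: assumes "A \<subseteq> A'" "W \<subseteq> W'" shows "PF A W \<subseteq> PF A' W'"
proof
  fix f assume "f \<in> PF A W" then show "f \<in> PF A' W'"
    by induction (use assms in \<open>auto intro: PF.intros\<close>)
qed

lemma PF_zero: "(\<lambda>v. 0) \<in> PF A W"
  using PF_add[OF PF_one PF_neg[OF PF_one]] by simp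

lemma PF_of_nat: "(\<lambda>v. of_nat n) \<in> PF A W"
  by (induction n) (auto intro: PF_one PF_zero PF_add)

lemma PF_sum: "(\<And>i. i \<in> S \<Longrightarrow> f i \<in> PF A W) \<Longrightarrow> (\<lambda>v. \<Sum>i\<in>S. f i v) \<in> PF A W"
  by (induction S rule: infinite_finite_induct) (auto intro: PF_zero PF_add)

lemma PF_power: "f \<in> PF A W \<Longrightarrow> (\<lambda>v. f v ^ n) \<in> PF A W"
  by (induction n) (auto intro: PF_one PF_mult)

lemma PF_prod: "(\<And>i. i \<in> S \<Longrightarrow> f i \<in> PF A W) \<Longrightarrow> (\<lambda>v. \<Prod>i\<in>S. f i v) \<in> PF A W"
  by (induction S rule: infinite_finite_induct) (auto intro: PF_one PF_mult)

lemma PF_cong: "f \<in> PF A W \<Longrightarrow> (\<And>w. w \<in> W \<Longrightarrow> dv v w = dv v' w) \<Longrightarrow> f v = f v'"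
  by (induction rule: PF.induct) auto

lemma rgen_eq_PF: "rgen (A \<union> dv v ` W) = (\<lambda>f. f v) ` PF A W"
proof
  show "rgen (A \<union> dv v ` W) \<subseteq> (\<lambda>f. f v) ` PF A W"
  proof
    fix x assume "x \<in> rgen (A \<union> dv v ` W)" then show "x \<in> (\<lambda>f. f v) ` PF A W"
    proof induction
      case rgen_one then show ?case by (intro image_eqI[of _ _ "\<lambda>v. 1"]) (auto intro: PF.intros)
    next
      case (rgen_base x)
      then show ?case
      proof
        assume "x \<in> A" then show ?thesis by (intro image_eqI[of _ _ "\<lambda>v. x"]) (auto intro: PF.intros)
      next
        assume "x \<in> dv v ` W"
        then obtain w where "w \<in> W" "x = dv v w" by auto
        then show ?thesis by (intro image_eqI[of _ _ "\<lambda>v. dv v w"]) (auto intro: PF.intros)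
      qed
    next
      case (rgen_add x y)
      then obtain f g where "f \<in> PF A W" "g \<in> PF A W" "x = f v" "y = g v" by auto
      then show ?case by (intro image_eqI[of _ _ "\<lambda>v. f v + g v"]) (auto intro: PF.intros)
    next
      case (rgen_neg x)
      then obtain f where "f \<in> PF A W" "x = f v" by auto
      then show ?case by (intro image_eqI[of _ _ "\<lambda>v. - f v"]) (auto intro: PF.intros)
    next
      case (rgen_mult x y)
      then obtain f g where "f \<in> PF A W" "g \<in> PF A W" "x = f v" "y = g v" by auto
      then show ?case by (intro image_eqI[of _ _ "\<lambda>v. f v * g v"]) (auto intro: PF.intros)
    qed
  qed
  show "(\<lambda>f. f v) ` PF A W \<subseteq> rgen (A \<union> dv v ` W)"
  proof (rule image_subsetI)
    fix f assume "f \<in> PF A W" then show "f v \<in> rgen (A \<union> dv v ` W)"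
      by induction (auto intro: rgen.intros)
  qed
qed

text \<open>When the ring generated by the paired coordinates is functional, it is the graph of the
  specialisation of \<open>v\<close> to \<open>v'\<close>; this places the values of polynomials in
  it.\<close>

lemma PF_pair:
  assumes "f \<in> PF A W"
  shows "(f v, f v') \<in> rgen ((\<lambda>c. (c, c)) ` A \<union> (\<lambda>w. (dv v w, dv v' w)) ` W)" (is "_ \<in> rgen ?S")
  using assms
proof induction
  case PF_one then show ?case using rgen_one[of ?S] by (simp add: one_prod_def)
next
  case (PF_const c) then show ?case by (auto intro: rgen_base)
next
  case (PF_var w) then show ?case by (auto intro: rgen_base)
next
  case (PF_add f g) then show ?case using rgen_add[of "(f v, f v')" ?S "(g v, g v')"] by (simp add: plus_prod_def)
next
  case (PF_neg f) then show ?case using rgen_neg[of "(f v, f v')" ?S] by (simp add: uminus_prod_def)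
next
  case (PF_mult f g) then show ?case using rgen_mult[of "(f v, f v')" ?S "(g v, g v')"] by (simp add: times_prod_def)
qed

end

lemma rgen_Union_chain:
  assumes "\<And>M N. M \<le> N \<Longrightarrow> T M \<subseteq> T N" "x \<in> rgen (\<Union>N::nat. T N)" shows "\<exists>N. x \<in> rgen (T N)"
proof -
  have mono: "rgen (T M) \<subseteq> rgen (T (max M N))" "rgen (T N) \<subseteq> rgen (T (max M N))" for M N
    by (intro rgen_mono assms(1); simp)+
  from assms(2) show ?thesis
  proof induction
    case (rgen_base x) then show ?case by (auto intro: rgen.rgen_base)
  next
    case (rgen_add x y) then show ?case using mono rgen.rgen_add by (metis subsetD)
  next
    case (rgen_mult x y) then show ?case using mono rgen.rgen_mult by (metis subsetD)
  qed (auto intro: rgen.intros)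
qed

text \<open>A single ring element involves finitely many derivatives only, so functionality may be
  proved along the ranking.\<close>

lemma functional_Union_ini:
  assumes "\<And>N. functional \<pi> (rgen (S \<union> z ` ini m I N))" shows "functional \<pi> (rgen (S \<union> z ` idxs m I))"
  unfolding functional_def
proof (intro ballI impI)
  fix \<gamma> assume \<gamma>: "\<gamma> \<in> rgen (S \<union> z ` idxs m I)" "\<pi> \<gamma> = 0"
  have "S \<union> z ` idxs m I = (\<Union>N. S \<union> z ` ini m I N)" by (auto simp: idxs_eq_Union_ini)
  then obtain N where "\<gamma> \<in> rgen (S \<union> z ` ini m I N)"
    using rgen_Union_chain[of "\<lambda>N. S \<union> z ` ini m I N" \<gamma>] \<gamma>(1) ini_mono by (metis (no_types, lifting) Un_mono image_mono order_refl)
  then show "\<gamma> = 0" using functionalD[OF assms] \<gamma>(2) by blast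
qed


section \<open>Specialisation\<close>

text \<open>The lift is cut off at the degree of \<open>p\<close>, so that zero coefficients beyond
  it are not lifted to nonzero ones.\<close>

lemma lift_poly:
  assumes "rhom \<pi>" "p \<in> pov (rgen (\<pi> ` S))"
  obtains P where "P \<in> pov (rgen S)" "map_poly \<pi> P = p" "Polynomial.degree P \<le> Polynomial.degree p"
proof -
  have "\<forall>i. \<exists>a\<in>rgen S. \<pi> a = Polynomial.coeff p i"
    using assms(2) unfolding pov_def rhom_image_rgen[OF assms(1), symmetric] by (auto simp: image_iff) metis
  then obtain a where a: "a i \<in> rgen S" "\<pi> (a i) = Polynomial.coeff p i" for i by metis
  let ?P = "\<Sum>i\<le>Polynomial.degree p. Polynomial.monom (a i) i"
  have cP: "Polynomial.coeff ?P i = (if i \<le> Polynomial.degree p then a i else 0)" for i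
    unfolding coeff_sum by (auto simp: sum.delta)
  show ?thesis
  proof (rule that[of ?P])
    show "?P \<in> pov (rgen S)" by (intro pov_sum pov_monom a)
    show "map_poly \<pi> ?P = p"
    proof (rule poly_eqI)
      fix i show "Polynomial.coeff (map_poly \<pi> ?P) i = Polynomial.coeff p i"
        unfolding coeff_map_poly[where f=\<pi>, OF rhomD(4)[OF assms(1)]] cP by (auto simp: a(2) rhomD(4)[OF assms(1)] coeff_eq_0)
    qed
    show "Polynomial.degree ?P \<le> Polynomial.degree p" by (rule degree_le) (auto simp: cP simp del: coeff_sum)
  qed
qed

text \<open>A leading coefficient with nonzero second component annihilates no nonzero pair whose
  first component is zero; so a relation that is minimal in the first component extends the
  graph.\<close>

lemma functional_min_lift:
  fixes S :: "('a::field \<times> 'b::idom) set"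
  assumes f: "functional fst (rgen S)" and P: "P \<in> pov (rgen S)" "poly P z = 0" "snd (Polynomial.coeff P (Polynomial.degree p)) \<noteq> 0"
    and p: "map_poly fst P = p" "p \<noteq> 0" "Polynomial.degree P \<le> Polynomial.degree p"
    "\<And>q. q \<in> pov (rgen (fst ` S)) \<Longrightarrow> q \<noteq> 0 \<Longrightarrow> poly q (fst z) = 0 \<Longrightarrow> Polynomial.degree p \<le> Polynomial.degree q"
  shows "functional fst (rgen (insert z S))"
proof (rule functional_algebraic[OF rhom_fst f P(1) _ P(2)])
  show "P \<noteq> 0" using p(1,2) by auto
  have deg: "Polynomial.degree P = Polynomial.degree p"
    using p(3) degree_map_poly_rhom[OF rhom_fst, of P] p(1) by simp
  fix R assume R: "R \<in> pov (rgen S)" "R \<noteq> 0" "fst (poly R z) = 0"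
  have "map_poly fst R \<noteq> 0" using functional_pov[OF rhom_fst f R(1)] R(2) by auto
  moreover have "poly (map_poly fst R) (fst z) = 0" using R(3) by (simp add: rhom_poly[OF rhom_fst])
  ultimately have "Polynomial.degree p \<le> Polynomial.degree (map_poly fst R)"
    using p(4) rhom_map_poly_pov[OF rhom_fst R(1)] by blast
  then show "Polynomial.degree P \<le> Polynomial.degree R"
    using degree_map_poly_rhom[OF rhom_fst, of R] deg by simp
next
  have deg: "Polynomial.degree P = Polynomial.degree p"
    using p(3) degree_map_poly_rhom[OF rhom_fst, of P] p(1) by simp
  fix \<gamma> :: "'a \<times> 'b" assume "fst \<gamma> = 0" "Polynomial.lead_coeff P * \<gamma> = 0"
  then show "\<gamma> = 0" using prod_nzd[of "Polynomial.lead_coeff P" \<gamma>] P(3) deg by simp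
qed

context dfld
begin

text \<open>The local form of the Ritt--Raudenbush theorem.\<close>

lemma local_basis:
  assumes I: "finite I" and A: "dclosed A"
  shows "\<exists>Z N. finite Z \<and> finite N \<and> Z \<subseteq> PF A (idxs m I) \<and> N \<subseteq> PF A (idxs m I) \<and>
    (\<forall>f\<in>Z. f v0 = 0) \<and> (\<forall>f\<in>N. f v0 \<noteq> 0) \<and>
    (\<forall>v. (\<forall>f\<in>Z. f v = 0) \<and> (\<forall>f\<in>N. f v \<noteq> 0) \<longrightarrow>
      functional fst (rgen ((\<lambda>c. (c, c)) ` A \<union> (\<lambda>w. (dv v0 w, dv v w)) ` idxs m I)))"
proof -
  define E where "E = leads m I A (dv v0)"
  define G where "G = mins m E"
  have EJ: "E \<subseteq> idxs m I" by (simp add: E_def leads_idxs)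
  have upE: "upclosed m E" unfolding E_def by (rule upclosed_leads[OF I A])
  have finG: "finite G" unfolding G_def by (rule finite_mins[OF I EJ upE])
  have GJ: "G \<subseteq> idxs m I" using EJ by (auto simp: G_def mins_def)
  let ?B = "\<lambda>w. A \<union> dv v0 ` ini m I (rk m I w)"
  have "\<forall>g\<in>G. \<exists>p. p \<in> pov (rgen (?B g)) \<and> p \<noteq> 0 \<and> poly p (dv v0 g) = 0 \<and>
      (\<forall>q. q \<in> pov (rgen (?B g)) \<longrightarrow> q \<noteq> 0 \<longrightarrow> poly q (dv v0 g) = 0 \<longrightarrow> Polynomial.degree p \<le> Polynomial.degree q) \<and>
      Polynomial.degree p > 0"
  proof
    fix g assume "g \<in> G"
    then have "dv v0 g \<in> acl (?B g)" by (auto simp: G_def mins_def E_def leads_def)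
    from minimal_root_polynomial[OF this] show "\<exists>p. p \<in> pov (rgen (?B g)) \<and> p \<noteq> 0 \<and> poly p (dv v0 g) = 0 \<and>
      (\<forall>q. q \<in> pov (rgen (?B g)) \<longrightarrow> q \<noteq> 0 \<longrightarrow> poly q (dv v0 g) = 0 \<longrightarrow> Polynomial.degree p \<le> Polynomial.degree q) \<and>
      Polynomial.degree p > 0" by metis
  qed
  from bchoice[OF this] obtain p where p: "\<And>g. g \<in> G \<Longrightarrow> p g \<in> pov (rgen (?B g))" "\<And>g. g \<in> G \<Longrightarrow> p g \<noteq> 0"
    "\<And>g. g \<in> G \<Longrightarrow> poly (p g) (dv v0 g) = 0"
    "\<And>g q. g \<in> G \<Longrightarrow> q \<in> pov (rgen (?B g)) \<Longrightarrow> q \<noteq> 0 \<Longrightarrow> poly q (dv v0 g) = 0 \<Longrightarrow> Polynomial.degree (p g) \<le> Polynomial.degree q"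
    "\<And>g. g \<in> G \<Longrightarrow> Polynomial.degree (p g) > 0" by blast
  have "\<exists>h. h \<in> PF A (ini m I (rk m I g)) \<and> h v0 = Polynomial.coeff (p g) i" if "g \<in> G" for g i
    using p(1)[OF that] unfolding pov_def rgen_eq_PF by (auto simp: image_iff) metis
  then obtain h where h: "\<And>g i. g \<in> G \<Longrightarrow> h g i \<in> PF A (ini m I (rk m I g))" "\<And>g i. g \<in> G \<Longrightarrow> h g i v0 = Polynomial.coeff (p g) i"
    by metis
  let ?d = "\<lambda>g. Polynomial.degree (p g)"
  define rel where "rel = (\<lambda>g v. \<Sum>i\<le>?d g. h g i v * dv v g ^ i)"
  define sp where "sp = (\<lambda>g v. \<Sum>i\<le>?d g. of_nat i * h g i v * dv v g ^ (i - 1))"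
  \<comment> \<open>Being near \<open>v0\<close> means that the minimal relations at the finitely
    many generators of \<open>E\<close> still hold (\<open>Z\<close>), while their initials and
    separants do not vanish (\<open>N\<close>).\<close>
  define Z where "Z = rel ` G"
  define N where "N = (\<lambda>g. h g (?d g)) ` G \<union> sp ` G"
  have hPF: "h g i \<in> PF A (idxs m I)" if "g \<in> G" for g i using h(1)[OF that] PF_mono[OF order_refl ini_idxs] by blast
  have vPF: "(\<lambda>v. dv v g) \<in> PF A (idxs m I)" if "g \<in> G" for g using that GJ by (auto intro: PF_var)
  have "rel g \<in> PF A (idxs m I)" "sp g \<in> PF A (idxs m I)" if "g \<in> G" for g
    unfolding rel_def sp_def using hPF[OF that] vPF[OF that] by (auto intro!: PF_sum PF_mult PF_power PF_of_nat)
  then have PFs: "Z \<subseteq> PF A (idxs m I)" "N \<subseteq> PF A (idxs m I)" using hPF by (auto simp: Z_def N_def)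
  have Z0: "\<forall>f\<in>Z. f v0 = 0" using p(3) h(2) by (auto simp: Z_def rel_def poly_altdef)
  have N0: "\<forall>f\<in>N. f v0 \<noteq> 0"
  proof -
    have "sp g v0 \<noteq> 0" if "g \<in> G" for g
      using minimal_polynomial_separable[OF p(1)[OF that] p(5)[OF that] p(4)[OF that]] h(2)[OF that]
      by (simp add: sp_def sep_def)
    moreover have "h g (?d g) v0 \<noteq> 0" if "g \<in> G" for g using h(2)[OF that] p(2)[OF that] by simp
    ultimately show ?thesis by (auto simp: N_def)
  qed
  have main: "functional fst (rgen ((\<lambda>c. (c, c)) ` A \<union> (\<lambda>w. (dv v0 w, dv v w)) ` idxs m I))"
    if v: "\<forall>f\<in>Z. f v = 0" "\<forall>f\<in>N. f v \<noteq> 0" for v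
  proof (rule functional_Union_ini)
    let ?S = "(\<lambda>c. (c, c)) ` A :: ('a \<times> 'a) set"
    let ?z = "\<lambda>w. (dv v0 w, dv v w)"
    \<comment> \<open>The componentwise derivation of the product ring; the relations
      \<open>PP g\<close> between pairs can then be differentiated as they stand.\<close>
    let ?D = "\<lambda>j (x::'a \<times> 'a). (\<delta> j (fst x), \<delta> j (snd x))"
    define PP where "PP = (\<lambda>g. \<Sum>i\<le>?d g. Polynomial.monom (h g i v0, h g i v) i)"
    have cPP: "Polynomial.coeff (PP g) i = (if i \<le> ?d g then (h g i v0, h g i v) else 0)" for g i
      unfolding PP_def coeff_sum by (auto simp: sum.delta)
    have dPP: "Polynomial.degree (PP g) \<le> ?d g" for g by (rule degree_le) (auto simp: cPP)
    have PPov: "PP g \<in> pov (rgen (?S \<union> ?z ` ini m I (rk m I g)))" if "g \<in> G" for g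
      unfolding PP_def by (intro pov_sum pov_monom PF_pair h(1) that)
    have mPP: "map_poly fst (PP g) = p g" if "g \<in> G" for g
      by (rule poly_eqI) (auto simp: coeff_map_poly cPP h(2)[OF that] coeff_eq_0)
    have root: "poly (PP g) (?z g) = 0" if "g \<in> G" for g
    proof -
      have "fst (poly (PP g) (?z g)) = 0" using p(3)[OF that] mPP[OF that] by (simp add: rhom_poly[OF rhom_fst])
      moreover have "snd (poly (PP g) (?z g)) = rel g v"
        unfolding PP_def poly_sum poly_monom rel_def by (simp add: rhom_sum[OF rhom_snd] rhom_power[OF rhom_snd])
      ultimately show ?thesis using v(1) that by (simp add: prod_eq_iff Z_def)
    qed
    have sepPP: "snd (sep (PP g) (?z g)) \<noteq> 0" if "g \<in> G" for g
    proof -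
      have "snd (sep (PP g) (?z g)) = sp g v"
        unfolding sep_superset[OF dPP] sp_def cPP
        by (simp add: rhom_sum[OF rhom_snd] rhom_power[OF rhom_snd] rhom_of_nat[OF rhom_snd])
      then show ?thesis using v(2) that by (simp add: N_def)
    qed
    have derD2: "der (?D j)" if "j < m" for j
      using derD[OF der[OF that]] by (auto simp: der_def plus_prod_def times_prod_def)
    have cS: "?D j x \<in> rgen ?S" if "j < m" "x \<in> ?S" for j x
    proof -
      from that(2) obtain c where c: "c \<in> A" "x = (c, c)" by auto
      have "\<delta> j c \<in> rgen (A \<union> dv v0 ` {})" using A that c by (auto simp: dclosed_def)
      then obtain f where f: "f \<in> PF A {}" "f v0 = \<delta> j c" unfolding rgen_eq_PF by auto
      have "f v = f v0" by (rule PF_cong[OF f(1)]) simp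
      then show ?thesis using PF_pair[OF f(1), of v0 v] f(2) c(2) by simp
    qed
    have fstS: "fst ` (?S \<union> ?z ` W) = A \<union> dv v0 ` W" for W by (simp add: image_Un image_image)
    \<comment> \<open>One derivative at a time: a non-leader is transcendental at \<open>v0\<close>,
      a generator of \<open>E\<close> has its minimal relation, and every other leader has the
      linear relation obtained from a generator by differentiation.\<close>
    show "functional fst (rgen (?S \<union> ?z ` ini m I M))" for M
    proof (induction M)
      case 0
      have "rgen (?S \<union> ?z ` ini m I 0) \<subseteq> range (\<lambda>c. (c, c))"
      proof
        fix x assume "x \<in> rgen (?S \<union> ?z ` ini m I 0)" then show "x \<in> range (\<lambda>c. (c, c))"
          by induction (auto simp: ini_def one_prod_def plus_prod_def uminus_prod_def times_prod_def)
      qed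
      then show ?case by (auto simp: functional_def zero_prod_def)
    next
      case (Suc M)
      show ?case
      proof (cases "\<exists>w\<in>idxs m I. rk m I w = M")
        case False then show ?thesis using Suc by (simp add: ini_Suc_not)
      next
        case True
        then obtain w where w: "w \<in> idxs m I" "M = rk m I w" by auto
        let ?T = "?S \<union> ?z ` ini m I M"
        have eq: "?S \<union> ?z ` ini m I (Suc M) = insert (?z w) ?T" unfolding w(2) ini_Suc[OF I w(1)] by auto
        show ?thesis unfolding eq
        proof (cases "w \<in> E")
          case False
          show "functional fst (rgen (insert (?z w) ?T))"
            by (rule functional_transcendental[OF rhom_fst Suc]) (use False w in \<open>simp add: fstS E_def leads_def\<close>)
        next
          case wE: True
          show "functional fst (rgen (insert (?z w) ?T))"
          proof (cases "w \<in> G")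
            case True
            show ?thesis
            proof (rule functional_min_lift[OF Suc, of "PP w" _ "p w"])
              show "PP w \<in> pov (rgen ?T)" using PPov[OF True] w(2) by simp
              show "snd (Polynomial.coeff (PP w) (?d w)) \<noteq> 0" using v(2) True by (simp add: cPP N_def)
              show "Polynomial.degree (p w) \<le> Polynomial.degree q"
                if "q \<in> pov (rgen (fst ` ?T))" "q \<noteq> 0" "poly q (fst (?z w)) = 0" for q
                using p(4)[OF True, of q] that w(2) unfolding fstS by simp
            qed (use root[OF True] mPP[OF True] p(2)[OF True] dPP in auto)
          next
            case False
            obtain g where g: "g \<in> G" "fst g = fst w" "pm_le (snd g) (snd w)"
              using mins_generate[OF wE, of m] by (auto simp: G_def)
            define \<zeta> where "\<zeta> = snd w - snd g"
            have w': "w = (fst g, snd g + \<zeta>)" using g pm_le_diff[OF g(3)] by (simp add: \<zeta>_def prod_eq_iff)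
            have \<zeta>: "\<zeta> \<in> multi_indices m" "\<zeta> \<noteq> 0"
            proof -
              have "snd w \<in> multi_indices m" using w(1) by (simp add: idxs_def mem_Times_iff)
              then show "\<zeta> \<in> multi_indices m" unfolding \<zeta>_def by (rule multi_indices_minus)
              show "\<zeta> \<noteq> 0"
              proof
                assume "\<zeta> = 0"
                then have "w = g" by (subst w') simp
                then show False using False g(1) by simp
              qed
            qed
            have gJ: "(fst g, snd g) \<in> idxs m I" using g(1) GJ by auto
            have zsh: "?z (shift j u) = ?D j (?z u)" if "j < m" for j u using that by (simp add: dv_shift)
            have PPg: "PP g \<in> pov (rgen (?S \<union> ?z ` ini m I (rk m I (fst g, snd g))))" "poly (PP g) (?z (fst g, snd g)) = 0"
              using PPov[OF g(1)] root[OF g(1)] by simp_all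
            note red = separant_reduction[of I m ?D ?S ?z, OF I derD2 cS zsh gJ PPg \<zeta>]
            let ?s = "sep (PP g) (?z g)"
            have s: "?s \<in> rgen ?T" "?s * ?z w \<in> rgen ?T"
              using red by (simp_all add: w'[symmetric] w(2))
            show ?thesis
            proof (rule functional_linear[OF rhom_fst Suc s refl])
              show "?s \<noteq> 0" using sepPP[OF g(1)] by auto
              show "\<gamma> = 0" if "fst \<gamma> = 0" "?s * \<gamma> = 0" for \<gamma>
                by (rule prod_nzd[OF sepPP[OF g(1)] that])
            qed
          qed
        qed
      qed
    qed
  qed
  show ?thesis
    by (intro exI[of _ Z] exI[of _ N] conjI PFs Z0 N0 allI impI main) (use finG in \<open>auto simp: Z_def N_def\<close>)
qed

text \<open>\<open>H\<close> collects the initials and separants. It can be finite because the relation of a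
  non-minimal leader is obtained by differentiation and is linear, with a separant as initial.\<close>

lemma leader_relations:
  fixes v :: "nat \<Rightarrow> 'a"
  assumes I: "finite I" and A: "dclosed A"
  defines "E \<equiv> leads m I A (dv v)" and "B \<equiv> (\<lambda>w. rgen (A \<union> dv v ` ini m I (rk m I w)))"
  shows "\<exists>H P. finite H \<and> 0 \<notin> H \<and> (\<forall>w\<in>E. P w \<in> pov (B w) \<and> P w \<noteq> 0 \<and> poly (P w) (dv v w) = 0 \<and>
    (\<forall>q. q \<in> pov (B w) \<longrightarrow> q \<noteq> 0 \<longrightarrow> poly q (dv v w) = 0 \<longrightarrow> Polynomial.degree (P w) \<le> Polynomial.degree q) \<and>
    Polynomial.degree (P w) > 0 \<and> Polynomial.lead_coeff (P w) \<in> H \<and> sep (P w) (dv v w) \<in> H)"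
proof -
  define G where "G = mins m E"
  have EJ: "E \<subseteq> idxs m I" by (simp add: E_def leads_idxs)
  have upE: "upclosed m E" unfolding E_def by (rule upclosed_leads[OF I A])
  have finG: "finite G" unfolding G_def by (rule finite_mins[OF I EJ upE])
  have GJ: "G \<subseteq> idxs m I" using EJ by (auto simp: G_def mins_def)
  have "\<forall>g\<in>G. \<exists>p. p \<in> pov (B g) \<and> p \<noteq> 0 \<and> poly p (dv v g) = 0 \<and>
      (\<forall>q. q \<in> pov (B g) \<longrightarrow> q \<noteq> 0 \<longrightarrow> poly q (dv v g) = 0 \<longrightarrow> Polynomial.degree p \<le> Polynomial.degree q) \<and>
      Polynomial.degree p > 0"
  proof
    fix g assume "g \<in> G"
    then have "dv v g \<in> acl (A \<union> dv v ` ini m I (rk m I g))" by (auto simp: G_def mins_def E_def leads_def)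
    from minimal_root_polynomial[OF this] show "\<exists>p. p \<in> pov (B g) \<and> p \<noteq> 0 \<and> poly p (dv v g) = 0 \<and>
      (\<forall>q. q \<in> pov (B g) \<longrightarrow> q \<noteq> 0 \<longrightarrow> poly q (dv v g) = 0 \<longrightarrow> Polynomial.degree p \<le> Polynomial.degree q) \<and>
      Polynomial.degree p > 0" unfolding B_def by metis
  qed
  from bchoice[OF this] obtain p where p: "\<And>g. g \<in> G \<Longrightarrow> p g \<in> pov (B g)" "\<And>g. g \<in> G \<Longrightarrow> p g \<noteq> 0"
    "\<And>g. g \<in> G \<Longrightarrow> poly (p g) (dv v g) = 0"
    "\<And>g q. g \<in> G \<Longrightarrow> q \<in> pov (B g) \<Longrightarrow> q \<noteq> 0 \<Longrightarrow> poly q (dv v g) = 0 \<Longrightarrow> Polynomial.degree (p g) \<le> Polynomial.degree q"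
    "\<And>g. g \<in> G \<Longrightarrow> Polynomial.degree (p g) > 0" by blast
  define H where "H = (\<lambda>g. Polynomial.lead_coeff (p g)) ` G \<union> (\<lambda>g. sep (p g) (dv v g)) ` G"
  have sep0: "sep (p g) (dv v g) \<noteq> 0" if "g \<in> G" for g
    by (rule minimal_polynomial_separable[OF p(1)[OF that, unfolded B_def] p(5)[OF that] p(4)[OF that, unfolded B_def]])
  have "\<forall>w\<in>E. \<exists>P. P \<in> pov (B w) \<and> P \<noteq> 0 \<and> poly P (dv v w) = 0 \<and>
    (\<forall>q. q \<in> pov (B w) \<longrightarrow> q \<noteq> 0 \<longrightarrow> poly q (dv v w) = 0 \<longrightarrow> Polynomial.degree P \<le> Polynomial.degree q) \<and>
    Polynomial.degree P > 0 \<and> Polynomial.lead_coeff P \<in> H \<and> sep P (dv v w) \<in> H"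
  proof
    fix w assume wE: "w \<in> E"
    show "\<exists>P. P \<in> pov (B w) \<and> P \<noteq> 0 \<and> poly P (dv v w) = 0 \<and>
      (\<forall>q. q \<in> pov (B w) \<longrightarrow> q \<noteq> 0 \<longrightarrow> poly q (dv v w) = 0 \<longrightarrow> Polynomial.degree P \<le> Polynomial.degree q) \<and>
      Polynomial.degree P > 0 \<and> Polynomial.lead_coeff P \<in> H \<and> sep P (dv v w) \<in> H"
    proof (cases "w \<in> G")
      case True
      then have "Polynomial.lead_coeff (p w) \<in> H" "sep (p w) (dv v w) \<in> H" by (simp_all add: H_def)
      then show ?thesis using p[OF True] by blast
    next
      case False
      obtain g where g: "g \<in> G" "fst g = fst w" "pm_le (snd g) (snd w)"
        using mins_generate[OF wE, of m] by (auto simp: G_def)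
      define \<zeta> where "\<zeta> = snd w - snd g"
      have w': "w = (fst g, snd g + \<zeta>)" using g pm_le_diff[OF g(3)] by (simp add: \<zeta>_def prod_eq_iff)
      have \<zeta>: "\<zeta> \<in> multi_indices m" "\<zeta> \<noteq> 0"
      proof -
        have "snd w \<in> multi_indices m" using subsetD[OF EJ wE] by (simp add: idxs_def mem_Times_iff)
        then show "\<zeta> \<in> multi_indices m" unfolding \<zeta>_def by (rule multi_indices_minus)
        show "\<zeta> \<noteq> 0"
        proof
          assume "\<zeta> = 0"
          then have "w = g" by (subst w') simp
          then show False using False g(1) by simp
        qed
      qed
      have gJ: "(fst g, snd g) \<in> idxs m I" using g(1) GJ by auto
      have pg: "p g \<in> pov (rgen (A \<union> dv v ` ini m I (rk m I (fst g, snd g))))" "poly (p g) (dv v (fst g, snd g)) = 0"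
        using p(1,3)[OF g(1)] by (simp_all add: B_def)
      have cA: "\<delta> j x \<in> rgen A" if "j < m" "x \<in> A" for j x using A that by (auto simp: dclosed_def)
      note red = separant_reduction[of I m \<delta> A "dv v", OF I der cA dv_shift gJ pg \<zeta>]
      let ?s = "sep (p g) (dv v g)"
      \<comment> \<open>Leading coefficient and separant of this linear polynomial are both
        \<open>?s\<close>, the separant of a generator, so \<open>H\<close> need not grow.\<close>
      let ?P = "[:- (?s * dv v w), ?s:]"
      have s: "?s \<in> B w" "?s * dv v w \<in> B w" using red by (simp_all add: w'[symmetric] B_def)
      have "?P \<in> pov (B w)" using s unfolding B_def by (intro pov_pCons pov_0 rgen_neg)
      moreover have "Polynomial.degree ?P \<le> Polynomial.degree q" if "q \<noteq> 0" "poly q (dv v w) = 0" for q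
      proof (rule ccontr)
        assume "\<not> ?thesis"
        then have "Polynomial.degree q = 0" by (simp split: if_splits)
        then obtain a where "q = [:a:]" by (metis degree_eq_zeroE)
        then show False using that by simp
      qed
      moreover have "sep ?P (dv v w) = ?s" by (simp add: sep_pCons) (simp add: sep_def)
      ultimately show ?thesis using sep0[OF g(1)] g(1) by (intro exI[of _ ?P]) (auto simp: H_def mult.commute)
    qed
  qed
  from bchoice[OF this] obtain P where P: "\<forall>w\<in>E. P w \<in> pov (B w) \<and> P w \<noteq> 0 \<and> poly (P w) (dv v w) = 0 \<and>
    (\<forall>q. q \<in> pov (B w) \<longrightarrow> q \<noteq> 0 \<longrightarrow> poly q (dv v w) = 0 \<longrightarrow> Polynomial.degree (P w) \<le> Polynomial.degree q) \<and>
    Polynomial.degree (P w) > 0 \<and> Polynomial.lead_coeff (P w) \<in> H \<and> sep (P w) (dv v w) \<in> H" ..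
  show ?thesis by (rule exI[of _ H], rule exI[of _ P], intro conjI) (use finG p(2) sep0 P in \<open>auto simp: H_def\<close>)
qed

end


lemma pairs_image [simp]: "fst ` (\<lambda>w. (f w, g w)) ` W = f ` W" "snd ` (\<lambda>w. (f w, g w)) ` W = g ` W"
  by (simp_all add: image_image)

lemma functional_eq:
  assumes "functional fst (rgen S)" "(c, a) \<in> rgen S" "(c, b) \<in> rgen S" shows "a = b"
proof -
  have "(c, a) - (c, b) \<in> rgen S" by (rule rgen_diff[OF assms(2,3)])
  moreover have "fst ((c, a) - (c, b)) = 0" by simp
  ultimately have "(c, a) - (c, b) = 0" by (rule functionalD[OF assms(1)])
  then show ?thesis by (simp add: minus_prod_def zero_prod_def)
qed

lemma rgen_lift: assumes "c \<in> rgen (fst ` S)" shows "\<exists>c'. (c, c') \<in> rgen S"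
proof -
  obtain x where "x \<in> rgen S" "fst x = c" using assms unfolding rhom_image_rgen[OF rhom_fst, symmetric] by auto
  then show ?thesis by (metis prod.collapse)
qed

text \<open>\<open>z\<close> is the point to be specialised, over the ring generated by
  \<open>A\<close>; \<open>H\<close> and \<open>P\<close> are as supplied by
  \<open>leader_relations\<close>. Values are taken in an algebraically closed field, so that
  transported relations have roots, and \<open>T N\<close> is the transcendental reserved for rank
  \<open>N\<close>. A specialisation of the base is a set \<open>S\<close> of pairs over
  \<open>A\<close> with second components in \<open>K\<close>.\<close>

locale specialisation =
  fixes m :: nat and I :: "nat set" and A :: "'a::field set" and z :: "dvar \<Rightarrow> 'a" and H :: "'a set"
    and P :: "dvar \<Rightarrow> 'a poly" and K :: "'b::alg_closed_field set" and T :: "nat \<Rightarrow> 'b"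
  assumes I: "finite I" and H: "finite H" "0 \<notin> H"
    and P: "\<And>w. w \<in> leads m I A z \<Longrightarrow> P w \<in> pov (rgen (A \<union> z ` ini m I (rk m I w)))"
      "\<And>w. w \<in> leads m I A z \<Longrightarrow> P w \<noteq> 0"
      "\<And>w. w \<in> leads m I A z \<Longrightarrow> poly (P w) (z w) = 0"
      "\<And>w q. w \<in> leads m I A z \<Longrightarrow> q \<in> pov (rgen (A \<union> z ` ini m I (rk m I w))) \<Longrightarrow> q \<noteq> 0 \<Longrightarrow> poly q (z w) = 0 \<Longrightarrow>
         Polynomial.degree (P w) \<le> Polynomial.degree q"
      "\<And>w. w \<in> leads m I A z \<Longrightarrow> Polynomial.degree (P w) > 0"
      "\<And>w. w \<in> leads m I A z \<Longrightarrow> Polynomial.lead_coeff (P w) \<in> H"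
      "\<And>w. w \<in> leads m I A z \<Longrightarrow> sep (P w) (z w) \<in> H"
    and T: "\<And>N. T N \<notin> acl (K \<union> T ` {..<N})"
begin

definition gens :: "('a \<times> 'b) set \<Rightarrow> (dvar \<Rightarrow> 'b) \<Rightarrow> nat \<Rightarrow> ('a \<times> 'b) set" where
  "gens S y N = S \<union> (\<lambda>w. (z w, y w)) ` ini m I N"

text \<open>A partial specialisation up to rank \<open>N\<close>. Non-leaders receive the
  transcendental of their rank, and the value at rank \<open>r\<close> is algebraic over
  \<open>K\<close> and \<open>T 0, ..., T r\<close>; this keeps \<open>T N\<close> fresh at stage
  \<open>N\<close> (\<open>T_not_acl\<close>).\<close>

definition good :: "('a \<times> 'b) set \<Rightarrow> (dvar \<Rightarrow> 'b) \<Rightarrow> nat \<Rightarrow> bool" where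
  "good S y N \<longleftrightarrow> functional fst (rgen (gens S y N)) \<and>
     (\<forall>w\<in>ini m I N. (w \<notin> leads m I A z \<longrightarrow> y w = T (rk m I w)) \<and> y w \<in> acl (K \<union> T ` {..rk m I w}))"

lemma gens_mono: "M \<le> N \<Longrightarrow> rgen (gens S y M) \<subseteq> rgen (gens S y N)"
  unfolding gens_def by (intro rgen_mono Un_mono image_mono ini_mono order_refl)

lemma gens_cong: "(\<And>w. w \<in> ini m I N \<Longrightarrow> y w = y' w) \<Longrightarrow> gens S y N = gens S y' N"
  by (auto simp: gens_def)

lemma good_cong: assumes "\<And>w. w \<in> ini m I N \<Longrightarrow> y w = y' w" shows "good S y N \<longleftrightarrow> good S y' N"
proof -
  have "gens S y N = gens S y' N" using assms by (rule gens_cong)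
  then show ?thesis unfolding good_def using assms by simp
qed

lemma good_mono: assumes "M \<le> N" "good S y N" shows "good S y M"
  using assms(2) functional_subset[OF _ gens_mono[OF assms(1)]] ini_mono[OF assms(1), of m I]
  unfolding good_def by blast

lemma fst_gens: "fst ` S = A \<Longrightarrow> fst ` gens S y N = A \<union> z ` ini m I N"
  by (simp add: gens_def image_Un)

lemma gens_Suc: assumes "w \<in> idxs m I" shows "gens S y (Suc (rk m I w)) = insert (z w, y w) (gens S y (rk m I w))"
  by (auto simp: gens_def ini_Suc[OF I assms])

lemma good_acl: assumes "good S y N" "snd ` S \<subseteq> K" shows "acl (K \<union> y ` ini m I N) \<subseteq> acl (K \<union> T ` {..<N})"
    "snd ` gens S y N \<subseteq> acl (K \<union> T ` {..<N})"
proof -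
  have 1: "y ` ini m I N \<subseteq> acl (K \<union> T ` {..<N})"
  proof (rule image_subsetI)
    fix w assume w: "w \<in> ini m I N"
    then have "y w \<in> acl (K \<union> T ` {..rk m I w})" using assms(1) by (simp add: good_def)
    moreover have "acl (K \<union> T ` {..rk m I w}) \<subseteq> acl (K \<union> T ` {..<N})"
      by (rule acl_mono) (use w in \<open>auto simp: ini_def\<close>)
    ultimately show "y w \<in> acl (K \<union> T ` {..<N})" by auto
  qed
  have 2: "K \<subseteq> acl (K \<union> T ` {..<N})" using acl_base[of "K \<union> T ` {..<N}"] by simp
  show "acl (K \<union> y ` ini m I N) \<subseteq> acl (K \<union> T ` {..<N})" by (rule acl_least) (use 1 2 in auto)
  show "snd ` gens S y N \<subseteq> acl (K \<union> T ` {..<N})" using 1 2 assms(2) by (auto simp: gens_def)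
qed

lemma T_not_acl: assumes "good S y N" "snd ` S \<subseteq> K" shows "T N \<notin> acl (snd ` gens S y N)" "T N \<notin> acl (K \<union> y ` ini m I N)"
  using T[of N] good_acl[OF assms] acl_least[OF good_acl(2)[OF assms]] by auto

text \<open>A nonzero element survives the specialisation as soon as a suitable nonzero element of the
  base ring does.\<close>

lemma pull_back:
  assumes "c0 \<in> rgen (A \<union> z ` ini m I N)" "c0 \<noteq> 0"
  shows "\<exists>c\<in>rgen A. c \<noteq> 0 \<and> (\<forall>S y. fst ` S = A \<longrightarrow> snd ` S \<subseteq> K \<longrightarrow> good S y N \<longrightarrow> (\<forall>c'. (c, c') \<in> rgen S \<longrightarrow> c' \<noteq> 0) \<longrightarrow>
    (\<forall>z'. (c0, z') \<in> rgen (gens S y N) \<longrightarrow> z' \<noteq> 0))"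
  using assms
proof (induction N arbitrary: c0)
  case 0
  then show ?case by (intro bexI[of _ c0]) (auto simp: ini_def gens_def)
next
  case (Suc N)
  show ?case
  proof (cases "\<exists>w\<in>idxs m I. rk m I w = N")
    case False
    then have eq: "ini m I (Suc N) = ini m I N" by (rule ini_Suc_not)
    then have "gens S y (Suc N) = gens S y N" "good S y (Suc N) = good S y N" for S y
      by (simp_all add: gens_def good_def)
    then show ?thesis using Suc.IH[of c0] Suc.prems eq by simp
  next
    case True
    then obtain w where w: "w \<in> idxs m I" "N = rk m I w" by auto
    let ?B = "A \<union> z ` ini m I N"
    have eq: "A \<union> z ` ini m I (Suc N) = insert (z w) ?B" unfolding w(2) ini_Suc[OF I w(1)] by auto
    have sub: "rgen (gens S y N) \<subseteq> rgen (gens S y (Suc N))" for S y by (rule gens_mono) simp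
    have gN: "good S y N" if "good S y (Suc N)" for S y using good_mono[OF _ that] by simp
    show ?thesis
    proof (cases "w \<in> leads m I A z")
      case False
      obtain p where p: "p \<in> pov (rgen ?B)" "c0 = poly p (z w)"
        using Suc.prems(1) unfolding eq rgen_insert by auto
      \<comment> \<open>A non-leader goes to a fresh transcendental, where a polynomial vanishes
        only if all its coefficients do; so it is enough that the leading one survives.\<close>
      let ?a = "Polynomial.lead_coeff p"
      have "?a \<in> rgen ?B" "?a \<noteq> 0" using p Suc.prems(2) by (auto simp: pov_def)
      from Suc.IH[OF this] obtain c where c: "c \<in> rgen A" "c \<noteq> 0"
        "\<And>S y z'. fst ` S = A \<Longrightarrow> snd ` S \<subseteq> K \<Longrightarrow> good S y N \<Longrightarrow> \<forall>c'. (c, c') \<in> rgen S \<longrightarrow> c' \<noteq> 0 \<Longrightarrow>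
           (?a, z') \<in> rgen (gens S y N) \<Longrightarrow> z' \<noteq> 0" by blast
      have "z' \<noteq> 0" if S: "fst ` S = A" "snd ` S \<subseteq> K" and g: "good S y (Suc N)"
        and cc: "\<forall>c'. (c, c') \<in> rgen S \<longrightarrow> c' \<noteq> 0" and z': "(c0, z') \<in> rgen (gens S y (Suc N))" for S y z'
      proof -
        have "p \<in> pov (rgen (fst ` gens S y N))" using p(1) fst_gens[OF S(1)] by simp
        then obtain Q where Q: "Q \<in> pov (rgen (gens S y N))" "map_poly fst Q = p" "Polynomial.degree Q \<le> Polynomial.degree p"
          using lift_poly[OF rhom_fst] by metis
        let ?zw = "(z w, y w)"
        have "?zw \<in> rgen (gens S y (Suc N))" using w by (simp add: gens_Suc rgen_base)
        then have "poly Q ?zw \<in> rgen (gens S y (Suc N))" by (rule poly_in_rgen[OF pov_mono[OF sub Q(1)]])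
        moreover have "poly Q ?zw = (c0, poly (map_poly snd Q) (y w))"
          using p(2) Q(2) by (simp add: prod_eq_iff rhom_poly[OF rhom_fst] rhom_poly[OF rhom_snd])
        ultimately have "z' = poly (map_poly snd Q) (y w)"
          using functional_eq[OF _ z'] g by (auto simp: good_def)
        moreover have "Polynomial.coeff Q (Polynomial.degree p) \<in> rgen (gens S y N)" using Q(1) by (simp add: pov_def)
        then have "(?a, snd (Polynomial.coeff Q (Polynomial.degree p))) \<in> rgen (gens S y N)"
          using Q(2) by (metis coeff_map_poly fst_zero prod.collapse)
        then have "snd (Polynomial.coeff Q (Polynomial.degree p)) \<noteq> 0" using c(3)[OF S gN[OF g] cc] by blast
        then have "map_poly snd Q \<noteq> 0" by (metis coeff_map_poly snd_zero Polynomial.coeff_0)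
        moreover have "map_poly snd Q \<in> pov (rgen (snd ` gens S y N))" by (rule rhom_map_poly_pov[OF rhom_snd Q(1)])
        moreover have "w \<in> ini m I (Suc N)" using w by (simp add: ini_def)
        then have "y w = T N" using g False w(2) by (simp add: good_def)
        ultimately show ?thesis using T_not_acl(1)[OF gN[OF g] S(2)] by (auto simp: acl_def)
      qed
      then show ?thesis using c(1,2) by blast
    next
      case True
      have "c0 \<in> acl (insert (z w) ?B)" using Suc.prems(1) rgen_subset_acl unfolding eq by auto
      moreover have "z w \<in> acl ?B" using True w by (simp add: leads_def)
      then have "acl (insert (z w) ?B) \<subseteq> acl ?B" using acl_base[of ?B] by (intro acl_least insert_subsetI)
      ultimately have "c0 \<in> acl ?B" by auto
      from minimal_root_polynomial[OF this] obtain p where p: "p \<in> pov (rgen ?B)" "p \<noteq> 0" "poly p c0 = 0"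
        "\<And>q. q \<in> pov (rgen ?B) \<Longrightarrow> q \<noteq> 0 \<Longrightarrow> poly q c0 = 0 \<Longrightarrow> Polynomial.degree p \<le> Polynomial.degree q" by metis
      \<comment> \<open>If \<open>c0\<close> went to zero, its relation would send the constant term
        to zero as well. Minimality of \<open>p\<close> makes this term nonzero.\<close>
      let ?a = "Polynomial.coeff p 0"
      have "?a \<noteq> 0"
      proof
        assume a0: "?a = 0"
        obtain b q where q: "p = pCons b q" by (cases p)
        with a0 have pq: "p = pCons 0 q" by simp
        then have "q \<noteq> 0" "poly q c0 = 0" using p(2,3) Suc.prems(2) by auto
        moreover have "Polynomial.coeff q i = Polynomial.coeff p (Suc i)" for i using pq by simp
        then have "q \<in> pov (rgen ?B)" using p(1) unfolding pov_def by simp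
        ultimately have "Polynomial.degree p \<le> Polynomial.degree q" using p(4) by blast
        then show False using pq \<open>q \<noteq> 0\<close> by simp
      qed
      moreover have "?a \<in> rgen ?B" using p(1) by (simp add: pov_def)
      ultimately obtain c where c: "c \<in> rgen A" "c \<noteq> 0"
        "\<And>S y z'. fst ` S = A \<Longrightarrow> snd ` S \<subseteq> K \<Longrightarrow> good S y N \<Longrightarrow> \<forall>c'. (c, c') \<in> rgen S \<longrightarrow> c' \<noteq> 0 \<Longrightarrow>
           (?a, z') \<in> rgen (gens S y N) \<Longrightarrow> z' \<noteq> 0" using Suc.IH[of ?a] by blast
      have "z' \<noteq> 0" if S: "fst ` S = A" "snd ` S \<subseteq> K" and g: "good S y (Suc N)"
        and cc: "\<forall>c'. (c, c') \<in> rgen S \<longrightarrow> c' \<noteq> 0" and z': "(c0, z') \<in> rgen (gens S y (Suc N))" for S y z'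
      proof
        assume z0: "z' = 0"
        have "p \<in> pov (rgen (fst ` gens S y N))" using p(1) fst_gens[OF S(1)] by simp
        then obtain Q where Q: "Q \<in> pov (rgen (gens S y N))" "map_poly fst Q = p" "Polynomial.degree Q \<le> Polynomial.degree p"
          using lift_poly[OF rhom_fst] by metis
        have "poly Q (c0, z') \<in> rgen (gens S y (Suc N))" by (rule poly_in_rgen[OF pov_mono[OF sub Q(1)] z'])
        moreover have "fst (poly Q (c0, z')) = 0" using Q(2) p(3) by (simp add: rhom_poly[OF rhom_fst])
        ultimately have "poly Q (c0, z') = 0" using g functionalD by (auto simp: good_def)
        then have "snd (poly Q (c0, z')) = 0" by simp
        then have "poly (map_poly snd Q) 0 = 0" using z0 by (simp add: rhom_poly[OF rhom_snd])
        then have s0: "snd (Polynomial.coeff Q 0) = 0" by (simp add: poly_0_coeff_0 coeff_map_poly)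
        have "Polynomial.coeff Q 0 \<in> rgen (gens S y N)" using Q(1) by (simp add: pov_def)
        then have "(?a, snd (Polynomial.coeff Q 0)) \<in> rgen (gens S y N)"
          using Q(2) by (metis coeff_map_poly fst_zero prod.collapse)
        then show False using c(3)[OF S gN[OF g] cc] s0 by blast
      qed
      then show ?thesis using c(1,2) by blast
    qed
  qed
qed

text \<open>At a non-leader the reserved transcendental is appended. At a leader the transported
  relation keeps its positive degree because the initial survives, so it has a root
  \<open>u\<close>, and minimality of \<open>P w\<close> makes this root a consistent value.\<close>

lemma extend_step:
  assumes S: "fst ` S = A" "snd ` S \<subseteq> K" and g: "good S y N"
    and h: "\<And>w h'. w \<in> leads m I A z \<Longrightarrow> N = rk m I w \<Longrightarrow> (Polynomial.lead_coeff (P w), h') \<in> rgen (gens S y N) \<Longrightarrow> h' \<noteq> 0"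
  shows "\<exists>y'. good S y' (Suc N) \<and> (\<forall>w\<in>ini m I N. y' w = y w)"
proof (cases "\<exists>w\<in>idxs m I. rk m I w = N")
  case False
  then have "ini m I (Suc N) = ini m I N" by (rule ini_Suc_not)
  then have "good S y (Suc N)" using g by (simp add: good_def gens_def)
  then show ?thesis by blast
next
  case True
  then obtain w where w: "w \<in> idxs m I" "N = rk m I w" by auto
  have wn: "w \<notin> ini m I N" using w by (simp add: ini_def)
  have f: "functional fst (rgen (gens S y N))" using g by (simp add: good_def)
  have red: "\<exists>y'. good S y' (Suc N) \<and> (\<forall>w\<in>ini m I N. y' w = y w)"
    if u: "functional fst (rgen (insert (z w, u) (gens S y N)))" "w \<notin> leads m I A z \<Longrightarrow> u = T N" "u \<in> acl (K \<union> T ` {..N})" for u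
  proof (intro exI[of _ "y(w := u)"] conjI ballI)
    have "gens S (y(w := u)) N = gens S y N" by (rule gens_cong) (use wn in auto)
    then have "functional fst (rgen (gens S (y(w := u)) (Suc N)))"
      unfolding w(2) gens_Suc[OF w(1)] using u(1) w(2) by simp
    then show "good S (y(w := u)) (Suc N)"
      using g wn u(2,3) w unfolding good_def w(2) ini_Suc[OF I w(1)] by auto
    show "(y(w := u)) v = y v" if "v \<in> ini m I N" for v using that wn by auto
  qed
  show ?thesis
  proof (cases "w \<in> leads m I A z")
    case False
    show ?thesis
    proof (rule red)
      have "z w \<notin> acl (fst ` gens S y N)" using False w by (simp add: fst_gens[OF S(1)] leads_def)
      then show "functional fst (rgen (insert (z w, T N) (gens S y N)))"
        by (intro functional_transcendental[OF rhom_fst f]) simp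
      show "T N \<in> acl (K \<union> T ` {..N})" by (rule subsetD[OF acl_base]) simp
    qed simp
  next
    case True
    have "P w \<in> pov (rgen (fst ` gens S y N))" using P(1)[OF True] w(2) by (simp add: fst_gens[OF S(1)])
    then obtain Q where Q: "Q \<in> pov (rgen (gens S y N))" "map_poly fst Q = P w" "Polynomial.degree Q \<le> Polynomial.degree (P w)"
      using lift_poly[OF rhom_fst] by metis
    let ?d = "Polynomial.degree (P w)"
    have "Polynomial.coeff Q ?d \<in> rgen (gens S y N)" using Q(1) by (simp add: pov_def)
    then have "(Polynomial.lead_coeff (P w), snd (Polynomial.coeff Q ?d)) \<in> rgen (gens S y N)"
      using Q(2) by (metis coeff_map_poly fst_zero prod.collapse)
    then have lc: "snd (Polynomial.coeff Q ?d) \<noteq> 0" using h[OF True w(2)] by blast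
    let ?q = "map_poly snd Q"
    have cq: "Polynomial.coeff ?q ?d \<noteq> 0" using lc by (simp add: coeff_map_poly)
    then have "?d \<le> Polynomial.degree ?q" by (rule le_degree)
    then have "Polynomial.degree ?q > 0" using P(5)[OF True] by simp
    then obtain u where u: "poly ?q u = 0" using alg_closed_imp_poly_has_root by blast
    have qpov: "?q \<in> pov (rgen (snd ` gens S y N))" by (rule rhom_map_poly_pov[OF rhom_snd Q(1)])
    have "?q \<noteq> 0" using cq by auto
    then have "u \<in> acl (snd ` gens S y N)" using qpov u by (intro acl_root)
    then have "u \<in> acl (K \<union> T ` {..<N})" using acl_least[OF good_acl(2)[OF g S(2)]] by auto
    moreover have "acl (K \<union> T ` {..<N}) \<subseteq> acl (K \<union> T ` {..N})" by (rule acl_mono) auto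
    ultimately have uacl: "u \<in> acl (K \<union> T ` {..N})" by auto
    show ?thesis
    proof (rule red[OF _ _ uacl])
      show "functional fst (rgen (insert (z w, u) (gens S y N)))"
      proof (rule functional_min_lift[OF f Q(1) _ lc Q(2) P(2)[OF True] Q(3)])
        show "poly Q (z w, u) = 0"
          using u P(3)[OF True] Q(2) by (simp add: prod_eq_iff rhom_poly[OF rhom_fst] rhom_poly[OF rhom_snd])
        show "?d \<le> Polynomial.degree q" if "q \<in> pov (rgen (fst ` gens S y N))" "q \<noteq> 0" "poly q (fst (z w, u)) = 0" for q
          using P(4)[OF True, of q] that w(2) by (simp add: fst_gens[OF S(1)])
      qed
    qed (use True in simp)
  qed
qed

text \<open>Each initial or separant occurring in the finite set \<open>H\<close> is pulled back to
  one nonzero element of the base ring. If these elements survive, no initial vanishes at any stage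
  and the construction never stops. \<open>C\<close> is chosen before \<open>S\<close>, which makes
  the condition uniform in the target parameters.\<close>

lemma specialise:
  "\<exists>C. finite C \<and> C \<subseteq> rgen A \<and> 0 \<notin> C \<and> (\<forall>S. fst ` S = A \<longrightarrow> snd ` S \<subseteq> K \<longrightarrow> functional fst (rgen S) \<longrightarrow>
     (\<forall>c\<in>C. \<forall>c'. (c, c') \<in> rgen S \<longrightarrow> c' \<noteq> 0) \<longrightarrow>
     (\<exists>y. functional fst (rgen (S \<union> (\<lambda>w. (z w, y w)) ` idxs m I)) \<and>
       (\<forall>w\<in>idxs m I - leads m I A z. y w \<notin> acl (K \<union> y ` ini m I (rk m I w))) \<and>
       (\<forall>w\<in>leads m I A z. \<forall>s. (sep (P w) (z w), s) \<in> rgen (S \<union> (\<lambda>w. (z w, y w)) ` idxs m I) \<longrightarrow> s \<noteq> 0)))"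
proof -
  define H' where "H' = {h \<in> H. \<exists>N. h \<in> rgen (A \<union> z ` ini m I N)}"
  \<comment> \<open>The least stage whose ring contains \<open>h\<close>: the pulled-back element
    then depends on \<open>h\<close> alone, although \<open>h\<close> may be the initial of
    relations at many ranks.\<close>
  define Nh where "Nh = (\<lambda>h. LEAST N. h \<in> rgen (A \<union> z ` ini m I N))"
  have Nh: "h \<in> rgen (A \<union> z ` ini m I (Nh h))" if "h \<in> H'" for h
    unfolding Nh_def by (rule LeastI_ex) (use that in \<open>simp add: H'_def\<close>)
  have Nh_le: "Nh h \<le> N" if "h \<in> rgen (A \<union> z ` ini m I N)" for h N
    unfolding Nh_def using that by (rule Least_le)
  have H'0: "h \<noteq> 0" if "h \<in> H'" for h using that H(2) by (auto simp: H'_def)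
  have "\<forall>h\<in>H'. \<exists>c. c \<in> rgen A \<and> c \<noteq> 0 \<and> (\<forall>S y. fst ` S = A \<longrightarrow> snd ` S \<subseteq> K \<longrightarrow> good S y (Nh h) \<longrightarrow> (\<forall>c'. (c, c') \<in> rgen S \<longrightarrow> c' \<noteq> 0) \<longrightarrow>
    (\<forall>z'. (h, z') \<in> rgen (gens S y (Nh h)) \<longrightarrow> z' \<noteq> 0))"
    using pull_back[OF Nh H'0] by blast
  from bchoice[OF this] obtain c where c: "\<And>h. h \<in> H' \<Longrightarrow> c h \<in> rgen A" "\<And>h. h \<in> H' \<Longrightarrow> c h \<noteq> 0"
    "\<And>h S y z'. h \<in> H' \<Longrightarrow> fst ` S = A \<Longrightarrow> snd ` S \<subseteq> K \<Longrightarrow> good S y (Nh h) \<Longrightarrow> \<forall>c'. (c h, c') \<in> rgen S \<longrightarrow> c' \<noteq> 0 \<Longrightarrow>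
      (h, z') \<in> rgen (gens S y (Nh h)) \<Longrightarrow> z' \<noteq> 0" by blast
  have survive: "z' \<noteq> 0" if S: "fst ` S = A" "snd ` S \<subseteq> K" and cc: "\<forall>c0\<in>c ` H'. \<forall>c'. (c0, c') \<in> rgen S \<longrightarrow> c' \<noteq> 0"
    and g: "good S y N" and h: "h \<in> H" "h \<in> rgen (A \<union> z ` ini m I N)" "(h, z') \<in> rgen (gens S y N)" for S y N h z'
  proof -
    have hH: "h \<in> H'" using h by (auto simp: H'_def)
    have le: "Nh h \<le> N" by (rule Nh_le[OF h(2)])
    have "h \<in> rgen (fst ` gens S y (Nh h))" using Nh[OF hH] by (simp add: fst_gens[OF S(1)])
    then obtain z'' where z'': "(h, z'') \<in> rgen (gens S y (Nh h))" using rgen_lift by blast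
    then have "(h, z'') \<in> rgen (gens S y N)" using gens_mono[OF le] by blast
    then have "z' = z''" using functional_eq[OF _ h(3)] g by (auto simp: good_def)
    then show ?thesis using c(3)[OF hH S good_mono[OF le g] _ z''] cc hH by auto
  qed
  have main: "\<exists>y. functional fst (rgen (S \<union> (\<lambda>w. (z w, y w)) ` idxs m I)) \<and>
       (\<forall>w\<in>idxs m I - leads m I A z. y w \<notin> acl (K \<union> y ` ini m I (rk m I w))) \<and>
       (\<forall>w\<in>leads m I A z. \<forall>s. (sep (P w) (z w), s) \<in> rgen (S \<union> (\<lambda>w. (z w, y w)) ` idxs m I) \<longrightarrow> s \<noteq> 0)"
    if S: "fst ` S = A" "snd ` S \<subseteq> K" and f: "functional fst (rgen S)"
      and cc: "\<forall>c0\<in>c ` H'. \<forall>c'. (c0, c') \<in> rgen S \<longrightarrow> c' \<noteq> 0" for S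
  proof -
    have PH: "Polynomial.lead_coeff (P w) \<in> rgen (A \<union> z ` ini m I (rk m I w))" if "w \<in> leads m I A z" for w
      using P(1)[OF that] by (simp add: pov_def)
    \<comment> \<open>Dependent choice of compatible stages; the final sequence reads each value off
      at the first stage that contains it.\<close>
    have "\<exists>Y. \<forall>N. good S (Y N) N \<and> (\<forall>w\<in>ini m I N. Y (Suc N) w = Y N w)"
    proof (rule dependent_nat_choice)
      show "\<exists>y. good S y 0" using f by (auto simp: good_def gens_def ini_def)
      fix y N assume g: "good S y N"
      show "\<exists>y'. good S y' (Suc N) \<and> (\<forall>w\<in>ini m I N. y' w = y w)"
      proof (rule extend_step[OF S g])
        fix w h' assume w: "w \<in> leads m I A z" "N = rk m I w" "(Polynomial.lead_coeff (P w), h') \<in> rgen (gens S y N)"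
        show "h' \<noteq> 0" using survive[OF S cc g P(6)[OF w(1)] _ w(3)] PH[OF w(1)] w(2) by simp
      qed
    qed
    then obtain Y where Y: "\<And>N. good S (Y N) N" "\<And>N w. w \<in> ini m I N \<Longrightarrow> Y (Suc N) w = Y N w" by blast
    define y where "y = (\<lambda>w. Y (Suc (rk m I w)) w)"
    have Yy: "Y N w = y w" if "w \<in> ini m I N" for N w
    proof -
      have "Y (Suc (rk m I w) + k) w = y w" for k
      proof (induction k)
        case (Suc k)
        have "w \<in> ini m I (Suc (rk m I w) + k)" using that by (auto simp: ini_def)
        then show ?case using Suc Y(2) by simp
      qed (simp add: y_def)
      moreover have "\<exists>k. N = Suc (rk m I w) + k" using that by (auto simp: ini_def intro: less_iff_Suc_add[THEN iffD1])
      ultimately show ?thesis by metis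
    qed
    have good: "good S y N" for N using Y(1)[of N] good_cong[of N "Y N" y] Yy by blast
    have func: "functional fst (rgen (S \<union> (\<lambda>w. (z w, y w)) ` idxs m I))"
      by (rule functional_Union_ini) (use good in \<open>simp add: good_def gens_def\<close>)
    moreover have "y w \<notin> acl (K \<union> y ` ini m I (rk m I w))" if "w \<in> idxs m I - leads m I A z" for w
    proof -
      have "w \<in> ini m I (Suc (rk m I w))" using that by (simp add: ini_def)
      then have "y w = T (rk m I w)" using good[of "Suc (rk m I w)"] that by (simp add: good_def)
      then show ?thesis using T_not_acl(2)[OF good S(2)] by simp
    qed
    moreover have "s \<noteq> 0" if w: "w \<in> leads m I A z"
      and s: "(sep (P w) (z w), s) \<in> rgen (S \<union> (\<lambda>w. (z w, y w)) ` idxs m I)" for w s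
    proof -
      let ?N = "Suc (rk m I w)"
      have wJ: "w \<in> idxs m I" using w by (simp add: leads_def)
      have "P w \<in> pov (rgen (A \<union> z ` ini m I ?N))"
        by (rule pov_mono[OF rgen_mono P(1)[OF w]]) (use ini_mono[of "rk m I w" ?N] in auto)
      moreover have "z w \<in> rgen (A \<union> z ` ini m I ?N)" using wJ by (auto simp: ini_def intro: rgen_base)
      ultimately have sN: "sep (P w) (z w) \<in> rgen (A \<union> z ` ini m I ?N)" by (rule sep_in_rgen)
      then obtain s' where s': "(sep (P w) (z w), s') \<in> rgen (gens S y ?N)"
        using rgen_lift[of _ "gens S y ?N"] by (auto simp: fst_gens[OF S(1)])
      then have "s' \<noteq> 0" using survive[OF S cc good P(7)[OF w] sN] by blast
      moreover have "rgen (gens S y ?N) \<subseteq> rgen (S \<union> (\<lambda>w. (z w, y w)) ` idxs m I)"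
        unfolding gens_def by (intro rgen_mono Un_mono image_mono ini_idxs order_refl)
      then have "s = s'" using functional_eq[OF func s] s' by blast
      ultimately show ?thesis by simp
    qed
    ultimately show ?thesis by blast
  qed
  have "finite H'" using H(1) by (simp add: H'_def)
  then have "finite (c ` H')" "c ` H' \<subseteq> rgen A" "0 \<notin> c ` H'" using c(1,2) by force+
  then show ?thesis using main by (intro exI[of _ "c ` H'"]) simp
qed

end


section \<open>Differential field extensions\<close>

lemma dual_eq_iff: "x = y \<longleftrightarrow> re x = re y \<and> eps x = eps y"
  by (cases x; cases y) auto

text \<open>Derivations on the field of fractions are obtained from their graphs in the dual numbers.\<close>

lemma derivation_fraction_field:
  fixes G :: "'b::field dual set" and C :: "'b set"
  assumes f: "functional re (rgen G)" and re: "re ` G = C" and eps: "eps ` G \<subseteq> rgen C"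
  defines "F \<equiv> {a / b |a b. a \<in> rgen C \<and> b \<in> rgen C \<and> b \<noteq> 0}"
  shows "\<exists>D. (\<forall>x\<in>F. D x \<in> F) \<and> (\<forall>x\<in>F. \<forall>y\<in>F. D (x + y) = D x + D y \<and> D (x * y) = D x * y + x * D y) \<and>
    (\<forall>\<theta>\<in>G. D (re \<theta>) = eps \<theta>)"
proof -
  \<comment> \<open>The graph of the extended derivation consists of the fractions of elements of
    the given graph, written without division in the dual numbers.\<close>
  define Q where "Q = {\<theta>. \<exists>\<alpha>\<in>rgen G. \<exists>\<beta>\<in>rgen G. re \<beta> \<noteq> 0 \<and> \<theta> * \<beta> = \<alpha>}"
  have rec: "re ` rgen G = rgen C" using rhom_image_rgen[OF rhom_re, of G] re by simp
  have epsc: "eps \<theta> \<in> rgen C" if "\<theta> \<in> rgen G" for \<theta>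
    using that
  proof induction
    case (rgen_base x) then show ?case using eps by auto
  next
    case (rgen_mult x y)
    then have "re x \<in> rgen C" "re y \<in> rgen C" using rec by auto
    then show ?case using rgen_mult by (auto intro: rgen.intros)
  qed (auto intro: rgen.intros rgen_zero)
  have uniq: "\<theta> = 0" if "\<theta> \<in> Q" "re \<theta> = 0" for \<theta>
  proof -
    from that(1) obtain \<alpha> \<beta> where ab: "\<alpha> \<in> rgen G" "\<beta> \<in> rgen G" "re \<beta> \<noteq> 0" "\<theta> * \<beta> = \<alpha>" by (auto simp: Q_def)
    have "re \<alpha> = 0" using ab(4) that(2) by auto
    then have "\<alpha> = 0" using functionalD[OF f ab(1)] by simp
    then show ?thesis using dual_nzd[of \<beta> \<theta>] ab that(2) by (simp add: mult.commute)
  qed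
  have Qadd: "\<theta> + \<eta> \<in> Q" and Qmult: "\<theta> * \<eta> \<in> Q" and Qdiff: "\<theta> - \<eta> \<in> Q" if "\<theta> \<in> Q" "\<eta> \<in> Q" for \<theta> \<eta>
  proof -
    from that(1) obtain \<alpha> \<beta> where ab: "\<alpha> \<in> rgen G" "\<beta> \<in> rgen G" "re \<beta> \<noteq> 0" "\<theta> * \<beta> = \<alpha>" by (auto simp: Q_def)
    from that(2) obtain \<gamma> \<epsilon> where ce: "\<gamma> \<in> rgen G" "\<epsilon> \<in> rgen G" "re \<epsilon> \<noteq> 0" "\<eta> * \<epsilon> = \<gamma>" by (auto simp: Q_def)
    have "(\<theta> + \<eta>) * (\<beta> * \<epsilon>) = \<alpha> * \<epsilon> + \<gamma> * \<beta>" "(\<theta> - \<eta>) * (\<beta> * \<epsilon>) = \<alpha> * \<epsilon> - \<gamma> * \<beta>" "(\<theta> * \<eta>) * (\<beta> * \<epsilon>) = \<alpha> * \<gamma>"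
      unfolding ab(4)[symmetric] ce(4)[symmetric] by (simp_all add: algebra_simps)
    moreover have "\<beta> * \<epsilon> \<in> rgen G" "re (\<beta> * \<epsilon>) \<noteq> 0" "\<alpha> * \<epsilon> + \<gamma> * \<beta> \<in> rgen G" "\<alpha> * \<epsilon> - \<gamma> * \<beta> \<in> rgen G" "\<alpha> * \<gamma> \<in> rgen G"
      using ab ce by (auto intro: rgen.intros rgen_diff)
    ultimately show "\<theta> + \<eta> \<in> Q" "\<theta> * \<eta> \<in> Q" "\<theta> - \<eta> \<in> Q" unfolding Q_def by blast+
  qed
  have ex: "\<exists>u. Dual x u \<in> Q \<and> u \<in> F" if x: "x \<in> F" for x
  proof -
    obtain a b where ab: "x = a / b" "a \<in> rgen C" "b \<in> rgen C" "b \<noteq> 0" using x by (auto simp: F_def)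
    obtain \<alpha> \<beta> where l: "\<alpha> \<in> rgen G" "re \<alpha> = a" "\<beta> \<in> rgen G" "re \<beta> = b" using ab rec by (metis imageE)
    \<comment> \<open>The quotient rule.\<close>
    let ?u = "(eps \<alpha> * b - a * eps \<beta>) / (b * b)"
    have "Dual x ?u * \<beta> = \<alpha>" using ab(4) by (simp add: dual_eq_iff l ab(1) field_simps)
    then have "Dual x ?u \<in> Q" using l ab(4) by (auto simp: Q_def)
    moreover have "eps \<alpha> * b - a * eps \<beta> \<in> rgen C" "b * b \<in> rgen C" "b * b \<noteq> 0"
      using epsc[OF l(1)] epsc[OF l(3)] ab by (auto intro: rgen_diff rgen_mult)
    then have "?u \<in> F" unfolding F_def by blast
    ultimately show ?thesis by blast
  qed
  define D where "D = (\<lambda>x. SOME u. Dual x u \<in> Q \<and> u \<in> F)"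
  have D: "Dual x (D x) \<in> Q" "D x \<in> F" if "x \<in> F" for x
    unfolding D_def using someI_ex[OF ex[OF that]] by auto
  have eqD: "D (re \<theta>) = eps \<theta>" if "\<theta> \<in> Q" "re \<theta> \<in> F" for \<theta>
  proof -
    have "Dual (re \<theta>) (D (re \<theta>)) - \<theta> \<in> Q" by (rule Qdiff[OF D(1)[OF that(2)] that(1)])
    then have "Dual (re \<theta>) (D (re \<theta>)) - \<theta> = 0" by (rule uniq) simp
    then show ?thesis by (simp add: dual_eq_iff)
  qed
  have Fcl: "x + y \<in> F" "x * y \<in> F" if xy: "x \<in> F" "y \<in> F" for x y
  proof -
    obtain a b c d where *: "x = a / b" "a \<in> rgen C" "b \<in> rgen C" "b \<noteq> 0" "y = c / d" "c \<in> rgen C" "d \<in> rgen C" "d \<noteq> 0"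
      using xy by (auto simp: F_def)
    have "x + y = (a * d + c * b) / (b * d)" "x * y = (a * c) / (b * d)" using * by (simp_all add: add_frac_eq)
    then show "x + y \<in> F" "x * y \<in> F" unfolding F_def using *
      by (force intro: rgen.intros)+
  qed
  have "G \<subseteq> Q"
  proof
    fix \<theta> assume "\<theta> \<in> G"
    then show "\<theta> \<in> Q" unfolding Q_def by (intro CollectI bexI[of _ \<theta>] bexI[of _ 1]) (auto intro: rgen.intros)
  qed
  moreover have "rgen C \<subseteq> F"
  proof
    fix x assume "x \<in> rgen C" then show "x \<in> F" unfolding F_def
      by (intro CollectI exI[of _ x] exI[of _ 1]) (auto intro: rgen.intros)
  qed
  then have "re \<theta> \<in> F" if "\<theta> \<in> G" for \<theta> using that re by (auto intro: rgen_base)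
  ultimately have "D (re \<theta>) = eps \<theta>" if "\<theta> \<in> G" for \<theta> using that eqD by blast
  moreover have "D (x + y) = D x + D y" "D (x * y) = D x * y + x * D y" if "x \<in> F" "y \<in> F" for x y
    using eqD[OF Qadd[OF D(1)[OF that(1)] D(1)[OF that(2)]]] eqD[OF Qmult[OF D(1)[OF that(1)] D(1)[OF that(2)]]] Fcl[OF that]
    by simp_all
  ultimately show ?thesis using D(2) by (intro exI[of _ D]) auto
qed

lemma fraction_subfield:
  fixes C :: "'b::field set"
  shows "subfield {a / b |a b. a \<in> rgen C \<and> b \<in> rgen C \<and> b \<noteq> 0} (rta :: 'b ring)" (is "subfield ?F _")
proof (rule subfield_rta)
  have I: "a / b \<in> ?F" if "a \<in> rgen C" "b \<in> rgen C" "b \<noteq> 0" for a b using that by blast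
  show "1 \<in> ?F" using I[of 1 1] by (simp add: rgen_one)
  fix x assume "x \<in> ?F"
  then obtain a b where ab: "x = a / b" "a \<in> rgen C" "b \<in> rgen C" "b \<noteq> 0" by blast
  show "- x \<in> ?F" using I[of "- a" b] ab by (simp add: rgen_neg)
  show "inverse x \<in> ?F" using I[of b a] I[of 0 1] ab by (cases "a = 0") (simp_all add: rgen_zero rgen_one)
  fix y assume "y \<in> ?F"
  then obtain c d where cd: "y = c / d" "c \<in> rgen C" "d \<in> rgen C" "d \<noteq> 0" by blast
  show "x + y \<in> ?F" using I[of "a * d + c * b" "b * d"] ab cd by (simp add: rgen_add rgen_mult add_frac_eq)
  show "x * y \<in> ?F" using I[of "a * c" "b * d"] ab cd by (simp add: rgen_mult)
qed

context dfld
begin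

text \<open>Turns the sequence \<open>y\<close> into the derivatives of a point: each derivation is
  extended from \<open>K\<close> by prescribing \<open>y (shift j w)\<close> as the derivative of
  \<open>y w\<close>, rank by rank. At a non-leader \<open>y w\<close> is transcendental and any
  value is allowed. At a leader the separant does not vanish, and the prescribed value satisfies the
  differentiated relation because that relation holds at the original point and
  \<open>\<Gamma>\<close> is a graph.\<close>

lemma differential_extension:
  fixes emb :: "'a \<Rightarrow> 'b::field" and y :: "dvar \<Rightarrow> 'b" and v0 v :: "nat \<Rightarrow> 'a" and Y :: "nat set"
  assumes I: "finite I" and emb: "rhom emb" "inj emb" and k: "\<And>j c. j < m \<Longrightarrow> c \<in> k \<Longrightarrow> \<delta> j c \<in> k"
  defines "A \<equiv> k \<union> dv v0 ` idxs m Y"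
    and "S \<equiv> (\<lambda>c. (c, emb c)) ` k \<union> (\<lambda>w. (dv v0 w, emb (dv v w))) ` idxs m Y"
    and "K \<equiv> range emb"
  defines "\<Gamma> \<equiv> rgen (S \<union> (\<lambda>w. (dv v0 w, y w)) ` idxs m I)"
  assumes func: "functional fst \<Gamma>"
    and tr: "\<And>w. w \<in> idxs m I \<Longrightarrow> w \<notin> leads m I A (dv v0) \<Longrightarrow> y w \<notin> acl (K \<union> y ` ini m I (rk m I w))"
    and P: "\<And>w. w \<in> leads m I A (dv v0) \<Longrightarrow> P w \<in> pov (rgen (A \<union> dv v0 ` ini m I (rk m I w)))"
      "\<And>w. w \<in> leads m I A (dv v0) \<Longrightarrow> poly (P w) (dv v0 w) = 0"
      "\<And>w s. w \<in> leads m I A (dv v0) \<Longrightarrow> (sep (P w) (dv v0 w), s) \<in> \<Gamma> \<Longrightarrow> s \<noteq> 0"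
  shows "\<exists>F D. subfield F rta \<and> K \<union> y ` idxs m I \<subseteq> F \<and> F \<subseteq> acl (K \<union> y ` idxs m I) \<and>
    (\<forall>j<m. \<forall>x\<in>F. D j x \<in> F) \<and> 
    (\<forall>j<m. \<forall>x\<in>F. \<forall>y\<in>F. D j (x + y) = D j x + D j y \<and> D j (x * y) = D j x * y + x * D j y) \<and>
    (\<forall>i<m. \<forall>j<m. \<forall>x\<in>F. D i (D j x) = D j (D i x)) \<and>
    (\<forall>j<m. \<forall>c. D j (emb c) = emb (\<delta> j c)) \<and> (\<forall>j<m. \<forall>w\<in>idxs m I. D j (y w) = y (shift j w))"
proof -
  define E where "E = leads m I A (dv v0)"
  define dK :: "nat \<Rightarrow> 'b dual set" where "dK = (\<lambda>j. range (\<lambda>c. Dual (emb c) (emb (\<delta> j c))))"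
  define dy where "dy = (\<lambda>j w. Dual (y w) (y (shift j w)))"
  have func_dual: "functional re (rgen (dK j \<union> dy j ` idxs m I))" if j: "j < m" for j
  proof (rule functional_Union_ini)
    \<comment> \<open>Generators pairing \<open>c\<close> with a dual number whose real part is an
      image of \<open>c\<close> and whose infinitesimal part is an image of
      \<open>\<delta> j c\<close>; by the Leibniz rule this property passes to the generated
      ring.\<close>
    define \<Theta> where "\<Theta> = (\<lambda>W. (\<lambda>c. (c, Dual (emb c) (emb (\<delta> j c)))) ` k \<union>
       (\<lambda>w. (dv v0 w, Dual (emb (dv v w)) (emb (dv v (shift j w))))) ` idxs m Y \<union> (\<lambda>w. (dv v0 w, dy j w)) ` W)"
    have \<Theta>: "(c, re \<theta>) \<in> \<Gamma> \<and> (\<delta> j c, eps \<theta>) \<in> \<Gamma>" if "(c, \<theta>) \<in> rgen (\<Theta> (idxs m I))" for c \<theta>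
    proof -
      have "(fst x, re (snd x)) \<in> \<Gamma> \<and> (\<delta> j (fst x), eps (snd x)) \<in> \<Gamma>" if "x \<in> rgen (\<Theta> (idxs m I))" for x
        using that
      proof induction
        case rgen_one
        have "(1, 1) \<in> \<Gamma>" "(0, 0) \<in> \<Gamma>"
          unfolding \<Gamma>_def one_prod_def[symmetric] zero_prod_def[symmetric] by (rule rgen.rgen_one rgen_zero)+
        then show ?case by (simp add: derD[OF der[OF j]])
      next
        case (rgen_base x)
        then show ?case
          unfolding \<Theta>_def
        proof (elim UnE imageE)
          fix c assume x: "x = (c, Dual (emb c) (emb (\<delta> j c)))" "c \<in> k"
          have "(c, emb c) \<in> \<Gamma>" if "c \<in> k" for c unfolding \<Gamma>_def S_def using that by (intro rgen.rgen_base) simp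
          then show ?thesis using x k[OF j x(2)] by simp
        next
          fix w assume x: "x = (dv v0 w, Dual (emb (dv v w)) (emb (dv v (shift j w))))" "w \<in> idxs m Y"
          have "(dv v0 w, emb (dv v w)) \<in> \<Gamma>" if "w \<in> idxs m Y" for w
            unfolding \<Gamma>_def S_def using that by (intro rgen.rgen_base) simp
          from this[OF x(2)] this[OF shift_idxs[OF x(2) j]] show ?thesis using x(1) by (simp add: dv_shift[OF j])
        next
          fix w assume x: "x = (dv v0 w, dy j w)" "w \<in> idxs m I"
          have "(dv v0 w, y w) \<in> \<Gamma>" if "w \<in> idxs m I" for w
            unfolding \<Gamma>_def using that by (intro rgen.rgen_base) simp
          from this[OF x(2)] this[OF shift_idxs[OF x(2) j]] show ?thesis using x(1) by (simp add: dv_shift[OF j] dy_def)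
        qed
      next
        case (rgen_add p q)
        note a = rgen.rgen_add[of "(_, _)" _ "(_, _)", unfolded plus_prod_def fst_conv snd_conv]
        have IH: "(fst p, re (snd p)) \<in> \<Gamma>" "(\<delta> j (fst p), eps (snd p)) \<in> \<Gamma>" "(fst q, re (snd q)) \<in> \<Gamma>" "(\<delta> j (fst q), eps (snd q)) \<in> \<Gamma>"
          using rgen_add by auto
        have "(fst p + fst q, re (snd p) + re (snd q)) \<in> \<Gamma>" using a IH(1,3) unfolding \<Gamma>_def by blast
        moreover have "(\<delta> j (fst p) + \<delta> j (fst q), eps (snd p) + eps (snd q)) \<in> \<Gamma>" using a IH(2,4) unfolding \<Gamma>_def by blast
        ultimately show ?case by (simp add: derD[OF der[OF j]])
      next
        case (rgen_neg p)
        note n = rgen.rgen_neg[of "(_, _)", unfolded uminus_prod_def fst_conv snd_conv]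
        have IH: "(fst p, re (snd p)) \<in> \<Gamma>" "(\<delta> j (fst p), eps (snd p)) \<in> \<Gamma>" using rgen_neg by auto
        have "(- fst p, - re (snd p)) \<in> \<Gamma>" using n IH(1) unfolding \<Gamma>_def by blast
        moreover have "(- \<delta> j (fst p), - eps (snd p)) \<in> \<Gamma>" using n IH(2) unfolding \<Gamma>_def by blast
        ultimately show ?case by (simp add: derD[OF der[OF j]])
      next
        case (rgen_mult p q)
        note m = rgen.rgen_mult[of "(_, _)" _ "(_, _)", unfolded times_prod_def fst_conv snd_conv]
        note a = rgen.rgen_add[of "(_, _)" _ "(_, _)", unfolded plus_prod_def fst_conv snd_conv]
        have IH: "(fst p, re (snd p)) \<in> \<Gamma>" "(\<delta> j (fst p), eps (snd p)) \<in> \<Gamma>" "(fst q, re (snd q)) \<in> \<Gamma>" "(\<delta> j (fst q), eps (snd q)) \<in> \<Gamma>"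
          using rgen_mult by auto
        have 1: "(fst p * fst q, re (snd p) * re (snd q)) \<in> \<Gamma>" using m IH(1,3) unfolding \<Gamma>_def by blast
        have 2: "(\<delta> j (fst p) * fst q, eps (snd p) * re (snd q)) \<in> \<Gamma>" using m IH(2,3) unfolding \<Gamma>_def by blast
        have 3: "(fst p * \<delta> j (fst q), re (snd p) * eps (snd q)) \<in> \<Gamma>" using m IH(1,4) unfolding \<Gamma>_def by blast
        have "(\<delta> j (fst p) * fst q + fst p * \<delta> j (fst q), eps (snd p) * re (snd q) + re (snd p) * eps (snd q)) \<in> \<Gamma>"
          using a 2 3 unfolding \<Gamma>_def by blast
        then show ?case using 1 by (simp add: derD[OF der[OF j]] add.commute)
      qed
      from this[OF that] show ?thesis by simp
    qed
    have re_dK: "re ` (dK j \<union> dy j ` W) = K \<union> y ` W" for W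
      by (auto simp: dK_def dy_def K_def image_Un image_image)
    show "functional re (rgen (dK j \<union> dy j ` ini m I N))" for N
    proof (induction N)
      case 0
      \<comment> \<open>At the start the ring is the graph of \<open>\<delta> j\<close> transported
        to \<open>K\<close>, which is already closed under the ring operations.\<close>
      have "rgen (dK j \<union> dy j ` ini m I 0) \<subseteq> dK j"
      proof
        fix x assume "x \<in> rgen (dK j \<union> dy j ` ini m I 0)"
        then show "x \<in> dK j"
        proof induction
          case rgen_one
          have "1 = Dual (emb 1) (emb (\<delta> j 1))" by (simp add: dual_eq_iff rhomD[OF emb(1)] derD[OF der[OF j]])
          then show ?case unfolding dK_def by (rule range_eqI)
        next
          case (rgen_base x) then show ?case by (simp add: ini_def)
        next
          case (rgen_add x y)
          then obtain a b where "x = Dual (emb a) (emb (\<delta> j a))" "y = Dual (emb b) (emb (\<delta> j b))" by (auto simp: dK_def)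
          then have "x + y = Dual (emb (a + b)) (emb (\<delta> j (a + b)))" by (simp add: dual_eq_iff rhomD[OF emb(1)] derD[OF der[OF j]])
          then show ?case unfolding dK_def by (rule range_eqI)
        next
          case (rgen_neg x)
          then obtain a where "x = Dual (emb a) (emb (\<delta> j a))" by (auto simp: dK_def)
          then have "- x = Dual (emb (- a)) (emb (\<delta> j (- a)))" by (simp add: dual_eq_iff rhomD[OF emb(1)] derD[OF der[OF j]])
          then show ?case unfolding dK_def by (rule range_eqI)
        next
          case (rgen_mult x y)
          then obtain a b where "x = Dual (emb a) (emb (\<delta> j a))" "y = Dual (emb b) (emb (\<delta> j b))" by (auto simp: dK_def)
          then have "x * y = Dual (emb (a * b)) (emb (\<delta> j (a * b)))" by (simp add: dual_eq_iff rhomD[OF emb(1)] derD[OF der[OF j]] add.commute)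
          then show ?case unfolding dK_def by (rule range_eqI)
        qed
      qed
      moreover have "functional re (dK j)"
        unfolding functional_def dK_def
      proof (intro ballI impI, elim rangeE)
        fix \<gamma> c assume "re \<gamma> = 0" "\<gamma> = Dual (emb c) (emb (\<delta> j c))"
        moreover from this have "emb c = emb 0" by (simp add: rhomD(4)[OF emb(1)])
        then have "c = 0" by (rule injD[OF emb(2)])
        ultimately show "\<gamma> = 0" by (simp add: dual_eq_iff derD[OF der[OF j]] rhomD[OF emb(1)])
      qed
      ultimately show ?case by (rule functional_subset[rotated])
    next
      case (Suc N)
      show ?case
      proof (cases "\<exists>w\<in>idxs m I. rk m I w = N")
        case False then show ?thesis using Suc by (simp add: ini_Suc_not)
      next
        case True
        then obtain w where w: "w \<in> idxs m I" "N = rk m I w" by auto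
        let ?T = "dK j \<union> dy j ` ini m I N"
        have eq: "dK j \<union> dy j ` ini m I (Suc N) = insert (dy j w) ?T" unfolding w(2) ini_Suc[OF I w(1)] by auto
        show ?thesis unfolding eq
        proof (cases "w \<in> E")
          case False
          have "re (dy j w) \<notin> acl (re ` ?T)" using tr[OF w(1)] False w(2) unfolding re_dK by (simp add: dy_def E_def)
          then show "functional re (rgen (insert (dy j w) ?T))" by (rule functional_transcendental[OF rhom_re Suc])
        next
          case True
          have "fst ` \<Theta> (ini m I N) = A \<union> dv v0 ` ini m I N" by (simp add: \<Theta>_def A_def image_Un image_image)
          then have "P w \<in> pov (rgen (fst ` \<Theta> (ini m I N)))" using P(1)[OF True[unfolded E_def]] w(2) by simp
          \<comment> \<open>The relation lifted to \<open>\<Theta>\<close> has a version over the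
            dual numbers; both parts of its value at \<open>dy j w\<close> are images of zero under
            \<open>\<Gamma>\<close>, hence zero.\<close>
          then obtain Q where Q: "Q \<in> pov (rgen (\<Theta> (ini m I N)))" "map_poly fst Q = P w" using lift_poly[OF rhom_fst] by metis
          have sub: "rgen (\<Theta> (ini m I N)) \<subseteq> rgen (\<Theta> (idxs m I))" 
            unfolding \<Theta>_def by (intro rgen_mono Un_mono image_mono ini_idxs order_refl)
          let ?x = "(dv v0 w, dy j w)"
          have x: "?x \<in> rgen (\<Theta> (idxs m I))" using w(1) by (auto simp: \<Theta>_def intro!: rgen_base)
          let ?Q = "map_poly snd Q"
          show "functional re (rgen (insert (dy j w) ?T))"
          proof (rule functional_separable[OF rhom_re Suc])
            have "snd ` \<Theta> (ini m I N) \<subseteq> ?T" by (auto simp: \<Theta>_def dK_def dv_shift[OF j])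
            then show "?Q \<in> pov (rgen ?T)" using rhom_map_poly_pov[OF rhom_snd Q(1)] pov_mono[OF rgen_mono] by blast
            have "poly Q ?x \<in> rgen (\<Theta> (idxs m I))" by (rule poly_in_rgen[OF pov_mono[OF sub Q(1)] x])
            moreover have "poly Q ?x = (0, poly ?Q (dy j w))"
              using P(2)[OF True[unfolded E_def]] Q(2) by (simp add: prod_eq_iff rhom_poly[OF rhom_fst] rhom_poly[OF rhom_snd])
            ultimately have "(0, re (poly ?Q (dy j w))) \<in> \<Gamma>" "(0, eps (poly ?Q (dy j w))) \<in> \<Gamma>"
              using \<Theta> derD(3)[OF der[OF j]] by metis+
            then have "re (poly ?Q (dy j w)) = 0" "eps (poly ?Q (dy j w)) = 0"
              using functionalD[OF func] by (metis fst_conv snd_conv snd_zero)+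
            then show "poly ?Q (dy j w) = 0" by (simp add: dual_eq_iff)
            have "sep Q ?x \<in> rgen (\<Theta> (idxs m I))" by (rule sep_in_rgen[OF pov_mono[OF sub Q(1)] x])
            moreover have "sep Q ?x = (sep (P w) (dv v0 w), sep ?Q (dy j w))"
              using Q(2) by (simp add: prod_eq_iff rhom_sep[OF rhom_fst] rhom_sep[OF rhom_snd])
            ultimately have "(sep (P w) (dv v0 w), re (sep ?Q (dy j w))) \<in> \<Gamma>" using \<Theta> by metis
            then show "re (sep ?Q (dy j w)) \<noteq> 0" by (rule P(3)[OF True[unfolded E_def]])
          qed (rule dual_nzd)
        qed
      qed
    qed
  qed
  let ?C = "K \<union> y ` idxs m I"
  define F where "F = {a / b |a b. a \<in> rgen ?C \<and> b \<in> rgen ?C \<and> b \<noteq> 0}"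
  have sF: "subfield F rta" unfolding F_def by (rule fraction_subfield)
  note Fcl = subfield_rtaD[OF sF]
  have "\<exists>D. (\<forall>x\<in>F. D x \<in> F) \<and> (\<forall>x\<in>F. \<forall>y\<in>F. D (x + y) = D x + D y \<and> D (x * y) = D x * y + x * D y) \<and>
    (\<forall>\<theta>\<in>dK j \<union> dy j ` idxs m I. D (re \<theta>) = eps \<theta>)" if j: "j < m" for j
    unfolding F_def
  proof (rule derivation_fraction_field[OF func_dual[OF j]])
    show "re ` (dK j \<union> dy j ` idxs m I) = ?C" by (auto simp: dK_def dy_def K_def image_Un image_image)
    show "eps ` (dK j \<union> dy j ` idxs m I) \<subseteq> rgen ?C"
      using shift_idxs[OF _ j, of _ I] by (auto simp: dK_def dy_def K_def intro!: rgen_base)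
  qed
  then have "\<forall>j. \<exists>D. j < m \<longrightarrow> (\<forall>x\<in>F. D x \<in> F) \<and> (\<forall>x\<in>F. \<forall>y\<in>F. D (x + y) = D x + D y \<and> D (x * y) = D x * y + x * D y) \<and>
    (\<forall>\<theta>\<in>dK j \<union> dy j ` idxs m I. D (re \<theta>) = eps \<theta>)" by blast
  from choice[OF this] obtain D where D0: "\<forall>j. j < m \<longrightarrow> (\<forall>x\<in>F. D j x \<in> F) \<and>
    (\<forall>x\<in>F. \<forall>y\<in>F. D j (x + y) = D j x + D j y \<and> D j (x * y) = D j x * y + x * D j y) \<and>
    (\<forall>\<theta>\<in>dK j \<union> dy j ` idxs m I. D j (re \<theta>) = eps \<theta>)" ..
  have D: "D j x \<in> F" if "j < m" "x \<in> F" for j x using D0 that by simp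
  have D2: "D j (x + y) = D j x + D j y" "D j (x * y) = D j x * y + x * D j y" if "j < m" "x \<in> F" "y \<in> F" for j x y
    using D0[rule_format, OF that(1)] that(2,3) by simp_all
  have D4: "D j (re \<theta>) = eps \<theta>" if "j < m" "\<theta> \<in> dK j \<union> dy j ` idxs m I" for j \<theta>
    using D0[rule_format, OF that(1)] that(2) by blast
  note D = D D2 D4
  have Demb: "D j (emb c) = emb (\<delta> j c)" if "j < m" for j c
    using D(4)[OF that, of "Dual (emb c) (emb (\<delta> j c))"] by (simp add: dK_def)
  have Dy: "D j (y w) = y (shift j w)" if "j < m" "w \<in> idxs m I" for j w
    using D(4)[OF that(1), of "dy j w"] that(2) by (simp add: dy_def)
  have CF: "rgen ?C \<subseteq> F"
  proof
    fix x assume "x \<in> rgen ?C" then show "x \<in> F" unfolding F_def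
      by (intro CollectI exI[of _ x] exI[of _ 1]) (auto intro: rgen.intros)
  qed
  have "F \<subseteq> acl ?C"
  proof
    fix x assume "x \<in> F"
    then obtain a b where ab: "x = a / b" "a \<in> rgen ?C" "b \<in> rgen ?C" by (auto simp: F_def)
    then have "a \<in> acl ?C" "b \<in> acl ?C" using rgen_subset_acl by auto
    then show "x \<in> acl ?C" unfolding ab(1) divide_inverse by (intro acl_closed)
  qed
  moreover have "D i (D j x) = D j (D i x)" if ij: "i < m" "j < m" and x: "x \<in> F" for i j x
  proof -
    \<comment> \<open>The expansion carries commutation from the generators to products; for a
      fraction, \<open>a = x * b\<close> is differentiated twice and solved for the derivatives of
      \<open>x\<close>.\<close>
    have DD: "D i (D j (p * q)) = D i (D j p) * q + D j p * D i q + D i p * D j q + p * D i (D j q)"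
      "D j (D i (p * q)) = D j (D i p) * q + D i p * D j q + D j p * D i q + p * D j (D i q)" 
      if "p \<in> F" "q \<in> F" for p q
      using that ij D(1)[OF ij(1)] D(1)[OF ij(2)] by (simp_all add: D(2,3) Fcl(3,5) add.assoc)
    have C: "D i (D j x) = D j (D i x)" if "x \<in> rgen ?C" for x
      using that
    proof induction
      case rgen_one
      have "D j 1 = 0" if "j < m" for j using Demb[OF that, of 1] by (simp add: rhomD[OF emb(1)] derD[OF der[OF that]])
      moreover have "D j 0 = 0" if "j < m" for j using Demb[OF that, of 0] by (simp add: rhomD[OF emb(1)] derD[OF der[OF that]])
      ultimately show ?case using ij by simp
    next
      case (rgen_base x)
      then show ?case
      proof
        assume "x \<in> K" then show ?thesis using ij by (auto simp: K_def Demb comm)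
      next
        assume "x \<in> y ` idxs m I"
        then show ?thesis using ij shift_idxs by (auto simp: Dy shift_commute)
      qed
    next
      case (rgen_add p q)
      then have "p \<in> F" "q \<in> F" using CF by auto
      then show ?case using rgen_add(3,4) ij D(1,2) by simp
    next
      case (rgen_neg x)
      then have x: "x \<in> F" using CF by auto
      have "D j 0 = 0" if "j < m" for j using Demb[OF that, of 0] by (simp add: rhomD[OF emb(1)] derD[OF der[OF that]])
      then have neg: "D j (- x) = - D j x" if "j < m" "x \<in> F" for j x
        using D(2)[OF that(1), of x "- x"] that Fcl(4) by (simp add: eq_neg_iff_add_eq_0 add.commute)
      show ?case using rgen_neg x ij by (simp add: D neg)
    next
      case (rgen_mult p q)
      then have "p \<in> F" "q \<in> F" using CF by auto
      then show ?case using rgen_mult(3,4) by (simp add: DD)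
    qed
    obtain a b where ab: "x = a / b" "a \<in> rgen ?C" "b \<in> rgen ?C" "b \<noteq> 0" using x by (auto simp: F_def)
    have xb: "a = x * b" using ab by simp
    have bF: "b \<in> F" using ab CF by auto
    have "D i (D j (x * b)) = D j (D i (x * b))" using C[OF ab(2)] xb by simp
    then have "D i (D j x) * b + x * D i (D j b) = D j (D i x) * b + x * D j (D i b)"
      using DD[OF x bF] by simp
    then show ?thesis using C[OF ab(3)] ab(4) by simp
  qed
  moreover have "?C \<subseteq> F" using CF by (auto intro: rgen_base)
  ultimately show ?thesis using sF D(1-3) Demb Dy
    by (intro exI[of _ F] exI[of _ D]) simp
qed

end


section \<open>Cardinalities\<close>

no_notation iso_incl (infixl \<open>\<lesssim>\<close> 65)

lemma lepoll_card_of: "A \<lesssim> B \<longleftrightarrow> (card_of A, card_of B) \<in> ordLeq"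
  unfolding lepoll_def card_of_ordLeq[symmetric] by auto

lemma lepoll_Times: assumes "infinite B" "A \<lesssim> B" "A' \<lesssim> B" shows "A \<times> A' \<lesssim> B"
proof -
  have "A \<times> A' \<lesssim> B \<times> B" using assms(2,3) by (rule times_lepoll_mono)
  also have "B \<times> B \<lesssim> B" unfolding lepoll_card_of
    using card_of_Times_same_infinite[OF assms(1)] by (rule ordIso_imp_ordLeq)
  finally show ?thesis .
qed

lemma lepoll_UN: assumes "infinite B" "J \<lesssim> B" "\<And>i. i \<in> J \<Longrightarrow> f i \<lesssim> B" shows "(\<Union>i\<in>J. f i) \<lesssim> B"
  unfolding lepoll_card_of
  by (rule card_of_UNION_ordLeq_infinite[OF assms(1)]) (use assms(2,3) in \<open>auto simp: lepoll_card_of\<close>)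

lemma lepoll_Un: assumes "infinite B" "A \<lesssim> B" "A' \<lesssim> B" shows "A \<union> A' \<lesssim> B"
proof -
  have "(\<Union>b\<in>UNIV. if b then A else A') \<lesssim> B"
    by (rule lepoll_UN[OF assms(1)]) (use assms in \<open>auto intro: finite_lepoll_infinite\<close>)
  moreover have "(\<Union>b\<in>UNIV. if b then A else A') = A \<union> A'" by (auto split: if_splits)
  ultimately show ?thesis by simp
qed

lemma lepoll_image: "A \<lesssim> B \<Longrightarrow> f ` A \<lesssim> B"
  using image_lepoll lepoll_trans by blast

lemma nat_lepoll_infinite: "infinite B \<Longrightarrow> (UNIV :: nat set) \<lesssim> B"
  by (simp add: infinite_le_lepoll)

lemma countable_lepoll_infinite: assumes "infinite B" "countable A" shows "A \<lesssim> B"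
proof -
  have "A \<lesssim> (UNIV :: nat set)" using assms(2) by (auto simp: countable_def lepoll_def)
  then show ?thesis using nat_lepoll_infinite[OF assms(1)] lepoll_trans by blast
qed

text \<open>The generated ring is exhausted by countably many stages, each obtained from the
  previous one and its square by finitely many maps.\<close>

lemma rgen_lepoll: fixes S :: "'r::comm_ring_1 set" assumes "infinite B" "S \<lesssim> B" shows "rgen S \<lesssim> B"
proof -
  define C :: "nat \<Rightarrow> 'r set" where "C = rec_nat (insert 1 S) (\<lambda>_ T. T \<union> (\<lambda>(x, y). x + y) ` (T \<times> T) \<union> uminus ` T \<union> (\<lambda>(x, y). x * y) ` (T \<times> T))"
  have C0: "C 0 = insert 1 S" by (simp add: C_def)
  have CS: "C (Suc n) = C n \<union> (\<lambda>(x, y). x + y) ` (C n \<times> C n) \<union> uminus ` C n \<union> (\<lambda>(x, y). x * y) ` (C n \<times> C n)" for n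
    by (simp add: C_def)
  have "C n \<lesssim> B" for n
  proof (induction n)
    case 0
    have "insert 1 S = {1} \<union> S" by simp
    also have "\<dots> \<lesssim> B" by (rule lepoll_Un[OF assms(1) _ assms(2)]) (rule finite_lepoll_infinite[OF assms(1)], simp)
    finally show ?case by (simp add: C0)
  next
    case (Suc n)
    then show ?case unfolding CS by (intro lepoll_Un lepoll_image lepoll_Times assms(1))
  qed
  then have "(\<Union>n. C n) \<lesssim> B" by (intro lepoll_UN assms(1) nat_lepoll_infinite)
  moreover have mono: "C i \<subseteq> C j" if "i \<le> j" for i j by (rule lift_Suc_mono_le[OF _ that]) (auto simp: CS)
  have "rgen S \<subseteq> (\<Union>n. C n)"
  proof
    fix x assume "x \<in> rgen S" then show "x \<in> (\<Union>n. C n)"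
    proof induction
      case rgen_one then show ?case using C0 by blast
    next
      case (rgen_base x) then show ?case using C0 by blast
    next
      case (rgen_add x y)
      then obtain i j where "x \<in> C i" "y \<in> C j" by auto
      then have "x \<in> C (max i j)" "y \<in> C (max i j)" using mono by (meson max.cobounded1 max.cobounded2 subsetD)+
      then have "x + y \<in> C (Suc (max i j))" unfolding CS by force
      then show ?case by blast
    next
      case (rgen_neg x)
      then obtain i where "x \<in> C i" by auto
      then have "- x \<in> C (Suc i)" unfolding CS by force
      then show ?case by blast
    next
      case (rgen_mult x y)
      then obtain i j where "x \<in> C i" "y \<in> C j" by auto
      then have "x \<in> C (max i j)" "y \<in> C (max i j)" using mono by (meson max.cobounded1 max.cobounded2 subsetD)+
      then have "x * y \<in> C (Suc (max i j))" unfolding CS by force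
      then show ?case by blast
    qed
  qed
  ultimately show ?thesis using subset_imp_lepoll lepoll_trans by blast
qed

text \<open>The polynomials in question lie in the ring generated by the constants from
  \<open>S\<close> and the variable, and each nonzero one has finitely many roots.\<close>

lemma acl_lepoll: fixes S :: "'a::field set" assumes "infinite B" "S \<lesssim> B" shows "acl S \<lesssim> B"
proof -
  let ?G = "insert [:0, 1:] ((\<lambda>c. [:c:]) ` S)"
  have const: "[:c:] \<in> rgen ?G" if "c \<in> rgen S" for c
    using that
  proof induction
    case rgen_one show ?case using rgen.rgen_one[of ?G] by (simp add: one_pCons)
  next
    case (rgen_base x) then show ?case by (intro rgen.rgen_base) auto
  next
    case (rgen_add x y) then show ?case using rgen.rgen_add[of "[:x:]" ?G "[:y:]"] by simp
  next
    case (rgen_neg x) then show ?case using rgen.rgen_neg[of "[:x:]" ?G] by simp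
  next
    case (rgen_mult x y) then show ?case using rgen.rgen_mult[of "[:x:]" ?G "[:y:]"] by (simp add: mult.commute)
  qed
  have "p \<in> rgen ?G" if "p \<in> pov (rgen S)" for p
  proof -
    have "[:0,1:] \<in> rgen ?G" by (rule rgen_base) simp
    then have "Polynomial.monom (Polynomial.coeff p i) i \<in> rgen ?G" for i
      using const[OF pov_coeff[OF that], of i] rgen_mult[OF _ rgen_power, of "[:Polynomial.coeff p i:]" ?G "[:0,1:]" i]
      by (simp add: monom_altdef)
    then have "(\<Sum>i\<le>Polynomial.degree p. Polynomial.monom (Polynomial.coeff p i) i) \<in> rgen ?G" by (intro rgen_sum)
    then show ?thesis by (simp add: poly_as_sum_of_monoms)
  qed
  then have "pov (rgen S) \<subseteq> rgen ?G" by auto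
  moreover have "?G \<lesssim> B"
  proof -
    have "?G = {[:0, 1:]} \<union> (\<lambda>c. [:c:]) ` S" by simp
    also have "\<dots> \<lesssim> B"
      by (rule lepoll_Un[OF assms(1) finite_lepoll_infinite[OF assms(1)] lepoll_image[OF assms(2)]]) simp
    finally show ?thesis .
  qed
  ultimately have "pov (rgen S) - {0} \<lesssim> B"
    using rgen_lepoll[OF assms(1)] by (meson Diff_subset lepoll_trans subset_imp_lepoll)
  then have "(\<Union>p\<in>pov (rgen S) - {0}. {x. poly p x = 0}) \<lesssim> B"
  proof (rule lepoll_UN[OF assms(1)])
    show "{x. poly p x = 0} \<lesssim> B" if "p \<in> pov (rgen S) - {0}" for p
      by (rule finite_lepoll_infinite[OF assms(1)]) (use that in \<open>simp add: poly_roots_finite\<close>)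
  qed
  moreover have "acl S = (\<Union>p\<in>pov (rgen S) - {0}. {x. poly p x = 0})" by (auto simp: acl_def)
  ultimately show ?thesis by simp
qed

lemma countable_dvars: "countable (U :: dvar set)"
proof -
  have "countable (UNIV :: (nat \<Rightarrow>\<^sub>0 nat) set)"
  proof -
    have "inj (\<lambda>\<xi> :: nat \<Rightarrow>\<^sub>0 nat. (map (lkp \<xi>) [0..<Suc (Max (insert 0 (Poly_Mapping.keys \<xi>)))]))"
    proof (rule injI, rule poly_mapping_eqI)
      fix \<xi> \<eta> :: "nat \<Rightarrow>\<^sub>0 nat" and j
      let ?M = "\<lambda>\<xi> :: nat \<Rightarrow>\<^sub>0 nat. Max (insert 0 (Poly_Mapping.keys \<xi>))"
      assume eq: "map (lkp \<xi>) [0..<Suc (?M \<xi>)] = map (lkp \<eta>) [0..<Suc (?M \<eta>)]"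
      have len: "?M \<xi> = ?M \<eta>" using arg_cong[OF eq, of length] by simp
      have out: "lkp \<zeta> j = 0" if "\<not> j \<le> ?M \<zeta>" for \<zeta> :: "nat \<Rightarrow>\<^sub>0 nat"
        using that Max_ge[of "insert 0 (Poly_Mapping.keys \<zeta>)" j] by (auto simp: in_keys_iff)
      show "lkp \<xi> j = lkp \<eta> j"
      proof (cases "j \<le> ?M \<xi>")
        case True
        then have "map (lkp \<xi>) [0..<Suc (?M \<xi>)] ! j = map (lkp \<eta>) [0..<Suc (?M \<eta>)] ! j" using eq by simp
        then show ?thesis using True len by (simp del: upt_Suc)
      next
        case False then show ?thesis using out[of \<xi>] out[of \<eta>] len by simp
      qed
    qed
    then show ?thesis by (rule countableI') 
  qed
  then have "countable ((UNIV :: nat set) \<times> (UNIV :: (nat \<Rightarrow>\<^sub>0 nat) set))" by (intro countable_SIGMA countableI_type)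
  then have "countable (UNIV :: dvar set)" by simp
  then show ?thesis by (rule countable_subset[rotated]) simp
qed

section \<open>A large algebraically closed extension\<close>

text \<open>The algebraic closure of the field of rational functions over \<open>'a\<close> in
  countably many variables, one for each rank.\<close>

type_synonym 'a omega = "((nat \<Rightarrow>\<^sub>0 nat) \<Rightarrow>\<^sub>0 'a) fract alg_closure"

definition om :: "((nat \<Rightarrow>\<^sub>0 nat) \<Rightarrow>\<^sub>0 'a::field) \<Rightarrow> 'a omega" where
  "om P = to_ac (Fract P 1)"

lemma om: "rhom om" "om P = 0 \<longleftrightarrow> P = 0"
  by (simp_all add: rhom_def om_def flip: to_ac_add to_ac_mult) (simp_all add: Zero_fract_def One_fract_def eq_fract)

definition om_emb :: "'a::field \<Rightarrow> 'a omega" where "om_emb c = om (Poly_Mapping.single 0 c)"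

definition om_T :: "nat \<Rightarrow> 'a::field omega" where "om_T i = om (Poly_Mapping.single (sngl i 1) 1)"

lemma om_emb: "rhom (om_emb :: 'a::field \<Rightarrow> 'a omega)" "inj (om_emb :: 'a \<Rightarrow> 'a omega)"
proof -
  have "Poly_Mapping.single (0 :: nat \<Rightarrow>\<^sub>0 nat) (x * y) = Poly_Mapping.single 0 x * Poly_Mapping.single 0 y" for x y :: 'a
    by (simp add: mult_single)
  then show "rhom (om_emb :: 'a \<Rightarrow> 'a omega)"
    by (simp add: rhom_def om_emb_def rhomD[OF om(1)] single_add)
  show "inj (om_emb :: 'a \<Rightarrow> 'a omega)"
  proof (rule injI)
    fix x y :: 'a assume "om_emb x = om_emb y"
    then have "om (Poly_Mapping.single 0 x - Poly_Mapping.single 0 y) = 0" by (simp add: om_emb_def rhomD[OF om(1)])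
    then have "Poly_Mapping.single (0 :: nat \<Rightarrow>\<^sub>0 nat) x = Poly_Mapping.single 0 y" by (simp add: om(2))
    then show "x = y" by (metis lookup_single_eq)
  qed
qed

text \<open>A dependence of \<open>om_T N\<close> lifts along \<open>om\<close> to a polynomial
  identity; its coefficients do not contain the variable \<open>N\<close>, so the powers of this
  variable cannot cancel.\<close>

lemma om_T_transcendental: "om_T N \<notin> acl (range om_emb \<union> om_T ` {..<N})"
proof
  let ?G = "range (Poly_Mapping.single 0) \<union> (\<lambda>i. Poly_Mapping.single (sngl i 1) 1) ` {..<N} :: ((nat \<Rightarrow>\<^sub>0 nat) \<Rightarrow>\<^sub>0 'a) set"
  assume "(om_T N :: 'a omega) \<in> acl (range om_emb \<union> om_T ` {..<N})"
  moreover have eq: "range om_emb \<union> om_T ` {..<N} = om ` ?G" by (simp add: om_emb_def om_T_def image_Un image_image)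
  ultimately obtain p where p: "p \<in> pov (rgen (om ` ?G))" "p \<noteq> 0" "poly p (om_T N) = 0" unfolding acl_def by auto
  obtain P where P: "P \<in> pov (rgen ?G)" "map_poly om P = p" using lift_poly[OF om(1) p(1)] by metis
  have G: "rgen ?G \<subseteq> mpolys UNIV {..<N}"
  proof
    fix x assume "x \<in> rgen ?G" then show "x \<in> mpolys UNIV {..<N}"
    proof induction
      case rgen_one
      have "Poly_Mapping.single (0 :: nat \<Rightarrow>\<^sub>0 nat) (1 :: 'a) \<in> mpolys UNIV {..<N}" by (rule mpolys_single) auto
      then show ?case by simp
    next
      case (rgen_base x) then show ?case by (auto intro!: mpolys_single)
    qed (auto intro: mpolys_add mpolys_uminus mpolys_mult)
  qed
  let ?x = "Poly_Mapping.single (sngl N 1) 1"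
  have pw: "?x ^ k = Poly_Mapping.single (sngl N k) (1::'a)" for k
    by (induction k) (simp_all add: mult_single flip: single_add)
  have "om (poly P ?x) = 0" using p(3) P(2) by (simp add: rhom_poly[OF om(1)] om_T_def)
  then have "poly P ?x = 0" by (simp add: om(2))
  moreover have "(\<Sum>k\<le>Polynomial.degree P. Polynomial.coeff P k * Poly_Mapping.single (sngl N k) 1) \<noteq> 0"
  proof (rule mpoly_comb_nonzero[of _ _ "Polynomial.degree P"])
    show "N \<notin> Poly_Mapping.keys u" if "u \<in> Poly_Mapping.keys (Polynomial.coeff P k)" for k u
      using subsetD[OF G pov_coeff[OF P(1), of k]] that by (auto simp: mpolys_def)
    show "Polynomial.coeff P (Polynomial.degree P) \<noteq> 0" using P(2) p(2) by auto
  qed simp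
  ultimately show False by (simp only: poly_altdef pw)
qed


section \<open>First-order formulas\<close>

primrec tsubst :: "(nat \<Rightarrow> 'c dterm) \<Rightarrow> 'c dterm \<Rightarrow> 'c dterm" where
  "tsubst \<sigma> (TVar x) = \<sigma> x"
| "tsubst \<sigma> (TConst c) = TConst c"
| "tsubst \<sigma> TZero = TZero"
| "tsubst \<sigma> TOne = TOne"
| "tsubst \<sigma> (TNeg s) = TNeg (tsubst \<sigma> s)"
| "tsubst \<sigma> (TAdd s t) = TAdd (tsubst \<sigma> s) (tsubst \<sigma> t)"
| "tsubst \<sigma> (TMul s t) = TMul (tsubst \<sigma> s) (tsubst \<sigma> t)"
| "tsubst \<sigma> (TDer i s) = TDer i (tsubst \<sigma> s)"

lemma dterm_val_tsubst: "dterm_val R d h v (tsubst \<sigma> t) = dterm_val R d h (\<lambda>i. dterm_val R d h v (\<sigma> i)) t"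
  by (induction t) simp_all

lemma dterm_val_cong: "(\<And>i. i \<in> dterm_vars t \<Longrightarrow> v i = v' i) \<Longrightarrow> dterm_val R d h v t = dterm_val R d h v' t"
  by (induction t) simp_all

lemma dterm_vars_tsubst: "dterm_vars (tsubst \<sigma> t) = (\<Union>i\<in>dterm_vars t. dterm_vars (\<sigma> i))"
  by (induction t) auto

lemma dterm_over_tsubst: "dterm_over m A t \<Longrightarrow> (\<And>i. i \<in> dterm_vars t \<Longrightarrow> dterm_over m A (\<sigma> i)) \<Longrightarrow> dterm_over m A (tsubst \<sigma> t)"
  by (induction t) auto

lemma dterm_over_mono: "A \<subseteq> B \<Longrightarrow> dterm_over m A t \<Longrightarrow> dterm_over m B t"
  by (induction t) auto

lemma dform_over_mono: "A \<subseteq> B \<Longrightarrow> dform_over m A p \<Longrightarrow> dform_over m B p"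
  by (induction p) (auto intro: dterm_over_mono)

definition tdv :: "nat \<Rightarrow> dvar \<Rightarrow> 'c dterm" where
  "tdv m w = foldr (\<lambda>j. TDer j ^^ lkp (snd w) j) [0..<m] (TVar (fst w))"

lemma tdv_over: "dterm_over m A (tdv m w :: 'c dterm)" "dterm_vars (tdv m w :: 'c dterm) = {fst w}"
proof -
  have 1: "dterm_over m A ((TDer j ^^ k) t) = dterm_over m A t" "dterm_vars ((TDer j ^^ k) t) = dterm_vars t" if "j < m" for j k and t :: "'c dterm"
    using that by (induction k) auto
  have 2: "set xs \<subseteq> {..<m} \<Longrightarrow> dterm_over m A (foldr (\<lambda>j. TDer j ^^ lkp (snd w) j) xs (TVar (fst w) :: 'c dterm)) \<and>
     dterm_vars (foldr (\<lambda>j. TDer j ^^ lkp (snd w) j) xs (TVar (fst w) :: 'c dterm)) = {fst w}" for xs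
    by (induction xs) (auto simp: 1)
  have "set [0..<m] \<subseteq> {..<m}" by auto
  from 2[OF this] show "dterm_over m A (tdv m w :: 'c dterm)" "dterm_vars (tdv m w :: 'c dterm) = {fst w}"
    unfolding tdv_def by (rule conjunct1, rule conjunct2)
qed

lemma dterm_val_tdv: "dterm_val R d h v (tdv m w) = foldr (\<lambda>j. d j ^^ lkp (snd w) j) [0..<m] (v (fst w))"
proof -
  have 1: "dterm_val R d h v ((TDer j ^^ k) t) = (d j ^^ k) (dterm_val R d h v t)" for j k t by (induction k) auto
  have "dterm_val R d h v (foldr (\<lambda>j. TDer j ^^ lkp (snd w) j) xs (TVar (fst w))) = foldr (\<lambda>j. d j ^^ lkp (snd w) j) xs (v (fst w))" for xs
    by (induction xs) (auto simp: 1)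
  then show ?thesis by (simp add: tdv_def)
qed

text \<open>The syntactic counterpart of \<open>PF\<close>, needed because saturation and
  differential closedness speak about formulas.\<close>

inductive_set PT :: "nat \<Rightarrow> 'c set \<Rightarrow> dvar set \<Rightarrow> 'c dterm set" for m A W where
  PT_one: "TOne \<in> PT m A W"
| PT_const: "c \<in> A \<Longrightarrow> TConst c \<in> PT m A W"
| PT_var: "w \<in> W \<Longrightarrow> tdv m w \<in> PT m A W"
| PT_add: "s \<in> PT m A W \<Longrightarrow> t \<in> PT m A W \<Longrightarrow> TAdd s t \<in> PT m A W"
| PT_neg: "s \<in> PT m A W \<Longrightarrow> TNeg s \<in> PT m A W"
| PT_mult: "s \<in> PT m A W \<Longrightarrow> t \<in> PT m A W \<Longrightarrow> TMul s t \<in> PT m A W"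

lemma PT_over: "t \<in> PT m A W \<Longrightarrow> dterm_over m A t \<and> dterm_vars t \<subseteq> fst ` W"
  by (induction rule: PT.induct) (auto simp: tdv_over)

section \<open>Formulas excluding algebraic relations\<close>

definition horner :: "'c dterm list \<Rightarrow> 'c dterm \<Rightarrow> 'c dterm" where
  "horner ts x = foldr (\<lambda>t s. TAdd t (TMul x s)) ts TZero"

definition all_zero :: "'c dterm list \<Rightarrow> 'c dform" where
  "all_zero ts = foldr (\<lambda>t p. FAnd (FEq t TZero) p) ts (FEq TZero TZero)"

text \<open>Excludes one nontrivial relation with coefficients \<open>ts\<close>; transcendence of
  \<open>x\<close> over a set is the scheme of all such formulas.\<close>

definition no_root :: "'c dterm list \<Rightarrow> 'c dterm \<Rightarrow> 'c dform" where
  "no_root ts x = FNot (FAnd (FEq (horner ts x) TZero) (FNot (all_zero ts)))"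

lemma horner_over: "dterm_over m A (horner ts x) \<longleftrightarrow> ts = [] \<or> dterm_over m A x \<and> (\<forall>t\<in>set ts. dterm_over m A t)"
  by (induction ts) (auto simp: horner_def)

lemma horner_vars: "dterm_vars (horner ts x) \<subseteq> dterm_vars x \<union> (\<Union>t\<in>set ts. dterm_vars t)"
  by (induction ts) (auto simp: horner_def)

lemma all_zero_over: "dform_over m A (all_zero ts) \<longleftrightarrow> (\<forall>t\<in>set ts. dterm_over m A t)"
  by (induction ts) (auto simp: all_zero_def)

lemma all_zero_vars: "free_vars (all_zero ts) = (\<Union>t\<in>set ts. dterm_vars t)"
  by (induction ts) (auto simp: all_zero_def)

lemma all_zero_qf: "quantifier_free (all_zero ts)"
  by (induction ts) (auto simp: all_zero_def)

lemma all_zero_sat: "satisfies R d h v (all_zero ts) \<longleftrightarrow> (\<forall>t\<in>set ts. dterm_val R d h v t = \<zero>\<^bsub>R\<^esub>)"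
  by (induction ts) (auto simp: all_zero_def)

lemma no_root_over:
  assumes "dterm_over m A x" "\<And>t. t \<in> set ts \<Longrightarrow> dterm_over m A t"
  shows "dform_over m A (no_root ts x)" "quantifier_free (no_root ts x)"
  using assms by (auto simp: no_root_def horner_over all_zero_over all_zero_qf)

lemma no_root_vars: "free_vars (no_root ts x) \<subseteq> dterm_vars x \<union> (\<Union>t\<in>set ts. dterm_vars t)"
  using horner_vars[of ts x] by (auto simp: no_root_def all_zero_vars)

definition conj_list :: "'c dform list \<Rightarrow> 'c dform" where
  "conj_list ps = foldr FAnd ps (FEq TZero TZero)"

lemma conj_list:
  "satisfies R d h v (conj_list ps) \<longleftrightarrow> (\<forall>p\<in>set ps. satisfies R d h v p)"
  "dform_over m A (conj_list ps) \<longleftrightarrow> (\<forall>p\<in>set ps. dform_over m A p)"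
  "quantifier_free (conj_list ps) \<longleftrightarrow> (\<forall>p\<in>set ps. quantifier_free p)"
  "free_vars (conj_list ps) = (\<Union>p\<in>set ps. free_vars p)"
  by (induction ps) (auto simp: conj_list_def)

lemma horner_val:
  fixes F :: "'b::field set"
  shows "dterm_val (rta\<lparr>carrier := F\<rparr>) d h v (horner ts x) =
    poly (Poly (map (dterm_val (rta\<lparr>carrier := F\<rparr>) d h v) ts)) (dterm_val (rta\<lparr>carrier := F\<rparr>) d h v x)"
  by (induction ts) (simp_all add: horner_def ring_of_type_algebra_def)

lemma rta_carrier: "(rta :: 'b::field ring) = rta\<lparr>carrier := UNIV\<rparr>"
  by (simp add: ring_of_type_algebra_def)

lemma no_root_sat:
  fixes F :: "'b::field set"
  shows "satisfies (rta\<lparr>carrier := F\<rparr>) d h v (no_root ts x) \<longleftrightarrow>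
    (poly (Poly (map (dterm_val (rta\<lparr>carrier := F\<rparr>) d h v) ts)) (dterm_val (rta\<lparr>carrier := F\<rparr>) d h v x) = 0 \<longrightarrow>
      (\<forall>t\<in>set ts. dterm_val (rta\<lparr>carrier := F\<rparr>) d h v t = 0))"
  by (simp add: no_root_def all_zero_sat horner_val)

subsection \<open>Transport of an extension into the universe\<close>

lemma subfield_rta_ops:
  fixes F :: "'b::field set"
  assumes "subfield F rta"
  shows "field (rta\<lparr>carrier := F\<rparr>)" "x \<in> F \<Longrightarrow> \<ominus>\<^bsub>rta\<lparr>carrier := F\<rparr>\<^esub> x = - x"
proof -
  interpret R: field "rta :: 'b ring" by (rule field_from_type_algebra)
  show f: "field (rta\<lparr>carrier := F\<rparr>)" by (rule R.subfield_iff(2)[OF assms])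
  interpret f: field "rta\<lparr>carrier := F\<rparr>" by (rule f)
  show "x \<in> F \<Longrightarrow> \<ominus>\<^bsub>rta\<lparr>carrier := F\<rparr>\<^esub> x = - x"
    using f.minus_equality[of "- x" x] subfield_rtaD(4)[OF assms] by simp
qed

text \<open>\<open>differentially_closed\<close> speaks only of extensions whose carrier lies in
  \<open>'a\<close>, so \<open>F\<close> is copied along an injection \<open>\<iota>\<close>, with
  operations and derivations conjugated by it.\<close>

lemma transported_solution:
  fixes F :: "'b::field set" and \<delta> :: "nat \<Rightarrow> 'a::field_char_0 \<Rightarrow> 'a"
  assumes dc: "differentially_closed m \<delta>" and F: "subfield F rta" "F \<lesssim> (UNIV :: 'a set)"
    and D: "\<And>j x. j < m \<Longrightarrow> x \<in> F \<Longrightarrow> D j x \<in> F"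
      "\<And>j x y. j < m \<Longrightarrow> x \<in> F \<Longrightarrow> y \<in> F \<Longrightarrow> D j (x + y) = D j x + D j y"
      "\<And>j x y. j < m \<Longrightarrow> x \<in> F \<Longrightarrow> y \<in> F \<Longrightarrow> D j (x * y) = D j x * y + x * D j y"
      "\<And>i j x. i < m \<Longrightarrow> j < m \<Longrightarrow> x \<in> F \<Longrightarrow> D i (D j x) = D j (D i x)"
    and emb: "rhom emb" "range emb \<subseteq> F" "\<And>j c. j < m \<Longrightarrow> D j (emb c) = emb (\<delta> j c)"
    and p: "quantifier_free p" "dform_over m UNIV p" and u: "\<And>x. u x \<in> F"
    and sat: "satisfies (rta\<lparr>carrier := F\<rparr>) D emb u p"
  shows "\<exists>w. satisfies rta \<delta> id w p"
proof -
  let ?RF = "rta\<lparr>carrier := F\<rparr>"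
  note Fcl = subfield_rtaD[OF F(1)]
  obtain \<iota> :: "'b \<Rightarrow> 'a" where \<iota>: "inj_on \<iota> F" using F(2) by (auto simp: lepoll_def)
  define \<kappa> where "\<kappa> = the_inv_into F \<iota>"
  have \<kappa>: "\<kappa> (\<iota> x) = x" if "x \<in> F" for x unfolding \<kappa>_def by (rule the_inv_into_f_f[OF \<iota> that])
  define R :: "'a ring" where "R = \<lparr>carrier = \<iota> ` F, monoid.mult = \<lambda>x y. \<iota> (\<kappa> x * \<kappa> y), one = \<iota> 1, zero = \<iota> 0, add = \<lambda>x y. \<iota> (\<kappa> x + \<kappa> y)\<rparr>"
  define d where "d = (\<lambda>j x. \<iota> (D j (\<kappa> x)))"
  interpret RF: field ?RF by (rule subfield_rta_ops(1)[OF F(1)])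
  have iso: "\<iota> \<in> ring_iso ?RF R"
    unfolding ring_iso_def ring_hom_def bij_betw_def using \<iota> \<kappa> by (auto simp: R_def)
  have fR: "field R"
    using RF.ring_iso_imp_img_field[OF iso] by (simp add: R_def)
  interpret R: field R by (rule fR)
  have hom: "\<iota> \<in> ring_hom ?RF R" using iso by (simp add: ring_iso_def)
  have neg: "\<ominus>\<^bsub>R\<^esub> (\<iota> x) = \<iota> (\<ominus>\<^bsub>?RF\<^esub> x)" if "x \<in> F" for x
  proof -
    interpret h: ring_hom_ring ?RF R \<iota> by (rule ring_hom_ringI2[OF RF.ring_axioms R.ring_axioms hom])
    show ?thesis using h.hom_a_inv[of x] that by simp
  qed
  have "differential_field m R d"
    unfolding differential_field_def derivation_def
  proof (intro conjI allI impI ballI fR)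
    fix j x assume j: "j < m"
    show "d j \<in> carrier R \<rightarrow> carrier R" using D(1)[OF j] \<kappa> by (auto simp: R_def d_def)
    fix y assume xy: "x \<in> carrier R" "y \<in> carrier R"
    then obtain a b where ab: "a \<in> F" "b \<in> F" "x = \<iota> a" "y = \<iota> b" by (auto simp: R_def)
    show "d j (x \<oplus>\<^bsub>R\<^esub> y) = d j x \<oplus>\<^bsub>R\<^esub> d j y" "d j (x \<otimes>\<^bsub>R\<^esub> y) = (d j x \<otimes>\<^bsub>R\<^esub> y) \<oplus>\<^bsub>R\<^esub> (x \<otimes>\<^bsub>R\<^esub> d j y)"
      using ab j D by (simp_all add: R_def d_def \<kappa> Fcl)
  next
    fix i j x assume "i < m" "j < m" "x \<in> carrier R"
    then show "d i (d j x) = d j (d i x)" using D(1,4) by (auto simp: R_def d_def \<kappa>)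
  qed
  moreover have "\<iota> \<circ> emb \<in> ring_hom rta R"
    using emb(2) unfolding ring_hom_def by (auto simp: R_def \<kappa> image_subset_iff rhomD[OF emb(1)])
  moreover have "(\<iota> \<circ> emb) (\<delta> j c) = d j ((\<iota> \<circ> emb) c)" if "j < m" for j c
    using emb(2,3) that by (auto simp: d_def \<kappa> image_subset_iff)
  moreover have "(\<iota> \<circ> u) x \<in> carrier R" for x using u by (simp add: R_def)
  moreover have "satisfies R d (\<iota> \<circ> emb) (\<iota> \<circ> u) p"
  proof -
    have val: "dterm_val R d (\<iota> \<circ> emb) (\<iota> \<circ> u) t = \<iota> (dterm_val ?RF D emb u t) \<and> dterm_val ?RF D emb u t \<in> F"
      if "dterm_over m UNIV t" for t
      using that
    proof (induction t)
      case (TNeg t)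
      then show ?case using neg[of "dterm_val ?RF D emb u t"] RF.a_inv_closed by auto
    next
      case (TConst c) then show ?case using emb(2) by auto
    qed (use u Fcl D(1) in \<open>auto simp: R_def \<kappa> d_def\<close>)
    have "satisfies R d (\<iota> \<circ> emb) (\<iota> \<circ> u) p = satisfies ?RF D emb u p"
      using p
    proof (induction p)
      case (FEq s t)
      then have o: "dterm_over m UNIV s" "dterm_over m UNIV t" by simp_all
      show ?case
        unfolding satisfies.simps val[OF o(1), THEN conjunct1] val[OF o(2), THEN conjunct1]
        using inj_on_eq_iff[OF \<iota>] val[OF o(1)] val[OF o(2)] by blast
    qed auto
    then show ?thesis using sat by simp
  qed
  ultimately show ?thesis using dc p unfolding differentially_closed_def by blast
qed


section \<open>Lower semicontinuity\<close>

text \<open>In the extension the values \<open>y\<close> are known only through the shift rule;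
  iterating it identifies the iterated derivatives of \<open>y (i, 0)\<close>.\<close>

lemma dterm_val_tdv_seq:
  assumes D: "\<And>j w. j < m \<Longrightarrow> w \<in> idxs m I \<Longrightarrow> d j (y w) = y (shift j w)" and w: "w \<in> idxs m I"
    and u: "u (fst w) = y (fst w, 0)"
  shows "dterm_val R d h u (tdv m w) = y w"
proof -
  obtain i \<xi> where w': "w = (i, \<xi>)" by (cases w)
  have i: "i \<in> I" and \<xi>: "\<xi> \<in> multi_indices m" using w w' by (auto simp: idxs_def)
  have 1: "(d j ^^ a) (y (i, \<eta>)) = y (i, \<eta> + sngl j a)" if "j < m" "\<eta> \<in> multi_indices m" for j a \<eta>
  proof (induction a)
    case (Suc a)
    have "(i, \<eta> + sngl j a) \<in> idxs m I" using i that by (auto simp: idxs_def intro!: multi_indices_add multi_indices_single)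
    then have "d j (y (i, \<eta> + sngl j a)) = y (i, \<eta> + sngl j a + sngl j 1)"
      using D[OF that(1)] by (simp add: shift_def)
    also have "\<eta> + sngl j a + sngl j 1 = \<eta> + sngl j (Suc a)" by (simp add: add.assoc flip: single_add)
    finally show ?case using Suc by simp
  qed simp
  have "set xs \<subseteq> {..<m} \<Longrightarrow> foldr (\<lambda>j. d j ^^ lkp \<xi> j) xs (y (i, 0)) = y (i, \<Sum>j\<leftarrow>xs. sngl j (lkp \<xi> j)) \<and>
     (\<Sum>j\<leftarrow>xs. sngl j (lkp \<xi> j)) \<in> multi_indices m" for xs
    by (induction xs) (auto simp: 1 add.commute multi_indices_0 intro!: multi_indices_add multi_indices_single)
  moreover have "set [0..<m] \<subseteq> {..<m}" by auto
  ultimately have "foldr (\<lambda>j. d j ^^ lkp \<xi> j) [0..<m] (y (i, 0)) = y (i, \<Sum>j\<leftarrow>[0..<m]. sngl j (lkp \<xi> j))" by blast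
  moreover have "(\<Sum>j\<leftarrow>[0..<m]. sngl j (lkp \<xi> j)) = \<xi>"
  proof (rule poly_mapping_eqI)
    fix a
    have "(\<Sum>j\<leftarrow>[0..<m]. sngl j (lkp \<xi> j)) = (\<Sum>j<m. sngl j (lkp \<xi> j))"
      by (simp add: interv_sum_list_conv_sum_set_nat atLeast0LessThan)
    then show "lkp (\<Sum>j\<leftarrow>[0..<m]. sngl j (lkp \<xi> j)) a = lkp \<xi> a"
      using \<xi> by (auto simp: lookup_sum lookup_single when_def multi_indices_iff)
  qed
  moreover have "u i = y (i, 0)" using u w' by simp
  ultimately show ?thesis by (simp add: dterm_val_tdv w')
qed

text \<open>A valuation encodes a point together with its parameters: \<open>x\<close> occupies the
  positions below \<open>n\<close>, and \<open>y\<close> the next \<open>l\<close>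
  positions.\<close>

locale universal = dfld m \<delta> for m :: nat and \<delta> :: "nat \<Rightarrow> 'a::field_char_0 \<Rightarrow> 'a" +
  fixes k :: "'a set" and n l :: nat
  assumes dc: "differentially_closed m \<delta>" and sat: "saturated m \<delta>"
    and dsub: "differential_subfield m \<delta> k" and small: "k \<prec> (UNIV :: 'a set)"
begin

abbreviation "Xs \<equiv> {..<n}"
abbreviation "Ys \<equiv> {n..<n+l}"

definition val :: "(nat \<Rightarrow> 'a) \<Rightarrow> 'a dterm \<Rightarrow> 'a" where "val v t = dterm_val rta \<delta> id v t"

lemma val_simps [simp]:
  "val v (TVar x) = v x" "val v (TConst c) = c" "val v TZero = 0" "val v TOne = 1" "val v (TNeg s) = - val v s"
  "val v (TAdd s t) = val v s + val v t" "val v (TMul s t) = val v s * val v t" "val v (TDer j s) = \<delta> j (val v s)"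
  by (simp_all add: val_def)

lemma val_tsubst: "val v (tsubst \<sigma> t) = val (\<lambda>i. val v (\<sigma> i)) t"
  by (simp add: val_def dterm_val_tsubst)

lemma sat_FEq: "satisfies rta \<delta> id v (FEq s t) \<longleftrightarrow> val v s = val v t"
  by (simp add: val_def)

lemma sat_no_root: "satisfies rta \<delta> id v (no_root ts x) \<longleftrightarrow>
    (poly (Poly (map (val v) ts)) (val v x) = 0 \<longrightarrow> (\<forall>t\<in>set ts. val v t = 0))"
  using no_root_sat[where F="UNIV :: 'a set", folded rta_carrier, of \<delta> id v ts x] unfolding val_def .

text \<open>Generators of a differential ring instead of the field k\<langle>a\<rangle>; both have
  the same algebraic closure (\<open>parameters\<close>), so the leaders agree.\<close>

definition base :: "(nat \<Rightarrow> 'a) \<Rightarrow> 'a set" where "base v = k \<union> dv v ` idxs m Ys"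

definition EE :: "(nat \<Rightarrow> 'a) \<Rightarrow> dvar set" where "EE v = leads m Xs (base v) (dv v)"

text \<open>Differential specialisation over \<open>k\<close> of the parameters of \<open>v0\<close>
  to those of \<open>v\<close>.\<close>

definition spec :: "(nat \<Rightarrow> 'a) \<Rightarrow> (nat \<Rightarrow> 'a) \<Rightarrow> bool" where
  "spec v0 v \<longleftrightarrow> functional fst (rgen ((\<lambda>c. (c, c)) ` k \<union> (\<lambda>w. (dv v0 w, dv v w)) ` idxs m Ys))"

lemma k_closed: "rgen k \<subseteq> k" "\<And>j c. j < m \<Longrightarrow> c \<in> k \<Longrightarrow> \<delta> j c \<in> k" "dclosed k"
proof -
  have sf: "subfield k rta" and d: "\<And>j c. j < m \<Longrightarrow> c \<in> k \<Longrightarrow> \<delta> j c \<in> k" using dsub by (auto simp: differential_subfield_def)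
  show "rgen k \<subseteq> k"
  proof
    fix x assume "x \<in> rgen k" then show "x \<in> k" by induction (auto intro: subfield_rtaD[OF sf])
  qed
  show "\<delta> j c \<in> k" if "j < m" "c \<in> k" for j c using d that .
  show "dclosed k" using d by (auto simp: dclosed_def intro: rgen_base)
qed

lemma dclosed_base: "dclosed (base v)"
  unfolding base_def by (rule dclosed_idxs[OF k_closed(3)])

lemma EE_upclosed: "EE v \<subseteq> idxs m Xs" "upclosed m (EE v)"
  unfolding EE_def by (rule leads_idxs, rule upclosed_leads[OF _ dclosed_base]) simp

lemma val_tdv: "val v (tdv m w) = dv v w"
  by (simp add: val_def dterm_val_tdv dv_def der_pow_def)

lemma PF_PT: "f \<in> PF A W \<Longrightarrow> \<exists>t\<in>PT m A W. \<forall>v. val v t = f v"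
proof (induction rule: PF.induct)
  case PF_one then show ?case by (intro bexI[of _ TOne]) (auto intro: PT.intros)
next
  case (PF_const c) then show ?case by (intro bexI[of _ "TConst c"]) (auto intro: PT.intros)
next
  case (PF_var w) then show ?case using val_tdv PT.PT_var by blast
next
  case (PF_add f g)
  then obtain s t where "s \<in> PT m A W" "t \<in> PT m A W" "\<forall>v. val v s = f v" "\<forall>v. val v t = g v" by auto
  then show ?case by (intro bexI[of _ "TAdd s t"]) (auto intro: PT.intros)
next
  case (PF_neg f)
  then obtain s where "s \<in> PT m A W" "\<forall>v. val v s = f v" by auto
  then show ?case by (intro bexI[of _ "TNeg s"]) (auto intro: PT.intros)
next
  case (PF_mult f g)
  then obtain s t where "s \<in> PT m A W" "t \<in> PT m A W" "\<forall>v. val v s = f v" "\<forall>v. val v t = g v" by auto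
  then show ?case by (intro bexI[of _ "TMul s t"]) (auto intro: PT.intros)
qed

lemma infinite_k: "infinite k"
proof -
  have "of_nat i \<in> k" for i using rgen_of_nat[of i k] k_closed(1) by auto
  then have "range (of_nat :: nat \<Rightarrow> 'a) \<subseteq> k" by auto
  moreover have "infinite (range (of_nat :: nat \<Rightarrow> 'a))" using inj_of_nat range_inj_infinite by blast
  ultimately show ?thesis using finite_subset by blast
qed

lemma small_parameters: assumes "finite B" shows "k \<union> B \<prec> (UNIV :: 'a set)"
proof -
  have "k \<union> B \<lesssim> k"
    by (rule lepoll_Un[OF infinite_k lepoll_refl finite_lepoll_infinite[OF infinite_k assms]])
  then show ?thesis using small by (rule lesspoll_trans1)
qed

lemma realise:
  assumes "A \<prec> (UNIV :: 'a set)" "\<And>p. p \<in> T \<Longrightarrow> dform_over m A p \<and> free_vars p \<subseteq> {..<r}"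
    "\<And>T0. T0 \<subseteq> T \<Longrightarrow> finite T0 \<Longrightarrow> \<exists>v. \<forall>p\<in>T0. satisfies rta \<delta> id v p"
  shows "\<exists>v. \<forall>p\<in>T. satisfies rta \<delta> id v p"
  using sat assms unfolding saturated_def by metis

text \<open>Moves a point to other parameters without creating leaders. The set \<open>C\<close>
  holds the pulled-back initials and separants. Absence of leaders is an infinite scheme, so the new
  point is found as a realisation of a type over \<open>k\<close> and the new parameters, whose
  finite parts are satisfied in a suitable extension.\<close>

lemma lower_semicontinuity:
  "\<exists>C. finite C \<and> C \<subseteq> PF k (idxs m Ys) \<and> (\<forall>c\<in>C. c v0 \<noteq> 0) \<and>
    (\<forall>v. spec v0 v \<longrightarrow> (\<forall>c\<in>C. c v \<noteq> 0) \<longrightarrow> (\<exists>v'. (\<forall>i\<in>Ys. v' i = v i) \<and>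
       (\<forall>t. dterm_over m k t \<longrightarrow> dterm_vars t \<subseteq> {..<n+l} \<longrightarrow> val v0 t = 0 \<longrightarrow> val v' t = 0) \<and> EE v' \<subseteq> EE v0))"
proof -
  let ?A = "base v0" and ?E = "EE v0"
  let ?B = "\<lambda>w. rgen (base v0 \<union> dv v0 ` ini m Xs (rk m Xs w))"
  have fX: "finite Xs" by simp
  obtain H P where HP: "finite H" "0 \<notin> H" "\<forall>w\<in>?E. P w \<in> pov (?B w) \<and> P w \<noteq> 0 \<and> poly (P w) (dv v0 w) = 0 \<and>
    (\<forall>q. q \<in> pov (?B w) \<longrightarrow> q \<noteq> 0 \<longrightarrow> poly q (dv v0 w) = 0 \<longrightarrow> Polynomial.degree (P w) \<le> Polynomial.degree q) \<and>
    Polynomial.degree (P w) > 0 \<and> Polynomial.lead_coeff (P w) \<in> H \<and> sep (P w) (dv v0 w) \<in> H"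
    using leader_relations[OF fX dclosed_base, of v0 v0] unfolding EE_def by blast
  interpret sp: specialisation m Xs ?A "dv v0" H P "range (om_emb :: 'a \<Rightarrow> 'a omega)" om_T
  proof
    fix w assume "w \<in> leads m Xs (base v0) (dv v0)"
    then have w: "w \<in> ?E" by (simp add: EE_def)
    from HP(3)[rule_format, OF w] show "P w \<in> pov (?B w)" "P w \<noteq> 0" "poly (P w) (dv v0 w) = 0"
      "Polynomial.degree (P w) > 0" "Polynomial.lead_coeff (P w) \<in> H" "sep (P w) (dv v0 w) \<in> H" by simp_all
    show "Polynomial.degree (P w) \<le> Polynomial.degree q" if "q \<in> pov (?B w)" "q \<noteq> 0" "poly q (dv v0 w) = 0" for q
      using HP(3)[rule_format, OF w] that by blast
  qed (use HP(1,2) om_T_transcendental in auto)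
  obtain C0 where C0: "finite C0" "C0 \<subseteq> rgen ?A" "0 \<notin> C0" 
    "\<And>S. fst ` S = ?A \<Longrightarrow> snd ` S \<subseteq> range (om_emb :: 'a \<Rightarrow> 'a omega) \<Longrightarrow> functional fst (rgen S) \<Longrightarrow>
     \<forall>c\<in>C0. \<forall>c'. (c, c') \<in> rgen S \<longrightarrow> c' \<noteq> 0 \<Longrightarrow>
     \<exists>y. functional fst (rgen (S \<union> (\<lambda>w. (dv v0 w, y w)) ` idxs m Xs)) \<and>
       (\<forall>w\<in>idxs m Xs - leads m Xs ?A (dv v0). y w \<notin> acl (range om_emb \<union> y ` ini m Xs (rk m Xs w))) \<and>
       (\<forall>w\<in>leads m Xs ?A (dv v0). \<forall>s. (sep (P w) (dv v0 w), s) \<in> rgen (S \<union> (\<lambda>w. (dv v0 w, y w)) ` idxs m Xs) \<longrightarrow> s \<noteq> 0)"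
    using sp.specialise by blast
  have "\<forall>c\<in>C0. \<exists>f. f \<in> PF k (idxs m Ys) \<and> f v0 = c"
    using C0(2) rgen_eq_PF[of k v0 "idxs m Ys"] by (auto simp: base_def)
  from bchoice[OF this] obtain f where f: "\<And>c. c \<in> C0 \<Longrightarrow> f c \<in> PF k (idxs m Ys)" "\<And>c. c \<in> C0 \<Longrightarrow> f c v0 = c" by blast
  have main: "\<exists>v'. (\<forall>i\<in>Ys. v' i = v i) \<and>
       (\<forall>t. dterm_over m k t \<longrightarrow> dterm_vars t \<subseteq> {..<n+l} \<longrightarrow> val v0 t = 0 \<longrightarrow> val v' t = 0) \<and> EE v' \<subseteq> EE v0"
    if v: "spec v0 v" "\<forall>c\<in>f ` C0. c v \<noteq> 0" for v
  proof -
    let ?emb = "om_emb :: 'a \<Rightarrow> 'a omega"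
    \<comment> \<open>\<open>S0\<close> is the graph of the given specialisation of parameters, and
      \<open>S\<close> the same graph moved into the large field.\<close>
    define S0 where "S0 = (\<lambda>c. (c, c)) ` k \<union> (\<lambda>w. (dv v0 w, dv v w)) ` idxs m Ys"
    define S where "S = (\<lambda>c. (c, ?emb c)) ` k \<union> (\<lambda>w. (dv v0 w, ?emb (dv v w))) ` idxs m Ys"
    let ?\<pi> = "\<lambda>x :: 'a \<times> 'a. (fst x, ?emb (snd x))"
    have hom: "rhom ?\<pi>" by (simp add: rhom_def prod_eq_iff rhomD[OF om_emb(1)])
    have "S = ?\<pi> ` S0" by (auto simp: S_def S0_def image_Un image_image)
    then have rS: "rgen S = ?\<pi> ` rgen S0" by (simp add: rhom_image_rgen[OF hom])
    have fS0: "functional fst (rgen S0)" using v(1) by (simp add: spec_def S0_def)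
    have fS: "functional fst (rgen S)"
      unfolding functional_def rS using functionalD[OF fS0] rhomD(4)[OF om_emb(1)] by (auto simp: prod_eq_iff)
    have SA: "fst ` S = base v0" "snd ` S \<subseteq> range ?emb"
      by (auto simp: S_def base_def image_Un image_image)
    have nz: "\<forall>c\<in>C0. \<forall>c'. (c, c') \<in> rgen S \<longrightarrow> c' \<noteq> 0"
    proof (intro ballI allI impI)
      fix c c' assume c: "c \<in> C0" "(c, c') \<in> rgen S"
      then obtain b where b: "(c, b) \<in> rgen S0" "c' = ?emb b" unfolding rS by auto
      have "(c, f c v) \<in> rgen S0" using PF_pair[OF f(1)[OF c(1)], of v0 v] f(2)[OF c(1)] by (simp add: S0_def)
      then have "b = f c v" using functional_eq[OF fS0 b(1)] by simp
      then have "b \<noteq> 0" using v(2) c(1) by simp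
      then show "c' \<noteq> 0" using b(2) injD[OF om_emb(2), of b 0] rhomD(4)[OF om_emb(1)] by auto
    qed
    obtain y where y: "functional fst (rgen (S \<union> (\<lambda>w. (dv v0 w, y w)) ` idxs m Xs))"
       "\<forall>w\<in>idxs m Xs - leads m Xs (base v0) (dv v0). y w \<notin> acl (range ?emb \<union> y ` ini m Xs (rk m Xs w))"
       "\<forall>w\<in>leads m Xs (base v0) (dv v0). \<forall>s. (sep (P w) (dv v0 w), s) \<in> rgen (S \<union> (\<lambda>w. (dv v0 w, y w)) ` idxs m Xs) \<longrightarrow> s \<noteq> 0"
      using C0(4)[OF SA fS nz] by blast
    let ?K = "range ?emb"
    have "\<exists>F D. subfield F rta \<and> ?K \<union> y ` idxs m Xs \<subseteq> F \<and> F \<subseteq> acl (?K \<union> y ` idxs m Xs) \<and>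
      (\<forall>j<m. \<forall>x\<in>F. D j x \<in> F) \<and> 
      (\<forall>j<m. \<forall>x\<in>F. \<forall>y\<in>F. D j (x + y) = D j x + D j y \<and> D j (x * y) = D j x * y + x * D j y) \<and>
      (\<forall>i<m. \<forall>j<m. \<forall>x\<in>F. D i (D j x) = D j (D i x)) \<and>
      (\<forall>j<m. \<forall>c. D j (?emb c) = ?emb (\<delta> j c)) \<and> (\<forall>j<m. \<forall>w\<in>idxs m Xs. D j (y w) = y (shift j w))"
    proof (rule differential_extension[OF fX om_emb k_closed(2), where Y = Ys and ?v0.0 = v0 and v = v and P = P])
      show "functional fst (rgen ((\<lambda>c. (c, ?emb c)) ` k \<union> (\<lambda>w. (dv v0 w, ?emb (dv v w))) ` idxs m Ys \<union> (\<lambda>w. (dv v0 w, y w)) ` idxs m Xs))"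
        using y(1) by (simp add: S_def)
      fix w
      show "w \<in> idxs m Xs \<Longrightarrow> w \<notin> leads m Xs (k \<union> dv v0 ` idxs m Ys) (dv v0) \<Longrightarrow> y w \<notin> acl (range ?emb \<union> y ` ini m Xs (rk m Xs w))"
        using y(2) by (simp add: base_def)
      assume w: "w \<in> leads m Xs (k \<union> dv v0 ` idxs m Ys) (dv v0)"
      then have wE: "w \<in> ?E" by (simp add: EE_def base_def)
      show "P w \<in> pov (rgen (k \<union> dv v0 ` idxs m Ys \<union> dv v0 ` ini m Xs (rk m Xs w)))" "poly (P w) (dv v0 w) = 0"
        using HP(3)[rule_format, OF wE] by (simp_all add: base_def)
      fix s assume "(sep (P w) (dv v0 w), s) \<in> rgen ((\<lambda>c. (c, ?emb c)) ` k \<union> (\<lambda>w. (dv v0 w, ?emb (dv v w))) ` idxs m Ys \<union> (\<lambda>w. (dv v0 w, y w)) ` idxs m Xs)"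
      then show "s \<noteq> 0" using y(3) w by (simp add: base_def S_def)
    qed
    then obtain F D where F: "subfield F rta" "?K \<union> y ` idxs m Xs \<subseteq> F" "F \<subseteq> acl (?K \<union> y ` idxs m Xs)"
      and D1: "\<forall>j<m. \<forall>x\<in>F. D j x \<in> F"
      and D2: "\<forall>j<m. \<forall>x\<in>F. \<forall>y\<in>F. D j (x + y) = D j x + D j y \<and> D j (x * y) = D j x * y + x * D j y"
      and D3: "\<forall>i<m. \<forall>j<m. \<forall>x\<in>F. D i (D j x) = D j (D i x)"
      and D4: "\<forall>j<m. \<forall>c. D j (?emb c) = ?emb (\<delta> j c)"
      and D5: "\<forall>j<m. \<forall>w\<in>idxs m Xs. D j (y w) = y (shift j w)"
      by (elim exE conjE)
    have D: "\<And>j x. j < m \<Longrightarrow> x \<in> F \<Longrightarrow> D j x \<in> F"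
      "\<And>j x y. j < m \<Longrightarrow> x \<in> F \<Longrightarrow> y \<in> F \<Longrightarrow> D j (x + y) = D j x + D j y"
      "\<And>j x y. j < m \<Longrightarrow> x \<in> F \<Longrightarrow> y \<in> F \<Longrightarrow> D j (x * y) = D j x * y + x * D j y"
      "\<And>i j x. i < m \<Longrightarrow> j < m \<Longrightarrow> x \<in> F \<Longrightarrow> D i (D j x) = D j (D i x)"
      "\<And>j c. j < m \<Longrightarrow> D j (?emb c) = ?emb (\<delta> j c)"
      "\<And>j w. j < m \<Longrightarrow> w \<in> idxs m Xs \<Longrightarrow> D j (y w) = y (shift j w)"
      using D1 D2 D3 D4 D5 by simp_all
    note Fcl = subfield_rtaD[OF F(1)]
    have embF: "?emb c \<in> F" for c using F(2) by auto
    have inf: "infinite (UNIV :: 'a set)" by (rule infinite_UNIV_char_0)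
    have "?K \<union> y ` idxs m Xs \<lesssim> (UNIV :: 'a set)"
      by (intro lepoll_Un[OF inf] image_lepoll countable_lepoll_infinite[OF inf] countable_image countable_dvars)
    then have FK: "F \<lesssim> (UNIV :: 'a set)" using acl_lepoll[OF inf] F(3) by (meson lepoll_trans subset_imp_lepoll)
    let ?RF = "rta\<lparr>carrier := F\<rparr>"
    have neg: "\<ominus>\<^bsub>?RF\<^esub> x = - x" if "x \<in> F" for x by (rule subfield_rta_ops(2)[OF F(1) that])
    let ?\<Gamma> = "rgen (S \<union> (\<lambda>w. (dv v0 w, y w)) ` idxs m Xs)"
    \<comment> \<open>\<open>u'\<close> evaluates all variables in the extension. In the formulas
      \<open>\<sigma>\<close> replaces the parameters by constants, so that only the
      \<open>n\<close> point variables stay free; \<open>u\<close> is the valuation for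
      these.\<close>
    define u where "u = (\<lambda>i. if i < n then y (i, 0) else 0)"
    define u' where "u' = (\<lambda>i. if i < n then y (i, 0) else ?emb (v i))"
    define \<sigma> where "\<sigma> = (\<lambda>i. if i < n then TVar i else TConst (v i))"
    have XI: "(i, 0) \<in> idxs m Xs" if "i < n" for i using that by (simp add: idxs_def multi_indices_0)
    have uF: "u i \<in> F" for i using F(2) XI Fcl(2) by (auto simp: u_def)
    have \<sigma>u: "(\<lambda>i. dterm_val ?RF D ?emb u (\<sigma> i)) = u'" by (auto simp: \<sigma>_def u_def u'_def)
    have rgenF: "rgen (?K \<union> y ` idxs m Xs) \<subseteq> F"
    proof
      fix x assume "x \<in> rgen (?K \<union> y ` idxs m Xs)" then show "x \<in> F"
        by induction (use F(2) Fcl in auto)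
    qed
    have \<Gamma>F: "b \<in> F" if "(a, b) \<in> ?\<Gamma>" for a b
    proof -
      have "b \<in> snd ` ?\<Gamma>" using that by force
      also have "snd ` ?\<Gamma> \<subseteq> rgen (?K \<union> y ` idxs m Xs)"
        unfolding rhom_image_rgen[OF rhom_snd] by (rule rgen_mono) (use SA(2) in auto)
      finally show ?thesis using rgenF by auto
    qed
    have \<Gamma>F': "snd x \<in> F" if "x \<in> ?\<Gamma>" for x using \<Gamma>F[of "fst x" "snd x"] that by simp
    \<comment> \<open>\<open>?\<Gamma>\<close> is stable under simultaneous derivation, so the
      values of a differential term at \<open>v0\<close> and in the extension form a pair of the
      graph.\<close>
    have \<Gamma>D: "(\<delta> j a, D j b) \<in> ?\<Gamma>" if "(a, b) \<in> ?\<Gamma>" "j < m" for a b j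
    proof -
      have D0: "D j 0 = 0" "D j 1 = 0" using D(5)[OF that(2), of 0] D(5)[OF that(2), of 1]
        by (simp_all add: rhomD[OF om_emb(1)] derD[OF der[OF that(2)]])
      have Dneg: "D j (- x) = - D j x" if "x \<in> F" for x
        using D(2)[OF \<open>j < m\<close> that Fcl(4)[OF that]] D0 by (simp add: eq_neg_iff_add_eq_0 add.commute)
      have "(\<delta> j (fst x), D j (snd x)) \<in> ?\<Gamma>" if "x \<in> ?\<Gamma>" for x
        using that
      proof induction
        case rgen_one
        show ?case using rgen_zero[of "S \<union> (\<lambda>w. (dv v0 w, y w)) ` idxs m Xs"]
          by (simp add: D0 derD[OF der[OF \<open>j < m\<close>]] zero_prod_def)
      next
        case (rgen_base x)
        then consider c where "c \<in> k" "x = (c, ?emb c)" | w where "w \<in> idxs m Ys" "x = (dv v0 w, ?emb (dv v w))"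
          | w where "w \<in> idxs m Xs" "x = (dv v0 w, y w)" by (auto simp: S_def)
        then show ?case
        proof cases
          case 1
          then have "(\<delta> j c, ?emb (\<delta> j c)) \<in> S" using k_closed(2)[OF \<open>j < m\<close>] by (simp add: S_def)
          then show ?thesis using 1 D(5)[OF \<open>j < m\<close>] by (simp add: rgen.rgen_base)
        next
          case 2
          then have "(dv v0 (shift j w), ?emb (dv v (shift j w))) \<in> S"
            using shift_idxs[OF _ \<open>j < m\<close>] unfolding S_def by blast
          then show ?thesis using 2 D(5)[OF \<open>j < m\<close>] by (simp add: rgen.rgen_base dv_shift[OF \<open>j < m\<close>])
        next
          case 3
          then have "(dv v0 (shift j w), y (shift j w)) \<in> (\<lambda>w. (dv v0 w, y w)) ` idxs m Xs"
            using shift_idxs[OF _ \<open>j < m\<close>] by blast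
          then show ?thesis using 3 D(6)[OF \<open>j < m\<close>] by (simp add: rgen.rgen_base dv_shift[OF \<open>j < m\<close>])
        qed
      next
        case (rgen_add p q)
        have "snd p \<in> F" "snd q \<in> F" by (rule \<Gamma>F', rule rgen_add(1), rule \<Gamma>F', rule rgen_add(2))
        then have "(\<delta> j (fst (p + q)), D j (snd (p + q))) = (\<delta> j (fst p), D j (snd p)) + (\<delta> j (fst q), D j (snd q))"
          by (simp add: plus_prod_def D(2)[OF \<open>j < m\<close>] derD[OF der[OF \<open>j < m\<close>]])
        then show ?case using rgen.rgen_add[OF rgen_add(3,4)] by simp
      next
        case (rgen_neg p)
        have "snd p \<in> F" by (rule \<Gamma>F'[OF rgen_neg(1)])
        then have "(\<delta> j (fst (- p)), D j (snd (- p))) = - (\<delta> j (fst p), D j (snd p))"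
          by (simp add: uminus_prod_def Dneg derD[OF der[OF \<open>j < m\<close>]])
        then show ?case using rgen.rgen_neg[OF rgen_neg(2)] by simp
      next
        case (rgen_mult p q)
        have "snd p \<in> F" "snd q \<in> F" by (rule \<Gamma>F', rule rgen_mult(1), rule \<Gamma>F', rule rgen_mult(2))
        then have "(\<delta> j (fst (p * q)), D j (snd (p * q))) = (\<delta> j (fst p), D j (snd p)) * q + p * (\<delta> j (fst q), D j (snd q))"
          by (simp add: plus_prod_def times_prod_def D(3)[OF \<open>j < m\<close>] derD[OF der[OF \<open>j < m\<close>]])
        then show ?case using rgen.rgen_add[OF rgen.rgen_mult[OF rgen_mult(3,2)] rgen.rgen_mult[OF rgen_mult(1,4)]] by simp
      qed
      from this[OF that(1)] show ?thesis by simp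
    qed
    have \<Gamma>val: "(val v0 t, dterm_val ?RF D ?emb u' t) \<in> ?\<Gamma>" if "dterm_over m k t" "dterm_vars t \<subseteq> {..<n+l}" for t
      using that
    proof (induction t)
      case (TVar i)
      show ?case
      proof (cases "i < n")
        case True
        then have "(dv v0 (i, 0), y (i, 0)) \<in> ?\<Gamma>" using XI by (intro rgen_base UnI2) (rule imageI)
        then show ?thesis using True by (simp add: dv_0 u'_def)
      next
        case False
        then have "(i, 0) \<in> idxs m Ys" using TVar by (simp add: idxs_def multi_indices_0)
        then have "(dv v0 (i, 0), ?emb (dv v (i, 0))) \<in> ?\<Gamma>" unfolding S_def by (intro rgen_base) blast
        then show ?thesis using False by (simp add: dv_0 u'_def)
      qed
    next
      case (TConst c) then show ?case by (auto simp: S_def intro!: rgen_base)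
    next
      case TZero then show ?case using rgen_zero[of "S \<union> (\<lambda>w. (dv v0 w, y w)) ` idxs m Xs"] by (simp add: zero_prod_def)
    next
      case TOne then show ?case using rgen_one[of "S \<union> (\<lambda>w. (dv v0 w, y w)) ` idxs m Xs"] by (simp add: one_prod_def)
    next
      case (TNeg t)
      then have t: "(val v0 t, dterm_val ?RF D ?emb u' t) \<in> ?\<Gamma>" by simp
      from rgen_neg[OF t] show ?case using \<Gamma>F[OF t] by (simp add: uminus_prod_def neg)
    next
      case (TAdd s t)
      then have "(val v0 s, dterm_val ?RF D ?emb u' s) \<in> ?\<Gamma>" "(val v0 t, dterm_val ?RF D ?emb u' t) \<in> ?\<Gamma>" by simp_all
      from rgen_add[OF this] show ?case by (simp add: plus_prod_def)
    next
      case (TMul s t)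
      then have "(val v0 s, dterm_val ?RF D ?emb u' s) \<in> ?\<Gamma>" "(val v0 t, dterm_val ?RF D ?emb u' t) \<in> ?\<Gamma>" by simp_all
      from rgen_mult[OF this] show ?case by (simp add: times_prod_def)
    next
      case (TDer j t)
      then have "dterm_over m k t" "dterm_vars t \<subseteq> {..<n+l}" "j < m" by simp_all
      from \<Gamma>D[OF TDer.IH[OF this(1,2)] this(3)] show ?case by simp
    qed
    have tdvX: "dterm_val ?RF D ?emb u' (tdv m w) = y w" "dterm_val ?RF D ?emb u (tdv m w) = y w" if "w \<in> idxs m Xs" for w
      using that D(6) by (auto intro!: dterm_val_tdv_seq[of m Xs] simp: u_def u'_def idxs_def)
    have tdvY: "dterm_val ?RF D ?emb u' (tdv m w) = ?emb (dv v w)" if "w \<in> idxs m Ys" for w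
    proof (rule dterm_val_tdv_seq[OF _ that])
      show "D j (?emb (dv v w)) = ?emb (dv v (shift j w))" if "j < m" for j w using that D(5) by (simp add: dv_shift)
      show "u' (fst w) = ?emb (dv v (fst w, 0))" using that by (auto simp: u'_def dv_0 idxs_def)
    qed
    have PTval: "dterm_val ?RF D ?emb u' t \<in> rgen (?K \<union> y ` ini m Xs N)"
      if "t \<in> PT m k (ini m Xs N \<union> idxs m Ys)" for t N
      using that
    proof induction
      case (PT_var w)
      then show ?case
      proof
        assume w: "w \<in> ini m Xs N"
        then have "w \<in> idxs m Xs" by (simp add: ini_def)
        then show ?thesis using w by (simp add: tdvX rgen_base)
      next
        assume "w \<in> idxs m Ys"
        then show ?thesis by (simp add: tdvY rgen_base)
      qed
    next
      case (PT_neg s)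
      have "rgen (?K \<union> y ` ini m Xs N) \<subseteq> rgen (?K \<union> y ` idxs m Xs)"
        by (intro rgen_mono Un_mono image_mono ini_idxs order_refl)
      then have "dterm_val ?RF D ?emb u' s \<in> F" using PT_neg(2) rgenF by auto
      then show ?case using PT_neg(2) by (simp add: neg rgen_neg)
    qed (auto intro: rgen.intros)
    \<comment> \<open>\<open>T1\<close> transports every equation over \<open>k\<close> valid at
      \<open>v0\<close>; \<open>T2\<close> keeps each non-leader of \<open>v0\<close> transcendental
      over the parameters and the lower derivatives.\<close>
    define T1 where "T1 = {FEq (tsubst \<sigma> t) TZero |t. dterm_over m k t \<and> dterm_vars t \<subseteq> {..<n+l} \<and> val v0 t = 0}"
    define T2 where "T2 = {no_root (map (tsubst \<sigma>) ts) (tdv m w) |ts w. w \<in> idxs m Xs - ?E \<and> set ts \<subseteq> PT m k (ini m Xs (rk m Xs w) \<union> idxs m Ys)}"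
    let ?A' = "k \<union> v ` {n..<n+l}"
    have \<sigma>over: "dterm_over m ?A' (tsubst \<sigma> t) \<and> dterm_vars (tsubst \<sigma> t) \<subseteq> {..<n}" if "dterm_over m k t" "dterm_vars t \<subseteq> {..<n+l}" for t
    proof
      show "dterm_over m ?A' (tsubst \<sigma> t)"
        by (rule dterm_over_tsubst[OF dterm_over_mono[OF _ that(1)]]) (use that(2) in \<open>auto simp: \<sigma>_def\<close>)
      show "dterm_vars (tsubst \<sigma> t) \<subseteq> {..<n}" using that(2) by (auto simp: dterm_vars_tsubst \<sigma>_def split: if_splits)
    qed
    have PTo: "dterm_over m k t \<and> dterm_vars t \<subseteq> {..<n+l}" if "t \<in> PT m k (ini m Xs N \<union> idxs m Ys)" for t N
      using PT_over[OF that] ini_idxs[of m Xs N] by (fastforce simp: idxs_def)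
    have forms: "dform_over m ?A' p \<and> free_vars p \<subseteq> {..<n} \<and> quantifier_free p \<and> satisfies ?RF D ?emb u p" if "p \<in> T1 \<union> T2" for p
      using that
    proof
      assume "p \<in> T1"
      then obtain t where t: "p = FEq (tsubst \<sigma> t) TZero" "dterm_over m k t" "dterm_vars t \<subseteq> {..<n+l}" "val v0 t = 0" by (auto simp: T1_def)
      have "fst (val v0 t, dterm_val ?RF D ?emb u' t) = 0" using t(4) by simp
      from functionalD[OF y(1) \<Gamma>val[OF t(2,3)] this] have "dterm_val ?RF D ?emb u' t = 0" by (simp add: zero_prod_def)
      then show ?thesis using \<sigma>over[OF t(2,3)] by (simp add: t(1) dterm_val_tsubst \<sigma>u)
    next
      assume "p \<in> T2"
      then obtain ts w where p: "p = no_root (map (tsubst \<sigma>) ts) (tdv m w)" and w: "w \<in> idxs m Xs" "w \<notin> ?E"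
        and ts: "set ts \<subseteq> PT m k (ini m Xs (rk m Xs w) \<union> idxs m Ys)" by (auto simp: T2_def)
      let ?cs = "map (dterm_val ?RF D ?emb u') ts"
      have cs: "set ?cs \<subseteq> rgen (?K \<union> y ` ini m Xs (rk m Xs w))" using PTval ts by auto
      have "Poly ?cs \<in> pov (rgen (?K \<union> y ` ini m Xs (rk m Xs w)))"
        using cs by (auto simp: pov_def nth_default_def rgen_zero)
      moreover have "y w \<notin> acl (?K \<union> y ` ini m Xs (rk m Xs w))" using y(2) w by (simp add: EE_def)
      ultimately have "poly (Poly ?cs) (y w) = 0 \<Longrightarrow> Poly ?cs = 0" by (auto simp: acl_def)
      then have "poly (Poly ?cs) (y w) = 0 \<Longrightarrow> \<forall>t\<in>set ts. dterm_val ?RF D ?emb u' t = 0"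
        unfolding Poly_eq_0 by (metis (no_types, lifting) image_eqI in_set_replicate list.set_map)
      then have "satisfies ?RF D ?emb u p"
        unfolding p no_root_sat by (simp add: tdvX(2)[OF w(1)] dterm_val_tsubst \<sigma>u comp_def)
      moreover have so: "dterm_over m ?A' t \<and> dterm_vars t \<subseteq> {..<n}" if "t \<in> set (map (tsubst \<sigma>) ts)" for t
      proof -
        from that obtain s where s: "s \<in> set ts" "t = tsubst \<sigma> s" by auto
        have "dterm_over m k s \<and> dterm_vars s \<subseteq> {..<n+l}" using PTo[OF subsetD[OF ts s(1)]] .
        then show ?thesis using \<sigma>over s(2) by blast
      qed
      have "dform_over m ?A' p" "quantifier_free p"
        unfolding p by (rule no_root_over[OF tdv_over(1) so[THEN conjunct1]], assumption)+
      moreover have "free_vars p \<subseteq> {..<n}"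
      proof -
        have "free_vars p \<subseteq> dterm_vars (tdv m w :: 'a dterm) \<union> (\<Union>t\<in>set (map (tsubst \<sigma>) ts). dterm_vars t)"
          unfolding p by (rule no_root_vars)
        also have "\<dots> \<subseteq> {..<n}" using so w(1) by (intro Un_least UN_least) (auto simp: tdv_over idxs_def)
        finally show ?thesis .
      qed
      ultimately show ?thesis by simp
    qed
    have "\<exists>v1. \<forall>p\<in>T1 \<union> T2. satisfies rta \<delta> id v1 p"
    proof (rule realise[of ?A' _ n])
      show "?A' \<prec> (UNIV :: 'a set)" by (rule small_parameters) simp
      show "dform_over m ?A' p \<and> free_vars p \<subseteq> {..<n}" if "p \<in> T1 \<union> T2" for p using forms[OF that] by simp
      fix T0 assume T0: "T0 \<subseteq> T1 \<union> T2" "finite T0"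
      obtain ps where ps: "set ps = T0" using finite_list[OF T0(2)] by blast
      have "\<exists>w. satisfies rta \<delta> id w (conj_list ps)"
      proof (rule transported_solution[where m = m and \<delta> = \<delta> and F = F and D = D and emb = ?emb and u = u and p = "conj_list ps"])
        show "differentially_closed m \<delta>" "subfield F rta" "F \<lesssim> (UNIV :: 'a set)" "rhom ?emb"
          by (fact dc F(1) FK om_emb(1))+
        show "D j x \<in> F" if "j < m" "x \<in> F" for j x using D(1) that .
        show "D j (x + y) = D j x + D j y" "D j (x * y) = D j x * y + x * D j y" if "j < m" "x \<in> F" "y \<in> F" for j x y
          using D(2,3) that by auto
        show "D i (D j x) = D j (D i x)" if "i < m" "j < m" "x \<in> F" for i j x using D(4) that .
        show "D j (?emb c) = ?emb (\<delta> j c)" if "j < m" for j c using D(5) that .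
        show "range ?emb \<subseteq> F" using embF by auto
        show "quantifier_free (conj_list ps)" "satisfies ?RF D ?emb u (conj_list ps)"
          using forms T0(1) ps by (auto simp: conj_list)
        show "dform_over m UNIV (conj_list ps)"
          using forms T0(1) ps dform_over_mono[of ?A' UNIV] unfolding conj_list by blast
        show "u i \<in> F" for i by (rule uF)
      qed
      then show "\<exists>v. \<forall>p\<in>T0. satisfies rta \<delta> id v p" by (simp add: conj_list ps)
    qed
    then obtain v1 where v1: "\<And>p. p \<in> T1 \<union> T2 \<Longrightarrow> satisfies rta \<delta> id v1 p" by blast
    define v' where "v' = (\<lambda>i. if i < n then v1 i else v i)"
    have \<sigma>v: "(\<lambda>i. val v1 (\<sigma> i)) = v'" by (auto simp: \<sigma>_def v'_def)
    have "val v' t = 0" if "dterm_over m k t" "dterm_vars t \<subseteq> {..<n+l}" "val v0 t = 0" for t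
    proof -
      have "FEq (tsubst \<sigma> t) TZero \<in> T1" using that by (auto simp: T1_def)
      from v1[OF UnI1[OF this]] have "val v1 (tsubst \<sigma> t) = 0" unfolding sat_FEq by simp
      then show ?thesis by (simp add: val_tsubst \<sigma>v)
    qed
    \<comment> \<open>A relation making \<open>w\<close> a leader at \<open>v'\<close> is rewritten
      with terms as coefficients; \<open>T2\<close> contains the very formula that forbids
      it.\<close>
    moreover have "w \<in> ?E" if "w \<in> EE v'" for w
    proof (rule ccontr)
      assume nE: "w \<notin> ?E"
      have w: "w \<in> idxs m Xs" "dv v' w \<in> acl (base v' \<union> dv v' ` ini m Xs (rk m Xs w))" using that by (auto simp: EE_def leads_def)
      then obtain p where p: "p \<in> pov (rgen (base v' \<union> dv v' ` ini m Xs (rk m Xs w)))" "p \<noteq> 0" "poly p (dv v' w) = 0"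
        by (auto simp: acl_def)
      let ?W = "ini m Xs (rk m Xs w) \<union> idxs m Ys"
      have eq: "base v' \<union> dv v' ` ini m Xs (rk m Xs w) = k \<union> dv v' ` ?W" by (auto simp: base_def)
      have "\<exists>t\<in>PT m k ?W. val v' t = Polynomial.coeff p i" for i
      proof -
        have "Polynomial.coeff p i \<in> rgen (k \<union> dv v' ` ?W)" using p(1) eq by (simp add: pov_def)
        then obtain h where "h \<in> PF k ?W" "h v' = Polynomial.coeff p i" unfolding rgen_eq_PF by auto
        then show ?thesis using PF_PT[of h] by metis
      qed
      then obtain t where t: "t i \<in> PT m k ?W" "val v' (t i) = Polynomial.coeff p i" for i by metis
      let ?ts = "map t [0..<Suc (Polynomial.degree p)]"
      have "no_root (map (tsubst \<sigma>) ?ts) (tdv m w) \<in> T1 \<union> T2"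
      proof (intro UnI2)
        have "set ?ts \<subseteq> PT m k ?W" using t(1) by auto
        then show "no_root (map (tsubst \<sigma>) ?ts) (tdv m w) \<in> T2" unfolding T2_def using w(1) nE by blast
      qed
      from v1[OF this] have "poly (Poly (map (val v') ?ts)) (val v1 (tdv m w)) = 0 \<longrightarrow> (\<forall>t\<in>set ?ts. val v' t = 0)"
        unfolding sat_no_root by (simp add: val_tsubst \<sigma>v comp_def del: upt_Suc)
      moreover have "val v1 (tdv m w) = dv v' w"
        unfolding val_tdv by (rule dv_cong) (use w(1) in \<open>auto simp: v'_def idxs_def\<close>)
      moreover have "Poly (map (val v') ?ts) = p"
        by (rule poly_eqI) (auto simp: nth_default_def t(2) coeff_eq_0 simp del: upt_Suc)
      ultimately have "\<forall>t\<in>set ?ts. val v' t = 0" using p(3) by simp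
      then have "val v' (t (Polynomial.degree p)) = 0" by simp
      then show False using t(2) p(2) by simp
    qed
    ultimately show ?thesis by (intro exI[of _ v']) (auto simp: v'_def)
  qed
  have nzC: "\<forall>c\<in>f ` C0. c v0 \<noteq> 0"
    using f(2) C0(3) by auto
  show ?thesis
    by (intro exI[of _ "f ` C0"] conjI allI impI main nzC) (use C0(1) f(1) in auto)
qed

end


section \<open>Finitely many values\<close>

lemma (in dfld) rgen_pair_PF:
  assumes "x \<in> rgen ((\<lambda>c. (c, c)) ` A \<union> (\<lambda>w. (dv v w, dv v' w)) ` W)"
  shows "\<exists>f\<in>PF A W. x = (f v, f v')"
  using assms
proof induction
  case rgen_one then show ?case by (intro bexI[of _ "\<lambda>v. 1"]) (auto intro: PF.intros simp: one_prod_def)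
next
  case (rgen_base x)
  then show ?case
  proof
    assume "x \<in> (\<lambda>c. (c, c)) ` A"
    then obtain c where "c \<in> A" "x = (c, c)" by auto
    then show ?thesis by (intro bexI[of _ "\<lambda>v. c"]) (auto intro: PF.intros)
  next
    assume "x \<in> (\<lambda>w. (dv v w, dv v' w)) ` W"
    then obtain w where "w \<in> W" "x = (dv v w, dv v' w)" by blast
    then show ?thesis by (intro bexI[of _ "\<lambda>v. dv v w"]) (auto intro: PF.intros)
  qed
next
  case (rgen_add x y)
  then obtain f g where "f \<in> PF A W" "g \<in> PF A W" "x = (f v, f v')" "y = (g v, g v')" by blast
  then show ?case by (intro bexI[of _ "\<lambda>v. f v + g v"]) (auto intro: PF.intros)
next
  case (rgen_neg x)
  then obtain f where "f \<in> PF A W" "x = (f v, f v')" by blast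
  then show ?case by (intro bexI[of _ "\<lambda>v. - f v"]) (auto intro: PF.intros)
next
  case (rgen_mult x y)
  then obtain f g where "f \<in> PF A W" "g \<in> PF A W" "x = (f v, f v')" "y = (g v, g v')" by blast
  then show ?case by (intro bexI[of _ "\<lambda>v. f v * g v"]) (auto intro: PF.intros simp: times_prod_def)
qed

context universal
begin

abbreviation "PFa \<equiv> PF k (idxs m {..<n+l})"
abbreviation "PFy \<equiv> PF k (idxs m Ys)"

text \<open>Equations and inequations of a basic constructible set; \<open>wfc\<close> makes them
  finite in number and defined over \<open>k\<close>.\<close>

type_synonym 'x cond = "((nat \<Rightarrow> 'x) \<Rightarrow> 'x) set \<times> ((nat \<Rightarrow> 'x) \<Rightarrow> 'x) set"

definition near :: "'a cond \<Rightarrow> (nat \<Rightarrow> 'a) \<Rightarrow> bool" where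
  "near q v \<longleftrightarrow> (\<forall>f\<in>fst q. f v = 0) \<and> (\<forall>f\<in>snd q. f v \<noteq> 0)"

definition wfc :: "'a cond \<Rightarrow> bool" where
  "wfc q \<longleftrightarrow> finite (fst q) \<and> finite (snd q) \<and> fst q \<subseteq> PFa \<and> snd q \<subseteq> PFa"

lemma PFy_PFa: "PFy \<subseteq> PFa"
  by (rule PF_mono) (auto simp: idxs_def)

lemma PF_term:
  assumes "f \<in> PFa" shows "\<exists>t. dterm_over m k t \<and> dterm_vars t \<subseteq> {..<n+l} \<and> (\<forall>v. val v t = f v)"
proof -
  obtain t where t: "t \<in> PT m k (idxs m {..<n+l})" "\<forall>v. val v t = f v" using PF_PT[OF assms] by blast
  have "fst ` idxs m {..<n+l} \<subseteq> {..<n+l}" by (auto simp: idxs_def)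
  then show ?thesis using PT_over[OF t(1)] t(2) by blast
qed

lemma cond_formula:
  assumes "wfc q"
  shows "\<exists>p. dform_over m k p \<and> free_vars p \<subseteq> {..<n+l} \<and> (\<forall>v. satisfies rta \<delta> id v p \<longleftrightarrow> near q v)"
proof -
  have "\<forall>f\<in>PFa. \<exists>t. dterm_over m k t \<and> dterm_vars t \<subseteq> {..<n+l} \<and> (\<forall>v. val v t = f v)" using PF_term by blast
  from bchoice[OF this] obtain t where t: "\<And>f. f \<in> PFa \<Longrightarrow> dterm_over m k (t f) \<and> dterm_vars (t f) \<subseteq> {..<n+l} \<and> (\<forall>v. val v (t f) = f v)"
    by blast
  obtain xs where xs: "set xs = (\<lambda>f. FEq (t f) TZero) ` fst q \<union> (\<lambda>f. FNot (FEq (t f) TZero)) ` snd q"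
    using assms finite_list[of "(\<lambda>f. FEq (t f) TZero) ` fst q \<union> (\<lambda>f. FNot (FEq (t f) TZero)) ` snd q"] by (auto simp: wfc_def)
  have tq: "dterm_over m k (t f)" "dterm_vars (t f) \<subseteq> {..<n+l}" "val v (t f) = f v" if "f \<in> fst q \<union> snd q" for f v
    using t[of f] that assms by (auto simp: wfc_def)
  have "dform_over m k (conj_list xs)" "free_vars (conj_list xs) \<subseteq> {..<n+l}"
    unfolding conj_list xs using tq(1,2) by auto
  moreover have "satisfies rta \<delta> id v (conj_list xs) \<longleftrightarrow> near q v" for v
  proof -
    have "satisfies rta \<delta> id v (conj_list xs) \<longleftrightarrow> (\<forall>f\<in>fst q. val v (t f) = 0) \<and> (\<forall>f\<in>snd q. val v (t f) \<noteq> 0)"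
      unfolding conj_list xs ball_Un ball_simps satisfies.simps(2) sat_FEq val_simps ..
    then show ?thesis using tq(3) by (simp add: near_def)
  qed
  ultimately show ?thesis by blast
qed

text \<open>If no finite part of the cover sufficed, the formulas of \<open>\<H>\<close> and the
  negations of those of \<open>\<Q>\<close> would be finitely satisfiable, and saturation over
  \<open>k\<close> would produce an uncovered point.\<close>

lemma compactness:
  assumes wf: "\<And>q. q \<in> \<H> \<union> \<Q> \<Longrightarrow> wfc q"
    and cover: "\<And>v. (\<forall>q\<in>\<H>. near q v) \<Longrightarrow> \<exists>q\<in>\<Q>. near q v"
  shows "\<exists>\<H>0 \<Q>0. finite \<H>0 \<and> \<H>0 \<subseteq> \<H> \<and> finite \<Q>0 \<and> \<Q>0 \<subseteq> \<Q> \<and> (\<forall>v. (\<forall>q\<in>\<H>0. near q v) \<longrightarrow> (\<exists>q\<in>\<Q>0. near q v))"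
proof (rule ccontr)
  assume contra: "\<not> ?thesis"
  have "\<forall>q\<in>\<H> \<union> \<Q>. \<exists>p. dform_over m k p \<and> free_vars p \<subseteq> {..<n+l} \<and> (\<forall>v. satisfies rta \<delta> id v p \<longleftrightarrow> near q v)"
    using cond_formula wf by blast
  from bchoice[OF this] obtain p where p: "\<And>q. q \<in> \<H> \<union> \<Q> \<Longrightarrow> dform_over m k (p q) \<and> free_vars (p q) \<subseteq> {..<n+l} \<and>
     (\<forall>v. satisfies rta \<delta> id v (p q) \<longleftrightarrow> near q v)" by blast
  let ?T = "p ` \<H> \<union> (\<lambda>q. FNot (p q)) ` \<Q>"
  have "\<exists>v. \<forall>\<phi>\<in>?T. satisfies rta \<delta> id v \<phi>"
  proof (rule realise[OF small])
    show "dform_over m k \<phi> \<and> free_vars \<phi> \<subseteq> {..<n+l}" if "\<phi> \<in> ?T" for \<phi>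
    proof -
      from that consider q where "q \<in> \<H>" "\<phi> = p q" | q where "q \<in> \<Q>" "\<phi> = FNot (p q)" by blast
      then show ?thesis
      proof cases
        case (1 q) then show ?thesis using p[of q] by simp
      next
        case (2 q) then show ?thesis using p[of q] by simp
      qed
    qed
    fix T0 assume T0: "T0 \<subseteq> ?T" "finite T0"
    have "finite (T0 \<inter> p ` \<H>)" "finite (T0 \<inter> (\<lambda>q. FNot (p q)) ` \<Q>)" using T0(2) by auto
    obtain \<H>0 where h: "finite \<H>0" "\<H>0 \<subseteq> \<H>" "T0 \<inter> p ` \<H> = p ` \<H>0"
      using finite_subset_image[OF \<open>finite (T0 \<inter> p ` \<H>)\<close>, of p \<H>] by auto
    obtain \<Q>0 where q: "finite \<Q>0" "\<Q>0 \<subseteq> \<Q>" "T0 \<inter> (\<lambda>q. FNot (p q)) ` \<Q> = (\<lambda>q. FNot (p q)) ` \<Q>0"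
      using finite_subset_image[OF \<open>finite (T0 \<inter> (\<lambda>q. FNot (p q)) ` \<Q>)\<close>, of "\<lambda>q. FNot (p q)" \<Q>] by auto
    have "\<not> (\<forall>v. (\<forall>q\<in>\<H>0. near q v) \<longrightarrow> (\<exists>q\<in>\<Q>0. near q v))"
    proof
      assume "\<forall>v. (\<forall>q\<in>\<H>0. near q v) \<longrightarrow> (\<exists>q\<in>\<Q>0. near q v)"
      then show False using contra h(1,2) q(1,2) by metis
    qed
    then obtain v where v: "\<forall>q\<in>\<H>0. near q v" "\<forall>q\<in>\<Q>0. \<not> near q v" by blast
    have "T0 = p ` \<H>0 \<union> (\<lambda>q. FNot (p q)) ` \<Q>0" using T0(1) unfolding h(3)[symmetric] q(3)[symmetric] by blast
    moreover have "satisfies rta \<delta> id v (p q)" if "q \<in> \<H>0" for q using p[of q] v(1) that h(2) by auto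
    moreover have "satisfies rta \<delta> id v (FNot (p q))" if "q \<in> \<Q>0" for q
      using p[of q] v(2) that q(2) unfolding satisfies.simps by auto
    ultimately show "\<exists>v. \<forall>\<phi>\<in>T0. satisfies rta \<delta> id v \<phi>" by blast
  qed
  then obtain v where v: "\<And>\<phi>. \<phi> \<in> ?T \<Longrightarrow> satisfies rta \<delta> id v \<phi>" by blast
  have "near q v" if q: "q \<in> \<H>" for q
  proof -
    have "satisfies rta \<delta> id v (p q)" by (rule v) (use q in simp)
    then show ?thesis using p[OF UnI1[OF q]] by blast
  qed
  moreover have "\<not> near q v" if q: "q \<in> \<Q>" for q
  proof -
    have "satisfies rta \<delta> id v (FNot (p q))" by (rule v) (use q in simp)
    then show ?thesis using p[OF UnI2[OF q]] unfolding satisfies.simps by blast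
  qed
  ultimately show False using cover by blast
qed

text \<open>Only the finitely many minimal leaders have to be secured: each remains a leader while
  its relation holds and the leading coefficient does not vanish, and upward closure supplies the
  rest.\<close>

lemma leader_condition:
  "\<exists>q. wfc q \<and> near q v0 \<and> (\<forall>v. near q v \<longrightarrow> EE v0 \<subseteq> EE v)"
proof -
  let ?W = "\<lambda>g. idxs m Ys \<union> ini m Xs (rk m Xs g)"
  have base_eq: "base v \<union> dv v ` ini m Xs (rk m Xs g) = k \<union> dv v ` ?W g" for v g by (auto simp: base_def)
  define G where "G = mins m (EE v0)"
  have finG: "finite G" unfolding G_def by (rule finite_mins[OF _ EE_upclosed]) simp
  have GE: "G \<subseteq> EE v0" by (auto simp: G_def mins_def)
  have "\<exists>h d. (\<forall>i. h i \<in> PF k (?W g)) \<and> h d v0 \<noteq> 0 \<and> (\<Sum>i\<le>d. h i v0 * dv v0 g ^ i) = 0" if g: "g \<in> G" for g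
  proof -
    have "dv v0 g \<in> acl (k \<union> dv v0 ` ?W g)" using g GE by (auto simp: EE_def leads_def base_eq)
    then obtain p where p: "p \<in> pov (rgen (k \<union> dv v0 ` ?W g))" "p \<noteq> 0" "poly p (dv v0 g) = 0" by (auto simp: acl_def)
    have "\<exists>h. h \<in> PF k (?W g) \<and> h v0 = Polynomial.coeff p i" for i
      using p(1) unfolding pov_def rgen_eq_PF by (auto simp: image_iff) metis
    then obtain h where h: "h i \<in> PF k (?W g)" "h i v0 = Polynomial.coeff p i" for i by metis
    then show ?thesis using p(2,3) by (intro exI[of _ h] exI[of _ "Polynomial.degree p"]) (simp add: poly_altdef)
  qed
  then have "\<forall>g. \<exists>h. g \<in> G \<longrightarrow> (\<exists>d. (\<forall>i. h i \<in> PF k (?W g)) \<and> h d v0 \<noteq> 0 \<and> (\<Sum>i\<le>d. h i v0 * dv v0 g ^ i) = 0)" by blast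
  from choice[OF this] obtain h where h: "\<forall>g. g \<in> G \<longrightarrow> (\<exists>d. (\<forall>i. h g i \<in> PF k (?W g)) \<and> h g d v0 \<noteq> 0 \<and> (\<Sum>i\<le>d. h g i v0 * dv v0 g ^ i) = 0)" ..
  then have "\<forall>g. \<exists>d. g \<in> G \<longrightarrow> (\<forall>i. h g i \<in> PF k (?W g)) \<and> h g d v0 \<noteq> 0 \<and> (\<Sum>i\<le>d. h g i v0 * dv v0 g ^ i) = 0" by blast
  from choice[OF this] obtain d where d: "\<forall>g. g \<in> G \<longrightarrow> (\<forall>i. h g i \<in> PF k (?W g)) \<and> h g (d g) v0 \<noteq> 0 \<and> (\<Sum>i\<le>d g. h g i v0 * dv v0 g ^ i) = 0" ..
  have hd: "h g i \<in> PF k (?W g)" "h g (d g) v0 \<noteq> 0" "(\<Sum>i\<le>d g. h g i v0 * dv v0 g ^ i) = 0" if "g \<in> G" for g i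
    using d[rule_format, OF that] by simp_all
  define q where "q = ((\<lambda>g v. \<Sum>i\<le>d g. h g i v * dv v g ^ i) ` G, (\<lambda>g. h g (d g)) ` G)"
  have W: "?W g \<subseteq> idxs m {..<n+l}" for g using ini_idxs[of m Xs] by (fastforce simp: idxs_def)
  have hPFa: "h g i \<in> PFa" if "g \<in> G" for g i using hd(1)[OF that] PF_mono[OF order_refl W] by blast
  have "g \<in> idxs m {..<n+l}" if "g \<in> G" for g using that GE EE_upclosed(1) by (fastforce simp: idxs_def)
  then have "wfc q" unfolding wfc_def q_def using finG hPFa by (auto intro!: PF_sum PF_mult PF_power PF_var)
  moreover have "near q v0" using hd(2,3) by (auto simp: near_def q_def)
  moreover have "EE v0 \<subseteq> EE v" if v: "near q v" for v
  proof
    fix w assume w: "w \<in> EE v0"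
    have GEv: "g \<in> EE v" if g: "g \<in> G" for g
    proof -
      let ?p = "\<Sum>i\<le>d g. Polynomial.monom (h g i v) i"
      have "h g i v \<in> rgen (k \<union> dv v ` ?W g)" for i unfolding rgen_eq_PF using hd(1)[OF g] by blast
      then have "?p \<in> pov (rgen (k \<union> dv v ` ?W g))" by (intro pov_sum pov_monom)
      moreover have "Polynomial.coeff ?p (d g) \<noteq> 0" using v g by (simp add: coeff_sum near_def q_def)
      then have "?p \<noteq> 0" by (metis Polynomial.coeff_0)
      moreover have "poly ?p (dv v g) = 0" using v g by (simp add: poly_sum poly_monom near_def q_def)
      ultimately have "dv v g \<in> acl (k \<union> dv v ` ?W g)" by (rule acl_root)
      then show ?thesis using g GE EE_upclosed(1) by (auto simp: EE_def leads_def base_eq)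
    qed
    obtain g where g: "g \<in> G" "fst g = fst w" "pm_le (snd g) (snd w)" using mins_generate[OF w, of m] by (auto simp: G_def)
    have "snd w \<in> multi_indices m" using subsetD[OF EE_upclosed(1) w] by (simp add: idxs_def mem_Times_iff)
    then have "snd w - snd g \<in> multi_indices m" by (rule multi_indices_minus)
    moreover have "(fst g, snd g) \<in> EE v" using GEv[OF g(1)] by simp
    ultimately have "(fst g, snd g + (snd w - snd g)) \<in> EE v" by (rule upclosed_add[OF EE_upclosed(2)])
    then show "w \<in> EE v" using pm_le_diff[OF g(3)] g(2) by simp
  qed
  ultimately show ?thesis by blast
qed

section \<open>Maxima of Kolchin polynomials over a fibre\<close>

definition kp :: "(nat \<Rightarrow> 'a) \<Rightarrow> rat poly" where "kp v = kpoly m Xs (EE v)"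

lemma kp_mono: "EE v \<subseteq> EE v' \<Longrightarrow> eventually_dominated (kp v') (kp v)"
  unfolding kp_def by (rule kpoly_mono[OF _ EE_upclosed EE_upclosed cocount_mono]) simp_all

lemma finite_max_kp:
  assumes "finite S" "S \<noteq> {}" shows "\<exists>v\<in>S. \<forall>v'\<in>S. eventually_dominated (kp v') (kp v)"
  using assms
proof (induction rule: finite_ne_induct)
  case (singleton v) then show ?case by (simp add: eventually_dominated_refl)
next
  case (insert x S)
  then obtain v where v: "v \<in> S" "\<forall>v'\<in>S. eventually_dominated (kp v') (kp v)" by auto
  show ?case
  proof (cases "eventually_dominated (kp x) (kp v)")
    case True then show ?thesis using v by (intro bexI[of _ v]) auto
  next
    case False
    then have "eventually_dominated (kp v) (kp x)" using eventually_dominated_linear by blast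
    then show ?thesis using v by (intro bexI[of _ x]) (auto intro: eventually_dominated_refl eventually_dominated_trans)
  qed
qed

definition agree :: "(nat \<Rightarrow> 'a) \<Rightarrow> (nat \<Rightarrow> 'a) \<Rightarrow> bool" where
  "agree v v' \<longleftrightarrow> (\<forall>i\<in>Ys. v i = v' i)"

lemma agree_PFy: "agree v v' \<Longrightarrow> f \<in> PFy \<Longrightarrow> f v = f v'"
  by (rule PF_cong, assumption) (auto simp: agree_def idxs_def intro: dv_cong)

definition is_max :: "(nat \<Rightarrow> 'a) set \<Rightarrow> (nat \<Rightarrow> 'a) \<Rightarrow> rat poly \<Rightarrow> bool" where
  "is_max V v M \<longleftrightarrow> (\<exists>v'\<in>V. agree v' v \<and> kp v' = M) \<and> (\<forall>v'\<in>V. agree v' v \<longrightarrow> eventually_dominated (kp v') M)"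

text \<open>Upper bound: points over parameters of the same type as those of \<open>v0\<close> are
  covered by finitely many neighbourhoods on which leaders only grow, and compactness leaves
  finitely many conditions on the parameters that guarantee this. Lower bound: a point
  \<open>vs\<close> with the largest polynomial over the parameters of \<open>v0\<close> itself is
  moved to nearby parameters. Both bounds are the same \<open>M\<close>.\<close>

lemma locally_constant_max:
  assumes \<F>: "\<F> \<subseteq> PFa" and V: "V = {v. \<forall>f\<in>\<F>. f v = 0}" and v0: "v0 \<in> V"
  shows "\<exists>q M. wfc q \<and> near q v0 \<and> (\<forall>v\<in>V. near q v \<longrightarrow> is_max V v M)"
proof -
  \<comment> \<open>Compactness works over \<open>k\<close>, so it sees the parameters of
    \<open>v0\<close> only through the differential polynomials over \<open>k\<close> vanishing at
    them.\<close>
  define eqv where "eqv = (\<lambda>v. \<forall>f\<in>PFy. f v0 = 0 \<longleftrightarrow> f v = 0)"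
  have "\<forall>v. \<exists>q. wfc q \<and> near q v \<and> (\<forall>v'. near q v' \<longrightarrow> EE v \<subseteq> EE v')" using leader_condition by blast
  from choice[OF this] obtain \<theta> where \<theta>: "\<And>v. wfc (\<theta> v)" "\<And>v. near (\<theta> v) v" "\<And>v v'. near (\<theta> v) v' \<Longrightarrow> EE v \<subseteq> EE v'" by blast
  define H1 where "H1 = (\<lambda>f. ({f}, {} :: ((nat \<Rightarrow> 'a) \<Rightarrow> 'a) set)) ` \<F>"
  define H2 where "H2 = (\<lambda>f. ({f}, {} :: ((nat \<Rightarrow> 'a) \<Rightarrow> 'a) set)) ` {f \<in> PFy. f v0 = 0}"
  define H3 where "H3 = (\<lambda>f. ({} :: ((nat \<Rightarrow> 'a) \<Rightarrow> 'a) set, {f})) ` {f \<in> PFy. f v0 \<noteq> 0}"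
  define \<Q> where "\<Q> = \<theta> ` {v \<in> V. eqv v}"
  have Vterm: "v' \<in> V" if "v \<in> V" "\<And>t. dterm_over m k t \<Longrightarrow> dterm_vars t \<subseteq> {..<n+l} \<Longrightarrow> val v t = 0 \<Longrightarrow> val v' t = 0" for v v'
    unfolding V
  proof (intro CollectI ballI)
    fix f assume f: "f \<in> \<F>"
    obtain t where "dterm_over m k t" "dterm_vars t \<subseteq> {..<n+l}" "\<forall>v. val v t = f v" using PF_term f \<F> by blast
    moreover have "f v = 0" using that(1) f V by auto
    ultimately show "f v' = 0" using that(2)[of t] by simp
  qed
  have "\<exists>\<H>0 \<Q>0. finite \<H>0 \<and> \<H>0 \<subseteq> H1 \<union> H2 \<union> H3 \<and> finite \<Q>0 \<and> \<Q>0 \<subseteq> \<Q> \<and> (\<forall>v. (\<forall>q\<in>\<H>0. near q v) \<longrightarrow> (\<exists>q\<in>\<Q>0. near q v))"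
  proof (rule compactness)
    show "wfc q" if "q \<in> H1 \<union> H2 \<union> H3 \<union> \<Q>" for q
    proof -
      have "wfc q" if "q \<in> H1" using that \<F> by (auto simp: H1_def wfc_def)
      moreover have "wfc q" if "q \<in> H2" using that PFy_PFa by (auto simp: H2_def wfc_def)
      moreover have "wfc q" if "q \<in> H3" using that PFy_PFa by (auto simp: H3_def wfc_def)
      moreover have "wfc q" if "q \<in> \<Q>" using that \<theta>(1) unfolding \<Q>_def by blast
      ultimately show ?thesis using that by blast
    qed
    fix v assume v: "\<forall>q\<in>H1 \<union> H2 \<union> H3. near q v"
    have "f v = 0" if "f \<in> \<F>" for f
    proof -
      have "({f}, {}) \<in> H1" using that by (auto simp: H1_def)
      then have "near ({f}, {}) v" using v by blast
      then show ?thesis by (simp add: near_def)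
    qed
    then have "v \<in> V" by (simp add: V)
    moreover have "eqv v" unfolding eqv_def
    proof
      fix f assume f: "f \<in> PFy"
      show "f v0 = 0 \<longleftrightarrow> f v = 0"
      proof (cases "f v0 = 0")
        case True
        then have "({f}, {}) \<in> H2" using f by (auto simp: H2_def)
        then have "near ({f}, {}) v" using v by blast
        then show ?thesis using True by (simp add: near_def)
      next
        case False
        then have "({}, {f}) \<in> H3" using f by (auto simp: H3_def)
        then have "near ({}, {f}) v" using v by blast
        then show ?thesis using False by (simp add: near_def)
      qed
    qed
    ultimately show "\<exists>q\<in>\<Q>. near q v" using \<theta>(2) by (auto simp: \<Q>_def)
  qed
  then obtain \<H>0 \<Q>0 where HQ: "finite \<H>0" "\<H>0 \<subseteq> H1 \<union> H2 \<union> H3" "finite \<Q>0" "\<Q>0 \<subseteq> \<Q>"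
    "\<And>v. \<forall>q\<in>\<H>0. near q v \<Longrightarrow> \<exists>q\<in>\<Q>0. near q v" by blast
  obtain U where U: "finite U" "U \<subseteq> {v \<in> V. eqv v}" "\<Q>0 = \<theta> ` U"
    using finite_subset_image[OF HQ(3), of \<theta> "{v \<in> V. eqv v}"] HQ(4) by (auto simp: \<Q>_def)
  \<comment> \<open>The centre of a neighbourhood lies over other parameters of the same type.
    Moving it over those of \<open>v0\<close> without new leaders replaces its bound by a value that
    occurs in the fibre of \<open>v0\<close>.\<close>
  have "\<forall>v\<in>U. \<exists>v'. v' \<in> V \<and> agree v' v0 \<and> EE v' \<subseteq> EE v"
  proof
    fix v assume "v \<in> U"
    then have v: "v \<in> V" "eqv v" using U(2) by auto
    obtain C where C: "C \<subseteq> PFy" "\<forall>c\<in>C. c v \<noteq> 0"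
      "\<And>u. spec v u \<Longrightarrow> \<forall>c\<in>C. c u \<noteq> 0 \<Longrightarrow> \<exists>v'. (\<forall>i\<in>Ys. v' i = u i) \<and>
       (\<forall>t. dterm_over m k t \<longrightarrow> dterm_vars t \<subseteq> {..<n+l} \<longrightarrow> val v t = 0 \<longrightarrow> val v' t = 0) \<and> EE v' \<subseteq> EE v"
      using lower_semicontinuity[of v] by blast
    have "spec v v0" unfolding spec_def functional_def
    proof (intro ballI impI)
      fix \<gamma> assume "\<gamma> \<in> rgen ((\<lambda>c. (c, c)) ` k \<union> (\<lambda>w. (dv v w, dv v0 w)) ` idxs m Ys)" "fst \<gamma> = 0"
      then obtain f where "f \<in> PFy" "\<gamma> = (f v, f v0)" using rgen_pair_PF by blast
      then show "\<gamma> = 0" using \<open>fst \<gamma> = 0\<close> v(2) by (auto simp: eqv_def zero_prod_def)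
    qed
    moreover have "\<forall>c\<in>C. c v0 \<noteq> 0" using C(1,2) v(2) by (auto simp: eqv_def)
    ultimately obtain v' where "\<forall>i\<in>Ys. v' i = v0 i" "EE v' \<subseteq> EE v"
      "\<forall>t. dterm_over m k t \<longrightarrow> dterm_vars t \<subseteq> {..<n+l} \<longrightarrow> val v t = 0 \<longrightarrow> val v' t = 0" using C(3) by blast
    moreover from this(3) have "v' \<in> V" by (intro Vterm[OF v(1)]) blast
    ultimately show "\<exists>v'. v' \<in> V \<and> agree v' v0 \<and> EE v' \<subseteq> EE v" unfolding agree_def by blast
  qed
  from bchoice[OF this] obtain \<tau> where \<tau>: "\<And>v. v \<in> U \<Longrightarrow> \<tau> v \<in> V" "\<And>v. v \<in> U \<Longrightarrow> agree (\<tau> v) v0" "\<And>v. v \<in> U \<Longrightarrow> EE (\<tau> v) \<subseteq> EE v" by blast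
  have near0: "near q v0" if "q \<in> H1 \<union> H2 \<union> H3" for q
  proof -
    from that consider f where "q = ({f}, {})" "f \<in> \<F>" | f where "q = ({f}, {})" "f v0 = 0" | f where "q = ({}, {f})" "f v0 \<noteq> 0"
      unfolding H1_def H2_def H3_def by blast
    then show ?thesis using v0 by cases (simp_all add: near_def V)
  qed
  have "U \<noteq> {}" using HQ(5)[of v0] near0 HQ(2) U(3) by blast
  then obtain vs where vs: "vs \<in> \<tau> ` U" "\<And>v. v \<in> \<tau> ` U \<Longrightarrow> eventually_dominated (kp v) (kp vs)"
    using finite_max_kp[of "\<tau> ` U"] U(1) by blast
  have vsV: "vs \<in> V" "agree vs v0" using vs(1) \<tau> by auto
  define M where "M = kp vs"
  \<comment> \<open>Of the finitely many hypotheses used, those from \<open>H1\<close> hold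
    throughout \<open>V\<close>; the others involve the parameters only and become part of the
    neighbourhood.\<close>
  define Hy where "Hy = \<H>0 \<inter> (H2 \<union> H3)"
  define Zy where "Zy = (\<Union>q\<in>Hy. fst q)"
  define Ny where "Ny = (\<Union>q\<in>Hy. snd q)"
  have ZNy: "finite Zy" "finite Ny" "Zy \<subseteq> PFy" "Ny \<subseteq> PFy" "\<forall>f\<in>Zy. f v0 = 0" "\<forall>f\<in>Ny. f v0 \<noteq> 0"
    using HQ(1) unfolding Zy_def Ny_def Hy_def by (auto simp: H2_def H3_def)
  \<comment> \<open>Any point over such parameters lies in one of the covering neighbourhoods, so
    its leaders include those of some \<open>\<tau> u\<close>.\<close>
  have upper: "eventually_dominated (kp v') M" if v: "\<forall>f\<in>Zy. f v = 0" "\<forall>f\<in>Ny. f v \<noteq> 0" and v': "v' \<in> V" "agree v' v" for v v'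
  proof -
    have "near q v'" if q: "q \<in> \<H>0" for q
    proof (cases "q \<in> H1")
      case True then show ?thesis using v'(1) by (auto simp: H1_def near_def V)
    next
      case False
      then have qy: "q \<in> Hy" using q HQ(2) by (auto simp: Hy_def)
      have "f v' = f v" if "f \<in> fst q \<union> snd q" for f
        by (rule agree_PFy[OF v'(2)]) (use qy that in \<open>auto simp: Hy_def H2_def H3_def\<close>)
      note eq = this
      have "fst q \<subseteq> Zy" "snd q \<subseteq> Ny" using qy by (auto simp: Zy_def Ny_def)
      then have "f v = 0" if "f \<in> fst q" for f using that v by blast
      moreover have "f v \<noteq> 0" if "f \<in> snd q" for f using that v \<open>snd q \<subseteq> Ny\<close> by blast
      ultimately show ?thesis unfolding near_def using eq by (metis UnI1 UnI2)
    qed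
    then obtain u where u: "u \<in> U" "near (\<theta> u) v'" using HQ(5) U(3) by blast
    then have "EE (\<tau> u) \<subseteq> EE v'" using \<theta>(3) \<tau>(3) by blast
    then have "eventually_dominated (kp v') (kp (\<tau> u))" by (rule kp_mono)
    then show ?thesis unfolding M_def using vs(2)[of "\<tau> u"] u(1) eventually_dominated_trans by blast
  qed
  \<comment> \<open>Finitely many conditions ensuring that the new parameters specialise those of
    \<open>v0\<close>, as needed to move \<open>vs\<close>.\<close>
  obtain Z1 N1 where ZN1: "finite Z1" "finite N1" "Z1 \<subseteq> PFy" "N1 \<subseteq> PFy" "\<forall>f\<in>Z1. f v0 = 0" "\<forall>f\<in>N1. f v0 \<noteq> 0"
    "\<And>v. \<forall>f\<in>Z1. f v = 0 \<Longrightarrow> \<forall>f\<in>N1. f v \<noteq> 0 \<Longrightarrow> spec v0 v"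
    using local_basis[OF _ k_closed(3), of Ys v0] unfolding spec_def by auto
  obtain C where C: "finite C" "C \<subseteq> PFy" "\<forall>c\<in>C. c vs \<noteq> 0"
      "\<And>u. spec vs u \<Longrightarrow> \<forall>c\<in>C. c u \<noteq> 0 \<Longrightarrow> \<exists>v'. (\<forall>i\<in>Ys. v' i = u i) \<and>
       (\<forall>t. dterm_over m k t \<longrightarrow> dterm_vars t \<subseteq> {..<n+l} \<longrightarrow> val vs t = 0 \<longrightarrow> val v' t = 0) \<and> EE v' \<subseteq> EE vs"
    using lower_semicontinuity[of vs] by blast
  have dvs: "dv vs w = dv v0 w" if "w \<in> idxs m Ys" for w
    by (rule dv_cong) (use vsV(2) that in \<open>auto simp: agree_def idxs_def\<close>)
  have spec_vs: "spec vs v = spec v0 v" for v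
  proof -
    have "(\<lambda>w. (dv vs w, dv v w)) ` idxs m Ys = (\<lambda>w. (dv v0 w, dv v w)) ` idxs m Ys"
      by (rule image_cong) (simp_all add: dvs)
    then show ?thesis by (simp add: spec_def)
  qed
  define q where "q = (Zy \<union> Z1, Ny \<union> N1 \<union> C)"
  have "Zy \<union> Z1 \<subseteq> PFa" "Ny \<union> N1 \<union> C \<subseteq> PFa" using ZNy(3,4) ZN1(3,4) C(2) PFy_PFa by (meson Un_least order_trans)+
  then have wfq: "wfc q" unfolding wfc_def q_def using ZNy(1,2) ZN1(1,2) C(1) by simp
  have "c v0 \<noteq> 0" if "c \<in> C" for c
  proof -
    have "c vs = c v0" using that C(2) by (intro agree_PFy[OF vsV(2)]) auto
    then show ?thesis using C(3) that by metis
  qed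
  then have "near q v0" unfolding near_def q_def fst_conv snd_conv ball_Un using ZNy(5,6) ZN1(5,6) by blast
  moreover have "is_max V v M" if v: "v \<in> V" "near q v" for v
    unfolding is_max_def
  proof (intro conjI ballI impI)
    have y: "\<forall>f\<in>Zy. f v = 0" "\<forall>f\<in>Ny. f v \<noteq> 0" and y1: "\<forall>f\<in>Z1. f v = 0" "\<forall>f\<in>N1. f v \<noteq> 0" and yC: "\<forall>c\<in>C. c v \<noteq> 0"
      using v(2) unfolding near_def q_def fst_conv snd_conv ball_Un by blast+
    show "eventually_dominated (kp v') M" if "v' \<in> V" "agree v' v" for v' by (rule upper[OF y that])
    have "spec vs v" unfolding spec_vs by (rule ZN1(7)[OF y1])
    then obtain v' where v': "\<forall>i\<in>Ys. v' i = v i" "EE v' \<subseteq> EE vs"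
      "\<forall>t. dterm_over m k t \<longrightarrow> dterm_vars t \<subseteq> {..<n+l} \<longrightarrow> val vs t = 0 \<longrightarrow> val v' t = 0" using C(4)[OF _ yC] by blast
    have "v' \<in> V" using Vterm[OF vsV(1)] v'(3) by blast
    moreover have "agree v' v" using v'(1) by (simp add: agree_def)
    moreover have "eventually_dominated M (kp v')" unfolding M_def by (rule kp_mono[OF v'(2)])
    ultimately show "\<exists>v'\<in>V. agree v' v \<and> kp v' = M"
      using upper[OF y] eventually_dominated_antisym by blast
  qed
  ultimately show ?thesis using wfq by blast
qed

text \<open>Compactness once more: the neighbourhoods on which the maximum is constant cover
  \<open>V\<close>, so finitely many of them do.\<close>

theorem finitely_many_maxima:
  assumes \<F>: "\<F> \<subseteq> PFa" and V: "V = {v. \<forall>f\<in>\<F>. f v = 0}"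
  shows "\<exists>\<M>. finite \<M> \<and> (\<forall>v\<in>V. \<exists>M\<in>\<M>. is_max V v M)"
proof -
  have "\<forall>v0\<in>V. \<exists>qM. wfc (fst qM) \<and> near (fst qM) v0 \<and> (\<forall>v\<in>V. near (fst qM) v \<longrightarrow> is_max V v (snd qM))"
    using locally_constant_max[OF assms] by force
  from bchoice[OF this] obtain qM where qM: "\<And>v0. v0 \<in> V \<Longrightarrow> wfc (fst (qM v0))" "\<And>v0. v0 \<in> V \<Longrightarrow> near (fst (qM v0)) v0"
    "\<And>v0 v. v0 \<in> V \<Longrightarrow> v \<in> V \<Longrightarrow> near (fst (qM v0)) v \<Longrightarrow> is_max V v (snd (qM v0))" by blast
  define H1 where "H1 = (\<lambda>f. ({f}, {} :: ((nat \<Rightarrow> 'a) \<Rightarrow> 'a) set)) ` \<F>"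
  have nH: "(\<forall>q\<in>H1. near q v) \<longleftrightarrow> v \<in> V" for v by (auto simp: H1_def near_def V)
  have "\<exists>\<H>0 \<Q>0. finite \<H>0 \<and> \<H>0 \<subseteq> H1 \<and> finite \<Q>0 \<and> \<Q>0 \<subseteq> (\<lambda>v. fst (qM v)) ` V \<and>
      (\<forall>v. (\<forall>q\<in>\<H>0. near q v) \<longrightarrow> (\<exists>q\<in>\<Q>0. near q v))"
  proof (rule compactness)
    show "wfc q" if "q \<in> H1 \<union> (\<lambda>v. fst (qM v)) ` V" for q
      using that \<F> qM(1) by (auto simp: H1_def wfc_def)
    show "\<exists>q\<in>(\<lambda>v. fst (qM v)) ` V. near q v" if "\<forall>q\<in>H1. near q v" for v
      using that qM(2) unfolding nH by blast
  qed
  then obtain \<H>0 \<Q>0 where HQ: "\<H>0 \<subseteq> H1" "finite \<Q>0" "\<Q>0 \<subseteq> (\<lambda>v. fst (qM v)) ` V"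
      "\<And>v. \<forall>q\<in>\<H>0. near q v \<Longrightarrow> \<exists>q\<in>\<Q>0. near q v" by blast
  obtain U where U: "finite U" "U \<subseteq> V" "\<Q>0 = (\<lambda>v. fst (qM v)) ` U" using finite_subset_image[OF HQ(2,3)] by auto
  have "\<exists>M\<in>(\<lambda>v. snd (qM v)) ` U. is_max V v M" if v: "v \<in> V" for v
  proof -
    have "\<forall>q\<in>\<H>0. near q v" using v HQ(1) unfolding nH[symmetric] by blast
    then obtain u where u: "u \<in> U" "near (fst (qM u)) v" using HQ(4) U(3) by blast
    then show ?thesis using qM(3)[OF _ v u(2)] U(2) by blast
  qed
  then show ?thesis using U(1) by (intro exI[of _ "(\<lambda>v. snd (qM v)) ` U"]) simp
qed

end


section \<open>Kolchin polynomials of points\<close>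

text \<open>The non-leaders of order at most \<open>s\<close> form a transcendence basis. They are
  independent by induction along the ranking. A leader is algebraic over derivatives of lower rank,
  and these have order at most \<open>s\<close> too because the ranking compares orders
  first.\<close>

lemma trdeg_cocount:
  fixes L :: "'a::field set"
  assumes L: "rgen L \<subseteq> L" and I: "finite I" and E: "E = leads m I L z"
  shows "trdeg L (generate_field rta (L \<union> z ` {w \<in> idxs m I. ord_idx m (snd w) \<le> s})) = cocount m I E s"
    and "indep L z {w \<in> idxs m I - E. ord_idx m (snd w) \<le> s}"
    and "z ` {w \<in> idxs m I. ord_idx m (snd w) \<le> s} \<subseteq> acl (L \<union> z ` {w \<in> idxs m I - E. ord_idx m (snd w) \<le> s})"
proof -
  let ?W = "{w \<in> idxs m I. ord_idx m (snd w) \<le> s}" and ?N = "{w \<in> idxs m I - E. ord_idx m (snd w) \<le> s}"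
  have fW: "finite ?W" by (rule finite_idxs_ord[OF I])
  then have fN: "finite ?N" by (rule rev_finite_subset) auto
  have ind: "indep L z (ini m I M - E) \<and> alg_independent L (z ` (ini m I M - E))" for M
  proof (induction M)
    case 0
    have "ini m I 0 - E = {}" by (auto simp: ini_def)
    then show ?case by (simp only: alg_independent_indep image_empty indep_empty)
  next
    case (Suc M)
    show ?case
    proof (cases "\<exists>w\<in>idxs m I. rk m I w = M")
      case True
      then obtain w where w: "w \<in> idxs m I" "rk m I w = M" by auto
      have ini: "ini m I (Suc M) = insert w (ini m I M)" using ini_Suc[OF I w(1)] w(2) by simp
      show ?thesis
      proof (cases "w \<in> E")
        case True then show ?thesis using Suc ini by simp
      next
        case False
        then have n: "z w \<notin> acl (L \<union> z ` ini m I M)" using w by (auto simp: E leads_def)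
        moreover have "acl (L \<union> z ` (ini m I M - E)) \<subseteq> acl (L \<union> z ` ini m I M)" by (rule acl_mono) auto
        ultimately have n': "z w \<notin> acl (L \<union> z ` (ini m I M - E))" by blast
        then have "z w \<notin> L \<union> z ` (ini m I M - E)" by (rule contra_subsetD[OF acl_base])
        then have "z w \<notin> z ` (ini m I M - E)" by blast
        moreover from this have "w \<notin> ini m I M - E" by blast
        ultimately show ?thesis using Suc n' False unfolding ini
          by (simp add: insert_Diff_if indep_insert[OF L] alg_independent_insert[OF L])
      qed
    next
      case False then show ?thesis using Suc ini_Suc_not by metis
    qed
  qed
  \<comment> \<open>A stage beyond the ranks of the finitely many non-leaders in question.\<close>
  define M where "M = Suc (Max (insert 0 (rk m I ` ?N)))"
  have "?N \<subseteq> ini m I M - E"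
  proof
    fix w assume w: "w \<in> ?N"
    then have "rk m I w \<le> Max (insert 0 (rk m I ` ?N))" using fN by (intro Max_ge) auto
    then show "w \<in> ini m I M - E" using w by (auto simp: ini_def M_def)
  qed
  then have sub_ini: "?N \<subseteq> ini m I M - E" .
  show N: "indep L z ?N" by (rule indep_mono[OF conjunct1[OF ind[of M]] sub_ini])
  have algN: "alg_independent L (z ` ?N)" by (rule alg_independent_mono[OF conjunct2[OF ind[of M]] image_mono[OF sub_ini]])
  have sub: "w \<in> ?W \<Longrightarrow> z w \<in> acl (L \<union> z ` ?N)" for w
  proof (induction "rk m I w" arbitrary: w rule: less_induct)
    case less
    show ?case
    proof (cases "w \<in> E")
      case False
      then have "z w \<in> L \<union> z ` ?N" using less.prems by blast
      then show ?thesis by (rule subsetD[OF acl_base])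
    next
      case True
      have "L \<union> z ` ini m I (rk m I w) \<subseteq> acl (L \<union> z ` ?N)"
      proof (intro Un_least image_subsetI)
        show "L \<subseteq> acl (L \<union> z ` ?N)" using acl_base[of "L \<union> z ` ?N"] by blast
        fix v assume v: "v \<in> ini m I (rk m I w)"
        then have "v \<in> idxs m I" "rk m I v < rk m I w" by (auto simp: ini_def)
        moreover from this have "dless m v w" using rk_less_iff[OF I] less.prems by simp
        ultimately show "z v \<in> acl (L \<union> z ` ?N)" using less by (intro less.hyps) (auto simp: dless_def)
      qed
      then have "acl (L \<union> z ` ini m I (rk m I w)) \<subseteq> acl (L \<union> z ` ?N)" by (rule acl_least)
      then show ?thesis using True by (auto simp: E leads_def)
    qed
  qed
  then show zW: "z ` ?W \<subseteq> acl (L \<union> z ` ?N)" by blast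
  have "trdeg L (generate_field rta (L \<union> z ` ?W)) = card (z ` ?N)"
  proof (rule trdeg_eq_card[OF L _ algN])
    show "finite (z ` ?N)" using fN by simp
    show "z ` ?N \<subseteq> generate_field rta (L \<union> z ` ?W)"
      using rgen_generate_field[of "L \<union> z ` ?W"] by (auto intro!: rgen_base)
    have "L \<subseteq> acl (L \<union> z ` ?N)" using acl_base[of "L \<union> z ` ?N"] by blast
    then have "L \<union> z ` ?W \<subseteq> acl (L \<union> z ` ?N)" using zW by (rule Un_least)
    then show "generate_field rta (L \<union> z ` ?W) \<subseteq> acl (L \<union> z ` ?N)"
      by (rule generate_field_subset[OF subfield_acl])
  qed
  then show "trdeg L (generate_field rta (L \<union> z ` ?W)) = cocount m I E s"
    using indep_inj[OF L N] by (simp add: cocount_def card_image)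
qed

text \<open>The non-leaders of \<open>z'\<close> stay independent at \<open>z\<close>, since every
  relation at \<open>z\<close> holds at \<open>z'\<close>; Steinitz compares them with the basis of
  non-leaders of \<open>z\<close>. Only cardinalities are compared, as the leader sets themselves
  may be incomparable.\<close>

lemma cocount_specialise:
  fixes L :: "'a::field set"
  assumes L: "rgen L \<subseteq> L" and I: "finite I"
    and sp: "\<And>P. P \<in> mpolys L (idxs m I) \<Longrightarrow> mpoly_eval z P = 0 \<Longrightarrow> mpoly_eval z' P = 0"
  shows "cocount m I (leads m I L z') s \<le> cocount m I (leads m I L z) s"
proof -
  let ?N = "{w \<in> idxs m I - leads m I L z. ord_idx m (snd w) \<le> s}"
  let ?N' = "{w \<in> idxs m I - leads m I L z'. ord_idx m (snd w) \<le> s}"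
  have f: "finite {w \<in> idxs m I. ord_idx m (snd w) \<le> s}" by (rule finite_idxs_ord[OF I])
  have fN: "finite ?N" "finite ?N'" by (rule rev_finite_subset[OF f]; auto)+
  have "mpolys L ?N' \<subseteq> mpolys L (idxs m I)" by (rule mpolys_mono) auto
  then have ind: "indep L z ?N'"
    using trdeg_cocount(2)[OF L I refl, where z = z' and m = m and s = s] sp unfolding indep_def by blast
  have "z ` ?N' \<subseteq> z ` {w \<in> idxs m I. ord_idx m (snd w) \<le> s}" by auto
  also have "\<dots> \<subseteq> acl (L \<union> z ` ?N)" by (rule trdeg_cocount(3)[OF L I refl])
  finally have "card (z ` ?N') \<le> card (z ` ?N)"
    using indep_image_not_acl[OF L ind] fN by (intro steinitz_card_le[of _ _ L]) auto
  also have "\<dots> \<le> card ?N" by (rule card_image_le[OF fN(1)])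
  also have "card (z ` ?N') = card ?N'" by (rule card_image[OF indep_inj[OF L ind]])
  finally show ?thesis by (simp add: cocount_def)
qed

lemma leads_cong_seq:
  assumes "\<And>w. w \<in> idxs m I \<Longrightarrow> z w = z' w" shows "leads m I A z = leads m I A z'"
proof -
  have "z ` ini m I N = z' ` ini m I N" for N by (rule image_cong) (use assms ini_idxs[of m I] in auto)
  then show ?thesis using assms by (auto simp: leads_def)
qed

context dfld
begin

lemma dpoly_eval_dv: "dpoly_eval m \<delta> b f = mpoly_eval (dv ((!) b)) f"
  by (simp add: dpoly_eval_def dv_def[abs_def] case_prod_unfold)

lemma dpolys_idxs: "dpolys m L N = mpolys L (idxs m {..<N})"
  by (simp add: dpolys_def idxs_def)

lemma mpoly_eval_PF: "f \<in> mpolys A W \<Longrightarrow> (\<lambda>v. mpoly_eval (dv v) f) \<in> PF A W"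
  unfolding mpoly_eval_def mpolys_def by (intro PF_sum PF_mult PF_prod PF_power) (auto intro: PF_const PF_var)

lemma PF_mpoly_eval:
  assumes A: "rgen A \<subseteq> A" and g: "g \<in> PF A W"
  shows "\<exists>f\<in>mpolys A W. \<forall>v. mpoly_eval (dv v) f = g v"
  using g
proof induction
  case PF_one
  have "1 \<in> A" using A rgen_one by blast
  then have "Poly_Mapping.single 0 1 \<in> mpolys A W" by (intro mpolys_single) auto
  then show ?case by (rule bexI[rotated]) (simp only: mpoly_eval_single mono_eval_0, simp)
next
  case (PF_const c)
  then show ?case by (intro bexI[of _ "Poly_Mapping.single 0 c"]) (auto simp: mpoly_eval_single intro: mpolys_single)
next
  case (PF_var w)
  have "1 \<in> A" using A rgen_one by blast
  then show ?case using PF_var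
    by (intro bexI[of _ "Poly_Mapping.single (Poly_Mapping.single w 1) 1"])
      (auto simp: mpoly_eval_single mono_eval_single intro!: mpolys_single)
next
  case (PF_add g h)
  then obtain f f' where "f \<in> mpolys A W" "f' \<in> mpolys A W" "\<forall>v. mpoly_eval (dv v) f = g v" "\<forall>v. mpoly_eval (dv v) f' = h v" by blast
  then show ?case by (intro bexI[of _ "f + f'"]) (auto simp: mpoly_eval_add intro: mpolys_add[OF A])
next
  case (PF_neg g)
  then obtain f where "f \<in> mpolys A W" "\<forall>v. mpoly_eval (dv v) f = g v" by blast
  then show ?case by (intro bexI[of _ "- f"]) (auto simp: mpoly_eval_uminus intro: mpolys_uminus[OF A])
next
  case (PF_mult g h)
  then obtain f f' where "f \<in> mpolys A W" "f' \<in> mpolys A W" "\<forall>v. mpoly_eval (dv v) f = g v" "\<forall>v. mpoly_eval (dv v) f' = h v" by blast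
  then show ?case by (intro bexI[of _ "f * f'"]) (auto simp: mpoly_eval_mult intro: mpolys_mult[OF A])
qed

text \<open>Once transcendence degrees are rewritten as counts of non-leaders, both sides are the
  same definite description.\<close>

lemma kolchin_poly_point_kpoly:
  assumes "rgen L \<subseteq> L" "length b = n"
  shows "kolchin_poly_point m \<delta> L b = kpoly m {..<n} (leads m {..<n} L (dv ((!) b)))"
proof -
  have "{der_pow m \<delta> \<xi> (b ! i) | \<xi> i. \<xi> \<in> multi_indices m \<and> ord_idx m \<xi> \<le> s \<and> i < length b}
      = dv ((!) b) ` {w \<in> idxs m {..<n}. ord_idx m (snd w) \<le> s}" for s
  proof (intro subset_antisym subsetI)
    fix x assume "x \<in> {der_pow m \<delta> \<xi> (b ! i) | \<xi> i. \<xi> \<in> multi_indices m \<and> ord_idx m \<xi> \<le> s \<and> i < length b}"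
    then obtain \<xi> i where "x = der_pow m \<delta> \<xi> (b ! i)" "\<xi> \<in> multi_indices m" "ord_idx m \<xi> \<le> s" "i < length b" by blast
    then show "x \<in> dv ((!) b) ` {w \<in> idxs m {..<n}. ord_idx m (snd w) \<le> s}"
      using assms(2) by (intro image_eqI[of _ _ "(i, \<xi>)"]) (auto simp: dv_def idxs_def)
  next
    fix x assume "x \<in> dv ((!) b) ` {w \<in> idxs m {..<n}. ord_idx m (snd w) \<le> s}"
    then obtain w where "w \<in> idxs m {..<n}" "ord_idx m (snd w) \<le> s" "x = dv ((!) b) w" by blast
    then show "x \<in> {der_pow m \<delta> \<xi> (b ! i) | \<xi> i. \<xi> \<in> multi_indices m \<and> ord_idx m \<xi> \<le> s \<and> i < length b}"
      using assms(2) by (intro CollectI exI[of _ "snd w"] exI[of _ "fst w"]) (auto simp: dv_def idxs_def)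
  qed
  then show ?thesis
    unfolding kolchin_poly_point_def kpoly_def by (simp add: trdeg_cocount(1)[OF assms(1) _ refl])
qed

lemma der_pow_closed:
  assumes "\<And>j x. j < m \<Longrightarrow> x \<in> F \<Longrightarrow> \<delta> j x \<in> F" "x \<in> F" "\<xi> \<in> multi_indices m"
  shows "der_pow m \<delta> \<xi> x \<in> F"
  using assms(3)
proof (induction rule: multi_index_induct)
  case zero then show ?case using assms(2) dv_0[of "\<lambda>_. x" 0] by (simp add: dv_def)
next
  case (step \<xi> j) then show ?case using assms(1) by (simp only: der_pow_Suc)
qed

lemma differential_subfield_acl:
  assumes "dclosed A" shows "differential_subfield m \<delta> (acl A)"
  using subfield_acl der_acl_closed[OF assms] by (auto simp: differential_subfield_def)

lemma differential_field_adjoin: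
  shows "differential_subfield m \<delta> (differential_field_adjoin m \<delta> k A)" "k \<union> A \<subseteq> differential_field_adjoin m \<delta> k A"
    "\<And>L. differential_subfield m \<delta> L \<Longrightarrow> k \<union> A \<subseteq> L \<Longrightarrow> differential_field_adjoin m \<delta> k A \<subseteq> L"
proof -
  let ?C = "{L. differential_subfield m \<delta> L \<and> k \<union> A \<subseteq> L}"
  have "subfield (\<Inter>?C) rta"
    by (rule subfield_rta) (auto simp: differential_subfield_def intro: subfield_rtaD)
  then show "differential_subfield m \<delta> (differential_field_adjoin m \<delta> k A)"
    by (auto simp: differential_field_adjoin_def differential_subfield_def)
qed (auto simp: differential_field_adjoin_def)

lemma differential_subfield_closed:
  assumes "differential_subfield m \<delta> L" shows "rgen L \<subseteq> L" "dclosed L"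
proof -
  have sf: "subfield L rta" using assms by (simp add: differential_subfield_def)
  show "rgen L \<subseteq> L"
  proof
    fix x assume "x \<in> rgen L" then show "x \<in> L" by induction (auto intro: subfield_rtaD[OF sf])
  qed
  show "dclosed L" using assms by (auto simp: differential_subfield_def dclosed_def intro: rgen_base)
qed

end

context universal
begin

text \<open>The differential field contains \<open>base v\<close> and is contained in
  \<open>acl (base v)\<close>, because the latter is a differential field; equality of the closures
  and the bound on the cardinality follow.\<close>

lemma parameters:
  assumes a: "length a = l" and b: "length b = n"
  defines "L \<equiv> differential_field_adjoin m \<delta> k (set a)" and "v \<equiv> (!) (b @ a)"
  shows "dv v ` idxs m Ys \<subseteq> L" "acl L = acl (base v)" "L \<prec> (UNIV :: 'a set)"
proof -
  note L = differential_field_adjoin[where k = k and A = "set a", folded L_def]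
  have vY: "v ` Ys = set a"
  proof -
    have "v ` Ys = (\<lambda>i. v (n + i)) ` {..<l}" by (auto simp: image_iff) (metis le_Suc_ex atLeastLessThan_iff lessThan_iff nat_add_left_cancel_less)
    also have "\<dots> = set a" using a b by (auto simp: v_def set_conv_nth)
    finally show ?thesis .
  qed
  show vL: "dv v ` idxs m Ys \<subseteq> L"
  proof (rule image_subsetI)
    fix w assume w: "w \<in> idxs m Ys"
    then have "v (fst w) \<in> v ` Ys" by (intro imageI) (simp add: idxs_def mem_Times_iff)
    then have "v (fst w) \<in> L" using vY L(2) by blast
    then show "dv v w \<in> L" unfolding dv_def
      by (rule der_pow_closed[rotated]) (use L(1) w in \<open>auto simp: differential_subfield_def idxs_def\<close>)
  qed
  have "set a \<subseteq> dv v ` idxs m Ys"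
  proof
    fix x assume "x \<in> set a"
    then obtain i where "i \<in> Ys" "x = v i" using vY by blast
    then have "(i, 0) \<in> idxs m Ys" "dv v (i, 0) = x" by (auto simp: idxs_def multi_indices_0 dv_0)
    then show "x \<in> dv v ` idxs m Ys" by blast
  qed
  then have "k \<union> set a \<subseteq> base v" by (auto simp: base_def)
  then have sub: "L \<subseteq> acl (base v)"
    by (intro L(3)[OF differential_subfield_acl[OF dclosed_base]] order_trans[OF _ acl_base])
  moreover have "base v \<subseteq> acl L" using vL L(2) acl_base[of L] by (auto simp: base_def)
  ultimately show "acl L = acl (base v)" by (rule acl_eqI)
  have "base v \<lesssim> k" unfolding base_def
    by (rule lepoll_Un[OF infinite_k lepoll_refl countable_lepoll_infinite[OF infinite_k]])
      (intro countable_image countable_dvars)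
  then have "acl (base v) \<lesssim> k" by (rule acl_lepoll[OF infinite_k])
  then have "L \<lesssim> k" using subset_imp_lepoll[OF sub] lepoll_trans by blast
  then show "L \<prec> (UNIV :: 'a set)" using small by (rule lesspoll_trans1)
qed

lemma kp_point:
  assumes a: "length a = l" and b: "length b = n"
  shows "kolchin_poly_point m \<delta> (differential_field_adjoin m \<delta> k (set a)) b = kp ((!) (b @ a))"
proof -
  let ?L = "differential_field_adjoin m \<delta> k (set a)"
  have "leads m Xs ?L (dv ((!) b)) = leads m Xs ?L (dv ((!) (b @ a)))"
    by (rule leads_cong_seq, rule dv_cong) (use b in \<open>auto simp: idxs_def nth_append\<close>)
  also have "\<dots> = EE ((!) (b @ a))" unfolding EE_def by (rule leads_cong[OF parameters(2)[OF a b]])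
  finally show ?thesis
    using kolchin_poly_point_kpoly[OF differential_subfield_closed(1)[OF differential_field_adjoin(1)] b] by (simp add: kp_def)
qed

text \<open>Serves to exhibit the members of the family as varieties over k\<langle>a\<rangle>:
  derivatives of \<open>y\<close> become constants of that field, while derivatives of
  \<open>x\<close> are untouched.\<close>

lemma substitute_parameters:
  assumes a: "length a = l" and g: "g \<in> PF k (idxs m {..<n+l})"
  shows "\<exists>f\<in>dpolys m (differential_field_adjoin m \<delta> k (set a)) n. \<forall>b. length b = n \<longrightarrow> dpoly_eval m \<delta> b f = g ((!) (b @ a))"
proof -
  let ?L = "differential_field_adjoin m \<delta> k (set a)"
  have "\<exists>h\<in>PF ?L (idxs m Xs). \<forall>b. length b = n \<longrightarrow> h ((!) b) = g ((!) (b @ a))"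
    using g
  proof induction
    case PF_one then show ?case by (intro bexI[of _ "\<lambda>v. 1"]) (auto intro: PF.intros)
  next
    case (PF_const c)
    then have "c \<in> ?L" using differential_field_adjoin(2)[of k "set a"] by blast
    then show ?case by (intro bexI[of _ "\<lambda>v. c"]) (auto intro: PF.intros)
  next
    case (PF_var w)
    show ?case
    proof (cases "fst w < n")
      case True
      then have "w \<in> idxs m Xs" using PF_var by (auto simp: idxs_def)
      moreover have "dv ((!) b) w = dv ((!) (b @ a)) w" if "length b = n" for b
        by (rule dv_cong) (use that True in \<open>simp add: nth_append\<close>)
      ultimately show ?thesis by (intro bexI[of _ "\<lambda>v. dv v w"]) (auto intro: PF.intros)
    next
      case False
      then have w: "w \<in> idxs m Ys" using PF_var by (auto simp: idxs_def)
      \<comment> \<open>Any point of the right length will do, since the value depends on the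
        parameter positions alone.\<close>
      let ?c = "dv ((!) (replicate n 0 @ a)) w"
      have "?c \<in> ?L" using parameters(1)[OF a, of "replicate n 0"] w by (simp add: image_subset_iff)
      moreover have "?c = dv ((!) (b @ a)) w" if "length b = n" for b
        by (rule dv_cong) (use that False in \<open>simp add: nth_append\<close>)
      ultimately show ?thesis by (intro bexI[of _ "\<lambda>v. ?c"] allI impI PF.PF_const)
    qed
  next
    case (PF_add f g)
    from PF_add.IH(1) obtain f' where "f' \<in> PF ?L (idxs m Xs)" "\<forall>b. length b = n \<longrightarrow> f' ((!) b) = f ((!) (b @ a))" ..
    moreover from PF_add.IH(2) obtain g' where "g' \<in> PF ?L (idxs m Xs)" "\<forall>b. length b = n \<longrightarrow> g' ((!) b) = g ((!) (b @ a))" ..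
    ultimately show ?case by (intro bexI[of _ "\<lambda>v. f' v + g' v"]) (auto intro: PF.intros)
  next
    case (PF_neg f)
    from PF_neg.IH obtain f' where "f' \<in> PF ?L (idxs m Xs)" "\<forall>b. length b = n \<longrightarrow> f' ((!) b) = f ((!) (b @ a))" ..
    then show ?case by (intro bexI[of _ "\<lambda>v. - f' v"]) (auto intro: PF.intros)
  next
    case (PF_mult f g)
    from PF_mult.IH(1) obtain f' where "f' \<in> PF ?L (idxs m Xs)" "\<forall>b. length b = n \<longrightarrow> f' ((!) b) = f ((!) (b @ a))" ..
    moreover from PF_mult.IH(2) obtain g' where "g' \<in> PF ?L (idxs m Xs)" "\<forall>b. length b = n \<longrightarrow> g' ((!) b) = g ((!) (b @ a))" ..
    ultimately show ?case by (intro bexI[of _ "\<lambda>v. f' v * g' v"]) (auto intro: PF.intros)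
  qed
  then obtain h where h: "h \<in> PF ?L (idxs m Xs)" "\<forall>b. length b = n \<longrightarrow> h ((!) b) = g ((!) (b @ a))" ..
  show ?thesis
    using PF_mpoly_eval[OF differential_subfield_closed(1)[OF differential_field_adjoin(1)] h(1)] h(2)
    unfolding dpolys_idxs dpoly_eval_dv by metis
qed

end


section \<open>Components and generic points\<close>

text \<open>The base field is now the small field \<open>L\<close>, with no parameter positions
  left, so that compactness is available over \<open>L\<close> for points of affine
  \<open>n\<close>-space.\<close>

locale points = universal m \<delta> L n 0
  for m :: nat and \<delta> :: "nat \<Rightarrow> 'a::field_char_0 \<Rightarrow> 'a" and L :: "'a set" and n :: nat
begin

abbreviation "ev \<equiv> dpoly_eval m \<delta>"
abbreviation "DP \<equiv> dpolys m L n"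
abbreviation "closed_set \<equiv> differential_variety m \<delta> L n"

lemma rgen_L: "rgen L \<subseteq> L" by (rule k_closed(1))

lemma ev_mult: "ev b (f * g) = ev b f * ev b g"
  by (simp add: dpoly_eval_def mpoly_eval_mult)

lemma closed_setI: "S \<subseteq> DP \<Longrightarrow> closed_set {b. length b = n \<and> (\<forall>f\<in>S. ev b f = 0)}"
  by (auto simp: differential_variety_def)

lemma closed_setE:
  assumes "closed_set V" obtains S where "S \<subseteq> DP" "V = {b. length b = n \<and> (\<forall>f\<in>S. ev b f = 0)}"
  using assms by (auto simp: differential_variety_def)

lemma closed_set_Int: assumes "closed_set V" "closed_set V'" shows "closed_set (V \<inter> V')"
proof -
  obtain S where S: "S \<subseteq> DP" "V = {b. length b = n \<and> (\<forall>f\<in>S. ev b f = 0)}" using assms(1) by (rule closed_setE)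
  obtain S' where S': "S' \<subseteq> DP" "V' = {b. length b = n \<and> (\<forall>f\<in>S'. ev b f = 0)}" using assms(2) by (rule closed_setE)
  have "V \<inter> V' = {b. length b = n \<and> (\<forall>f\<in>S \<union> S'. ev b f = 0)}" unfolding S(2) S'(2) by auto
  then show ?thesis using closed_setI[of "S \<union> S'"] S(1) S'(1) by simp
qed

lemma closed_set_Un: assumes "closed_set V" "closed_set V'" shows "closed_set (V \<union> V')"
proof -
  obtain S where S: "S \<subseteq> DP" "V = {b. length b = n \<and> (\<forall>f\<in>S. ev b f = 0)}" using assms(1) by (rule closed_setE)
  obtain S' where S': "S' \<subseteq> DP" "V' = {b. length b = n \<and> (\<forall>f\<in>S'. ev b f = 0)}" using assms(2) by (rule closed_setE)
  define T where "T = (\<lambda>(f, g). f * g) ` (S \<times> S')"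
  have "V \<union> V' = {b. length b = n \<and> (\<forall>f\<in>T. ev b f = 0)}" unfolding S(2) S'(2) T_def by (auto simp: ev_mult)
  moreover have "T \<subseteq> DP" using S(1) S'(1) unfolding T_def dpolys_def by (auto intro!: mpolys_mult[OF rgen_L])
  ultimately show ?thesis using closed_setI[of T] by simp
qed

lemma closed_set_empty: "closed_set {}"
proof -
  have "Poly_Mapping.single 0 1 \<in> DP" unfolding dpolys_def using rgen_L rgen_one by (intro mpolys_single) auto
  moreover have "ev b (Poly_Mapping.single 0 1) = 1" for b
    unfolding dpoly_eval_def mpoly_eval_single by simp
  ultimately show ?thesis using closed_setI[of "{Poly_Mapping.single 0 1}"] by simp
qed

lemma closed_set_Union: "finite \<V> \<Longrightarrow> (\<And>V. V \<in> \<V> \<Longrightarrow> closed_set V) \<Longrightarrow> closed_set (\<Union>\<V>)"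
  by (induction \<V> rule: finite_induct) (auto intro: closed_set_empty closed_set_Un)

lemma irreducible_Un:
  assumes W: "irreducible_variety m \<delta> L n W" and V: "closed_set V1" "closed_set V2" and sub: "W \<subseteq> V1 \<union> V2"
  shows "W \<subseteq> V1 \<or> W \<subseteq> V2"
proof -
  have cW: "closed_set W"
    and split: "\<And>V1 V2. closed_set V1 \<Longrightarrow> closed_set V2 \<Longrightarrow> W = V1 \<union> V2 \<Longrightarrow> W = V1 \<or> W = V2"
    using W by (auto simp: irreducible_variety_def)
  have "W = (W \<inter> V1) \<union> (W \<inter> V2)" using sub by blast
  then have "W = W \<inter> V1 \<or> W = W \<inter> V2" by (rule split[OF closed_set_Int[OF cW V(1)] closed_set_Int[OF cW V(2)]])
  then show ?thesis by blast
qed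

lemma irreducible_Union:
  assumes W: "irreducible_variety m \<delta> L n W"
  shows "finite \<V> \<Longrightarrow> (\<And>V. V \<in> \<V> \<Longrightarrow> closed_set V) \<Longrightarrow> W \<subseteq> \<Union>\<V> \<Longrightarrow> \<exists>V\<in>\<V>. W \<subseteq> V"
proof (induction \<V> rule: finite_induct)
  case empty
  then show ?case using W by (simp add: irreducible_variety_def)
next
  case (insert V \<V>)
  have "closed_set (\<Union>\<V>)" using insert.hyps insert.prems(1) by (intro closed_set_Union) auto
  moreover have "closed_set V" using insert.prems(1) by simp
  ultimately have "W \<subseteq> V \<or> W \<subseteq> \<Union>\<V>" using irreducible_Un[OF W, of V "\<Union>\<V>"] insert.prems(2) by simp
  then show ?case
  proof
    assume "W \<subseteq> V" then show ?thesis by blast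
  next
    assume "W \<subseteq> \<Union>\<V>"
    then have "\<exists>V\<in>\<V>. W \<subseteq> V" by (intro insert.IH insert.prems(1)) auto
    then show ?thesis by blast
  qed
qed

section \<open>Irreducible components and generic points in the Kolchin topology\<close>

definition zclosure :: "'a list set \<Rightarrow> 'a list set" where
  "zclosure B = {b. length b = n \<and> (\<forall>f\<in>{f \<in> DP. \<forall>c\<in>B. ev c f = 0}. ev b f = 0)}"

lemma closed_zclosure: "closed_set (zclosure B)"
  unfolding zclosure_def by (rule closed_setI) auto

lemma zclosure_least: assumes "closed_set V" "B \<subseteq> V" shows "zclosure B \<subseteq> V"
proof -
  obtain S where S: "S \<subseteq> DP" "V = {b. length b = n \<and> (\<forall>f\<in>S. ev b f = 0)}" using assms(1) by (rule closed_setE)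
  show ?thesis
  proof
    fix b assume "b \<in> zclosure B"
    moreover have "\<forall>c\<in>B. ev c f = 0" if "f \<in> S" for f using assms(2) that S(2) by blast
    ultimately show "b \<in> V" using S(1) unfolding zclosure_def S(2) by blast
  qed
qed

lemma zclosure_superset: "(\<And>c. c \<in> B \<Longrightarrow> length c = n) \<Longrightarrow> B \<subseteq> zclosure B"
  by (auto simp: zclosure_def)

lemma closed_set_length: "closed_set V \<Longrightarrow> b \<in> V \<Longrightarrow> length b = n"
  by (auto simp: differential_variety_def)

lemma irreducible_zclosure:
  assumes B: "B \<noteq> {}" "\<And>c. c \<in> B \<Longrightarrow> length c = n"
    and split: "\<And>V1 V2. closed_set V1 \<Longrightarrow> closed_set V2 \<Longrightarrow> B \<subseteq> V1 \<union> V2 \<Longrightarrow> B \<subseteq> V1 \<or> B \<subseteq> V2"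
  shows "irreducible_variety m \<delta> L n (zclosure B)"
  unfolding irreducible_variety_def
proof (intro conjI allI impI)
  have sup: "B \<subseteq> zclosure B" using B(2) by (rule zclosure_superset)
  show "closed_set (zclosure B)" by (rule closed_zclosure)
  show "zclosure B \<noteq> {}" using sup B(1) by blast
  fix V1 V2 assume V: "closed_set V1 \<and> closed_set V2 \<and> zclosure B = V1 \<union> V2"
  then have "B \<subseteq> V1 \<or> B \<subseteq> V2" using sup by (intro split) auto
  then have "zclosure B \<subseteq> V1 \<or> zclosure B \<subseteq> V2" using V zclosure_least by blast
  then show "zclosure B = V1 \<or> zclosure B = V2" using V by blast
qed

text \<open>Zorn's lemma for irreducible closed subsets containing \<open>c\<close>: the closure of
  the point itself starts the family, and a chain is bounded by the closure of its union, which is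
  again irreducible.\<close>

lemma component_through:
  assumes V: "closed_set V" and c: "c \<in> V"
  shows "\<exists>W. irreducible_component m \<delta> L n V W \<and> c \<in> W"
proof -
  let ?A = "{W. irreducible_variety m \<delta> L n W \<and> c \<in> W \<and> W \<subseteq> V}"
  have len: "length b = n" if "b \<in> V" for b using closed_set_length[OF V that] .
  have "irreducible_variety m \<delta> L n (zclosure {c})"
    by (rule irreducible_zclosure) (use len c in auto)
  then have c0: "zclosure {c} \<in> ?A" using zclosure_superset[of "{c}"] zclosure_least[OF V, of "{c}"] len c by auto
  have "\<exists>M\<in>?A. \<forall>W\<in>?A. M \<subseteq> W \<longrightarrow> W = M"
  proof (rule subset_Zorn)
    fix C assume C: "subset.chain ?A C"
    show "\<exists>U\<in>?A. \<forall>W\<in>C. W \<subseteq> U"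
    proof (cases "C = {}")
      case True then show ?thesis using c0 by blast
    next
      case False
      have CA: "irreducible_variety m \<delta> L n W" "c \<in> W" "W \<subseteq> V" if "W \<in> C" for W
        using C that unfolding subset_chain_def by blast+
      have lin: "W \<subseteq> W' \<or> W' \<subseteq> W" if "W \<in> C" "W' \<in> C" for W W'
        using C that unfolding subset_chain_def by blast
      have UV: "\<Union>C \<subseteq> V" using CA(3) by blast
      have sup: "\<Union>C \<subseteq> zclosure (\<Union>C)" by (rule zclosure_superset) (use UV len in blast)
      have "irreducible_variety m \<delta> L n (zclosure (\<Union>C))"
      proof (rule irreducible_zclosure)
        show "\<Union>C \<noteq> {}" using False CA(2) by blast
        show "length b = n" if "b \<in> \<Union>C" for b using that UV len by blast
        fix V1 V2 assume V12: "closed_set V1" "closed_set V2" "\<Union>C \<subseteq> V1 \<union> V2"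
        have each: "W \<subseteq> V1 \<or> W \<subseteq> V2" if "W \<in> C" for W
          using irreducible_Un[OF CA(1)[OF that] V12(1,2)] V12(3) that by blast
        show "\<Union>C \<subseteq> V1 \<or> \<Union>C \<subseteq> V2"
        proof (cases "\<forall>W\<in>C. W \<subseteq> V1")
          case True then show ?thesis by blast
        next
          case False
          then obtain W0 where W0: "W0 \<in> C" "\<not> W0 \<subseteq> V1" by blast
          \<comment> \<open>\<open>W0\<close> escapes \<open>V1\<close>, so it and every larger
            member lie in \<open>V2\<close>; the smaller members lie in \<open>W0\<close>.\<close>
          have "W \<subseteq> V2" if "W \<in> C" for W
          proof (cases "W \<subseteq> W0")
            case True then show ?thesis using each[OF W0(1)] W0(2) by blast
          next
            case False
            then have "W0 \<subseteq> W" using lin[OF that W0(1)] by blast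
            then show ?thesis using each[OF that] W0(2) by blast
          qed
          then show ?thesis by blast
        qed
      qed
      moreover have "c \<in> zclosure (\<Union>C)" using sup False CA(2) by blast
      moreover have "zclosure (\<Union>C) \<subseteq> V" by (rule zclosure_least[OF V UV])
      ultimately have "zclosure (\<Union>C) \<in> ?A" by simp
      moreover have "\<forall>W\<in>C. W \<subseteq> zclosure (\<Union>C)" using sup by (simp add: Sup_le_iff)
      ultimately show ?thesis by (rule bexI[rotated])
    qed
  qed
  then obtain W where W: "W \<in> ?A" "\<forall>W'\<in>?A. W \<subseteq> W' \<longrightarrow> W' = W" ..
  have "irreducible_component m \<delta> L n V W"
    unfolding irreducible_component_def
  proof (intro conjI allI impI)
    fix W' assume W': "irreducible_variety m \<delta> L n W' \<and> W \<subseteq> W' \<and> W' \<subseteq> V"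
    then have "W' \<in> ?A" using W(1) by blast
    then show "W' = W" using W(2) W' by blast
  qed (use W(1) in simp_all)
  then show ?thesis using W(1) by blast
qed

text \<open>A generic point realises the type prescribing exactly which polynomials vanish. If this
  were inconsistent, compactness would cover \<open>W\<close> by the zero sets of finitely many
  polynomials not vanishing on \<open>W\<close>, and irreducibility would put \<open>W\<close> into
  one of them.\<close>

lemma generic_point_exists:
  assumes W: "irreducible_variety m \<delta> L n W"
  shows "\<exists>b. generic_point m \<delta> L n W b"
proof -
  have cW: "closed_set W" using W by (simp add: irreducible_variety_def)
  define ef where "ef = (\<lambda>f v. mpoly_eval (dv v) f)"
  define \<Phi> where "\<Phi> = {f \<in> DP. \<forall>c\<in>W. ev c f = 0}"
  define \<Psi> where "\<Psi> = {f \<in> DP. \<exists>c\<in>W. ev c f \<noteq> 0}"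
  define cnd where "cnd = (\<lambda>f. ({ef f}, {} :: ((nat \<Rightarrow> 'a) \<Rightarrow> 'a) set))"
  have near_cnd: "near (cnd f) v \<longleftrightarrow> mpoly_eval (dv v) f = 0" for f v by (simp add: near_def cnd_def ef_def)
  have near_list: "near (cnd f) ((!) c) \<longleftrightarrow> ev c f = 0" for f c by (simp add: near_cnd dpoly_eval_dv)
  have wf: "wfc (cnd f)" if "f \<in> DP" for f
    using mpoly_eval_PF[of f L "idxs m {..<n}"] that by (simp add: wfc_def cnd_def ef_def dpolys_idxs)
  have "\<exists>v. (\<forall>f\<in>\<Phi>. near (cnd f) v) \<and> (\<forall>f\<in>\<Psi>. \<not> near (cnd f) v)"
  proof (rule ccontr)
    assume contra: "\<not> ?thesis"
    have "\<exists>\<H>0 \<Q>0. finite \<H>0 \<and> \<H>0 \<subseteq> cnd ` \<Phi> \<and> finite \<Q>0 \<and> \<Q>0 \<subseteq> cnd ` \<Psi> \<and>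
        (\<forall>v. (\<forall>q\<in>\<H>0. near q v) \<longrightarrow> (\<exists>q\<in>\<Q>0. near q v))"
    proof (rule compactness)
      show "wfc q" if "q \<in> cnd ` \<Phi> \<union> cnd ` \<Psi>" for q using that wf by (auto simp: \<Phi>_def \<Psi>_def)
      show "\<exists>q\<in>cnd ` \<Psi>. near q v" if "\<forall>q\<in>cnd ` \<Phi>. near q v" for v using that contra by blast
    qed
    then obtain \<H>0 \<Q>0 where HQ: "\<H>0 \<subseteq> cnd ` \<Phi>" "finite \<Q>0" "\<Q>0 \<subseteq> cnd ` \<Psi>"
        "\<And>v. \<forall>q\<in>\<H>0. near q v \<Longrightarrow> \<exists>q\<in>\<Q>0. near q v" by blast
    obtain U where U: "finite U" "U \<subseteq> \<Psi>" "\<Q>0 = cnd ` U" using finite_subset_image[OF HQ(2,3)] by auto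
    let ?Z = "\<lambda>f. {b. length b = n \<and> (\<forall>f\<in>{f}. ev b f = 0)}"
    have "\<exists>V\<in>?Z ` U. W \<subseteq> V"
    proof (rule irreducible_Union[OF W])
      show "finite (?Z ` U)" using U(1) by simp
      show "closed_set V" if V: "V \<in> ?Z ` U" for V
      proof -
        obtain f where f: "f \<in> U" "V = ?Z f" using V by blast
        have "{f} \<subseteq> DP" using f(1) U(2) by (auto simp: \<Psi>_def)
        then show ?thesis unfolding f(2) by (rule closed_setI)
      qed
      show "W \<subseteq> \<Union> (?Z ` U)"
      proof
        fix c assume c: "c \<in> W"
        have "near q ((!) c)" if q: "q \<in> \<H>0" for q
        proof -
          obtain f where f: "f \<in> \<Phi>" "q = cnd f" using q HQ(1) by blast
          show ?thesis unfolding f(2) near_list using f(1) c by (simp add: \<Phi>_def)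
        qed
        then have "\<exists>q\<in>\<Q>0. near q ((!) c)" by (intro HQ(4)) blast
        then obtain f where "f \<in> U" "near (cnd f) ((!) c)" unfolding U(3) by blast
        then show "c \<in> \<Union> (?Z ` U)" using closed_set_length[OF cW c] by (auto simp: near_list)
      qed
    qed
    then obtain f where f: "f \<in> U" "W \<subseteq> ?Z f" by blast
    then have "f \<in> \<Psi>" using U(2) by blast
    then show False using f(2) by (auto simp: \<Psi>_def)
  qed
  then obtain v where v: "\<And>f. f \<in> \<Phi> \<Longrightarrow> near (cnd f) v" "\<And>f. f \<in> \<Psi> \<Longrightarrow> \<not> near (cnd f) v" by blast
  \<comment> \<open>Positions of \<open>v\<close> from \<open>n\<close> on do not occur in the
    polynomials.\<close>
  define b where "b = map v [0..<n]"
  have ev: "ev b f = 0 \<longleftrightarrow> near (cnd f) v" if f: "f \<in> DP" for f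
  proof -
    have "mpoly_eval (dv ((!) b)) f = mpoly_eval (dv v) f"
      using f by (intro PF_cong[OF mpoly_eval_PF[of f L "idxs m {..<n}"]] dv_cong) (auto simp: dpolys_idxs idxs_def b_def)
    then show ?thesis by (simp add: near_cnd dpoly_eval_dv)
  qed
  have iff: "ev b f = 0 \<longleftrightarrow> (\<forall>c\<in>W. ev c f = 0)" if f: "f \<in> DP" for f
    using ev[OF f] v[of f] f unfolding \<Phi>_def \<Psi>_def by blast
  obtain S where S: "S \<subseteq> DP" "W = {b. length b = n \<and> (\<forall>f\<in>S. ev b f = 0)}" using cW by (rule closed_setE)
  have "ev b f = 0" if "f \<in> S" for f
    using iff[of f] that S by blast
  then have "b \<in> W" unfolding S(2) by (simp add: b_def)
  then show ?thesis using iff by (auto simp: generic_point_def)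
qed

lemma kolchin_poly_point_mono:
  assumes b: "generic_point m \<delta> L n W b" and cW: "closed_set W" and c: "c \<in> W"
  shows "eventually_dominated (kolchin_poly_point m \<delta> L c) (kolchin_poly_point m \<delta> L b)"
proof -
  have len: "length b = n" "length c = n"
    using closed_set_length[OF cW] c b by (auto simp: generic_point_def)
  have dc: "dclosed L" by (rule k_closed(3))
  have "cocount m {..<n} (leads m {..<n} L (dv ((!) c))) s \<le> cocount m {..<n} (leads m {..<n} L (dv ((!) b))) s" for s
  proof (rule cocount_specialise[OF rgen_L])
    show "mpoly_eval (dv ((!) c)) P = 0" if "P \<in> mpolys L (idxs m {..<n})" "mpoly_eval (dv ((!) b)) P = 0" for P
      using b c that by (auto simp: generic_point_def dpolys_idxs dpoly_eval_dv)
  qed simp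
  then show ?thesis
    unfolding kolchin_poly_point_kpoly[OF rgen_L len(1)] kolchin_poly_point_kpoly[OF rgen_L len(2)]
    by (intro kpoly_mono leads_idxs upclosed_leads[OF _ dc]) simp_all
qed

text \<open>A point attaining the maximum lies on some component, whose generic point dominates it
  by specialisation; generic points are themselves points of \<open>V\<close>. So the maxima over
  components and over points agree, whichever generic points are chosen.\<close>

lemma kolchin_poly_variety_max:
  assumes V: "closed_set V" and c: "c \<in> V" "kolchin_poly_point m \<delta> L c = M"
    and max: "\<And>c. c \<in> V \<Longrightarrow> eventually_dominated (kolchin_poly_point m \<delta> L c) M"
  shows "kolchin_poly_variety m \<delta> L n V = M"
proof -
  let ?g = "\<lambda>W. SOME b. generic_point m \<delta> L n W b"
  define P where "P = {kolchin_poly_irreducible m \<delta> L n W | W. irreducible_component m \<delta> L n V W}"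
  have gen: "generic_point m \<delta> L n W (?g W)" "closed_set W" "?g W \<in> V" if "irreducible_component m \<delta> L n V W" for W
  proof -
    have W: "irreducible_variety m \<delta> L n W" "W \<subseteq> V" using that by (auto simp: irreducible_component_def)
    show g: "generic_point m \<delta> L n W (?g W)" using generic_point_exists[OF W(1)] by (rule someI_ex)
    show "closed_set W" using W(1) by (simp add: irreducible_variety_def)
    show "?g W \<in> V" using g W(2) by (auto simp: generic_point_def)
  qed
  have ub: "eventually_dominated q M" if "q \<in> P" for q
    using that max gen(3) by (auto simp: P_def kolchin_poly_irreducible_def)
  obtain W where W: "irreducible_component m \<delta> L n V W" "c \<in> W" using component_through[OF V c(1)] by blast
  have "eventually_dominated M (kolchin_poly_point m \<delta> L (?g W))"
    using kolchin_poly_point_mono[OF gen(1,2)[OF W(1)] W(2)] c(2) by simp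
  then have "kolchin_poly_point m \<delta> L (?g W) = M" using max[OF gen(3)[OF W(1)]] by (intro eventually_dominated_antisym)
  then have MP: "M \<in> P" using W(1) by (auto simp: P_def kolchin_poly_irreducible_def)
  have "(THE p. p \<in> P \<and> (\<forall>q\<in>P. eventually_dominated q p)) = M"
    by (rule the_equality) (use MP ub eventually_dominated_antisym in blast)+
  then show ?thesis by (simp add: kolchin_poly_variety_def P_def)
qed

end

section \<open>From maxima over points to the varieties of the family\<close>

lemma dfld_differentially_closed:
  fixes \<delta> :: "nat \<Rightarrow> 'a::field_char_0 \<Rightarrow> 'a"
  assumes "differentially_closed m \<delta>" shows "dfld m \<delta>"
  using assms unfolding differentially_closed_def differential_field_def derivation_def
  by unfold_locales (auto simp: der_def)

theorem corollary5:
  fixes m n l :: nat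
    and \<delta> :: "nat \<Rightarrow> 'a::field_char_0 \<Rightarrow> 'a"
    and k :: "'a set"
    and F :: "'a dpoly set"
  assumes "m \<ge> 1"
    and "differentially_closed m \<delta>"
    and "saturated m \<delta>"
    and "differential_subfield m \<delta> k"
    and "k \<prec> (UNIV :: 'a set)"
    and "F \<subseteq> dpolys m k (n + l)"
  shows "finite {kolchin_poly_variety m \<delta> (differential_field_adjoin m \<delta> k (set a)) n
                   (family_member m \<delta> n F a)
                 | a. length a = l \<and> family_member m \<delta> n F a \<noteq> {}}"
proof -
  interpret dfld m \<delta> by (rule dfld_differentially_closed[OF assms(2)])
  interpret universal m \<delta> k n l by unfold_locales (fact assms)+
  define \<F> where "\<F> = (\<lambda>f v. mpoly_eval (dv v) f) ` F"
  define V where "V = {v. \<forall>f\<in>\<F>. f v = 0}"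
  have \<F>: "\<F> \<subseteq> PFa" using assms(6) by (auto simp: \<F>_def dpolys_idxs intro!: mpoly_eval_PF)
  \<comment> \<open>Valuations are functions on all natural numbers, but only the positions below
    \<open>n + l\<close> matter; this allows passing between valuations and lists.\<close>
  have V_cong: "v' \<in> V" if v: "v \<in> V" and eq: "\<And>i. i < n + l \<Longrightarrow> v i = v' i" for v v'
    unfolding V_def
  proof (intro CollectI ballI)
    fix f assume f: "f \<in> \<F>"
    have "f v = f v'"
    proof (rule PF_cong[OF subsetD[OF \<F> f]], rule dv_cong)
      fix w assume "w \<in> idxs m {..<n+l}"
      then show "v (fst w) = v' (fst w)" by (intro eq) (simp add: idxs_def mem_Times_iff)
    qed
    moreover have "f v = 0" using v f unfolding V_def mem_Collect_eq by (rule bspec)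
    ultimately show "f v' = 0" by simp
  qed
  have kp_cong: "kp v = kp v'" if v: "\<And>i. i < n + l \<Longrightarrow> v i = v' i" for v v'
  proof -
    have eq: "dv v w = dv v' w" if "w \<in> idxs m Xs \<union> idxs m Ys" for w
      by (rule dv_cong, rule v) (use that in \<open>auto simp: idxs_def\<close>)
    then have "dv v ` idxs m Ys = dv v' ` idxs m Ys" by (intro image_cong) auto
    moreover have "leads m Xs A (dv v) = leads m Xs A (dv v')" for A by (rule leads_cong_seq) (use eq in blast)
    ultimately show ?thesis by (simp add: kp_def EE_def base_def)
  qed
  have member: "b \<in> family_member m \<delta> n F a \<longleftrightarrow> length b = n \<and> (!) (b @ a) \<in> V" for a b
    by (simp add: family_member_def V_def \<F>_def dpoly_eval_dv)
  obtain \<M> where \<M>: "finite \<M>" "\<And>v. v \<in> V \<Longrightarrow> \<exists>M\<in>\<M>. is_max V v M"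
    using finitely_many_maxima[OF \<F> V_def] by blast
  have "kolchin_poly_variety m \<delta> (differential_field_adjoin m \<delta> k (set a)) n (family_member m \<delta> n F a) \<in> \<M>"
    if a: "length a = l" and ne: "family_member m \<delta> n F a \<noteq> {}" for a
  proof -
    let ?L = "differential_field_adjoin m \<delta> k (set a)" and ?V = "family_member m \<delta> n F a"
    \<comment> \<open>The list of zeros merely provides a point of the right length.\<close>
    have small: "?L \<prec> (UNIV :: 'a set)" by (rule parameters(3)[OF a, of "replicate n 0"]) simp
    interpret L: points m \<delta> ?L n
      by unfold_locales (fact assms(2,3) differential_field_adjoin(1) small)+
    obtain b0 where b0: "length b0 = n" "(!) (b0 @ a) \<in> V" using ne member by blast
    then obtain M where M: "M \<in> \<M>" "is_max V ((!) (b0 @ a)) M" using \<M>(2) by blast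
    have "L.closed_set ?V"
    proof -
      have "\<forall>f\<in>\<F>. \<exists>g. g \<in> dpolys m ?L n \<and> (\<forall>b. length b = n \<longrightarrow> dpoly_eval m \<delta> b g = f ((!) (b @ a)))"
        using substitute_parameters[OF a] \<F> by blast
      from bchoice[OF this] obtain G where G: "\<forall>f\<in>\<F>. G f \<in> dpolys m ?L n \<and> (\<forall>b. length b = n \<longrightarrow> dpoly_eval m \<delta> b (G f) = f ((!) (b @ a)))"
        by blast
      have "?V = {b. length b = n \<and> (\<forall>f\<in>G ` \<F>. dpoly_eval m \<delta> b f = 0)}"
        using G unfolding set_eq_iff member V_def by auto
      moreover have "G ` \<F> \<subseteq> dpolys m ?L n" using G by blast
      ultimately show ?thesis using L.closed_setI[of "G ` \<F>"] by simp
    qed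
    moreover from M(2) obtain v where v: "v \<in> V" "agree v ((!) (b0 @ a))" "kp v = M" by (auto simp: is_max_def)
    define b where "b = map v [0..<n]"
    have bn: "length b = n" by (simp add: b_def)
    have bv: "v i = (b @ a) ! i" if "i < n + l" for i
      using v(2) that b0(1) by (auto simp: agree_def b_def nth_append)
    have "b \<in> ?V" using V_cong[OF v(1) bv] bn member by blast
    moreover have "kolchin_poly_point m \<delta> ?L b = M"
      unfolding kp_point[OF a bn] using kp_cong[OF bv] v(3) by simp
    moreover have "eventually_dominated (kolchin_poly_point m \<delta> ?L c) M" if "c \<in> ?V" for c
    proof -
      have c: "length c = n" "(!) (c @ a) \<in> V" using that member by blast+
      have "agree ((!) (c @ a)) ((!) (b0 @ a))" using c(1) b0(1) by (auto simp: agree_def nth_append)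
      then show ?thesis unfolding kp_point[OF a c(1)] using M(2) c(2) by (simp add: is_max_def)
    qed
    ultimately have "kolchin_poly_variety m \<delta> ?L n ?V = M" by (rule L.kolchin_poly_variety_max)
    then show ?thesis using M(1) by simp
  qed
  then show ?thesis by (intro finite_subset[OF _ \<M>(1)]) blast
qed

end
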